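(* Let $H$ be a semisimple Hopf algebra over an algebraically closed field $k$ of characteristic $0$ and let $N$ be a left coideal subalgebra of $H$. For all irreducible characters $\chi_i$ of $H$ and $\phi_j$ of $N$, $$({\chi_i}_{|N}\,|\,\phi_j)_N=(\chi_i\,|\,\phi_j^{\uparrow H})_H=\langle\chi_i,t_j\rangle.$$ Consequently, $$m(\phi_j,{\chi_i}_{|N})=({\chi_i}_{|N}\,|\,\phi_j)_N=(\chi_i\,|\,\phi_j^{\uparrow H})_H=m(\chi_i,\phi_j^{\uparrow H}).$$
   Context: $s$ is the antipode of $H^*$ and $\Lambda$ the idempotent integral of $H$. A left coideal subalgebra of $H$ is a unital subalgebra $N$ with $\Delta(N)\subset H\otimes N$; it is a semisimple algebra with a unique idempotent two-sided integral $\Lambda_N$ ($n\Lambda_N=\Lambda_Nn=\langle\varepsilon,n\rangle\Lambda_N$, $\langle\varepsilon,\Lambda_N\rangle=1$). Let $\mathrm{Irr}(N)=\{\phi_0,\dots,\phi_{m-1}\}$ be the irreducible characters of $N$, $T_j$ the central primitive idempotent of $N$ associated with $\phi_j$, and $t_j\in N$ a primitive idempotent with $T_it_j=\delta_{ij}t_j$ (so $Nt_j$ is the irreducible $N$-module with character $\phi_j$). $\phi_j^{\uparrow H}$ is the character of the induced module $H\otimes_N Nt_j$. $m(\phi_j,{\chi_i}_{|N})$ (resp. $m(\chi_i,\phi_j^{\uparrow H})$) is the multiplicity of $\phi_j$ in ${\chi_i}_{|N}$ (resp. of $\chi_i$ in $\phi_j^{\uparrow H}$). Forms: on $R(H)$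 (the span of the irreducible characters of $H$), $(\chi|\Phi)_H=\langle\chi s(\Phi),\Lambda\rangle$. On $N^*$, $(p|p')_N=\langle p',F_N^{-1}(p)\rangle$, where $F_N:N\to N^*$ is the bijection $F_N(n)=\frac{1}{\langle\lambda_B,1\rangle}\,n\rightharpoonup(\lambda_{|N})$, with $\langle n\rightharpoonup p,n'\rangle=\langle p,n'n\rangle$, $\lambda=\sum_i\langle\chi_i,1\rangle\chi_i$ the regular character of $H$, and $\lambda_B=\Lambda_N\rightharpoonup\lambda\in H^*$ (where $\langle a\rightharpoonup p,a'\rangle=\langle p,a'a\rangle$ for $a,a'\in H$, $p\in H^*$); $\langle\lambda_B,1\rangle\ne0$. *)

theory Defs
  imports
    "HOL-Library.FuncSet"
    "HOL-Library.Poly_Mapping"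
    "HOL-Computational_Algebra.Polynomial"
    "Jordan_Normal_Form.Matrix"
begin

text \<open>The algebra \<open>H\<close> is a type \<open>'h\<close> of class \<open>ring_1\<close> together with a scalar multiplication
  \<open>sc\<close> over the field \<open>'k\<close>; subalgebras of \<open>H\<close> (including \<open>H = UNIV\<close>) are subsets of \<open>'h\<close>.
  Elements of the dual \<open>A\<^sup>*\<close> of a subalgebra \<open>A\<close> are functions \<open>'h \<Rightarrow> 'k\<close> that are
  \<open>undefined\<close> outside \<open>A\<close>, so that equality in \<open>A\<^sup>*\<close> is HOL equality.\<close>

section \<open>Tensor powers\<close>

definition free_scale :: "'k::field \<Rightarrow> ('a \<Rightarrow>\<^sub>0 'k) \<Rightarrow> ('a \<Rightarrow>\<^sub>0 'k)" where
  "free_scale c f = Poly_Mapping.map ((*) c) f"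

lemma lookup_free_scale: "Poly_Mapping.lookup (free_scale c f) k = c * Poly_Mapping.lookup f k"
  by (simp add: free_scale_def Poly_Mapping.map.rep_eq when_def)

lemma vector_space_free_scale:
  "vector_space (free_scale :: 'k::field \<Rightarrow> ('a \<Rightarrow>\<^sub>0 'k) \<Rightarrow> ('a \<Rightarrow>\<^sub>0 'k))"
  by standard (auto simp: lookup_free_scale lookup_add algebra_simps intro!: poly_mapping_eqI)

text \<open>The \<open>n\<close>-th tensor power of \<open>H\<close> is the free vector space on the words of length \<open>n\<close> over
  \<open>H\<close>, modulo the multilinearity relations, which span \<open>tensor_null\<close>.\<close>

definition tensor_null :: "('k::field \<Rightarrow> 'h::ring_1 \<Rightarrow> 'h) \<Rightarrow> ('h list \<Rightarrow>\<^sub>0 'k) set" where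
  "tensor_null sc = module.span free_scale
     ({Poly_Mapping.single (us @ (x + y) # vs) 1 - Poly_Mapping.single (us @ x # vs) 1
         - Poly_Mapping.single (us @ y # vs) 1 | us vs x y. True}
      \<union> {Poly_Mapping.single (us @ sc c x # vs) 1 - Poly_Mapping.single (us @ x # vs) c
         | us vs x c. True})"

definition tensor_eq ::
  "('k::field \<Rightarrow> 'h::ring_1 \<Rightarrow> 'h) \<Rightarrow> ('h list \<Rightarrow>\<^sub>0 'k) \<Rightarrow> ('h list \<Rightarrow>\<^sub>0 'k) \<Rightarrow> bool" where
  "tensor_eq sc f g \<longleftrightarrow> f - g \<in> tensor_null sc"

text \<open>A list of pairs stands for the formal sum of \<open>a \<otimes> b\<close> over its members \<open>(a, b)\<close>.\<close>

definition tensor_sum :: "('h \<times> 'h) list \<Rightarrow> ('h::ring_1 list \<Rightarrow>\<^sub>0 'k::field)" where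
  "tensor_sum xs = (\<Sum>(a, b)\<leftarrow>xs. Poly_Mapping.single [a, b] 1)"

section \<open>Hopf algebras\<close>

locale unital_algebra = vector_space sc
  for sc :: "'k::field \<Rightarrow> 'h::ring_1 \<Rightarrow> 'h" +
  assumes sc_mult_left: "sc c (x * y) = sc c x * y"
    and sc_mult_right: "sc c (x * y) = x * sc c y"

text \<open>The comultiplication is given by a Sweedler representative: \<open>\<Delta> h\<close> lists the summands
  \<open>h\<^sub>(\<^sub>1\<^sub>) \<otimes> h\<^sub>(\<^sub>2\<^sub>)\<close> of some expression of the coproduct of \<open>h\<close>, and identities between coproducts
  are required in the tensor powers only, i.e. up to \<open>tensor_eq\<close>.\<close>

locale hopf_algebra = unital_algebra sc
  for sc :: "'k::field \<Rightarrow> 'h::ring_1 \<Rightarrow> 'h" +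
  fixes \<Delta> :: "'h \<Rightarrow> ('h \<times> 'h) list"
    and \<epsilon> :: "'h \<Rightarrow> 'k"
    and S :: "'h \<Rightarrow> 'h"
  assumes comult_add: "tensor_eq sc (tensor_sum (\<Delta> (x + y))) (tensor_sum (\<Delta> x) + tensor_sum (\<Delta> y))"
    and comult_scale: "tensor_eq sc (tensor_sum (\<Delta> (sc c x))) (free_scale c (tensor_sum (\<Delta> x)))"
    and coassoc: "tensor_eq sc
        (\<Sum>(a, b)\<leftarrow>\<Delta> x. \<Sum>(a1, a2)\<leftarrow>\<Delta> a. Poly_Mapping.single [a1, a2, b] 1)
        (\<Sum>(a, b)\<leftarrow>\<Delta> x. \<Sum>(b1, b2)\<leftarrow>\<Delta> b. Poly_Mapping.single [a, b1, b2] 1)"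
    and comult_mult: "tensor_eq sc (tensor_sum (\<Delta> (x * y)))
        (\<Sum>(a, b)\<leftarrow>\<Delta> x. \<Sum>(a', b')\<leftarrow>\<Delta> y. Poly_Mapping.single [a * a', b * b'] 1)"
    and comult_one: "tensor_eq sc (tensor_sum (\<Delta> 1)) (Poly_Mapping.single [1, 1] 1)"
    and counit_add: "\<epsilon> (x + y) = \<epsilon> x + \<epsilon> y"
    and counit_scale: "\<epsilon> (sc c x) = c * \<epsilon> x"
    and counit_mult: "\<epsilon> (x * y) = \<epsilon> x * \<epsilon> y"
    and counit_one: "\<epsilon> 1 = 1"
    and counit_left: "(\<Sum>(a, b)\<leftarrow>\<Delta> x. sc (\<epsilon> a) b) = x"
    and counit_right: "(\<Sum>(a, b)\<leftarrow>\<Delta> x. sc (\<epsilon> b) a) = x"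
    and antipode_add: "S (x + y) = S x + S y"
    and antipode_scale: "S (sc c x) = sc c (S x)"
    and antipode_left: "(\<Sum>(a, b)\<leftarrow>\<Delta> x. S a * b) = sc (\<epsilon> x) 1"
    and antipode_right: "(\<Sum>(a, b)\<leftarrow>\<Delta> x. a * S b) = sc (\<epsilon> x) 1"

definition left_ideal :: "'h::ring_1 set \<Rightarrow> bool" where
  "left_ideal I \<longleftrightarrow> 0 \<in> I \<and> (\<forall>x\<in>I. \<forall>y\<in>I. x + y \<in> I) \<and> (\<forall>h. \<forall>x\<in>I. h * x \<in> I)"

text \<open>Finite-dimensionality is not assumed: a semisimple Hopf algebra is finite-dimensional.\<close>

locale semisimple_hopf_algebra = hopf_algebra sc \<Delta> \<epsilon> S
  for sc :: "'k::field \<Rightarrow> 'h::ring_1 \<Rightarrow> 'h" and \<Delta> \<epsilon> S +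
  assumes left_ideal_complement:
    "left_ideal (I :: 'h set) \<Longrightarrow> \<exists>J. left_ideal J \<and> I \<inter> J = {0} \<and> (\<forall>x. \<exists>a\<in>I. \<exists>b\<in>J. x = a + b)"

definition left_coideal_subalgebra ::
  "('k::field \<Rightarrow> 'h::ring_1 \<Rightarrow> 'h) \<Rightarrow> ('h \<Rightarrow> ('h \<times> 'h) list) \<Rightarrow> 'h set \<Rightarrow> bool" where
  "left_coideal_subalgebra sc \<Delta> N \<longleftrightarrow>
     1 \<in> N \<and> (\<forall>x\<in>N. \<forall>y\<in>N. x + y \<in> N) \<and> (\<forall>c. \<forall>x\<in>N. sc c x \<in> N) \<and> (\<forall>x\<in>N. \<forall>y\<in>N. x * y \<in> N) \<and>
     (\<forall>x\<in>N. \<exists>ys. set ys \<subseteq> UNIV \<times> N \<and> tensor_eq sc (tensor_sum (\<Delta> x)) (tensor_sum ys))"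

definition idem_integral :: "('k::field \<Rightarrow> 'h::ring_1 \<Rightarrow> 'h) \<Rightarrow> ('h \<Rightarrow> 'k) \<Rightarrow> 'h set \<Rightarrow> 'h" where
  "idem_integral sc \<epsilon> A = (THE \<Lambda>. \<Lambda> \<in> A \<and>
     (\<forall>a\<in>A. a * \<Lambda> = sc (\<epsilon> a) \<Lambda> \<and> \<Lambda> * a = sc (\<epsilon> a) \<Lambda>) \<and> \<epsilon> \<Lambda> = 1)"

section \<open>Representations and characters\<close>

text \<open>A \<open>d\<close>-dimensional \<open>A\<close>-module is given by a matrix representation \<open>A \<rightarrow> M\<^sub>d(k)\<close>.\<close>

definition is_rep ::
  "('k::field \<Rightarrow> 'h::ring_1 \<Rightarrow> 'h) \<Rightarrow> 'h set \<Rightarrow> nat \<Rightarrow> ('h \<Rightarrow> 'k mat) \<Rightarrow> bool" where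
  "is_rep sc A d \<rho> \<longleftrightarrow>
     (\<forall>a\<in>A. \<rho> a \<in> carrier_mat d d) \<and> \<rho> 1 = 1\<^sub>m d \<and>
     (\<forall>a\<in>A. \<forall>b\<in>A. \<rho> (a + b) = \<rho> a + \<rho> b \<and> \<rho> (a * b) = \<rho> a * \<rho> b) \<and>
     (\<forall>c. \<forall>a\<in>A. \<rho> (sc c a) = c \<cdot>\<^sub>m \<rho> a)"

definition invariant_subspace ::
  "'h set \<Rightarrow> nat \<Rightarrow> ('h \<Rightarrow> 'k::field mat) \<Rightarrow> 'k vec set \<Rightarrow> bool" where
  "invariant_subspace A d \<rho> W \<longleftrightarrow>
     W \<subseteq> carrier_vec d \<and> 0\<^sub>v d \<in> W \<and> (\<forall>v\<in>W. \<forall>w\<in>W. v + w \<in> W) \<and> (\<forall>c. \<forall>v\<in>W. c \<cdot>\<^sub>v v \<in> W) \<and>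
     (\<forall>a\<in>A. \<forall>v\<in>W. \<rho> a *\<^sub>v v \<in> W)"

definition irreducible_rep ::
  "('k::field \<Rightarrow> 'h::ring_1 \<Rightarrow> 'h) \<Rightarrow> 'h set \<Rightarrow> nat \<Rightarrow> ('h \<Rightarrow> 'k mat) \<Rightarrow> bool" where
  "irreducible_rep sc A d \<rho> \<longleftrightarrow> is_rep sc A d \<rho> \<and> d > 0 \<and>
     (\<forall>W. invariant_subspace A d \<rho> W \<longrightarrow> W = {0\<^sub>v d} \<or> W = carrier_vec d)"

definition mat_trace :: "'k::field mat \<Rightarrow> 'k" where
  "mat_trace M = (\<Sum>i<dim_row M. M $$ (i, i))"

definition character :: "'h set \<Rightarrow> ('h \<Rightarrow> 'k::field mat) \<Rightarrow> ('h \<Rightarrow> 'k)" where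
  "character A \<rho> = restrict (\<lambda>a. mat_trace (\<rho> a)) A"

definition irr_chars :: "('k::field \<Rightarrow> 'h::ring_1 \<Rightarrow> 'h) \<Rightarrow> 'h set \<Rightarrow> ('h \<Rightarrow> 'k) set" where
  "irr_chars sc A = {character A \<rho> | d \<rho>. irreducible_rep sc A d \<rho>}"

text \<open>\<open>mult_in sc A \<phi> \<psi>\<close> is the number of summands with character \<open>\<phi>\<close> in a decomposition of a module
  with character \<open>\<psi>\<close> into a direct sum of irreducible \<open>A\<close>-modules.\<close>

definition decomposition ::
  "('k::field \<Rightarrow> 'h::ring_1 \<Rightarrow> 'h) \<Rightarrow> 'h set \<Rightarrow> ('h \<Rightarrow> 'k mat) \<Rightarrow> (nat \<times> ('h \<Rightarrow> 'k mat)) list \<Rightarrow> bool" where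
  "decomposition sc A \<rho> rs \<longleftrightarrow> (\<forall>(e, \<sigma>)\<in>set rs. irreducible_rep sc A e \<sigma>) \<and>
     (\<exists>P Q. \<forall>a\<in>A. similar_mat_wit (\<rho> a) (diag_block_mat (map (\<lambda>(e, \<sigma>). \<sigma> a) rs)) P Q)"

definition mult_in ::
  "('k::field \<Rightarrow> 'h::ring_1 \<Rightarrow> 'h) \<Rightarrow> 'h set \<Rightarrow> ('h \<Rightarrow> 'k) \<Rightarrow> ('h \<Rightarrow> 'k) \<Rightarrow> nat" where
  "mult_in sc A \<phi> \<psi> = (THE m. \<exists>d \<rho> rs. is_rep sc A d \<rho> \<and> character A \<rho> = \<psi> \<and>
     decomposition sc A \<rho> rs \<and> m = length (filter (\<lambda>(e, \<sigma>). character A \<sigma> = \<phi>) rs))"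

section \<open>Idempotents\<close>

definition primitive_idem :: "'h::ring_1 set \<Rightarrow> 'h \<Rightarrow> bool" where
  "primitive_idem A e \<longleftrightarrow> e \<in> A \<and> e \<noteq> 0 \<and> e * e = e \<and>
     (\<forall>f\<in>A. \<forall>g\<in>A. f * f = f \<and> g * g = g \<and> f * g = 0 \<and> g * f = 0 \<and> e = f + g \<longrightarrow> f = 0 \<or> g = 0)"

definition alg_centre :: "'h::ring_1 set \<Rightarrow> 'h set" where
  "alg_centre A = {z \<in> A. \<forall>a\<in>A. z * a = a * z}"

definition central_idem ::
  "('k::field \<Rightarrow> 'h::ring_1 \<Rightarrow> 'h) \<Rightarrow> 'h set \<Rightarrow> ('h \<Rightarrow> 'k) \<Rightarrow> 'h" where
  "central_idem sc A \<phi> = (THE T. primitive_idem (alg_centre A) T \<and>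
     (\<forall>d \<rho>. irreducible_rep sc A d \<rho> \<and> character A \<rho> = \<phi> \<longrightarrow> \<rho> T = 1\<^sub>m d))"

section \<open>Induced characters\<close>

text \<open>For a subalgebra \<open>N\<close> and a left \<open>N\<close>-submodule \<open>M\<close> of \<open>H\<close>, the module \<open>H \<otimes>\<^sub>N M\<close> is the free vector
  space on \<open>H \<times> M\<close> modulo \<open>balanced_null sc N M\<close>. A representation \<open>\<sigma>\<close> of \<open>H\<close> on \<open>k\<^sup>d\<close> realizes it
  if some linear map from the free space onto \<open>k\<^sup>d\<close>, given by the values \<open>\<tau> x m\<close> on the
  generators, has kernel \<open>balanced_null sc N M\<close> and intertwines \<open>\<sigma>\<close> with left multiplication.\<close>

definition balanced_null ::
  "('k::field \<Rightarrow> 'h::ring_1 \<Rightarrow> 'h) \<Rightarrow> 'h set \<Rightarrow> 'h set \<Rightarrow> ('h \<times> 'h \<Rightarrow>\<^sub>0 'k) set" where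
  "balanced_null sc N M = module.span free_scale
     ({Poly_Mapping.single (x + y, m) 1 - Poly_Mapping.single (x, m) 1 - Poly_Mapping.single (y, m) 1
         | x y m. m \<in> M}
      \<union> {Poly_Mapping.single (x, m + m') 1 - Poly_Mapping.single (x, m) 1 - Poly_Mapping.single (x, m') 1
         | x m m'. m \<in> M \<and> m' \<in> M}
      \<union> {Poly_Mapping.single (sc c x, m) 1 - Poly_Mapping.single (x, m) c | c x m. m \<in> M}
      \<union> {Poly_Mapping.single (x, sc c m) 1 - Poly_Mapping.single (x, m) c | c x m. m \<in> M}
      \<union> {Poly_Mapping.single (x * n, m) 1 - Poly_Mapping.single (x, n * m) 1
         | x n m. n \<in> N \<and> m \<in> M})"

definition free_ext ::
  "nat \<Rightarrow> ('h \<Rightarrow> 'h \<Rightarrow> 'k::field vec) \<Rightarrow> ('h \<times> 'h \<Rightarrow>\<^sub>0 'k) \<Rightarrow> 'k vec" where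
  "free_ext d \<tau> f = vec d (\<lambda>i. \<Sum>(x, m)\<in>Poly_Mapping.keys f. Poly_Mapping.lookup f (x, m) * \<tau> x m $ i)"

definition induced_rep ::
  "('k::field \<Rightarrow> 'h::ring_1 \<Rightarrow> 'h) \<Rightarrow> 'h set \<Rightarrow> 'h set \<Rightarrow> nat \<Rightarrow> ('h \<Rightarrow> 'k mat) \<Rightarrow> bool" where
  "induced_rep sc N M d \<sigma> \<longleftrightarrow> is_rep sc UNIV d \<sigma> \<and>
     (\<exists>\<tau>. (\<forall>x. \<forall>m\<in>M. \<tau> x m \<in> carrier_vec d) \<and>
        (\<forall>v\<in>carrier_vec d. \<exists>f. Poly_Mapping.keys f \<subseteq> UNIV \<times> M \<and> free_ext d \<tau> f = v) \<and>
        (\<forall>f. Poly_Mapping.keys f \<subseteq> UNIV \<times> M \<longrightarrow>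
           (free_ext d \<tau> f = 0\<^sub>v d \<longleftrightarrow> f \<in> balanced_null sc N M)) \<and>
        (\<forall>h x. \<forall>m\<in>M. \<sigma> h *\<^sub>v \<tau> x m = \<tau> (h * x) m))"

definition induced_char ::
  "('k::field \<Rightarrow> 'h::ring_1 \<Rightarrow> 'h) \<Rightarrow> 'h set \<Rightarrow> 'h set \<Rightarrow> ('h \<Rightarrow> 'k)" where
  "induced_char sc N M = (THE \<psi>. \<exists>d \<sigma>. induced_rep sc N M d \<sigma> \<and> \<psi> = character UNIV \<sigma>)"

section \<open>The bilinear forms\<close>

text \<open>\<open>conv\<close> is the product of \<open>H\<^sup>*\<close>, whose antipode is \<open>\<Phi> \<mapsto> \<Phi> \<circ> S\<close>.\<close>

definition conv :: "('h \<Rightarrow> ('h \<times> 'h) list) \<Rightarrow> ('h \<Rightarrow> 'k::field) \<Rightarrow> ('h \<Rightarrow> 'k) \<Rightarrow> ('h \<Rightarrow> 'k)" where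
  "conv \<Delta> p q = (\<lambda>h. \<Sum>(a, b)\<leftarrow>\<Delta> h. p a * q b)"

definition form_H ::
  "('k::field \<Rightarrow> 'h::ring_1 \<Rightarrow> 'h) \<Rightarrow> ('h \<Rightarrow> ('h \<times> 'h) list) \<Rightarrow> ('h \<Rightarrow> 'k) \<Rightarrow> ('h \<Rightarrow> 'h)
     \<Rightarrow> ('h \<Rightarrow> 'k) \<Rightarrow> ('h \<Rightarrow> 'k) \<Rightarrow> 'k" where
  "form_H sc \<Delta> \<epsilon> S \<chi> \<Phi> = conv \<Delta> \<chi> (\<Phi> \<circ> S) (idem_integral sc \<epsilon> UNIV)"

definition regular_char :: "('k::field \<Rightarrow> 'h::ring_1 \<Rightarrow> 'h) \<Rightarrow> ('h \<Rightarrow> 'k)" where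
  "regular_char sc = (\<lambda>h. \<Sum>\<chi>\<in>irr_chars sc UNIV. \<chi> 1 * \<chi> h)"

definition harpoon :: "'h::ring_1 \<Rightarrow> ('h \<Rightarrow> 'k) \<Rightarrow> ('h \<Rightarrow> 'k)" (infixr \<open>\<rightharpoonup>\<^sub>H\<close> 75) where
  "a \<rightharpoonup>\<^sub>H p = (\<lambda>a'. p (a' * a))"

definition lambda_B ::
  "('k::field \<Rightarrow> 'h::ring_1 \<Rightarrow> 'h) \<Rightarrow> ('h \<Rightarrow> 'k) \<Rightarrow> 'h set \<Rightarrow> ('h \<Rightarrow> 'k)" where
  "lambda_B sc \<epsilon> N = idem_integral sc \<epsilon> N \<rightharpoonup>\<^sub>H regular_char sc"

definition F_map ::
  "('k::field \<Rightarrow> 'h::ring_1 \<Rightarrow> 'h) \<Rightarrow> ('h \<Rightarrow> 'k) \<Rightarrow> 'h set \<Rightarrow> 'h \<Rightarrow> ('h \<Rightarrow> 'k)" where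
  "F_map sc \<epsilon> N n =
     restrict (\<lambda>n'. 1 / lambda_B sc \<epsilon> N 1 * (n \<rightharpoonup>\<^sub>H restrict (regular_char sc) N) n') N"

definition form_N ::
  "('k::field \<Rightarrow> 'h::ring_1 \<Rightarrow> 'h) \<Rightarrow> ('h \<Rightarrow> 'k) \<Rightarrow> 'h set \<Rightarrow> ('h \<Rightarrow> 'k) \<Rightarrow> ('h \<Rightarrow> 'k) \<Rightarrow> 'k" where
  "form_N sc \<epsilon> N p p' = p' (inv_into N (F_map sc \<epsilon> N) p)"

end

theory Submission
  imports Defs "Jordan_Normal_Form.Char_Poly" "HOL-Library.Function_Algebras"
begin

text \<open>Let \<open>\<chi>\<close> be an irreducible character of \<open>H\<close>. All four quantities in the theorem equal \<open>\<chi> t\<close>.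

  On the side of \<open>H\<close>, the module \<open>H \<otimes>\<^sub>N N t\<close> is the left ideal \<open>H t\<close>, and the trace of \<open>x \<mapsto> h x t\<close> on the
  semisimple algebra \<open>H\<close> is \<open>\<Sum>\<psi>. \<psi> h * \<psi> t\<close>, summed over the irreducible characters (\<open>trace_left_right\<close>). Thus the
  induced character is \<open>\<Sum>\<psi>. \<psi> t * \<psi>\<close> (\<open>induced_char_eq\<close>), and its form with \<open>\<chi>\<close> is \<open>\<chi> t\<close> by the orthogonality
  relations (\<open>orthonormal\<close>), which follow from Schur's lemma because the integral yields a Casimir element.

  On the side of \<open>N\<close>, one needs that \<open>N\<close> is semisimple and that the regular character of \<open>H\<close> restricts to a
  multiple of the regular character of \<open>N\<close> (\<open>N_semisimple\<close>, \<open>lam_proportional\<close>). Then the map \<open>N \<rightarrow> N\<^sup>*\<close> defining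
  the form is given by the regular character of \<open>N\<close>, whose dual basis on characters is explicit: if
  \<open>\<chi>\<close> restricts to \<open>\<Sum>\<psi>. m \<psi> * \<psi>\<close>, then the preimage of this restriction is the sum of the central idempotents with
  the weights \<open>m \<psi> / \<psi> 1\<close>, so that the form is \<open>m \<phi>\<close>, which is \<open>\<chi> t\<close> as \<open>\<psi> t\<close> is \<open>1\<close> for \<open>\<psi> = \<phi>\<close> and \<open>0\<close>
  otherwise (\<open>primitive_char\<close>, \<open>form_N_trace_function\<close>).

  Both facts on \<open>N\<close> come from a freeness theorem in the manner of Skryabin (\<open>tensor_free\<close>): for every
  \<open>N\<close>-module \<open>V\<close>, some power of \<open>H \<otimes> V\<close> is a free \<open>N\<close>-module. Minimal families of generators are found by
  counting the irreducible quotients of \<open>H \<otimes> V\<close>; that they satisfy no relation rests on the absence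
  of proper nonzero costable ideals of \<open>N\<close> (\<open>costable_ideal_zero\<close>). The latter is shown by a count of
  multiplicities: tensoring the regular module of \<open>N\<close> with \<open>H\<close> multiplies its character by the
  dimension of \<open>H\<close> (\<open>conv_rhoN\<close>), and in characteristic zero a sum of multiplicities vanishes only if each does.
  Taking \<open>V\<close> trivial, freeness compares the two regular characters. Taking \<open>V\<close> irreducible, the integral of \<open>H\<close>
  embeds \<open>V\<close> into \<open>H \<otimes> V\<close>, hence into a free module, in such a way that the annihilator of the radical of \<open>N\<close>
  acts on every irreducible module without vanishing; so the radical is annihilated by an element that is the identity modulo
  the radical, and it is zero.\<close>


section \<open>Traces of linear operators on finite-dimensional subspaces\<close>

definition lin_on :: "('k::field \<Rightarrow> 'x::ab_group_add \<Rightarrow> 'x) \<Rightarrow> 'x set \<Rightarrow> ('x \<Rightarrow> 'k) \<Rightarrow> bool" where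
  "lin_on s X f \<longleftrightarrow> (\<forall>x\<in>X. \<forall>y\<in>X. f (x + y) = f x + f y) \<and> (\<forall>c. \<forall>x\<in>X. f (s c x) = c * f x)"

definition endo_on :: "('k::field \<Rightarrow> 'x::ab_group_add \<Rightarrow> 'x) \<Rightarrow> 'x set \<Rightarrow> ('x \<Rightarrow> 'x) \<Rightarrow> bool" where
  "endo_on s X T \<longleftrightarrow> (\<forall>x\<in>X. T x \<in> X) \<and> (\<forall>x\<in>X. \<forall>y\<in>X. T (x + y) = T x + T y)
     \<and> (\<forall>c. \<forall>x\<in>X. T (s c x) = s c (T x))"

locale vspace = vector_space scale for scale :: "'a::field \<Rightarrow> 'b::ab_group_add \<Rightarrow> 'b"
begin

definition frame :: "'b set \<Rightarrow> 'i set \<Rightarrow> ('i \<Rightarrow> 'b) \<Rightarrow> ('i \<Rightarrow> 'b \<Rightarrow> 'a) \<Rightarrow> bool" where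
  "frame X K x \<xi> \<longleftrightarrow> finite K \<and> (\<forall>a\<in>K. x a \<in> X \<and> lin_on scale X (\<xi> a))
     \<and> (\<forall>v\<in>X. v = (\<Sum>a\<in>K. scale (\<xi> a v) (x a)))"

definition fin_subspace :: "'b set \<Rightarrow> bool" where
  "fin_subspace X \<longleftrightarrow> subspace X \<and> (\<exists>F. finite F \<and> X \<subseteq> span F)"

definition basis_of :: "'b set \<Rightarrow> 'b set \<Rightarrow> bool" where
  "basis_of X \<beta> \<longleftrightarrow> finite \<beta> \<and> independent \<beta> \<and> span \<beta> = X"

definition op_trace :: "'b set \<Rightarrow> ('b \<Rightarrow> 'b) \<Rightarrow> 'a" where
  "op_trace X T = (let \<beta> = SOME \<beta>. basis_of X \<beta> in \<Sum>b\<in>\<beta>. representation \<beta> (T b) b)"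

lemma lin_on_sum:
  assumes "lin_on scale X f" "subspace X" "finite K" "\<And>a. a \<in> K \<Longrightarrow> x a \<in> X"
  shows "f (\<Sum>a\<in>K. scale (c a) (x a)) = (\<Sum>a\<in>K. c a * f (x a))"
  using assms(3,4)
proof (induction K rule: finite_induct)
  case empty
  have "f (scale 0 0) = 0 * f 0" using assms(1,2) subspace_0 unfolding lin_on_def by blast
  then show ?case by simp
next
  case (insert a K)
  have 1: "(\<Sum>a\<in>K. scale (c a) (x a)) \<in> X" using insert assms(2) by (intro subspace_sum subspace_scale) auto
  have 2: "scale (c a) (x a) \<in> X" using insert assms(2) by (intro subspace_scale) auto
  have "f (scale (c a) (x a) + (\<Sum>a\<in>K. scale (c a) (x a))) = f (scale (c a) (x a)) + f (\<Sum>a\<in>K. scale (c a) (x a))"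
    using assms(1) 1 2 unfolding lin_on_def by blast
  moreover have "f (scale (c a) (x a)) = c a * f (x a)" using assms(1) insert unfolding lin_on_def by blast
  ultimately show ?case using insert by simp
qed

lemma endo_on_sum:
  assumes "endo_on scale X T" "subspace X" "finite K" "\<And>a. a \<in> K \<Longrightarrow> x a \<in> X"
  shows "T (\<Sum>a\<in>K. scale (c a) (x a)) = (\<Sum>a\<in>K. scale (c a) (T (x a)))"
  using assms(3,4)
proof (induction K rule: finite_induct)
  case empty
  have "T (scale 0 0) = scale 0 (T 0)" using assms(1,2) subspace_0 unfolding endo_on_def by blast
  then show ?case by simp
next
  case (insert a K)
  have 1: "(\<Sum>a\<in>K. scale (c a) (x a)) \<in> X" using insert assms(2) by (intro subspace_sum subspace_scale) auto
  have 2: "scale (c a) (x a) \<in> X" using insert assms(2) by (intro subspace_scale) auto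
  have "T (scale (c a) (x a) + (\<Sum>a\<in>K. scale (c a) (x a))) = T (scale (c a) (x a)) + T (\<Sum>a\<in>K. scale (c a) (x a))"
    using assms(1) 1 2 unfolding endo_on_def by blast
  moreover have "T (scale (c a) (x a)) = scale (c a) (T (x a))" using assms(1) insert unfolding endo_on_def by blast
  ultimately show ?case using insert by simp
qed

text \<open>Expanding \<open>T x\<^sub>a\<close> in the second frame and \<open>T y\<^sub>b\<close> in the first produces the same double sum.
  Allowing \<open>T\<close> to take values in a smaller subspace \<open>Y\<close> costs nothing and is what computes traces
  of idempotents and of operators that vanish on a quotient.\<close>

lemma trace_frame:
  assumes X: "subspace X" "frame X K x \<xi>" and Y: "subspace Y" "frame Y K' y \<eta>" and YX: "Y \<subseteq> X"
    and T: "endo_on scale X T" and TY: "\<And>v. v \<in> X \<Longrightarrow> T v \<in> Y"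
  shows "(\<Sum>a\<in>K. \<xi> a (T (x a))) = (\<Sum>b\<in>K'. \<eta> b (T (y b)))"
proof -
  have fX: "finite K" "\<And>a. a \<in> K \<Longrightarrow> x a \<in> X" "\<And>a. a \<in> K \<Longrightarrow> lin_on scale X (\<xi> a)"
      "\<And>v. v \<in> X \<Longrightarrow> v = (\<Sum>a\<in>K. scale (\<xi> a v) (x a))" using X(2) unfolding frame_def by blast+
  have fY: "finite K'" "\<And>a. a \<in> K' \<Longrightarrow> y a \<in> Y" "\<And>a. a \<in> K' \<Longrightarrow> lin_on scale Y (\<eta> a)"
      "\<And>v. v \<in> Y \<Longrightarrow> v = (\<Sum>a\<in>K'. scale (\<eta> a v) (y a))" using Y(2) unfolding frame_def by blast+
  have "(\<Sum>a\<in>K. \<xi> a (T (x a))) = (\<Sum>a\<in>K. \<Sum>b\<in>K'. \<eta> b (T (x a)) * \<xi> a (y b))"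
  proof (rule sum.cong[OF refl])
    fix a assume a: "a \<in> K"
    have "\<xi> a (T (x a)) = \<xi> a (\<Sum>b\<in>K'. scale (\<eta> b (T (x a))) (y b))"
      using fY(4)[OF TY[OF fX(2)[OF a]]] by simp
    also have "\<dots> = (\<Sum>b\<in>K'. \<eta> b (T (x a)) * \<xi> a (y b))"
      using fY(2) YX by (intro lin_on_sum[OF fX(3)[OF a] X(1) fY(1)]) auto
    finally show "\<xi> a (T (x a)) = (\<Sum>b\<in>K'. \<eta> b (T (x a)) * \<xi> a (y b))" .
  qed
  also have "\<dots> = (\<Sum>b\<in>K'. \<Sum>a\<in>K. \<xi> a (y b) * \<eta> b (T (x a)))"
    by (subst sum.swap) (simp add: mult.commute)
  also have "\<dots> = (\<Sum>b\<in>K'. \<eta> b (T (y b)))"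
  proof (rule sum.cong[OF refl])
    fix b assume b: "b \<in> K'"
    have yb: "y b \<in> X" using fY(2) YX b by auto
    have "T (y b) = T (\<Sum>a\<in>K. scale (\<xi> a (y b)) (x a))" using fX(4)[OF yb] by simp
    also have "\<dots> = (\<Sum>a\<in>K. scale (\<xi> a (y b)) (T (x a)))"
      using fX(2) by (intro endo_on_sum[OF T X(1) fX(1)])
    finally have "\<eta> b (T (y b)) = \<eta> b (\<Sum>a\<in>K. scale (\<xi> a (y b)) (T (x a)))" by simp
    also have "\<dots> = (\<Sum>a\<in>K. \<xi> a (y b) * \<eta> b (T (x a)))"
      using fX(2) TY by (intro lin_on_sum[OF fY(3)[OF b] Y(1) fX(1)]) auto
    finally show "(\<Sum>a\<in>K. \<xi> a (y b) * \<eta> b (T (x a))) = \<eta> b (T (y b))" by simp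
  qed
  finally show ?thesis .
qed

lemma fin_subspace_basis:
  assumes "fin_subspace X" "independent \<beta>" "\<beta> \<subseteq> X"
  obtains \<gamma> where "basis_of X \<gamma>" "\<beta> \<subseteq> \<gamma>"
proof -
  obtain F where F: "subspace X" "finite F" "X \<subseteq> span F" using assms(1) unfolding fin_subspace_def by auto
  obtain \<gamma> where g: "\<beta> \<subseteq> \<gamma>" "\<gamma> \<subseteq> X" "independent \<gamma>" "X \<subseteq> span \<gamma>"
    using maximal_independent_subset_extend[OF assms(3,2)] by metis
  have "finite \<gamma>" using independent_span_bound[OF F(2) g(3)] g(2) F(3) by auto
  moreover have "span \<gamma> = X" using g F(1) span_minimal by blast
  ultimately show ?thesis using g that unfolding basis_of_def by auto
qed

lemma fin_subspace_has_basis: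
  assumes "fin_subspace X" obtains \<beta> where "basis_of X \<beta>"
  using fin_subspace_basis[OF assms independent_empty] by auto

lemma basis_frame:
  assumes "basis_of X \<beta>" shows "frame X \<beta> (\<lambda>b. b) (\<lambda>b v. representation \<beta> v b)"
  using assms unfolding basis_of_def frame_def lin_on_def
  by (auto simp: representation_add representation_scale sum_representation_eq span_base)

lemma basis_of_subspace: "basis_of X \<beta> \<Longrightarrow> subspace X"
  unfolding basis_of_def by auto

lemma basis_of_subset: "basis_of X \<beta> \<Longrightarrow> \<beta> \<subseteq> X"
  unfolding basis_of_def by (auto intro: span_base)

lemma op_trace_onto:
  assumes X: "fin_subspace X" and Y: "subspace Y" "frame Y K y \<eta>" "Y \<subseteq> X"
    and T: "endo_on scale X T" "\<And>v. v \<in> X \<Longrightarrow> T v \<in> Y"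
  shows "op_trace X T = (\<Sum>b\<in>K. \<eta> b (T (y b)))"
proof -
  define \<beta> where "\<beta> = (SOME \<beta>. basis_of X \<beta>)"
  have b: "basis_of X \<beta>" unfolding \<beta>_def using fin_subspace_has_basis[OF X] by (metis someI)
  show ?thesis unfolding op_trace_def Let_def \<beta>_def[symmetric]
    by (rule trace_frame[OF basis_of_subspace[OF b] basis_frame[OF b] Y T])
qed

lemma frame_fin_subspace:
  assumes "subspace X" "frame X K x \<xi>" shows "fin_subspace X"
proof -
  have "v \<in> span (x ` K)" if "v \<in> X" for v
  proof -
    have "(\<Sum>a\<in>K. scale (\<xi> a v) (x a)) \<in> span (x ` K)" by (intro span_sum span_scale span_base imageI)
    moreover have "v = (\<Sum>a\<in>K. scale (\<xi> a v) (x a))" using assms(2) that unfolding frame_def by blast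
    ultimately show ?thesis by simp
  qed
  then show ?thesis using assms unfolding fin_subspace_def frame_def by (intro conjI exI[of _ "x ` K"]) auto
qed

lemma op_trace_frame:
  assumes "subspace X" "frame X K x \<xi>" "endo_on scale X T"
  shows "op_trace X T = (\<Sum>b\<in>K. \<xi> b (T (x b)))"
  using op_trace_onto[OF frame_fin_subspace[OF assms(1,2)] assms(1,2) _ assms(3)] assms(3)
  unfolding endo_on_def by auto

lemma op_trace_sub:
  assumes "fin_subspace X" "fin_subspace Y" "Y \<subseteq> X" "endo_on scale X T" "\<And>v. v \<in> X \<Longrightarrow> T v \<in> Y"
  shows "op_trace X T = op_trace Y T"
proof -
  obtain \<beta> where b: "basis_of Y \<beta>" using fin_subspace_has_basis[OF assms(2)] .
  note s = basis_of_subspace[OF b] and f = basis_frame[OF b]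
  have "endo_on scale Y T" using assms(3,4,5) unfolding endo_on_def by blast
  from op_trace_frame[OF s f this] op_trace_onto[OF assms(1) s f assms(3,4,5)] show ?thesis by simp
qed

lemma op_trace_id: assumes "basis_of X \<beta>" shows "op_trace X (\<lambda>v. v) = of_nat (card \<beta>)"
proof -
  have e: "endo_on scale X (\<lambda>v. v)" unfolding endo_on_def by auto
  have "op_trace X (\<lambda>v. v) = (\<Sum>b\<in>\<beta>. representation \<beta> b b)"
    using op_trace_frame[OF basis_of_subspace[OF assms] basis_frame[OF assms] e] .
  also have "\<dots> = (\<Sum>b\<in>\<beta>. 1)" using assms unfolding basis_of_def
    by (intro sum.cong) (auto simp: representation_basis)
  finally show ?thesis by simp
qed

lemma op_trace_cong: 
  assumes "fin_subspace X" "\<And>v. v \<in> X \<Longrightarrow> T v = T' v" shows "op_trace X T = op_trace X T'"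
proof -
  define \<beta> where "\<beta> = (SOME \<beta>. basis_of X \<beta>)"
  have b: "basis_of X \<beta>" unfolding \<beta>_def using fin_subspace_has_basis[OF assms(1)] by (metis someI)
  show ?thesis unfolding op_trace_def Let_def \<beta>_def[symmetric]
    using basis_of_subset[OF b] assms(2) by (intro sum.cong) auto
qed

lemma op_trace_idem:
  assumes X: "fin_subspace X" and T: "endo_on scale X T" "\<And>v. v \<in> X \<Longrightarrow> T (T v) = T v"
  obtains n where "op_trace X T = of_nat n" "n = 0 \<longleftrightarrow> (\<forall>v\<in>X. T v = 0)"
proof -
  define Y where "Y = T ` X"
  have sX: "subspace X" using X unfolding fin_subspace_def by auto
  have YX: "Y \<subseteq> X" using T unfolding Y_def endo_on_def by auto
  have "subspace Y" unfolding subspace_def Y_def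
  proof (intro conjI ballI allI)
    have "T (scale 0 0) = scale 0 (T 0)" using T(1) sX subspace_0 unfolding endo_on_def by blast
    then have "T 0 = 0" by simp
    then show "0 \<in> T ` X" using sX subspace_0 by (metis imageI)
    fix u v c assume "u \<in> T ` X"
    then obtain u' where u: "u' \<in> X" "u = T u'" by auto
    have "scale c u = T (scale c u')" using T u unfolding endo_on_def by auto
    then show "scale c u \<in> T ` X" using u sX subspace_scale by auto
    assume "v \<in> T ` X"
    then obtain v' where v: "v' \<in> X" "v = T v'" by auto
    have "u + v = T (u' + v')" using T u v unfolding endo_on_def by auto
    then show "u + v \<in> T ` X" using u v sX subspace_add by auto
  qed
  with X YX have Y: "fin_subspace Y" unfolding fin_subspace_def by (meson order_trans)
  then obtain \<beta> where b: "basis_of Y \<beta>" using fin_subspace_has_basis by auto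
  have "op_trace X T = op_trace Y T" by (rule op_trace_sub[OF X Y YX T(1)]) (auto simp: Y_def)
  also have "\<dots> = op_trace Y (\<lambda>v. v)" using T(2) by (intro op_trace_cong[OF Y]) (auto simp: Y_def)
  also have "\<dots> = of_nat (card \<beta>)" by (rule op_trace_id[OF b])
  finally have 1: "op_trace X T = of_nat (card \<beta>)" .
  have "card \<beta> = 0 \<longleftrightarrow> Y \<subseteq> {0}"
  proof
    assume "card \<beta> = 0" then have "\<beta> = {}" using b unfolding basis_of_def by auto
    then show "Y \<subseteq> {0}" using b unfolding basis_of_def by auto
  next
    assume "Y \<subseteq> {0}"
    then have "\<beta> \<subseteq> {0}" using basis_of_subset[OF b] by auto
    moreover have "0 \<notin> \<beta>" using b dependent_zero unfolding basis_of_def by blast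
    ultimately have "\<beta> = {}" by blast
    then show "card \<beta> = 0" by simp
  qed
  then show ?thesis using 1 that[of "card \<beta>"] unfolding Y_def by auto
qed

text \<open>Dimensions of nested subspaces, in the form used for choosing maximal submodules.\<close>

lemma fin_subspace_subset:
  "fin_subspace X \<Longrightarrow> subspace Y \<Longrightarrow> Y \<subseteq> X \<Longrightarrow> fin_subspace Y"
  unfolding fin_subspace_def by (meson order_trans)

lemma dim_strict_mono:
  assumes "fin_subspace X" "subspace Y" "Y \<subset> X" shows "dim Y < dim X"
proof -
  have "fin_subspace Y" using fin_subspace_subset assms by blast
  then obtain \<beta> where b: "basis_of Y \<beta>" using fin_subspace_has_basis by auto
  obtain \<gamma> where g: "basis_of X \<gamma>" "\<beta> \<subseteq> \<gamma>"
    using fin_subspace_basis[OF assms(1)] b basis_of_subset[OF b] assms(3) unfolding basis_of_def by (metis order_trans psubset_imp_subset)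
  have "\<beta> \<noteq> \<gamma>" using b g assms(3) unfolding basis_of_def by auto
  then have "card \<beta> < card \<gamma>" using g unfolding basis_of_def by (intro psubset_card_mono) auto
  moreover have "dim Y = card \<beta>" "dim X = card \<gamma>"
    using b g dim_span_eq_card_independent unfolding basis_of_def by metis+
  ultimately show ?thesis by simp
qed

end

section \<open>Matrices\<close>

lemma mat_trace_comm:
  assumes "A \<in> carrier_mat m n" "B \<in> carrier_mat n m"
  shows "mat_trace (A * B) = mat_trace (B * (A::'k::field mat))"
proof -
  have "mat_trace (A * B) = (\<Sum>i<m. \<Sum>j<n. A $$ (i,j) * B $$ (j,i))"
    using assms unfolding mat_trace_def
    by (auto simp: scalar_prod_def lessThan_atLeast0 intro!: sum.cong)
  also have "\<dots> = (\<Sum>j<n. \<Sum>i<m. B $$ (j,i) * A $$ (i,j))"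
    by (subst sum.swap) (simp add: mult.commute)
  also have "\<dots> = mat_trace (B * A)"
    using assms unfolding mat_trace_def
    by (auto simp: scalar_prod_def lessThan_atLeast0 intro!: sum.cong)
  finally show ?thesis .
qed

lemma fun_matrix_left_right_inverse:
  fixes A B :: "'i \<Rightarrow> 'i \<Rightarrow> 'k::field"
  assumes fin: "finite I"
    and AB: "\<And>i j. i \<in> I \<Longrightarrow> j \<in> I \<Longrightarrow> (\<Sum>k\<in>I. A i k * B k j) = (if i = j then 1 else 0)"
    and ij: "i \<in> I" "j \<in> I"
  shows "(\<Sum>k\<in>I. B i k * A k j) = (if i = j then 1 else 0)"
proof -
  obtain h where h: "bij_betw h {..<card I} I"
    using ex_bij_betw_nat_finite[OF fin] by (auto simp: lessThan_atLeast0)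
  let ?n = "card I"
  define A' where "A' = mat ?n ?n (\<lambda>(i,j). A (h i) (h j))"
  define B' where "B' = mat ?n ?n (\<lambda>(i,j). B (h i) (h j))"
  have c: "A' \<in> carrier_mat ?n ?n" "B' \<in> carrier_mat ?n ?n" unfolding A'_def B'_def by auto
  have hI: "h i \<in> I" if "i < ?n" for i using h that unfolding bij_betw_def by auto
  have hinj: "h i = h j \<longleftrightarrow> i = j" if "i < ?n" "j < ?n" for i j
    using h that unfolding bij_betw_def inj_on_def by auto
  have re: "(\<Sum>k<?n. f (h k)) = (\<Sum>k\<in>I. f k)" for f :: "'i \<Rightarrow> 'k"
    by (rule sum.reindex_bij_betw[OF h])
  have "A' * B' = 1\<^sub>m ?n"
  proof (rule eq_matI)
    fix i j assume "i < dim_row (1\<^sub>m ?n :: 'k mat)" "j < dim_col (1\<^sub>m ?n :: 'k mat)"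
    then have l: "i < ?n" "j < ?n" by auto
    have "(A' * B') $$ (i,j) = (\<Sum>k<?n. A (h i) (h k) * B (h k) (h j))"
      using l unfolding A'_def B'_def by (auto simp: scalar_prod_def lessThan_atLeast0)
    also have "\<dots> = (if h i = h j then 1 else 0)" using re[of "\<lambda>k. A (h i) k * B k (h j)"] AB[OF hI hI] l by simp
    finally show "(A' * B') $$ (i,j) = 1\<^sub>m ?n $$ (i,j)" using l hinj by auto
  qed (auto simp: A'_def B'_def)
  then have BA: "B' * A' = 1\<^sub>m ?n" by (rule mat_mult_left_right_inverse[OF c])
  obtain i' j' where l: "i' < ?n" "j' < ?n" "i = h i'" "j = h j'"
    using h ij unfolding bij_betw_def by (metis imageE lessThan_iff)
  have "(\<Sum>k\<in>I. B i k * A k j) = (\<Sum>k<?n. B (h i') (h k) * A (h k) (h j'))"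
    using re[of "\<lambda>k. B i k * A k j"] l by simp
  also have "\<dots> = (B' * A') $$ (i',j')"
    using l unfolding A'_def B'_def by (auto simp: scalar_prod_def lessThan_atLeast0)
  also have "\<dots> = (if i' = j' then 1 else 0)" using BA l by simp
  finally show ?thesis using l hinj by auto
qed

lemma exists_eigenvector:
  fixes A :: "'k::alg_closed_field mat"
  assumes "A \<in> carrier_mat n n" "n > 0"
  obtains c v where "v \<in> carrier_vec n" "v \<noteq> 0\<^sub>v n" "A *\<^sub>v v = c \<cdot>\<^sub>v v"
proof -
  have "degree (char_poly A) = n" using degree_monic_char_poly[OF assms(1)] by auto
  then obtain c where "poly (char_poly A) c = 0" using alg_closed_imp_poly_has_root assms(2) by metis
  then have "eigenvalue A c" using eigenvalue_root_char_poly[OF assms(1)] by simp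
  then show ?thesis using that assms(1) unfolding eigenvalue_def eigenvector_def by auto
qed


lemma mult_mat_vec_index:
  assumes "A \<in> carrier_mat n m" "v \<in> carrier_vec m" "i < n"
  shows "(A *\<^sub>v v) $ i = (\<Sum>j<m. A $$ (i,j) * v $ j)"
  using assms by (auto simp: scalar_prod_def lessThan_atLeast0)

lemma mult_mat_index:
  assumes "A \<in> carrier_mat n m" "B \<in> carrier_mat m l" "i < n" "j < l"
  shows "(A * B) $$ (i,j) = (\<Sum>k<m. A $$ (i,k) * B $$ (k,j))"
  using assms by (auto simp: scalar_prod_def lessThan_atLeast0)

lemma mult_mat_unit_vec:
  fixes A :: "'k::field mat"
  assumes "A \<in> carrier_mat n m" "c < m"
  shows "A *\<^sub>v unit_vec m c = col A c"
proof (rule eq_vecI)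
  fix i assume "i < dim_vec (col A c)"
  then have i: "i < n" using assms by auto
  have "(A *\<^sub>v unit_vec m c) $ i = (\<Sum>j<m. A $$ (i,j) * unit_vec m c $ j)"
    using assms i by (intro mult_mat_vec_index) auto
  also have "\<dots> = (\<Sum>j<m. if j = c then A $$ (i,j) else 0)"
    using assms(2) by (intro sum.cong) (auto simp: unit_vec_def)
  also have "\<dots> = A $$ (i,c)" using assms by simp
  finally show "(A *\<^sub>v unit_vec m c) $ i = col A c $ i" using assms i by simp
qed (use assms in auto)

lemma mat_eq_by_vec:
  assumes "A \<in> carrier_mat n m" "B \<in> carrier_mat n m" "\<And>v. v \<in> carrier_vec m \<Longrightarrow> A *\<^sub>v v = B *\<^sub>v v"
  shows "A = (B :: 'k::field mat)"
proof (rule eq_matI)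
  fix i j assume "i < dim_row B" "j < dim_col B"
  then have ij: "i < n" "j < m" using assms by auto
  have "col A j = col B j" using assms(3)[of "unit_vec m j"] mult_mat_unit_vec[OF assms(1) ij(2)] mult_mat_unit_vec[OF assms(2) ij(2)] by simp
  then have "col A j $ i = col B j $ i" by simp
  then show "A $$ (i,j) = B $$ (i,j)" using assms ij by auto
qed (use assms in auto)

section \<open>Representations of finite-dimensional algebras\<close>

locale fd_subalgebra = unital_algebra sc + vspace sc
  for sc :: "'k::{alg_closed_field,field_char_0} \<Rightarrow> 'h::ring_1 \<Rightarrow> 'h" +
  fixes A :: "'h set"
  assumes fin_A: "fin_subspace A" and one_A: "1 \<in> A" and mult_A: "x \<in> A \<Longrightarrow> y \<in> A \<Longrightarrow> x * y \<in> A"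
begin

lemma subspace_A: "subspace A" using fin_A unfolding fin_subspace_def by auto
lemma add_A: "x \<in> A \<Longrightarrow> y \<in> A \<Longrightarrow> x + y \<in> A" using subspace_A subspace_add by auto
lemma diff_A: "x \<in> A \<Longrightarrow> y \<in> A \<Longrightarrow> x - y \<in> A" using subspace_A subspace_diff by auto
lemma scale_A: "x \<in> A \<Longrightarrow> sc c x \<in> A" using subspace_A subspace_scale by auto
lemma sum_A: "(\<And>i. i \<in> I \<Longrightarrow> f i \<in> A) \<Longrightarrow> sum f I \<in> A" using subspace_A subspace_sum by auto
lemma zero_A: "0 \<in> A" using subspace_A subspace_0 by auto

subsection \<open>Elementary properties of representations\<close>

context
  fixes d \<rho> assumes rep: "is_rep sc A d \<rho>"
begin

lemma rep_carrier: "a \<in> A \<Longrightarrow> \<rho> a \<in> carrier_mat d d" using rep unfolding is_rep_def by auto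
lemma rep_one: "\<rho> 1 = 1\<^sub>m d" using rep unfolding is_rep_def by auto
lemma rep_mult: "a \<in> A \<Longrightarrow> b \<in> A \<Longrightarrow> \<rho> (a * b) = \<rho> a * \<rho> b" using rep unfolding is_rep_def by auto
lemma rep_add: "a \<in> A \<Longrightarrow> b \<in> A \<Longrightarrow> \<rho> (a + b) = \<rho> a + \<rho> b" using rep unfolding is_rep_def by auto
lemma rep_scale: "a \<in> A \<Longrightarrow> \<rho> (sc c a) = c \<cdot>\<^sub>m \<rho> a" using rep unfolding is_rep_def by auto

lemma rep_entry_lin: "i < d \<Longrightarrow> j < d \<Longrightarrow> lin_on sc A (\<lambda>a. \<rho> a $$ (i,j))"
  unfolding lin_on_def
proof (intro conjI ballI allI)
  fix x assume x: "x \<in> A" and ij: "i < d" "j < d"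
  show "\<rho> (x + y) $$ (i,j) = \<rho> x $$ (i,j) + \<rho> y $$ (i,j)" if "y \<in> A" for y
    using rep_add[OF x that] rep_carrier[OF x] rep_carrier[OF that] ij by simp
  show "\<rho> (sc c x) $$ (i,j) = c * \<rho> x $$ (i,j)" for c
    using rep_scale[OF x] rep_carrier[OF x] ij by simp
qed

lemma rep_entry_mult:
  assumes "a \<in> A" "b \<in> A" "i < d" "j < d"
  shows "\<rho> (a * b) $$ (i,j) = (\<Sum>k<d. \<rho> a $$ (i,k) * \<rho> b $$ (k,j))"
  unfolding rep_mult[OF assms(1,2)]
  by (rule mult_mat_index[OF rep_carrier[OF assms(1)] rep_carrier[OF assms(2)] assms(3,4)])

lemma rep_entry_sum:
  assumes "finite K" "\<And>a. a \<in> K \<Longrightarrow> x a \<in> A" "i < d" "j < d"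
  shows "\<rho> (\<Sum>a\<in>K. sc (c a) (x a)) $$ (i,j) = (\<Sum>a\<in>K. c a * \<rho> (x a) $$ (i,j))"
  by (rule lin_on_sum[OF rep_entry_lin subspace_A]) (use assms in auto)

lemma rep_entry_add:
  "\<lbrakk>a \<in> A; b \<in> A; i < d; j < d\<rbrakk> \<Longrightarrow> \<rho> (a + b) $$ (i,j) = \<rho> a $$ (i,j) + \<rho> b $$ (i,j)"
  using rep_entry_lin unfolding lin_on_def by blast

lemma rep_entry_scale:
  "\<lbrakk>a \<in> A; i < d; j < d\<rbrakk> \<Longrightarrow> \<rho> (sc c a) $$ (i,j) = c * \<rho> a $$ (i,j)"
  using rep_entry_lin unfolding lin_on_def by blast

lemma rep_entry_sum':
  assumes "finite K" "\<And>a. a \<in> K \<Longrightarrow> x a \<in> A" "i < d" "j < d"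
  shows "\<rho> (\<Sum>a\<in>K. x a) $$ (i,j) = (\<Sum>a\<in>K. \<rho> (x a) $$ (i,j))"
  using rep_entry_sum[OF assms, where c="\<lambda>_. 1"] by simp

lemma rep_entry_zero: "i < d \<Longrightarrow> j < d \<Longrightarrow> \<rho> 0 $$ (i,j) = 0"
  using rep_entry_sum'[of "{}"] by simp

lemma rep_entry_diff:
  assumes "a \<in> A" "b \<in> A" "i < d" "j < d"
  shows "\<rho> (a - b) $$ (i,j) = \<rho> a $$ (i,j) - \<rho> b $$ (i,j)"
  using rep_entry_add[of "a - b" b i j] assms diff_A by (simp add: algebra_simps)

lemma rep_trace: "a \<in> A \<Longrightarrow> character A \<rho> a = (\<Sum>i<d. \<rho> a $$ (i,i))"
  using rep_carrier unfolding character_def mat_trace_def by auto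

lemma rep_trace_lin: "lin_on sc A (character A \<rho>)"
  unfolding lin_on_def
  by (auto simp: rep_trace add_A scale_A rep_entry_add rep_entry_scale sum.distrib sum_distrib_left)

lemma rep_char_one: "character A \<rho> 1 = of_nat d"
  using rep_trace[OF one_A] rep_one by simp

lemma rep_char_comm: "a \<in> A \<Longrightarrow> b \<in> A \<Longrightarrow> character A \<rho> (a * b) = character A \<rho> (b * a)"
  unfolding character_def using mat_trace_comm[OF rep_carrier rep_carrier] rep_mult mult_A by auto

end

subsection \<open>Schur's lemma\<close>

lemma irred_rep: "irreducible_rep sc A d \<rho> \<Longrightarrow> is_rep sc A d \<rho>"
  unfolding irreducible_rep_def by auto

lemma irred_pos: "irreducible_rep sc A d \<rho> \<Longrightarrow> d > 0"
  unfolding irreducible_rep_def by auto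

lemma schur:
  assumes irr: "irreducible_rep sc A d \<rho>" "irreducible_rep sc A e \<tau>"
    and th: "\<theta> \<in> carrier_mat e d" "\<And>a. a \<in> A \<Longrightarrow> \<tau> a * \<theta> = \<theta> * \<rho> a" and nz: "\<theta> \<noteq> 0\<^sub>m e d"
  obtains Y where "Y \<in> carrier_mat d e" "\<theta> * Y = 1\<^sub>m e" "Y * \<theta> = 1\<^sub>m d"
proof -
  note r1 = irred_rep[OF irr(1)] and r2 = irred_rep[OF irr(2)]
  define W where "W = {v \<in> carrier_vec d. \<theta> *\<^sub>v v = 0\<^sub>v e}"
  define W' where "W' = {\<theta> *\<^sub>v v | v. v \<in> carrier_vec d}"
  have eq: "\<theta> *\<^sub>v (\<rho> a *\<^sub>v v) = \<tau> a *\<^sub>v (\<theta> *\<^sub>v v)" if "a \<in> A" "v \<in> carrier_vec d" for a v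
    using assoc_mult_mat_vec[OF th(1) rep_carrier[OF r1 that(1)] that(2)]
      assoc_mult_mat_vec[OF rep_carrier[OF r2 that(1)] th(1) that(2)] th(2)[OF that(1)] by simp
  have "invariant_subspace A d \<rho> W"
    unfolding invariant_subspace_def
  proof (intro conjI ballI allI)
    show "W \<subseteq> carrier_vec d" "0\<^sub>v d \<in> W" unfolding W_def using th(1) by auto
    fix v assume v: "v \<in> W"
    show "v + w \<in> W" if "w \<in> W" for w
      using v that th(1) unfolding W_def by (auto simp: mult_add_distrib_mat_vec)
    show "c \<cdot>\<^sub>v v \<in> W" for c
      using v th(1) unfolding W_def by (auto simp: mult_mat_vec)
    show "\<rho> a *\<^sub>v v \<in> W" if "a \<in> A" for a
    proof -
      have "\<tau> a *\<^sub>v 0\<^sub>v e = 0\<^sub>v e" using rep_carrier[OF r2 that] by auto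
      then show ?thesis using v eq[OF that] rep_carrier[OF r1 that] unfolding W_def by auto
    qed
  qed
  then have "W = {0\<^sub>v d} \<or> W = carrier_vec d" using irr(1) unfolding irreducible_rep_def by auto
  moreover have "W \<noteq> carrier_vec d"
  proof
    assume "W = carrier_vec d"
    then have z: "\<theta> *\<^sub>v v = 0\<^sub>m e d *\<^sub>v v" if "v \<in> carrier_vec d" for v
    proof -
      have "\<theta> *\<^sub>v v = 0\<^sub>v e" using \<open>W = carrier_vec d\<close> that unfolding W_def by blast
      moreover have "0\<^sub>m e d *\<^sub>v v = 0\<^sub>v e" using that by (intro eq_vecI) auto
      ultimately show ?thesis by simp
    qed
    have "\<theta> = 0\<^sub>m e d" by (rule mat_eq_by_vec[OF th(1) zero_carrier_mat z])
    then show False using nz by simp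
  qed
  ultimately have W0: "W = {0\<^sub>v d}" by auto
  have "invariant_subspace A e \<tau> W'"
    unfolding invariant_subspace_def
  proof (intro conjI ballI allI)
    show "W' \<subseteq> carrier_vec e" unfolding W'_def using th(1) by auto
    have "\<theta> *\<^sub>v 0\<^sub>v d = 0\<^sub>v e" using th(1) by auto
    then show "0\<^sub>v e \<in> W'" unfolding W'_def by (metis (mono_tags, lifting) mem_Collect_eq zero_carrier_vec)
    fix w assume "w \<in> W'"
    then obtain v where v: "v \<in> carrier_vec d" "w = \<theta> *\<^sub>v v" unfolding W'_def by auto
    show "w + w' \<in> W'" if "w' \<in> W'" for w'
    proof -
      obtain v' where v': "v' \<in> carrier_vec d" "w' = \<theta> *\<^sub>v v'" using \<open>w' \<in> W'\<close> unfolding W'_def by auto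
      then have "w + w' = \<theta> *\<^sub>v (v + v')" using th(1) v by (simp add: mult_add_distrib_mat_vec)
      then show ?thesis using v v' unfolding W'_def by auto
    qed
    show "c \<cdot>\<^sub>v w \<in> W'" for c
    proof -
      have "c \<cdot>\<^sub>v w = \<theta> *\<^sub>v (c \<cdot>\<^sub>v v)" using th(1) v by (simp add: mult_mat_vec)
      then show ?thesis using v unfolding W'_def by auto
    qed
    show "\<tau> a *\<^sub>v w \<in> W'" if "a \<in> A" for a
    proof -
      have "\<tau> a *\<^sub>v w = \<theta> *\<^sub>v (\<rho> a *\<^sub>v v)" using eq[OF that v(1)] v by simp
      moreover have "\<rho> a *\<^sub>v v \<in> carrier_vec d" using rep_carrier[OF r1 that] v by simp
      ultimately show ?thesis unfolding W'_def by blast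
    qed
  qed
  then have "W' = {0\<^sub>v e} \<or> W' = carrier_vec e" using irr(2) unfolding irreducible_rep_def by auto
  moreover have "W' \<noteq> {0\<^sub>v e}"
  proof
    assume z: "W' = {0\<^sub>v e}"
    have "carrier_vec d \<subseteq> W" using z unfolding W_def W'_def by blast
    moreover have "unit_vec d 0 \<in> carrier_vec d" "unit_vec d 0 \<noteq> 0\<^sub>v d" using irred_pos[OF irr(1)] by auto
    ultimately show False using W0 by blast
  qed
  ultimately have W1: "W' = carrier_vec e" by auto
  have "\<exists>v. v \<in> carrier_vec d \<and> \<theta> *\<^sub>v v = unit_vec e i" for i
  proof -
    have "unit_vec e i \<in> W'" using W1 by simp
    then show ?thesis unfolding W'_def by auto
  qed
  then obtain v where v: "\<And>i. v i \<in> carrier_vec d" "\<And>i. \<theta> *\<^sub>v v i = unit_vec e i" by metis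
  define Y where "Y = mat_of_cols d (map v [0..<e])"
  have Y: "Y \<in> carrier_mat d e" unfolding Y_def by auto
  have cY: "col Y j = v j" if "j < e" for j unfolding Y_def using that v(1) by (subst col_mat_of_cols) auto
  have one: "\<theta> * Y = 1\<^sub>m e"
  proof (rule eq_matI)
    fix i j assume "i < dim_row (1\<^sub>m e :: 'k mat)" "j < dim_col (1\<^sub>m e :: 'k mat)"
    then have ij: "i < e" "j < e" by auto
    have "col (\<theta> * Y) j = \<theta> *\<^sub>v col Y j" using th(1) Y ij by simp
    also have "\<dots> = unit_vec e j" using cY[OF ij(2)] v by simp
    finally have "col (\<theta> * Y) j $ i = unit_vec e j $ i" by simp
    moreover have "col (\<theta> * Y) j $ i = (\<theta> * Y) $$ (i,j)" by (rule index_col) (use th(1) Y ij in auto)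
    ultimately show "(\<theta> * Y) $$ (i,j) = 1\<^sub>m e $$ (i,j)" using ij by auto
  qed (use th(1) Y in auto)
  have "Y * \<theta> = 1\<^sub>m d"
  proof (rule mat_eq_by_vec[of _ d d])
    fix x assume x: "(x::'k vec) \<in> carrier_vec d"
    let ?y = "(Y * \<theta>) *\<^sub>v x - x"
    have c: "(Y * \<theta>) *\<^sub>v x \<in> carrier_vec d" using Y th(1) x by (intro mult_mat_vec_carrier[of _ d d]) auto
    have "\<theta> *\<^sub>v ?y = \<theta> *\<^sub>v ((Y * \<theta>) *\<^sub>v x) - \<theta> *\<^sub>v x"
      using th(1) c x by (rule mult_minus_distrib_mat_vec)
    also have "\<theta> *\<^sub>v ((Y * \<theta>) *\<^sub>v x) = (\<theta> * Y) *\<^sub>v (\<theta> *\<^sub>v x)"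
      using Y th(1) x by (simp add: assoc_mult_mat_vec[of _ d e] assoc_mult_mat_vec[of _ e d])
    also have "\<dots> = \<theta> *\<^sub>v x" using one th(1) x by auto
    finally have "\<theta> *\<^sub>v ?y = 0\<^sub>v e" using th(1) x by auto
    then have "?y \<in> W" unfolding W_def using c x by auto
    then have "?y = 0\<^sub>v d" using W0 by auto
    have "(Y * \<theta>) *\<^sub>v x = x"
    proof (rule eq_vecI)
      fix i assume "i < dim_vec x"
      then have i: "i < d" using x by auto
      have "?y $ i = 0" using \<open>?y = 0\<^sub>v d\<close> i by simp
      then show "((Y * \<theta>) *\<^sub>v x) $ i = x $ i" using c x i by (simp del: index_mult_mat_vec)
    qed (use c x Y in auto)
    then show "(Y * \<theta>) *\<^sub>v x = 1\<^sub>m d *\<^sub>v x" using x by simp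
  qed (use Y th(1) in auto)
  then show ?thesis using that Y one by blast
qed

lemma schur_scalar:
  assumes irr: "irreducible_rep sc A d \<rho>"
    and th: "\<theta> \<in> carrier_mat d d" "\<And>a. a \<in> A \<Longrightarrow> \<rho> a * \<theta> = \<theta> * \<rho> a"
  obtains c where "\<theta> = c \<cdot>\<^sub>m 1\<^sub>m d"
proof -
  note r = irred_rep[OF irr] and d = irred_pos[OF irr]
  obtain c v where v: "v \<in> carrier_vec d" "v \<noteq> 0\<^sub>v d" "\<theta> *\<^sub>v v = c \<cdot>\<^sub>v v"
    using exists_eigenvector[OF th(1) d] by metis
  define \<theta>' where "\<theta>' = \<theta> - c \<cdot>\<^sub>m 1\<^sub>m d"
  have t': "\<theta>' \<in> carrier_mat d d" unfolding \<theta>'_def using th(1) by auto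
  have t'v: "\<theta>' *\<^sub>v v = 0\<^sub>v d"
  proof -
    have "\<theta>' *\<^sub>v v = \<theta> *\<^sub>v v - (c \<cdot>\<^sub>m 1\<^sub>m d) *\<^sub>v v" unfolding \<theta>'_def
      using th(1) v(1) by (intro minus_mult_distrib_mat_vec) auto
    also have "(c \<cdot>\<^sub>m 1\<^sub>m d) *\<^sub>v v = c \<cdot>\<^sub>v v" using v(1) by auto
    finally show ?thesis using v by auto
  qed
  have comm: "\<rho> a * \<theta>' = \<theta>' * \<rho> a" if "a \<in> A" for a
  proof -
    have ca: "\<rho> a \<in> carrier_mat d d" using rep_carrier[OF r that] .
    have "\<rho> a * \<theta>' = \<rho> a * \<theta> - \<rho> a * (c \<cdot>\<^sub>m 1\<^sub>m d)" unfolding \<theta>'_def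
      using ca th(1) by (intro mult_minus_distrib_mat) auto
    moreover have "\<theta>' * \<rho> a = \<theta> * \<rho> a - (c \<cdot>\<^sub>m 1\<^sub>m d) * \<rho> a" unfolding \<theta>'_def
      using ca th(1) by (intro minus_mult_distrib_mat) auto
    moreover have "\<rho> a * (c \<cdot>\<^sub>m 1\<^sub>m d) = c \<cdot>\<^sub>m \<rho> a" "(c \<cdot>\<^sub>m 1\<^sub>m d) * \<rho> a = c \<cdot>\<^sub>m \<rho> a"
      using ca by (auto simp: mult_smult_distrib mult_smult_assoc_mat[of _ d d])
    ultimately show ?thesis using th(2)[OF that] by simp
  qed
  have "\<theta>' = 0\<^sub>m d d"
  proof (rule ccontr)
    assume "\<theta>' \<noteq> 0\<^sub>m d d"
    then obtain Y where Y: "Y \<in> carrier_mat d d" "Y * \<theta>' = 1\<^sub>m d"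
      using schur[OF irr irr t' comm] by metis
    have "v = (Y * \<theta>') *\<^sub>v v" using Y v by simp
    also have "\<dots> = Y *\<^sub>v 0\<^sub>v d" using Y(1) t' v(1) t'v by (simp add: assoc_mult_mat_vec[of _ d d])
    also have "\<dots> = 0\<^sub>v d" using Y(1) by auto
    finally show False using v by simp
  qed
  have "\<theta> = c \<cdot>\<^sub>m 1\<^sub>m d"
  proof (rule eq_matI)
    fix i j assume "i < dim_row (c \<cdot>\<^sub>m 1\<^sub>m d :: 'k mat)" "j < dim_col (c \<cdot>\<^sub>m 1\<^sub>m d :: 'k mat)"
    then have ij: "i < d" "j < d" by auto
    have "\<theta>' $$ (i,j) = 0" using \<open>\<theta>' = 0\<^sub>m d d\<close> ij by simp
    then show "\<theta> $$ (i,j) = (c \<cdot>\<^sub>m 1\<^sub>m d) $$ (i,j)" unfolding \<theta>'_def using ij th(1) by auto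
  qed (use th(1) in auto)
  then show ?thesis using that by blast
qed

text \<open>Isomorphic irreducible representations have the same character.\<close>

lemma intertwiner_zero:
  assumes irr: "irreducible_rep sc A d \<rho>" "irreducible_rep sc A e \<tau>"
    and th: "\<theta> \<in> carrier_mat e d" "\<And>a. a \<in> A \<Longrightarrow> \<tau> a * \<theta> = \<theta> * \<rho> a"
    and ne: "character A \<rho> \<noteq> character A \<tau>"
  shows "\<theta> = 0\<^sub>m e d"
proof (rule ccontr)
  assume "\<theta> \<noteq> 0\<^sub>m e d"
  then obtain Y where Y: "Y \<in> carrier_mat d e" "\<theta> * Y = 1\<^sub>m e" "Y * \<theta> = 1\<^sub>m d"
    using schur[OF irr th] by metis
  have "character A \<rho> a = character A \<tau> a" for a
  proof (cases "a \<in> A")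
    case True
    have c: "\<rho> a \<in> carrier_mat d d" "\<tau> a \<in> carrier_mat e e"
      using rep_carrier[OF irred_rep] irr True by auto
    have "\<rho> a = Y * (\<theta> * \<rho> a)" using assoc_mult_mat[OF Y(1) th(1) c(1)] Y(3) c(1) by auto
    also have "\<theta> * \<rho> a = \<tau> a * \<theta>" using th(2)[OF True] by simp
    finally have "mat_trace (\<rho> a) = mat_trace (Y * (\<tau> a * \<theta>))" by simp
    also have "\<dots> = mat_trace ((\<tau> a * \<theta>) * Y)" using Y(1) c(2) th(1) by (intro mat_trace_comm[of _ d e]) auto
    also have "(\<tau> a * \<theta>) * Y = \<tau> a" using assoc_mult_mat[OF c(2) th(1) Y(1)] Y(2) c(2) by auto
    finally show ?thesis using True unfolding character_def by simp
  qed (auto simp: character_def)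
  then show False using ne by auto
qed

subsection \<open>The density theorem\<close>

text \<open>Columns of pairwise non-isomorphic irreducible representations can be prescribed independently
  of each other. When one more column is adjoined, either some element killing the columns already
  treated moves the new one, and irreducibility finishes; or the new column is a linear function
  of the others, and Schur's lemma expresses a unit vector through different unit vectors.\<close>

lemma density:
  assumes irr: "\<And>l. l \<in> L \<Longrightarrow> irreducible_rep sc A (d l) (s l)"
    and ineq: "\<And>l m \<theta>. \<lbrakk>l \<in> L; m \<in> L; l \<noteq> m; \<theta> \<in> carrier_mat (d m) (d l);
        \<And>a. a \<in> A \<Longrightarrow> s m a * \<theta> = \<theta> * s l a\<rbrakk> \<Longrightarrow> \<theta> = 0\<^sub>m (d m) (d l)"
    and fin: "finite T" and T: "T \<subseteq> Sigma L (\<lambda>l. {..<d l})"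
  shows "\<exists>a\<in>A. \<forall>(l,c)\<in>T. \<forall>i<d l. s l a $$ (i,c) = y l c i"
  using fin T
proof (induction T arbitrary: y rule: finite_induct)
  case empty then show ?case using one_A by auto
next
  case (insert p T)
  obtain l0 c0 where p: "p = (l0,c0)" by (cases p)
  have l0: "l0 \<in> L" "c0 < d l0" using insert p by auto
  note rep = irred_rep[OF irr]
  have T: "l \<in> L" "c < d l" if "(l,c) \<in> T" for l c using insert.prems that by auto
  have IH: "\<exists>a\<in>A. \<forall>(l,c)\<in>T. \<forall>i<d l. s l a $$ (i,c) = y l c i" for y using insert by auto
  define Z where "Z = {a\<in>A. \<forall>(l,c)\<in>T. \<forall>i<d l. s l a $$ (i,c) = 0}"
  have ZA: "a \<in> A" if "a \<in> Z" for a using that unfolding Z_def by auto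
  have Zent: "s l a $$ (i,c) = 0" if "a \<in> Z" "(l,c) \<in> T" "i < d l" for a l c i
    using that unfolding Z_def by auto
  have ZI: "a \<in> Z" if "a \<in> A" "\<And>l c i. (l,c) \<in> T \<Longrightarrow> i < d l \<Longrightarrow> s l a $$ (i,c) = 0" for a
    using that unfolding Z_def by auto
  have Tadd: "s l (a + b) $$ (i,c) = s l a $$ (i,c) + s l b $$ (i,c)"
    if "(l,c) \<in> T" "i < d l" "a \<in> A" "b \<in> A" for l c i a b
    using rep_entry_add[OF rep[OF T(1)[OF that(1)]] that(3,4) that(2) T(2)[OF that(1)]] .
  have Tscale: "s l (sc k a) $$ (i,c) = k * s l a $$ (i,c)"
    if "(l,c) \<in> T" "i < d l" "a \<in> A" for l c i a k
    using rep_entry_scale[OF rep[OF T(1)[OF that(1)]] that(3) that(2) T(2)[OF that(1)]] .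
  have Tmult: "s l (a * b) $$ (i,c) = (\<Sum>k<d l. s l a $$ (i,k) * s l b $$ (k,c))"
    if "(l,c) \<in> T" "i < d l" "a \<in> A" "b \<in> A" for l c i a b
    using rep_entry_mult[OF rep[OF T(1)[OF that(1)]] that(3,4) that(2) T(2)[OF that(1)]] .
  have Tzero: "s l 0 $$ (i,c) = 0" if "(l,c) \<in> T" "i < d l" for l c i
    using rep_entry_zero[OF rep[OF T(1)[OF that(1)]] that(2) T(2)[OF that(1)]] .
  show ?case
  proof (cases "\<exists>a0\<in>Z. \<exists>i<d l0. s l0 a0 $$ (i,c0) \<noteq> 0")
    case True
    then obtain a0 where a0: "a0 \<in> Z" "\<exists>i<d l0. s l0 a0 $$ (i,c0) \<noteq> 0" by auto
    define W where "W = {col (s l0 b) c0 | b. b \<in> Z}"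
    have cc: "s l0 b \<in> carrier_mat (d l0) (d l0)" if "b \<in> A" for b using rep_carrier[OF rep[OF l0(1)] that] .
    have "0 \<in> Z" by (rule ZI[OF zero_A Tzero])
    have WI: "col (s l0 b) c0 \<in> W" if "b \<in> Z" for b using that unfolding W_def by blast
    have "invariant_subspace A (d l0) (s l0) W"
      unfolding invariant_subspace_def
    proof (intro conjI ballI allI)
      show "W \<subseteq> carrier_vec (d l0)"
      proof
        fix v assume "v \<in> W"
        then obtain b where "b \<in> Z" "v = col (s l0 b) c0" unfolding W_def by blast
        then show "v \<in> carrier_vec (d l0)" using cc[OF ZA] by (metis carrier_matD(1) col_dim)
      qed
      have "col (s l0 0) c0 = 0\<^sub>v (d l0)"
        using cc[OF zero_A] l0 rep_entry_zero[OF rep[OF l0(1)]] by (intro eq_vecI) auto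
      then show "0\<^sub>v (d l0) \<in> W" using WI[OF \<open>0 \<in> Z\<close>] by simp
      fix v assume "v \<in> W" then obtain b where b: "b \<in> Z" "v = col (s l0 b) c0" unfolding W_def by auto
      show "v + w \<in> W" if "w \<in> W" for w
      proof -
        obtain b' where b': "b' \<in> Z" "w = col (s l0 b') c0" using \<open>w \<in> W\<close> unfolding W_def by auto
        have "b + b' \<in> Z"
          by (rule ZI) (simp_all add: Tadd Zent ZA b(1) b'(1) add_A)
        moreover have "v + w = col (s l0 (b + b')) c0"
          using b(2) b'(2) cc[OF ZA[OF b(1)]] cc[OF ZA[OF b'(1)]] cc[OF add_A[OF ZA[OF b(1)] ZA[OF b'(1)]]] l0
            rep_entry_add[OF rep[OF l0(1)] ZA[OF b(1)] ZA[OF b'(1)] _ l0(2)] by (intro eq_vecI) auto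
        ultimately show ?thesis using WI by simp
      qed
      show "c \<cdot>\<^sub>v v \<in> W" for c
      proof -
        have "sc c b \<in> Z"
          by (rule ZI) (simp_all add: Tscale Zent ZA b(1) scale_A)
        moreover have "c \<cdot>\<^sub>v v = col (s l0 (sc c b)) c0"
          using b(2) cc[OF ZA[OF b(1)]] cc[OF scale_A[OF ZA[OF b(1)], of c]] l0
            rep_entry_scale[OF rep[OF l0(1)] ZA[OF b(1)] _ l0(2), of _ c] by (intro eq_vecI) auto
        ultimately show ?thesis using WI by simp
      qed
      show "s l0 a *\<^sub>v v \<in> W" if a: "a \<in> A" for a
      proof -
        have "a * b \<in> Z"
          by (rule ZI) (simp_all add: Tmult Zent ZA b(1) a mult_A)
        moreover have "s l0 a *\<^sub>v v = col (s l0 (a * b)) c0"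
          using b(2) rep_mult[OF rep[OF l0(1)] a ZA[OF b(1)]] cc[OF a] cc[OF ZA[OF b(1)]] l0
          by simp
        ultimately show ?thesis using WI by simp
      qed
    qed
    then have "W = {0\<^sub>v (d l0)} \<or> W = carrier_vec (d l0)"
      using irr[OF l0(1)] unfolding irreducible_rep_def by auto
    moreover have "W \<noteq> {0\<^sub>v (d l0)}"
    proof
      assume "W = {0\<^sub>v (d l0)}"
      then have e: "col (s l0 a0) c0 = 0\<^sub>v (d l0)" using a0(1) unfolding W_def by auto
      obtain i where i: "i < d l0" "s l0 a0 $$ (i,c0) \<noteq> 0" using a0(2) by auto
      have "col (s l0 a0) c0 $ i = 0" using e i by simp
      then show False using i cc[OF ZA[OF a0(1)]] l0 by auto
    qed
    ultimately have W: "W = carrier_vec (d l0)" by auto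
    obtain a1 where a1: "a1 \<in> A" "\<forall>(l,c)\<in>T. \<forall>i<d l. s l a1 $$ (i,c) = y l c i" using IH by blast
    have "vec (d l0) (\<lambda>i. y l0 c0 i - s l0 a1 $$ (i,c0)) \<in> W" unfolding W by (rule vec_carrier)
    then obtain b where b: "b \<in> Z" "vec (d l0) (\<lambda>i. y l0 c0 i - s l0 a1 $$ (i,c0)) = col (s l0 b) c0"
      unfolding W_def by blast
    have bi: "s l0 b $$ (i,c0) = y l0 c0 i - s l0 a1 $$ (i,c0)" if "i < d l0" for i
    proof -
      have "col (s l0 b) c0 $ i = y l0 c0 i - s l0 a1 $$ (i,c0)" unfolding b(2)[symmetric] by (rule index_vec[OF that])
      then show ?thesis using cc[OF ZA[OF b(1)]] that l0 by auto
    qed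
    have "s l (a1 + b) $$ (i,c) = y l c i" if "(l,c) \<in> T" "i < d l" for l c i
      using that a1(2) Tadd[OF that a1(1) ZA[OF b(1)]] Zent[OF b(1) that] by auto
    moreover have "s l0 (a1 + b) $$ (i,c0) = y l0 c0 i" if "i < d l0" for i
      using bi[OF that] rep_entry_add[OF rep[OF l0(1)] a1(1) ZA[OF b(1)] that l0(2)] by simp
    ultimately have "\<forall>(l,c)\<in>insert p T. \<forall>i<d l. s l (a1 + b) $$ (i,c) = y l c i"
      unfolding p by auto
    then show ?thesis using add_A[OF a1(1) ZA[OF b(1)]] by blast
  next
    case False
    then have Zk: "s l0 a $$ (i,c0) = 0" if "a \<in> Z" "i < d l0" for a i using that by auto
    define P where "P l c i e \<longleftrightarrow> e \<in> A \<and> (\<forall>(l',c')\<in>T. \<forall>i'<d l'. s l' e $$ (i',c') = (if l' = l \<and> c' = c \<and> i' = i then 1 else 0))"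
      for l c i e
    define e where "e l c i = (SOME e. P l c i e)" for l c i
    have "\<exists>e. P l c i e" for l c i
      unfolding P_def Bex_def[symmetric] by (rule IH)
    then have "P l c i (e l c i)" for l c i unfolding e_def by (rule someI_ex)
    then have e': "\<And>l c i. e l c i \<in> A"
      "\<And>l c i. \<forall>(l',c')\<in>T. \<forall>i'<d l'. s l' (e l c i) $$ (i',c') = (if l' = l \<and> c' = c \<and> i' = i then 1 else 0)"
      unfolding P_def by blast+
    have e2: "s l' (e l c i) $$ (i',c') = (if l' = l \<and> c' = c \<and> i' = i then 1 else 0)"
      if "(l',c') \<in> T" "i' < d l'" for l c i l' c' i'
      using bspec[OF e'(2)[of l c i] that(1)] that(2) by simp
    note e = e'(1) e2
    define \<theta> where "\<theta> l c = mat (d l0) (d l) (\<lambda>(i',i). s l0 (e l c i) $$ (i',c0))" for l c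
    have inter: "s l0 a * \<theta> l c = \<theta> l c * s l a" if a: "a \<in> A" and lc: "(l,c) \<in> T" for a l c
    proof (rule eq_matI)
      have sl: "s l a \<in> carrier_mat (d l) (d l)" "s l0 a \<in> carrier_mat (d l0) (d l0)"
        using rep_carrier[OF rep] T[OF lc] l0 a by auto
      have tc: "\<theta> l c \<in> carrier_mat (d l0) (d l)" unfolding \<theta>_def by auto
      show "dim_row (s l0 a * \<theta> l c) = dim_row (\<theta> l c * s l a)" "dim_col (s l0 a * \<theta> l c) = dim_col (\<theta> l c * s l a)"
        using sl tc by auto
      fix i' i assume "i' < dim_row (\<theta> l c * s l a)" "i < dim_col (\<theta> l c * s l a)"
      then have i: "i' < d l0" "i < d l" using sl tc by auto
      let ?z = "a * e l c i - (\<Sum>k<d l. sc (s l a $$ (k,i)) (e l c k))"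
      have inA: "a * e l c i \<in> A" "(\<Sum>k<d l. sc (s l a $$ (k,i)) (e l c k)) \<in> A" using a e by (auto intro!: mult_A sum_A scale_A)
      have "?z \<in> Z"
      proof (rule ZI)
        show "?z \<in> A" using inA diff_A by auto
        fix l' c' i' assume t: "(l',c') \<in> T" and i': "i' < d l'"
        have "s l' (a * e l c i) $$ (i',c') = (\<Sum>k<d l'. s l' a $$ (i',k) * (if l' = l \<and> c' = c \<and> k = i then 1 else 0))"
          unfolding Tmult[OF t i' a e(1)] by (intro sum.cong refl) (simp add: e(2)[OF t])
        also have "\<dots> = (if l' = l \<and> c' = c then s l a $$ (i',i) else 0)"
          using i by (auto simp: if_distrib cong: if_cong)
        also have "\<dots> = (\<Sum>k<d l. s l a $$ (k,i) * (if l' = l \<and> c' = c \<and> i' = k then 1 else 0))"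
          using i' by (auto simp: if_distrib cong: if_cong)
        also have "\<dots> = s l' (\<Sum>k<d l. sc (s l a $$ (k,i)) (e l c k)) $$ (i',c')"
          by (subst rep_entry_sum[OF rep[OF T(1)[OF t]] _ e(1) i' T(2)[OF t]])
            (simp_all add: e(2)[OF t i'])
        finally show "s l' ?z $$ (i',c') = 0"
          using rep_entry_diff[OF rep[OF T(1)[OF t]] inA i' T(2)[OF t]] by simp
      qed
      then have "s l0 ?z $$ (i',c0) = 0" using Zk i by auto
      then have "s l0 (a * e l c i) $$ (i',c0) = s l0 (\<Sum>k<d l. sc (s l a $$ (k,i)) (e l c k)) $$ (i',c0)"
        using rep_entry_diff[OF rep[OF l0(1)] inA i(1) l0(2)] by simp
      also have "\<dots> = (\<Sum>k<d l. s l a $$ (k,i) * s l0 (e l c k) $$ (i',c0))"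
        by (subst rep_entry_sum[OF rep[OF l0(1)] _ e(1) i(1) l0(2)]) simp_all
      finally have "(\<Sum>k<d l0. s l0 a $$ (i',k) * s l0 (e l c i) $$ (k,c0)) = (\<Sum>k<d l. s l0 (e l c k) $$ (i',c0) * s l a $$ (k,i))"
        using rep_entry_mult[OF rep[OF l0(1)] a e(1) i(1) l0(2)] by (simp add: mult.commute)
      then show "(s l0 a * \<theta> l c) $$ (i',i) = (\<theta> l c * s l a) $$ (i',i)"
        using i mult_mat_index[OF sl(2) tc] mult_mat_index[OF tc sl(1)] unfolding \<theta>_def by simp
    qed
    have tdiag: "\<theta> l c $$ (c0, c) = 0" if lc: "(l,c) \<in> T" for l c
    proof (cases "l = l0")
      case False
      have "\<theta> l c = 0\<^sub>m (d l0) (d l)"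
        by (rule ineq[OF _ l0(1) False]) (use inter[OF _ lc] T[OF lc] in \<open>auto simp: \<theta>_def\<close>)
      then show ?thesis using l0 T[OF lc] by simp
    next
      case True
      have ne: "c \<noteq> c0" using insert.hyps lc True p by auto
      obtain k where "\<theta> l c = k \<cdot>\<^sub>m 1\<^sub>m (d l0)"
        using schur_scalar[OF irr[OF l0(1)], of "\<theta> l c"] inter[OF _ lc] True unfolding \<theta>_def by auto
      then show ?thesis using l0 T[OF lc] ne True by auto
    qed
    let ?z = "1 - (\<Sum>(l,c)\<in>T. e l c c)"
    have inA: "(\<Sum>(l,c)\<in>T. e l c c) \<in> A" using e by (auto intro!: sum_A)
    have esum: "s l (\<Sum>(l',c')\<in>T. e l' c' c') $$ (i,j) = (\<Sum>(l',c')\<in>T. s l (e l' c' c') $$ (i,j))" if "l \<in> L" "i < d l" "j < d l" for l i j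
      unfolding case_prod_beta
      by (rule rep_entry_sum'[OF rep[OF that(1)] insert.hyps(1) _ that(2,3)]) (rule e(1))
    have "?z \<in> Z"
    proof (rule ZI)
      show "?z \<in> A" using inA diff_A one_A by auto
      fix l c i assume t: "(l,c) \<in> T" and i: "i < d l"
      have "s l (\<Sum>(l',c')\<in>T. e l' c' c') $$ (i,c) = (\<Sum>q\<in>T. if q = (l,c) then (if i = c then 1 else 0) else 0)"
        unfolding esum[OF T(1)[OF t] i T(2)[OF t]]
        by (rule sum.cong[OF refl], clarify) (simp add: e(2)[OF t i])
      also have "\<dots> = (if i = c then 1 else 0)" using t insert.hyps(1) by simp
      finally show "s l ?z $$ (i,c) = 0"
        using rep_entry_diff[OF rep[OF T(1)[OF t]] one_A inA i T(2)[OF t]] rep_one[OF rep[OF T(1)[OF t]]]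
          i T(2)[OF t] by simp
    qed
    then have "s l0 ?z $$ (c0,c0) = 0" using Zk l0 by auto
    then have "s l0 (\<Sum>(l',c')\<in>T. e l' c' c') $$ (c0,c0) = 1"
      using rep_entry_diff[OF rep[OF l0(1)] one_A inA l0(2) l0(2)] rep_one[OF rep[OF l0(1)]] l0(2) by simp
    moreover have "s l0 (\<Sum>(l',c')\<in>T. e l' c' c') $$ (c0,c0) = (\<Sum>(l',c')\<in>T. \<theta> l' c' $$ (c0,c'))"
    proof (subst esum[OF l0(1) l0(2) l0(2)], rule sum.cong[OF refl], clarify)
      fix l c assume "(l,c) \<in> T"
      then show "s l0 (e l c c) $$ (c0,c0) = \<theta> l c $$ (c0,c)" using T l0 unfolding \<theta>_def by simp
    qed
    moreover have "(\<Sum>(l',c')\<in>T. \<theta> l' c' $$ (c0,c')) = 0"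
      by (rule sum.neutral, clarify) (rule tdiag)
    ultimately show ?thesis by simp
  qed
qed

end


context fd_subalgebra
begin

subsection \<open>Irreducible characters and matrix units\<close>

definition Irr :: "('h \<Rightarrow> 'k) set" where "Irr = irr_chars sc A"

definition irr_data :: "('h \<Rightarrow> 'k) \<Rightarrow> nat \<times> ('h \<Rightarrow> 'k mat)" where
  "irr_data \<phi> = (SOME p. irreducible_rep sc A (fst p) (snd p) \<and> character A (snd p) = \<phi>)"

definition rdim :: "('h \<Rightarrow> 'k) \<Rightarrow> nat" where "rdim \<phi> = fst (irr_data \<phi>)"
definition rrep :: "('h \<Rightarrow> 'k) \<Rightarrow> 'h \<Rightarrow> 'k mat" where "rrep \<phi> = snd (irr_data \<phi>)"

lemma Irr_rep:
  assumes "\<phi> \<in> Irr"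
  shows "irreducible_rep sc A (rdim \<phi>) (rrep \<phi>)" "character A (rrep \<phi>) = \<phi>"
proof -
  have "\<exists>p. irreducible_rep sc A (fst p) (snd p) \<and> character A (snd p) = \<phi>"
    using assms unfolding Irr_def irr_chars_def by auto
  from someI_ex[OF this] show "irreducible_rep sc A (rdim \<phi>) (rrep \<phi>)" "character A (rrep \<phi>) = \<phi>"
    unfolding rdim_def rrep_def irr_data_def by auto
qed

lemma IrrI: "irreducible_rep sc A d \<rho> \<Longrightarrow> character A \<rho> \<in> Irr"
  unfolding Irr_def irr_chars_def by auto

lemmas Irr_is_rep = irred_rep[OF Irr_rep(1)]
lemmas Irr_pos = irred_pos[OF Irr_rep(1)]

lemma Irr_trace: "\<phi> \<in> Irr \<Longrightarrow> a \<in> A \<Longrightarrow> \<phi> a = (\<Sum>i<rdim \<phi>. rrep \<phi> a $$ (i,i))"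
  using rep_trace[OF Irr_is_rep] Irr_rep(2) by metis

lemma Irr_lin: "\<phi> \<in> Irr \<Longrightarrow> lin_on sc A \<phi>"
  using rep_trace_lin[OF Irr_is_rep] Irr_rep(2) by metis

lemma Irr_one: "\<phi> \<in> Irr \<Longrightarrow> \<phi> 1 = of_nat (rdim \<phi>)"
  using rep_char_one[OF Irr_is_rep] Irr_rep(2) by metis

lemma Irr_comm: "\<phi> \<in> Irr \<Longrightarrow> a \<in> A \<Longrightarrow> b \<in> A \<Longrightarrow> \<phi> (a * b) = \<phi> (b * a)"
  using rep_char_comm[OF Irr_is_rep] Irr_rep(2) by metis

lemma Irr_density:
  assumes F: "finite F" "F \<subseteq> Irr"
  shows "\<exists>a\<in>A. \<forall>\<phi>\<in>F. \<forall>i<rdim \<phi>. \<forall>c<rdim \<phi>. rrep \<phi> a $$ (i,c) = y \<phi> c i"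
proof -
  have "\<exists>a\<in>A. \<forall>(\<phi>,c)\<in>Sigma F (\<lambda>\<phi>. {..<rdim \<phi>}). \<forall>i<rdim \<phi>. rrep \<phi> a $$ (i,c) = y \<phi> c i"
  proof (rule density[where L=F])
    show "irreducible_rep sc A (rdim l) (rrep l)" if "l \<in> F" for l using Irr_rep(1) F that by auto
    show "\<theta> = 0\<^sub>m (rdim m) (rdim l)" if "l \<in> F" "m \<in> F" "l \<noteq> m" "\<theta> \<in> carrier_mat (rdim m) (rdim l)"
      "\<And>a. a \<in> A \<Longrightarrow> rrep m a * \<theta> = \<theta> * rrep l a" for l m \<theta>
    proof (rule intertwiner_zero[OF Irr_rep(1) Irr_rep(1) that(4,5)])
      show I: "l \<in> Irr" "m \<in> Irr" using that F by auto
      show "character A (rrep l) \<noteq> character A (rrep m)" using that(3) Irr_rep(2)[OF I(1)] Irr_rep(2)[OF I(2)] by simp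
    qed
    show "finite (Sigma F (\<lambda>\<phi>. {..<rdim \<phi>}))" using F by auto
  qed auto
  then show ?thesis by fastforce
qed

lemma finite_Irr: "finite Irr"
proof -
  obtain \<beta> where b: "basis_of A \<beta>" using fin_subspace_has_basis[OF fin_A] .
  have "card F \<le> card \<beta>" if F: "finite F" "F \<subseteq> Irr" for F
  proof -
    have "\<forall>\<psi>. \<exists>a. a \<in> A \<and> (\<forall>\<phi>\<in>F. \<forall>i<rdim \<phi>. \<forall>c<rdim \<phi>. rrep \<phi> a $$ (i,c) = (if \<phi> = \<psi> then 1 else 0))"
      unfolding Bex_def[symmetric] by (intro allI Irr_density[OF F])
    from choice[OF this] obtain e where e: "\<And>\<psi>. e \<psi> \<in> A"
      "\<And>\<psi>. \<forall>\<phi>\<in>F. \<forall>i<rdim \<phi>. \<forall>c<rdim \<phi>. rrep \<phi> (e \<psi>) $$ (i,c) = (if \<phi> = \<psi> then 1 else 0)"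
      by blast
    have e2: "rrep \<phi> (e \<psi>) $$ (0,0) = (if \<phi> = \<psi> then 1 else 0)" if "\<phi> \<in> F" for \<phi> \<psi>
      using bspec[OF e(2)[of \<psi>] that] Irr_pos[of \<phi>] that F(2) by auto
    have inj: "inj_on e F"
    proof
      fix x y assume xy: "x \<in> F" "y \<in> F" "e x = e y"
      have "rrep x (e y) $$ (0,0) = 1" using e2[OF xy(1), of x] xy(3) by simp
      then show "x = y" using e2[OF xy(1), of y] by (simp split: if_splits)
    qed
    have "independent (e ` F)"
    proof (rule independent_if_scalars_zero)
      show "finite (e ` F)" using F by auto
      fix f x assume s: "(\<Sum>x\<in>e ` F. sc (f x) x) = 0" and "x \<in> e ` F"
      then obtain \<psi> where \<psi>: "\<psi> \<in> F" "x = e \<psi>" by auto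
      have I: "\<psi> \<in> Irr" using \<psi> F(2) by auto
      have "(\<Sum>\<phi>\<in>F. sc (f (e \<phi>)) (e \<phi>)) = 0" using s by (simp add: sum.reindex[OF inj])
      then have "0 = rrep \<psi> (\<Sum>\<phi>\<in>F. sc (f (e \<phi>)) (e \<phi>)) $$ (0,0)"
        using rep_entry_zero[OF Irr_is_rep[OF I] Irr_pos[OF I] Irr_pos[OF I]] by simp
      also have "\<dots> = (\<Sum>\<phi>\<in>F. f (e \<phi>) * rrep \<psi> (e \<phi>) $$ (0,0))"
        by (rule rep_entry_sum[OF Irr_is_rep[OF I] F(1) e(1) Irr_pos[OF I] Irr_pos[OF I]])
      also have "\<dots> = (\<Sum>\<phi>\<in>F. if \<phi> = \<psi> then f (e \<phi>) else 0)"
        by (intro sum.cong refl) (simp add: e2[OF \<psi>(1)])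
      also have "\<dots> = f x" using \<psi> F(1) by simp
      finally show "f x = 0" by simp
    qed
    then have "card (e ` F) \<le> card \<beta>"
      using independent_span_bound[of \<beta> "e ` F"] b e(1) unfolding basis_of_def by auto
    then show ?thesis using card_image[OF inj] by simp
  qed
  then show ?thesis using infinite_arbitrarily_large[of Irr "Suc (card \<beta>)"] by fastforce
qed

definition munit :: "('h \<Rightarrow> 'k) \<Rightarrow> nat \<Rightarrow> nat \<Rightarrow> 'h" where
  "munit \<phi> i j = (SOME a. a \<in> A \<and> (\<forall>\<psi>\<in>Irr. \<forall>k<rdim \<psi>. \<forall>l<rdim \<psi>.
      rrep \<psi> a $$ (k,l) = (if \<psi> = \<phi> \<and> k = i \<and> l = j then 1 else 0)))"

lemma munit:
  shows munit_A: "munit \<phi> i j \<in> A"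
    and rrep_munit: "\<lbrakk>\<psi> \<in> Irr; k < rdim \<psi>; l < rdim \<psi>\<rbrakk> \<Longrightarrow>
      rrep \<psi> (munit \<phi> i j) $$ (k,l) = (if \<psi> = \<phi> \<and> k = i \<and> l = j then 1 else 0)"
proof -
  have "\<exists>a. a \<in> A \<and> (\<forall>\<psi>\<in>Irr. \<forall>k<rdim \<psi>. \<forall>l<rdim \<psi>.
      rrep \<psi> a $$ (k,l) = (if \<psi> = \<phi> \<and> k = i \<and> l = j then 1 else 0))"
    using Irr_density[OF finite_Irr subset_refl, of "\<lambda>\<psi> l k. if \<psi> = \<phi> \<and> k = i \<and> l = j then 1 else 0"] by blast
  from someI_ex[OF this] show "munit \<phi> i j \<in> A"
    "\<lbrakk>\<psi> \<in> Irr; k < rdim \<psi>; l < rdim \<psi>\<rbrakk> \<Longrightarrow>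
      rrep \<psi> (munit \<phi> i j) $$ (k,l) = (if \<psi> = \<phi> \<and> k = i \<and> l = j then 1 else 0)"
    unfolding munit_def by blast+
qed

lemma rrep_munit_left:
  assumes "a \<in> A" "\<psi> \<in> Irr" "k < rdim \<psi>" "l < rdim \<psi>" "j < rdim \<phi>"
  shows "rrep \<psi> (munit \<phi> i j * a) $$ (k,l) = (if \<psi> = \<phi> \<and> k = i then rrep \<psi> a $$ (j,l) else 0)"
proof -
  have "rrep \<psi> (munit \<phi> i j * a) $$ (k,l) = (\<Sum>r<rdim \<psi>. rrep \<psi> (munit \<phi> i j) $$ (k,r) * rrep \<psi> a $$ (r,l))"
    by (rule rep_entry_mult[OF Irr_is_rep[OF assms(2)] munit_A assms(1,3,4)])
  also have "\<dots> = (\<Sum>r<rdim \<psi>. if r = j then (if \<psi> = \<phi> \<and> k = i then rrep \<psi> a $$ (r,l) else 0) else 0)"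
    by (intro sum.cong refl) (simp add: rrep_munit[OF assms(2,3)])
  also have "\<dots> = (if \<psi> = \<phi> \<and> k = i then rrep \<psi> a $$ (j,l) else 0)" using assms(5) by (cases "\<psi> = \<phi>") auto
  finally show ?thesis .
qed

lemma rrep_munit_right:
  assumes "a \<in> A" "\<psi> \<in> Irr" "k < rdim \<psi>" "l < rdim \<psi>" "i < rdim \<phi>"
  shows "rrep \<psi> (a * munit \<phi> i j) $$ (k,l) = (if \<psi> = \<phi> \<and> l = j then rrep \<psi> a $$ (k,i) else 0)"
proof -
  have "rrep \<psi> (a * munit \<phi> i j) $$ (k,l) = (\<Sum>r<rdim \<psi>. rrep \<psi> a $$ (k,r) * rrep \<psi> (munit \<phi> i j) $$ (r,l))"
    by (rule rep_entry_mult[OF Irr_is_rep[OF assms(2)] assms(1) munit_A assms(3,4)])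
  also have "\<dots> = (\<Sum>r<rdim \<psi>. if r = i then (if \<psi> = \<phi> \<and> l = j then rrep \<psi> a $$ (k,r) else 0) else 0)"
    by (intro sum.cong refl) (simp add: rrep_munit[OF assms(2) _ assms(4)])
  also have "\<dots> = (if \<psi> = \<phi> \<and> l = j then rrep \<psi> a $$ (k,i) else 0)" using assms(5) by (cases "\<psi> = \<phi>") auto
  finally show ?thesis .
qed

text \<open>Cutting out of an element its image in the matrix blocks: an ideal contains an element acting as
  the identity in exactly those irreducible representations that it does not annihilate.\<close>

lemma ideal_identity:
  assumes Q: "Q \<subseteq> A" "subspace Q" "\<And>a q. a \<in> A \<Longrightarrow> q \<in> Q \<Longrightarrow> a * q \<in> Q" "\<And>a q. a \<in> A \<Longrightarrow> q \<in> Q \<Longrightarrow> q * a \<in> Q"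
  obtains z where "z \<in> Q"
    "\<And>\<phi>. \<phi> \<in> Irr \<Longrightarrow> (\<exists>q\<in>Q. rrep \<phi> q \<noteq> 0\<^sub>m (rdim \<phi>) (rdim \<phi>)) \<Longrightarrow> rrep \<phi> z = 1\<^sub>m (rdim \<phi>)"
proof -
  define L where "L = {\<phi>\<in>Irr. \<exists>q\<in>Q. rrep \<phi> q \<noteq> 0\<^sub>m (rdim \<phi>) (rdim \<phi>)}"
  have "\<forall>\<phi>\<in>L. \<exists>z. z \<in> Q \<and> (\<forall>\<psi>\<in>Irr. \<forall>k<rdim \<psi>. \<forall>l<rdim \<psi>. rrep \<psi> z $$ (k,l) = (if \<psi> = \<phi> \<and> k = l then 1 else 0))"
  proof
    fix \<phi> assume ph: "\<phi> \<in> L"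
    obtain q where q: "q \<in> Q" "rrep \<phi> q \<noteq> 0\<^sub>m (rdim \<phi>) (rdim \<phi>)" and I: "\<phi> \<in> Irr" using ph unfolding L_def by auto
    note rp = Irr_is_rep
    have "rrep \<phi> q \<in> carrier_mat (rdim \<phi>) (rdim \<phi>)" using rep_carrier[OF rp[OF I]] q Q by auto
    then obtain i j where ij: "i < rdim \<phi>" "j < rdim \<phi>" "rrep \<phi> q $$ (i,j) \<noteq> 0"
      using q(2) by (metis eq_matI carrier_matD index_zero_mat)
    define c where "c = rrep \<phi> q $$ (i,j)"
    define z where "z = (\<Sum>m<rdim \<phi>. sc (1 / c) (munit \<phi> m i * q * munit \<phi> j m))"
    have inQ: "munit \<phi> m i * q * munit \<phi> j m \<in> Q" for m
      using Q(3,4) q(1) munit_A by blast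
    have qA: "q \<in> A" using q Q by auto
    have "rrep \<psi> z $$ (k,l) = (if \<psi> = \<phi> \<and> k = l then 1 else 0)" if ps: "\<psi> \<in> Irr" "k < rdim \<psi>" "l < rdim \<psi>" for \<psi> k l
    proof -
      have "rrep \<psi> (munit \<phi> m i * q * munit \<phi> j m) $$ (k,l) = (if \<psi> = \<phi> \<and> k = m \<and> l = m then c else 0)" if m: "m < rdim \<phi>" for m
        using ps I ij(1,2) m qA by (cases "\<psi> = \<phi>") (auto simp add: rrep_munit_right rrep_munit_left munit_A mult_A c_def)
      then have "rrep \<psi> z $$ (k,l) = (\<Sum>m<rdim \<phi>. 1 / c * (if \<psi> = \<phi> \<and> k = m \<and> l = m then c else 0))"
        unfolding z_def using inQ Q(1) ps by (subst rep_entry_sum[OF rp]) auto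
      also have "\<dots> = (\<Sum>m<rdim \<phi>. if m = k then (if \<psi> = \<phi> \<and> k = l then 1 else 0) else 0)"
        using ij(3) unfolding c_def by (intro sum.cong refl) auto
      also have "\<dots> = (if \<psi> = \<phi> \<and> k = l then 1 else 0)" using ps by auto
      finally show ?thesis .
    qed
    moreover have "z \<in> Q" unfolding z_def using inQ Q(2) by (intro subspace_sum subspace_scale) auto
    ultimately show "\<exists>z. z \<in> Q \<and> (\<forall>\<psi>\<in>Irr. \<forall>k<rdim \<psi>. \<forall>l<rdim \<psi>. rrep \<psi> z $$ (k,l) = (if \<psi> = \<phi> \<and> k = l then 1 else 0))"
      by (intro exI[of _ z] conjI ballI allI impI) simp_all
  qed
  from bchoice[OF this] obtain z where zz: "\<forall>\<phi>\<in>L. z \<phi> \<in> Q \<and> (\<forall>\<psi>\<in>Irr. \<forall>k<rdim \<psi>. \<forall>l<rdim \<psi>. rrep \<psi> (z \<phi>) $$ (k,l) = (if \<psi> = \<phi> \<and> k = l then 1 else 0))" ..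
  have z: "z \<phi> \<in> Q" if "\<phi> \<in> L" for \<phi> using bspec[OF zz that] by (rule conjunct1)
  have z2: "rrep \<psi> (z \<phi>) $$ (k,l) = (if \<psi> = \<phi> \<and> k = l then 1 else 0)"
    if "\<phi> \<in> L" "\<psi> \<in> Irr" "k < rdim \<psi>" "l < rdim \<psi>" for \<phi> \<psi> k l
    using bspec[OF conjunct2[OF bspec[OF zz that(1)]] that(2)] that(3,4) by (elim allE impE)
  define w where "w = (\<Sum>\<phi>\<in>L. z \<phi>)"
  have fL: "finite L" using finite_Irr unfolding L_def by auto
  have wQ: "w \<in> Q" unfolding w_def using z Q(2) by (intro subspace_sum) auto
  have "rrep \<psi> w = 1\<^sub>m (rdim \<psi>)" if "\<psi> \<in> Irr" "\<exists>q\<in>Q. rrep \<psi> q \<noteq> 0\<^sub>m (rdim \<psi>) (rdim \<psi>)" for \<psi>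
  proof (rule eq_matI)
    have cw: "rrep \<psi> w \<in> carrier_mat (rdim \<psi>) (rdim \<psi>)" using rep_carrier[OF Irr_is_rep[OF that(1)]] wQ Q by auto
    then show "dim_row (rrep \<psi> w) = dim_row (1\<^sub>m (rdim \<psi>) :: 'k mat)" "dim_col (rrep \<psi> w) = dim_col (1\<^sub>m (rdim \<psi>) :: 'k mat)" by auto
    fix k l assume "k < dim_row (1\<^sub>m (rdim \<psi>) :: 'k mat)" "l < dim_col (1\<^sub>m (rdim \<psi>) :: 'k mat)"
    then have kl: "k < rdim \<psi>" "l < rdim \<psi>" by auto
    have "rrep \<psi> w $$ (k,l) = (\<Sum>\<phi>\<in>L. rrep \<psi> (z \<phi>) $$ (k,l))"
      unfolding w_def using z Q(1) kl by (intro rep_entry_sum'[OF Irr_is_rep[OF that(1)] fL]) auto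
    also have "\<dots> = (\<Sum>\<phi>\<in>L. if \<phi> = \<psi> then (if k = l then 1 else 0) else 0)"
      by (intro sum.cong refl) (simp add: z2[OF _ that(1) kl] eq_commute)
    also have "\<dots> = (if k = l then 1 else 0)" using fL that unfolding L_def by auto
    finally show "rrep \<psi> w $$ (k,l) = 1\<^sub>m (rdim \<psi>) $$ (k,l)" using kl by auto
  qed
  then show ?thesis using that wQ by blast
qed

text \<open>An irreducible representation with character \<open>\<phi>\<close> is isomorphic to the chosen one.\<close>

lemma irred_iso:
  assumes irr: "irreducible_rep sc A d \<rho>"
  obtains \<theta> where "\<theta> \<in> carrier_mat (rdim (character A \<rho>)) d" "\<theta> \<noteq> 0\<^sub>m (rdim (character A \<rho>)) d"
    "\<And>a. a \<in> A \<Longrightarrow> rrep (character A \<rho>) a * \<theta> = \<theta> * \<rho> a"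
proof -
  let ?\<phi> = "character A \<rho>"
  note I = IrrI[OF irr]
  define D where "D l = (if l then d else rdim ?\<phi>)" for l :: bool
  define s where "s l = (if l then \<rho> else rrep ?\<phi>)" for l :: bool
  have irs: "irreducible_rep sc A (D l) (s l)" for l using irr Irr_rep(1)[OF I] unfolding D_def s_def by auto
  have ch: "character A (s l) = ?\<phi>" for l using Irr_rep(2)[OF I] unfolding s_def by auto
  have "\<exists>\<theta>. \<theta> \<in> carrier_mat (rdim ?\<phi>) d \<and> \<theta> \<noteq> 0\<^sub>m (rdim ?\<phi>) d \<and> (\<forall>a\<in>A. rrep ?\<phi> a * \<theta> = \<theta> * \<rho> a)"
  proof (rule ccontr)
    assume no: "\<not> ?thesis"
    have ze: "\<theta> = 0\<^sub>m (D m) (D l)" if lm: "l \<noteq> m" and t: "\<theta> \<in> carrier_mat (D m) (D l)" "\<And>a. a \<in> A \<Longrightarrow> s m a * \<theta> = \<theta> * s l a" for l m \<theta>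
    proof (rule ccontr)
      assume nz: "\<theta> \<noteq> 0\<^sub>m (D m) (D l)"
      obtain Y where Y: "Y \<in> carrier_mat (D l) (D m)" "\<theta> * Y = 1\<^sub>m (D m)" "Y * \<theta> = 1\<^sub>m (D l)"
        using schur[OF irs irs t nz] by blast
      have "s l a * Y = Y * s m a" if a: "a \<in> A" for a
      proof -
        have c: "s l a \<in> carrier_mat (D l) (D l)" "s m a \<in> carrier_mat (D m) (D m)"
          using rep_carrier[OF irred_rep[OF irs] a] by auto
        have "s l a * Y = (Y * \<theta>) * (s l a * Y)" using c Y by simp
        also have "\<dots> = Y * ((\<theta> * s l a) * Y)" using c Y(1) t(1)
          by (smt (verit) assoc_mult_mat mult_carrier_mat)
        also have "\<theta> * s l a = s m a * \<theta>" using t(2)[OF a] by simp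
        also have "(s m a * \<theta>) * Y = s m a * (\<theta> * Y)" using c Y(1) t(1) by (intro assoc_mult_mat)
        finally show ?thesis using Y c by simp
      qed
      moreover have "Y \<noteq> 0\<^sub>m (D l) (D m)"
      proof
        assume "Y = 0\<^sub>m (D l) (D m)"
        then have "(0\<^sub>m (D m) (D m) :: 'k mat) = 1\<^sub>m (D m)" using Y(2) t(1) by simp
        then have "(0\<^sub>m (D m) (D m) :: 'k mat) $$ (0,0) = 1\<^sub>m (D m) $$ (0,0)" by simp
        then show False using irred_pos[OF irs, of m] by simp
      qed
      ultimately show False using no lm t nz Y(1) unfolding D_def s_def by (cases l; cases m) auto
    qed
    have "\<exists>a\<in>A. \<forall>(l,c)\<in>Sigma UNIV (\<lambda>l. {..<D l}). \<forall>i<D l. s l a $$ (i,c) = (if l \<and> c = 0 \<and> i = 0 then 1 else 0)"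
      by (rule density[where L=UNIV and d=D and s=s]) (use irs ze in auto)
    then obtain a where a: "a \<in> A" "\<And>l c i. \<lbrakk>c < D l; i < D l\<rbrakk> \<Longrightarrow> s l a $$ (i,c) = (if l \<and> c = 0 \<and> i = 0 then 1 else 0)"
      by fastforce
    have tr: "?\<phi> a = (\<Sum>i<D l. if l \<and> i = 0 then 1 else 0)" for l
    proof -
      have "?\<phi> a = (\<Sum>i<D l. s l a $$ (i,i))" using rep_trace[OF irred_rep[OF irs] a(1)] ch by metis
      then show ?thesis using a(2) by simp
    qed
    show False using tr[of True] tr[of False] irred_pos[OF irr] unfolding D_def by simp
  qed
  then show ?thesis using that by blast
qed

lemma irred_acts_like:
  assumes irr: "irreducible_rep sc A d \<rho>" and a: "a \<in> A" and id: "rrep (character A \<rho>) a = 1\<^sub>m (rdim (character A \<rho>))"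
  shows "\<rho> a = 1\<^sub>m d"
proof -
  obtain \<theta> where t: "\<theta> \<in> carrier_mat (rdim (character A \<rho>)) d" "\<theta> \<noteq> 0\<^sub>m (rdim (character A \<rho>)) d"
    "\<And>a. a \<in> A \<Longrightarrow> rrep (character A \<rho>) a * \<theta> = \<theta> * \<rho> a" using irred_iso[OF irr] by blast
  obtain Y where Y: "Y \<in> carrier_mat d (rdim (character A \<rho>))" "Y * \<theta> = 1\<^sub>m d"
    using schur[OF irr Irr_rep(1)[OF IrrI[OF irr]] t(1,3,2)] by metis
  have c: "\<rho> a \<in> carrier_mat d d" using rep_carrier[OF irred_rep[OF irr] a] .
  have "\<rho> a = Y * (\<theta> * \<rho> a)" using assoc_mult_mat[OF Y(1) t(1) c] Y(2) c by simp
  also have "\<theta> * \<rho> a = \<theta>" using t(3)[OF a] id t(1) by simp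
  finally show ?thesis using Y(2) by simp
qed

text \<open>The Jacobson radical.\<close>

definition rad :: "'h set" where
  "rad = {a\<in>A. \<forall>\<phi>\<in>Irr. rrep \<phi> a = 0\<^sub>m (rdim \<phi>) (rdim \<phi>)}"

end


section \<open>Modules and their composition factors\<close>

locale fd_module = fd_subalgebra sc A + X: vspace scx
  for sc :: "'k::{alg_closed_field,field_char_0} \<Rightarrow> 'h::ring_1 \<Rightarrow> 'h" and A :: "'h set"
    and scx :: "'k \<Rightarrow> 'x::ab_group_add \<Rightarrow> 'x" +
  fixes act :: "'h \<Rightarrow> 'x \<Rightarrow> 'x" and M :: "'x set"
  assumes fin_M: "X.fin_subspace M"
    and act_endo: "a \<in> A \<Longrightarrow> endo_on scx M (act a)"
    and act_add: "\<lbrakk>a \<in> A; b \<in> A; x \<in> M\<rbrakk> \<Longrightarrow> act (a + b) x = act a x + act b x"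
    and act_scale: "\<lbrakk>a \<in> A; x \<in> M\<rbrakk> \<Longrightarrow> act (sc c a) x = scx c (act a x)"
    and act_mult: "\<lbrakk>a \<in> A; b \<in> A; x \<in> M\<rbrakk> \<Longrightarrow> act (a * b) x = act a (act b x)"
    and act_one: "x \<in> M \<Longrightarrow> act 1 x = x"
begin

lemma subspace_M: "X.subspace M" using fin_M unfolding X.fin_subspace_def by auto

lemma act_M: "a \<in> A \<Longrightarrow> x \<in> M \<Longrightarrow> act a x \<in> M" using act_endo unfolding endo_on_def by auto

lemma act_sum:
  "\<lbrakk>a \<in> A; finite K; \<And>i. i \<in> K \<Longrightarrow> x i \<in> M\<rbrakk> \<Longrightarrow> act a (\<Sum>i\<in>K. scx (c i) (x i)) = (\<Sum>i\<in>K. scx (c i) (act a (x i)))"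
  using X.endo_on_sum[OF act_endo subspace_M] by blast

definition submodule :: "'x set \<Rightarrow> bool" where
  "submodule Y \<longleftrightarrow> X.subspace Y \<and> Y \<subseteq> M \<and> (\<forall>a\<in>A. \<forall>y\<in>Y. act a y \<in> Y)"

definition module_hom_to :: "('h \<Rightarrow> 'k) \<Rightarrow> ('x \<Rightarrow> nat \<Rightarrow> 'k) \<Rightarrow> bool" where
  "module_hom_to \<phi> f \<longleftrightarrow> (\<forall>c<rdim \<phi>. lin_on scx M (\<lambda>x. f x c)) \<and>
     (\<forall>a\<in>A. \<forall>x\<in>M. \<forall>c<rdim \<phi>. f (act a x) c = (\<Sum>c'<rdim \<phi>. rrep \<phi> a $$ (c,c') * f x c'))"

lemma submodule_fd_module: assumes "submodule Y" shows "fd_module sc A scx act Y"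
proof unfold_locales
  show "X.fin_subspace Y" using X.fin_subspace_subset[OF fin_M] assms unfolding submodule_def by auto
  show "endo_on scx Y (act a)" if "a \<in> A" for a
    using act_endo[OF that] assms that unfolding submodule_def endo_on_def by blast
qed (use assms in \<open>auto simp: submodule_def subset_iff act_add act_scale act_mult act_one\<close>)

lemma simple_quotient:
  assumes Q: "submodule Q" "Q \<noteq> M"
  obtains Y \<phi> f where "submodule Y" "Q \<subseteq> Y" "Y \<subset> M" "\<phi> \<in> Irr" "module_hom_to \<phi> f"
    "\<And>x. x \<in> M \<Longrightarrow> x \<in> Y \<longleftrightarrow> (\<forall>c<rdim \<phi>. f x c = 0)"
    "\<And>a. a \<in> A \<Longrightarrow> X.op_trace M (act a) = X.op_trace Y (act a) + \<phi> a"
proof -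
  let ?P = "\<lambda>Y. submodule Y \<and> Q \<subseteq> Y \<and> Y \<subset> M"
  have PQ: "?P Q" using Q unfolding submodule_def by auto
  have bound: "X.dim Y < Suc (X.dim M)" if "?P Y" for Y
    using X.dim_strict_mono[OF fin_M] that unfolding submodule_def by (meson less_SucI)
  obtain Y where Y: "?P Y" and max0: "\<And>Z. ?P Z \<Longrightarrow> X.dim Z \<le> X.dim Y"
    using ex_has_greatest_nat[of ?P Q X.dim "Suc (X.dim M)"] PQ bound by (metis less_imp_le)
  have max: "Z = M" if "submodule Z" "Y \<subset> Z" for Z
  proof (rule ccontr)
    assume "Z \<noteq> M"
    then have "?P Z" using that Y unfolding submodule_def by auto
    moreover have "X.dim Y < X.dim Z"
      using X.dim_strict_mono[of Z Y] X.fin_subspace_subset[OF fin_M] that Y unfolding submodule_def by auto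
    ultimately show False using max0 by force
  qed
  have sY: "X.subspace Y" "Y \<subseteq> M" "\<And>a y. a \<in> A \<Longrightarrow> y \<in> Y \<Longrightarrow> act a y \<in> Y" using Y unfolding submodule_def by auto
  obtain \<beta> where b: "X.basis_of Y \<beta>" using X.fin_subspace_has_basis[OF X.fin_subspace_subset[OF fin_M sY(1,2)]] .
  have ib: "X.independent \<beta>" "\<beta> \<subseteq> M" "X.span \<beta> = Y" using b X.basis_of_subset[OF b] sY(2) unfolding X.basis_of_def by auto
  obtain \<gamma> where g: "X.basis_of M \<gamma>" "\<beta> \<subseteq> \<gamma>" using X.fin_subspace_basis[OF fin_M ib(1,2)] .
  have fg: "finite \<gamma>" "X.independent \<gamma>" "X.span \<gamma> = M" using g unfolding X.basis_of_def by auto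
  obtain bs where bs: "set bs = \<gamma> - \<beta>" "distinct bs" using finite_distinct_list[of "\<gamma> - \<beta>"] fg by auto
  define d where "d = length bs"
  let ?R = "X.representation \<gamma>"
  define f0 where "f0 x i = ?R x (bs ! i)" for x i
  have bsM: "bs ! i \<in> M" "bs ! i \<in> \<gamma>" "bs ! i \<notin> \<beta>" if "i < d" for i
    using that bs nth_mem[of i bs] X.basis_of_subset[OF g(1)] unfolding d_def by auto
  have f0_lin: "lin_on scx M (\<lambda>x. f0 x i)" for i
    unfolding lin_on_def f0_def using fg by (auto simp: X.representation_add X.representation_scale)
  have f0_Y0: "f0 x i = 0" if "x \<in> Y" "i < d" for x i
  proof -
    have "?R x = X.representation \<beta> x"
      using that ib g fg by (intro X.representation_extend) auto
    then show ?thesis unfolding f0_def using bsM(3)[OF that(2)] X.representation_ne_zero by metis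
  qed
  have expand: "x = (\<Sum>b\<in>\<beta>. scx (?R x b) b) + (\<Sum>i<d. scx (f0 x i) (bs ! i))" if "x \<in> M" for x
  proof -
    have "x = (\<Sum>b\<in>\<gamma>. scx (?R x b) b)" using X.sum_representation_eq[of \<gamma> x \<gamma>] fg that by simp
    also have "\<dots> = (\<Sum>b\<in>\<beta>. scx (?R x b) b) + (\<Sum>b\<in>set bs. scx (?R x b) b)"
      using sum.subset_diff[OF g(2) fg(1), of "\<lambda>b. scx (?R x b) b"] bs by (simp add: add.commute)
    also have "(\<Sum>b\<in>set bs. scx (?R x b) b) = (\<Sum>i<d. scx (f0 x i) (bs ! i))"
      unfolding f0_def d_def by (rule sum.reindex_bij_betw[OF bij_betw_nth[OF bs(2) refl refl], symmetric])
    finally show ?thesis .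
  qed
  have inY: "(\<Sum>b\<in>\<beta>. scx (k b) b) \<in> Y" for k
    using X.basis_of_subset[OF b] sY(1) by (intro X.subspace_sum X.subspace_scale) auto
  have f0_Y: "x \<in> Y \<longleftrightarrow> (\<forall>i<d. f0 x i = 0)" if "x \<in> M" for x
  proof
    assume "\<forall>i<d. f0 x i = 0"
    then have "x = (\<Sum>b\<in>\<beta>. scx (?R x b) b)" using expand[OF that] by simp
    then show "x \<in> Y" using inY[of "?R x"] by metis
  qed (use f0_Y0 in auto)
  have f0_bs: "f0 (bs ! j) i = (if i = j then 1 else 0)" if "i < d" "j < d" for i j
    using that fg bsM(2)[OF that(2)] bs(2) unfolding f0_def d_def
    by (auto simp: X.representation_basis nth_eq_iff_index_eq)
  define \<rho> where "\<rho> a = mat d d (\<lambda>(i,j). f0 (act a (bs ! j)) i)" for a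
  have rc: "\<rho> a \<in> carrier_mat d d" for a unfolding \<rho>_def by auto
  have rd: "dim_row (\<rho> a) = d" "dim_col (\<rho> a) = d" for a unfolding \<rho>_def by auto
  have f0_act: "f0 (act a x) i = (\<Sum>j<d. \<rho> a $$ (i,j) * f0 x j)" if "a \<in> A" "x \<in> M" "i < d" for a x i
  proof -
    let ?y = "\<Sum>b\<in>\<beta>. scx (?R x b) b" and ?z = "\<Sum>j<d. scx (f0 x j) (bs ! j)"
    have yz: "?y \<in> M" "?z \<in> M" using inY[of "?R x"] sY(2) bsM(1) subspace_M
      by (blast, auto intro!: X.subspace_sum X.subspace_scale)
    have "act a x = act a ?y + act a ?z"
    proof -
      have "act a (?y + ?z) = act a ?y + act a ?z" using act_endo[OF that(1)] yz unfolding endo_on_def by blast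
      then show ?thesis using expand[OF that(2)] by simp
    qed
    moreover have "act a ?y \<in> M" "act a ?z \<in> M" using act_M that yz by auto
    ultimately have "f0 (act a x) i = f0 (act a ?y) i + f0 (act a ?z) i"
      using f0_lin unfolding lin_on_def by auto
    also have "f0 (act a ?y) i = 0" using f0_Y0 sY(3)[OF that(1) inY] that(3) by auto
    also have "act a ?z = (\<Sum>j<d. scx (f0 x j) (act a (bs ! j)))"
      using that bsM(1) by (intro act_sum) auto
    also have "f0 \<dots> i = (\<Sum>j<d. f0 x j * f0 (act a (bs ! j)) i)"
      using that bsM(1) act_M by (intro X.lin_on_sum[OF f0_lin subspace_M]) auto
    finally show ?thesis using that(3) unfolding \<rho>_def by (simp add: mult.commute)
  qed
  have is_rep: "is_rep sc A d \<rho>" unfolding is_rep_def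
  proof (intro conjI ballI allI)
    show "\<rho> a \<in> carrier_mat d d" for a by (rule rc)
    show "\<rho> 1 = 1\<^sub>m d" by (rule eq_matI) (auto simp: \<rho>_def act_one bsM f0_bs)
    fix a assume a: "a \<in> A"
    show "\<rho> (sc c a) = c \<cdot>\<^sub>m \<rho> a" for c
      using f0_lin act_M[OF a bsM(1)] unfolding lin_on_def
      by (intro eq_matI) (auto simp: \<rho>_def act_scale[OF a] bsM(1))
    fix b assume b: "b \<in> A"
    show "\<rho> (a + b) = \<rho> a + \<rho> b"
      using f0_lin act_M[OF a bsM(1)] act_M[OF b bsM(1)] unfolding lin_on_def
      by (intro eq_matI) (auto simp: \<rho>_def act_add[OF a b] bsM(1))
    show "\<rho> (a * b) = \<rho> a * \<rho> b"
    proof (rule eq_matI)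
      fix i j assume "i < dim_row (\<rho> a * \<rho> b)" "j < dim_col (\<rho> a * \<rho> b)"
      then have ij: "i < d" "j < d" by (auto simp: rd)
      have "\<rho> (a * b) $$ (i,j) = f0 (act a (act b (bs ! j))) i"
        using ij act_mult[OF a b bsM(1)] unfolding \<rho>_def by simp
      also have "\<dots> = (\<Sum>k<d. \<rho> a $$ (i,k) * f0 (act b (bs ! j)) k)"
        using f0_act[OF a act_M[OF b bsM(1)]] ij by blast
      also have "\<dots> = (\<Sum>k<d. \<rho> a $$ (i,k) * \<rho> b $$ (k,j))" using ij unfolding \<rho>_def by simp
      finally show "\<rho> (a * b) $$ (i,j) = (\<rho> a * \<rho> b) $$ (i,j)" using mult_mat_index[OF rc rc] ij by simp
    qed (auto simp: \<rho>_def)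
  qed
  have vact: "vec d (f0 (act a x)) = \<rho> a *\<^sub>v vec d (f0 x)" if "a \<in> A" "x \<in> M" for a x
  proof (rule eq_vecI)
    fix i assume "i < dim_vec (\<rho> a *\<^sub>v vec d (f0 x))"
    then have i: "i < d" by (simp add: rd)
    show "vec d (f0 (act a x)) $ i = (\<rho> a *\<^sub>v vec d (f0 x)) $ i"
      using f0_act[OF that i] i mult_mat_vec_index[OF rc _ i, of "vec d (f0 x)" a] by simp
  qed (simp add: rd)
  have d0: "d > 0"
  proof (rule ccontr)
    assume "\<not> d > 0"
    then have "x \<in> Y" if "x \<in> M" for x using f0_Y[OF that] by simp
    then show False using Y by auto
  qed
  have "irreducible_rep sc A d \<rho>" unfolding irreducible_rep_def
  proof (intro conjI allI impI)
    fix W assume W: "invariant_subspace A d \<rho> W"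
    define Z where "Z = {x\<in>M. vec d (f0 x) \<in> W}"
    have W': "W \<subseteq> carrier_vec d" "0\<^sub>v d \<in> W" "\<And>v w. v \<in> W \<Longrightarrow> w \<in> W \<Longrightarrow> v + w \<in> W" "\<And>c v. v \<in> W \<Longrightarrow> c \<cdot>\<^sub>v v \<in> W"
      "\<And>a v. a \<in> A \<Longrightarrow> v \<in> W \<Longrightarrow> \<rho> a *\<^sub>v v \<in> W" using W unfolding invariant_subspace_def by auto
    have add: "vec d (f0 (x + y)) = vec d (f0 x) + vec d (f0 y)" if "x \<in> M" "y \<in> M" for x y
      using f0_lin that unfolding lin_on_def by (intro eq_vecI) auto
    have scl: "vec d (f0 (scx c x)) = c \<cdot>\<^sub>v vec d (f0 x)" if "x \<in> M" for c x
      using f0_lin that unfolding lin_on_def by (intro eq_vecI) auto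
    have Y0: "vec d (f0 y) = 0\<^sub>v d" if "y \<in> Y" for y using f0_Y0[OF that] by (intro eq_vecI) auto
    have YZ: "Y \<subseteq> Z" using Y0 sY(2) W'(2) unfolding Z_def by auto
    have "X.subspace Z" unfolding X.subspace_def
    proof (intro conjI ballI allI)
      show "0 \<in> Z" using YZ sY(1) X.subspace_0 by auto
      fix x assume "x \<in> Z"
      then have x: "x \<in> M" "vec d (f0 x) \<in> W" unfolding Z_def by auto
      show "scx c x \<in> Z" for c using x scl[OF x(1)] W'(4) subspace_M X.subspace_scale unfolding Z_def by auto
      show "x + y \<in> Z" if "y \<in> Z" for y using x add[OF x(1)] that W'(3) subspace_M X.subspace_add unfolding Z_def by auto
    qed
    then have "submodule Z" unfolding submodule_def using vact act_M W'(5) unfolding Z_def by auto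
    then have ZYM: "Z = Y \<or> Z = M" using max YZ by auto
    have ex: "\<exists>x\<in>M. vec d (f0 x) = v" if v: "v \<in> carrier_vec d" for v
    proof
      let ?x = "\<Sum>j<d. scx (v $ j) (bs ! j)"
      show xM: "?x \<in> M" using bsM(1) subspace_M by (auto intro!: X.subspace_sum X.subspace_scale)
      show "vec d (f0 ?x) = v"
      proof (rule eq_vecI)
        fix i assume "i < dim_vec v" then have i: "i < d" using v by auto
        have "f0 ?x i = (\<Sum>j<d. v $ j * f0 (bs ! j) i)" using bsM(1) by (intro X.lin_on_sum[OF f0_lin subspace_M]) auto
        also have "\<dots> = (\<Sum>j<d. if j = i then v $ j else 0)" using i f0_bs by (intro sum.cong) auto
        finally show "vec d (f0 ?x) $ i = v $ i" using i by simp
      qed (use v in auto)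
    qed
    from ZYM show "W = {0\<^sub>v d} \<or> W = carrier_vec d"
    proof
      assume ZY: "Z = Y"
      have "v = 0\<^sub>v d" if vW: "v \<in> W" for v
      proof -
        obtain x where x: "x \<in> M" "vec d (f0 x) = v" using ex[OF subsetD[OF W'(1) vW]] by blast
        then have "x \<in> Z" using vW unfolding Z_def by simp
        then have "x \<in> Y" using ZY by simp
        from Y0[OF this] show ?thesis using x(2) by simp
      qed
      then have "W = {0\<^sub>v d}" using W'(2) by blast
      then show ?thesis ..
    next
      assume ZM: "Z = M"
      have "v \<in> W" if vc: "v \<in> carrier_vec d" for v
      proof -
        obtain x where x: "x \<in> M" "vec d (f0 x) = v" using ex[OF vc] by blast
        have "x \<in> Z" using x(1) ZM by simp
        then show ?thesis using x(2) unfolding Z_def by simp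
      qed
      then have "W = carrier_vec d" using W'(1) by blast
      then show ?thesis ..
    qed
  qed (use is_rep d0 in auto)
  note irr = this
  let ?\<phi> = "character A \<rho>"
  have I: "?\<phi> \<in> Irr" by (rule IrrI[OF irr])
  obtain \<theta> where t: "\<theta> \<in> carrier_mat (rdim ?\<phi>) d" "\<theta> \<noteq> 0\<^sub>m (rdim ?\<phi>) d"
    "\<And>a. a \<in> A \<Longrightarrow> rrep ?\<phi> a * \<theta> = \<theta> * \<rho> a" by (rule irred_iso[OF irr]) (rule that; blast)
  obtain T where T0: "T \<in> carrier_mat d (rdim ?\<phi>)" "\<theta> * T = 1\<^sub>m (rdim ?\<phi>)" "T * \<theta> = 1\<^sub>m d"
    by (rule schur[OF irr Irr_rep(1)[OF I] t(1,3,2)])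
  note T = T0(1,3)
  define f where "f x c = (\<Sum>i<d. \<theta> $$ (c,i) * f0 x i)" for x c
  have hom: "module_hom_to ?\<phi> f" unfolding module_hom_to_def
  proof (intro conjI allI impI ballI)
    show "lin_on scx M (\<lambda>x. f x c)" for c
      unfolding lin_on_def
    proof (intro conjI ballI allI)
      fix x assume x: "x \<in> M"
      show "f (x + y) c = f x c + f y c" if "y \<in> M" for y
        using f0_lin x that unfolding lin_on_def f_def by (simp add: sum.distrib distrib_left)
      show "f (scx k x) c = k * f x c" for k
        using f0_lin x unfolding lin_on_def f_def by (simp add: sum_distrib_left mult.left_commute)
    qed
    fix a x c assume a: "a \<in> A" and x: "x \<in> M" and c: "c < rdim ?\<phi>"
    have rr: "rrep ?\<phi> a \<in> carrier_mat (rdim ?\<phi>) (rdim ?\<phi>)" using rep_carrier[OF Irr_is_rep[OF I] a] .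
    have "f (act a x) c = (\<Sum>i<d. \<Sum>j<d. \<theta> $$ (c,i) * \<rho> a $$ (i,j) * f0 x j)"
      unfolding f_def using f0_act[OF a x] by (simp add: sum_distrib_left mult.assoc)
    also have "\<dots> = (\<Sum>j<d. (\<theta> * \<rho> a) $$ (c,j) * f0 x j)"
      using mult_mat_index[OF t(1) rc c] by (subst sum.swap) (simp add: sum_distrib_right)
    also have "\<dots> = (\<Sum>j<d. (\<Sum>c'<rdim ?\<phi>. rrep ?\<phi> a $$ (c,c') * \<theta> $$ (c',j)) * f0 x j)"
      using mult_mat_index[OF rr t(1) c] t(3)[OF a] by simp
    also have "\<dots> = (\<Sum>c'<rdim ?\<phi>. rrep ?\<phi> a $$ (c,c') * f x c')"
      unfolding f_def sum_distrib_left sum_distrib_right by (subst sum.swap) (simp add: mult.assoc)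
    finally show "f (act a x) c = (\<Sum>c'<rdim ?\<phi>. rrep ?\<phi> a $$ (c,c') * f x c')" .
  qed
  have zero: "x \<in> Y \<longleftrightarrow> (\<forall>c<rdim ?\<phi>. f x c = 0)" if x: "x \<in> M" for x
  proof
    assume "x \<in> Y" then show "\<forall>c<rdim ?\<phi>. f x c = 0" using f0_Y[OF x] unfolding f_def by simp
  next
    assume z: "\<forall>c<rdim ?\<phi>. f x c = 0"
    have "f0 x i = 0" if i: "i < d" for i
    proof -
      have "f0 x i = (\<Sum>j<d. (if i = j then 1 else 0) * f0 x j)" using i by (simp add: if_distrib[of "\<lambda>u. u * _"] cong: if_cong)
      also have "\<dots> = (\<Sum>j<d. (T * \<theta>) $$ (i,j) * f0 x j)" using T(2) i by (intro sum.cong) auto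
      also have "\<dots> = (\<Sum>j<d. (\<Sum>c<rdim ?\<phi>. T $$ (i,c) * \<theta> $$ (c,j)) * f0 x j)"
        using mult_mat_index[OF T(1) t(1) i] by simp
      also have "\<dots> = (\<Sum>c<rdim ?\<phi>. T $$ (i,c) * f x c)"
        unfolding f_def sum_distrib_left sum_distrib_right by (subst sum.swap) (simp add: mult.assoc)
      also have "\<dots> = 0" using z by simp
      finally show ?thesis .
    qed
    then show "x \<in> Y" using f0_Y[OF x] by simp
  qed
  have tr: "X.op_trace M (act a) = X.op_trace Y (act a) + ?\<phi> a" if a: "a \<in> A" for a
  proof -
    have eY: "endo_on scx Y (act a)" using act_endo[OF a] sY a unfolding endo_on_def by blast
    have "X.op_trace M (act a) = (\<Sum>b\<in>\<gamma>. ?R (act a b) b)"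
      by (rule X.op_trace_frame[OF subspace_M X.basis_frame[OF g(1)] act_endo[OF a]])
    also have "\<dots> = (\<Sum>b\<in>\<beta>. ?R (act a b) b) + (\<Sum>b\<in>set bs. ?R (act a b) b)"
      using sum.subset_diff[OF g(2) fg(1), of "\<lambda>b. ?R (act a b) b"] bs by (simp add: add.commute)
    also have "(\<Sum>b\<in>\<beta>. ?R (act a b) b) = (\<Sum>b\<in>\<beta>. X.representation \<beta> (act a b) b)"
    proof (rule sum.cong[OF refl])
      fix b assume bb: "b \<in> \<beta>"
      have "act a b \<in> Y" using sY(3)[OF a] X.basis_of_subset[OF b] bb by auto
      then have "?R (act a b) = X.representation \<beta> (act a b)" using ib g fg by (intro X.representation_extend) auto
      then show "?R (act a b) b = X.representation \<beta> (act a b) b" by simp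
    qed
    also have "\<dots> = X.op_trace Y (act a)" by (rule X.op_trace_frame[OF sY(1) X.basis_frame[OF b] eY, symmetric])
    also have "(\<Sum>b\<in>set bs. ?R (act a b) b) = (\<Sum>i<d. f0 (act a (bs ! i)) i)"
      unfolding f0_def d_def by (rule sum.reindex_bij_betw[OF bij_betw_nth[OF bs(2) refl refl], symmetric])
    also have "\<dots> = ?\<phi> a" using rep_trace[OF is_rep a] unfolding \<rho>_def by simp
    finally show ?thesis .
  qed
  show ?thesis by (rule that[OF _ _ _ I hom zero tr]) (use Y in auto)
qed

lemma trace_diff_aux:
  "\<lbrakk>submodule Q; submodule Z; Q \<subseteq> Z\<rbrakk> \<Longrightarrow>
   \<exists>m :: ('h \<Rightarrow> 'k) \<Rightarrow> nat. \<forall>a\<in>A. X.op_trace Z (act a) = X.op_trace Q (act a) + (\<Sum>\<phi>\<in>Irr. of_nat (m \<phi>) * \<phi> a)"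
proof (induction "X.dim Z" arbitrary: Z rule: less_induct)
  case less
  show ?case
  proof (cases "Q = Z")
    case True then show ?thesis by (intro exI[of _ "\<lambda>_. 0"]) auto
  next
    case False
    interpret Z: fd_module sc A scx act Z by (rule submodule_fd_module[OF less.prems(2)])
    have Zq: "Z.submodule Q" using less.prems unfolding submodule_def Z.submodule_def by auto
    obtain Y \<phi> f where Y: "Z.submodule Y" "Q \<subseteq> Y" "Y \<subset> Z" "\<phi> \<in> Irr" "Z.module_hom_to \<phi> f"
      "\<And>x. x \<in> Z \<Longrightarrow> x \<in> Y \<longleftrightarrow> (\<forall>c<rdim \<phi>. f x c = 0)"
      "\<And>a. a \<in> A \<Longrightarrow> X.op_trace Z (act a) = X.op_trace Y (act a) + \<phi> a"
    proof (rule Z.simple_quotient[OF Zq False], goal_cases)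
      case (1 Y \<phi> f)
      show ?case by (rule 1(1)[OF 1(2-)])
    qed
    have sY: "submodule Y" using Y(1) less.prems unfolding submodule_def Z.submodule_def by auto
    have "X.dim Y < X.dim Z"
      using X.dim_strict_mono[OF Z.fin_M _ Y(3)] sY unfolding submodule_def by auto
    from less.hyps[OF this less.prems(1) sY Y(2)] obtain m :: "('h \<Rightarrow> 'k) \<Rightarrow> nat" where
      m: "\<forall>a\<in>A. X.op_trace Y (act a) = X.op_trace Q (act a) + (\<Sum>\<phi>\<in>Irr. of_nat (m \<phi>) * \<phi> a)" ..
    have "(\<Sum>\<psi>\<in>Irr. of_nat ((m(\<phi> := Suc (m \<phi>))) \<psi>) * \<psi> a) = (\<Sum>\<psi>\<in>Irr. of_nat (m \<psi>) * \<psi> a) + \<phi> a" for a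
    proof -
      have "(\<Sum>\<psi>\<in>Irr. of_nat ((m(\<phi> := Suc (m \<phi>))) \<psi>) * \<psi> a) = (\<Sum>\<psi>\<in>Irr. of_nat (m \<psi>) * \<psi> a + (if \<psi> = \<phi> then \<psi> a else 0))"
        by (intro sum.cong) (auto simp: algebra_simps)
      then show ?thesis using Y(4) finite_Irr by (simp add: sum.distrib)
    qed
    then show ?thesis using m Y(7) by (intro exI[of _ "m(\<phi> := Suc (m \<phi>))"]) (simp add: add.assoc)
  qed
qed

lemma submodule_M: "submodule M" using subspace_M act_M unfolding submodule_def by auto

lemma trace_diff:
  assumes "submodule Q"
  obtains m :: "('h \<Rightarrow> 'k) \<Rightarrow> nat" where
    "\<And>a. a \<in> A \<Longrightarrow> X.op_trace M (act a) = X.op_trace Q (act a) + (\<Sum>\<phi>\<in>Irr. of_nat (m \<phi>) * \<phi> a)"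
proof -
  have "Q \<subseteq> M" using assms unfolding submodule_def by blast
  from trace_diff_aux[OF assms submodule_M this] obtain m :: "('h \<Rightarrow> 'k) \<Rightarrow> nat" where
    m: "\<forall>a\<in>A. X.op_trace M (act a) = X.op_trace Q (act a) + (\<Sum>\<phi>\<in>Irr. of_nat (m \<phi>) * \<phi> a)" ..
  show ?thesis by (rule that[of m]) (rule bspec[OF m])
qed

lemma trace_decomposition:
  obtains m :: "('h \<Rightarrow> 'k) \<Rightarrow> nat" where
    "\<And>a. a \<in> A \<Longrightarrow> X.op_trace M (act a) = (\<Sum>\<phi>\<in>Irr. of_nat (m \<phi>) * \<phi> a)"
proof -
  have z: "act a 0 = 0" if "a \<in> A" for a
    using act_sum[OF that, of "{}"] by simp
  have sub: "submodule {0}" unfolding submodule_def using z X.subspace_0[OF subspace_M] X.subspace_single_0 by simp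
  have b: "X.basis_of {0} {}" unfolding X.basis_of_def using X.independent_empty X.span_empty by simp
  have s0: "X.subspace {0}" by (rule X.subspace_single_0)
  have t0: "X.op_trace {0} (act a) = 0" if "a \<in> A" for a
  proof -
    have "endo_on scx {0} (act a)" using z[OF that] unfolding endo_on_def by simp
    from X.op_trace_frame[OF s0 X.basis_frame[OF b] this] show ?thesis by simp
  qed
  obtain m :: "('h \<Rightarrow> 'k) \<Rightarrow> nat" where
    m: "\<And>a. a \<in> A \<Longrightarrow> X.op_trace M (act a) = X.op_trace {0} (act a) + (\<Sum>\<phi>\<in>Irr. of_nat (m \<phi>) * \<phi> a)"
  proof (rule trace_diff[OF sub], goal_cases)
    case (1 m)
    show ?case by (rule 1(1)[OF 1(2-)])
  qed
  show ?thesis by (rule that[of m]) (simp add: m t0)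
qed

end


lemma sum_lessThan_add: "(\<Sum>k<n + r. f k) = (\<Sum>k<n. f k) + (\<Sum>k<(r::nat). f (n + k))"
  for f :: "nat \<Rightarrow> 'a::comm_monoid_add"
  by (induction r) (simp_all add: add.assoc)

lemma fun_vspace: "vspace (\<lambda>(c::'k::field) (f :: 'i \<Rightarrow> 'k) i. c * f i)"
  by unfold_locales (auto simp: algebra_simps fun_eq_iff)

text \<open>An idempotent matrix is the projection onto its column space.\<close>

lemma idempotent_factor:
  assumes F: "F \<in> carrier_mat d d" "F * F = (F :: 'k::field mat)"
  obtains r \<iota> \<kappa> where "\<iota> \<in> carrier_mat d r" "\<kappa> \<in> carrier_mat r d" "\<iota> * \<kappa> = F" "\<kappa> * \<iota> = 1\<^sub>m r"
proof -
  let ?s = "\<lambda>(c::'k) (f :: nat \<Rightarrow> 'k) i. c * f i"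
  interpret v: vspace ?s by (rule fun_vspace)
  define ap where "ap x i = (if i < d then \<Sum>j<d. F $$ (i,j) * x j else 0)" for x :: "nat \<Rightarrow> 'k" and i
  define e where "e j i = (if i = j then 1 else 0 :: 'k)" for j i :: nat
  have ap_add: "ap (\<lambda>i. x i + y i) = (\<lambda>i. ap x i + ap y i)" for x y
    unfolding ap_def by (auto simp: fun_eq_iff sum.distrib algebra_simps)
  have ap_scale: "ap (\<lambda>i. c * x i) = (\<lambda>i. c * ap x i)" for c x
    unfolding ap_def by (auto simp: fun_eq_iff sum_distrib_left algebra_simps)
  have FF: "(\<Sum>j<d. F $$ (i,j) * F $$ (j,k)) = F $$ (i,k)" if "i < d" "k < d" for i k
    using mult_mat_index[OF F(1) F(1) that] F(2) by simp
  have ap_ap: "ap (ap x) = ap x" for x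
  proof
    fix i
    have "(\<Sum>j<d. F $$ (i,j) * (\<Sum>k<d. F $$ (j,k) * x k)) = (\<Sum>k<d. F $$ (i,k) * x k)" if "i < d"
    proof -
      have "(\<Sum>j<d. F $$ (i,j) * (\<Sum>k<d. F $$ (j,k) * x k)) = (\<Sum>k<d. (\<Sum>j<d. F $$ (i,j) * F $$ (j,k)) * x k)"
        unfolding sum_distrib_left sum_distrib_right by (subst sum.swap) (simp add: mult.assoc)
      then show ?thesis using FF[OF that] by simp
    qed
    then show "ap (ap x) i = ap x i" unfolding ap_def by simp
  qed
  define W where "W = range ap"
  have sW: "v.subspace W" unfolding v.subspace_def
  proof (intro conjI ballI allI)
    have "ap (\<lambda>_. 0) = 0" unfolding ap_def by (auto simp: fun_eq_iff)
    then show "0 \<in> W" unfolding W_def by (metis rangeI)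
    fix x c assume "x \<in> W" then obtain x' where x: "x = ap x'" unfolding W_def by blast
    have "?s c x = ap (?s c x')" unfolding x ap_scale ..
    then show "?s c x \<in> W" unfolding W_def by blast
    fix y assume "y \<in> W" then obtain y' where y: "y = ap y'" unfolding W_def by blast
    have "x + y = ap (\<lambda>i. x' i + y' i)" unfolding x y ap_add by (simp add: fun_eq_iff)
    then show "x + y \<in> W" unfolding W_def by blast
  qed
  have supp: "x = (\<Sum>j<d. ?s (x j) (e j))" if "\<And>i. i \<ge> d \<Longrightarrow> x i = 0" for x
  proof
    fix i
    have "(\<Sum>j<d. ?s (x j) (e j)) i = (\<Sum>j<d. x j * e j i)" by (induction d) auto
    also have "\<dots> = (\<Sum>j<d. if j = i then x j else 0)" unfolding e_def by (intro sum.cong) auto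
    also have "\<dots> = x i" using that[of i] by auto
    finally show "x i = (\<Sum>j<d. ?s (x j) (e j)) i" by simp
  qed
  have "W \<subseteq> v.span (e ` {..<d})"
  proof
    fix x assume "x \<in> W"
    then have "x i = 0" if "i \<ge> d" for i using that unfolding W_def ap_def by auto
    then have "x = (\<Sum>j<d. ?s (x j) (e j))" by (rule supp)
    moreover have "(\<Sum>j<d. ?s (x j) (e j)) \<in> v.span (e ` {..<d})"
      by (rule v.span_sum, rule v.span_scale, rule v.span_base) blast
    ultimately show "x \<in> v.span (e ` {..<d})" by metis
  qed
  then have "v.fin_subspace W" unfolding v.fin_subspace_def using sW by blast
  then obtain \<beta> where b: "v.basis_of W \<beta>" by (rule v.fin_subspace_has_basis)
  then have b': "finite \<beta>" "v.independent \<beta>" "v.span \<beta> = W" unfolding v.basis_of_def by blast+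
  obtain bs where bs: "set bs = \<beta>" "distinct bs" using finite_distinct_list[OF b'(1)] by blast
  define r where "r = length bs"
  define co where "co s x = v.representation \<beta> x (bs ! s)" for s x
  have bsb: "bs ! s \<in> \<beta>" "bs ! s \<in> W" if "s < r" for s
    using nth_mem[of s bs] that bs v.basis_of_subset[OF b] unfolding r_def by blast+
  have co_lin: "lin_on ?s W (co s)" for s
    using v.basis_frame[OF b] unfolding lin_on_def co_def using b'(2,3)
    by (simp add: v.representation_add v.representation_scale)
  have co_bs: "co s (bs ! t) = (if s = t then 1 else 0)" if "s < r" "t < r" for s t
    using that bs(2) bsb(1)[OF that(2)] b'(2) unfolding co_def r_def
    by (simp add: v.representation_basis nth_eq_iff_index_eq)
  have expand: "x = (\<Sum>s<r. ?s (co s x) (bs ! s))" if "x \<in> W" for x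
  proof -
    have "x = (\<Sum>c\<in>set bs. ?s (v.representation \<beta> x c) c)"
      using v.sum_representation_eq[of \<beta> x \<beta>] b' that bs by simp
    also have "\<dots> = (\<Sum>s<r. ?s (co s x) (bs ! s))"
      unfolding co_def r_def by (rule sum.reindex_bij_betw[OF bij_betw_nth[OF bs(2) refl refl], symmetric])
    finally show ?thesis .
  qed
  have sumapp: "(\<Sum>s<n. ?s (c s) (u s)) i = (\<Sum>s<n. c s * u s i)" for n :: nat and c u i by (induction n) auto
  define \<iota> where "\<iota> = mat d r (\<lambda>(i,s). (bs ! s) i)"
  define \<kappa> where "\<kappa> = mat r d (\<lambda>(s,j). co s (ap (e j)))"
  have cc: "\<iota> \<in> carrier_mat d r" "\<kappa> \<in> carrier_mat r d" unfolding \<iota>_def \<kappa>_def by auto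
  have apW: "ap x \<in> W" for x unfolding W_def by blast
  have ape: "ap (e j) i = F $$ (i,j)" if "i < d" "j < d" for i j
  proof -
    have "(\<Sum>k<d. F $$ (i,k) * e j k) = (\<Sum>k<d. if k = j then F $$ (i,k) else 0)"
      by (intro sum.cong refl) (simp add: e_def)
    then show ?thesis using that unfolding ap_def by simp
  qed
  have "\<iota> * \<kappa> = F"
  proof (rule eq_matI)
    fix i j assume "i < dim_row F" "j < dim_col F"
    then have ij: "i < d" "j < d" using F(1) by auto
    have "(\<iota> * \<kappa>) $$ (i,j) = (\<Sum>s<r. co s (ap (e j)) * (bs ! s) i)"
      using mult_mat_index[OF cc ij] ij unfolding \<iota>_def \<kappa>_def by (simp add: mult.commute)
    also have "\<dots> = ap (e j) i" using expand[OF apW, of "e j"] sumapp[of "\<lambda>s. co s (ap (e j))" "(!) bs" r i] by simp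
    also have "\<dots> = F $$ (i,j)" by (rule ape[OF ij])
    finally show "(\<iota> * \<kappa>) $$ (i,j) = F $$ (i,j)" .
  qed (use F(1) in \<open>auto simp: \<iota>_def \<kappa>_def\<close>)
  moreover have "\<kappa> * \<iota> = 1\<^sub>m r"
  proof (rule eq_matI)
    fix s t assume "s < dim_row (1\<^sub>m r :: 'k mat)" "t < dim_col (1\<^sub>m r :: 'k mat)"
    then have st: "s < r" "t < r" by auto
    let ?x = "bs ! t"
    obtain y where y: "?x = ap y" using bsb(2)[OF st(2)] unfolding W_def by blast
    have x0: "?x i = 0" if "i \<ge> d" for i using y that unfolding ap_def by simp
    have apx: "ap ?x = ?x" using y ap_ap by simp
    have "ap ?x = (\<Sum>j<d. ?s (?x j) (ap (e j)))"
    proof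
      fix i
      have "(\<Sum>j<d. ?s (?x j) (ap (e j))) i = (\<Sum>j<d. ?x j * ap (e j) i)" by (rule sumapp)
      also have "\<dots> = ap ?x i"
      proof (cases "i < d")
        case True
        have "(\<Sum>j<d. ?x j * ap (e j) i) = (\<Sum>j<d. F $$ (i,j) * ?x j)"
          by (intro sum.cong refl) (simp add: ape True mult.commute)
        then show ?thesis using True unfolding ap_def[of ?x] by simp
      qed (simp add: ap_def)
      finally show "ap ?x i = (\<Sum>j<d. ?s (?x j) (ap (e j))) i" by simp
    qed
    then have "co s ?x = co s (\<Sum>j<d. ?s (?x j) (ap (e j)))" using apx by simp
    also have "\<dots> = (\<Sum>j<d. ?x j * co s (ap (e j)))"
      by (rule v.lin_on_sum[OF co_lin sW]) (simp_all add: apW)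
    also have "\<dots> = (\<kappa> * \<iota>) $$ (s,t)"
      using mult_mat_index[OF cc(2,1) st] st unfolding \<iota>_def \<kappa>_def by (simp add: mult.commute)
    finally show "(\<kappa> * \<iota>) $$ (s,t) = 1\<^sub>m r $$ (s,t)" using co_bs[OF st] st by simp
  qed (auto simp: \<iota>_def \<kappa>_def)
  ultimately show ?thesis by (rule that[OF cc])
qed

section \<open>Semisimple algebras\<close>

context fd_subalgebra
begin

definition blk :: "('h \<Rightarrow> 'k) \<Rightarrow> (nat \<Rightarrow> nat \<Rightarrow> 'k) \<Rightarrow> 'h" where
  "blk \<phi> B = (\<Sum>p\<in>{..<rdim \<phi>} \<times> {..<rdim \<phi>}. sc (B (fst p) (snd p)) (munit \<phi> (fst p) (snd p)))"

lemma blk_A: "blk \<phi> B \<in> A" unfolding blk_def by (intro sum_A scale_A munit_A)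

lemma rrep_blk:
  assumes "\<psi> \<in> Irr" "k < rdim \<psi>" "l < rdim \<psi>"
  shows "rrep \<psi> (blk \<phi> B) $$ (k,l) = (if \<psi> = \<phi> then B k l else 0)"
proof -
  have "rrep \<psi> (blk \<phi> B) $$ (k,l) = (\<Sum>p\<in>{..<rdim \<phi>} \<times> {..<rdim \<phi>}. B (fst p) (snd p) * rrep \<psi> (munit \<phi> (fst p) (snd p)) $$ (k,l))"
    unfolding blk_def by (rule rep_entry_sum[OF Irr_is_rep[OF assms(1)] _ munit_A assms(2,3)]) simp
  also have "\<dots> = (\<Sum>p\<in>{..<rdim \<phi>} \<times> {..<rdim \<phi>}. if p = (k,l) then (if \<psi> = \<phi> then B k l else 0) else 0)"
    by (intro sum.cong refl) (auto simp: rrep_munit[OF assms] prod_eq_iff)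
  also have "\<dots> = (if \<psi> = \<phi> then B k l else 0)" using assms by (cases "\<psi> = \<phi>") auto
  finally show ?thesis .
qed

definition cidem :: "('h \<Rightarrow> 'k) \<Rightarrow> 'h" where "cidem \<phi> = blk \<phi> (\<lambda>k l. if k = l then 1 else 0)"

lemma cidem_A: "cidem \<phi> \<in> A" unfolding cidem_def by (rule blk_A)

lemma rrep_cidem:
  "\<lbrakk>\<psi> \<in> Irr; k < rdim \<psi>; l < rdim \<psi>\<rbrakk> \<Longrightarrow> rrep \<psi> (cidem \<phi>) $$ (k,l) = (if \<psi> = \<phi> \<and> k = l then 1 else 0)"
  unfolding cidem_def by (simp add: rrep_blk)

lemma rrep_cidem_mult:
  assumes "\<psi> \<in> Irr" "k < rdim \<psi>" "l < rdim \<psi>" "a \<in> A"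
  shows "rrep \<psi> (cidem \<phi> * a) $$ (k,l) = (if \<psi> = \<phi> then rrep \<psi> a $$ (k,l) else 0)"
    and "rrep \<psi> (a * cidem \<phi>) $$ (k,l) = (if \<psi> = \<phi> then rrep \<psi> a $$ (k,l) else 0)"
proof -
  have "rrep \<psi> (cidem \<phi> * a) $$ (k,l) = (\<Sum>r<rdim \<psi>. rrep \<psi> (cidem \<phi>) $$ (k,r) * rrep \<psi> a $$ (r,l))"
    by (rule rep_entry_mult[OF Irr_is_rep[OF assms(1)] cidem_A assms(4,2,3)])
  also have "\<dots> = (\<Sum>r<rdim \<psi>. if r = k then (if \<psi> = \<phi> then rrep \<psi> a $$ (r,l) else 0) else 0)"
    by (intro sum.cong refl) (simp add: rrep_cidem[OF assms(1,2)])
  finally show "rrep \<psi> (cidem \<phi> * a) $$ (k,l) = (if \<psi> = \<phi> then rrep \<psi> a $$ (k,l) else 0)" using assms(2) by simp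
  have "rrep \<psi> (a * cidem \<phi>) $$ (k,l) = (\<Sum>r<rdim \<psi>. rrep \<psi> a $$ (k,r) * rrep \<psi> (cidem \<phi>) $$ (r,l))"
    by (rule rep_entry_mult[OF Irr_is_rep[OF assms(1)] assms(4) cidem_A assms(2,3)])
  also have "\<dots> = (\<Sum>r<rdim \<psi>. if r = l then (if \<psi> = \<phi> then rrep \<psi> a $$ (k,r) else 0) else 0)"
    by (intro sum.cong refl) (simp add: rrep_cidem[OF assms(1) _ assms(3)])
  finally show "rrep \<psi> (a * cidem \<phi>) $$ (k,l) = (if \<psi> = \<phi> then rrep \<psi> a $$ (k,l) else 0)" using assms(3) by simp
qed

end

locale ss_algebra = fd_subalgebra sc A
  for sc :: "'k::{alg_closed_field,field_char_0} \<Rightarrow> 'h::ring_1 \<Rightarrow> 'h" and A :: "'h set" +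
  assumes radical_zero: "rad = {0}"
begin

lemma ss_eqI:
  assumes "a \<in> A" "b \<in> A"
    "\<And>\<phi> k l. \<lbrakk>\<phi> \<in> Irr; k < rdim \<phi>; l < rdim \<phi>\<rbrakk> \<Longrightarrow> rrep \<phi> a $$ (k,l) = rrep \<phi> b $$ (k,l)"
  shows "a = b"
proof -
  have d: "a - b \<in> A" using assms diff_A by blast
  have "rrep \<phi> (a - b) = 0\<^sub>m (rdim \<phi>) (rdim \<phi>)" if I: "\<phi> \<in> Irr" for \<phi>
  proof (rule eq_matI)
    have c: "rrep \<phi> (a - b) \<in> carrier_mat (rdim \<phi>) (rdim \<phi>)" by (rule rep_carrier[OF Irr_is_rep[OF I] d])
    then show "dim_row (rrep \<phi> (a - b)) = dim_row (0\<^sub>m (rdim \<phi>) (rdim \<phi>) :: 'k mat)"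
      "dim_col (rrep \<phi> (a - b)) = dim_col (0\<^sub>m (rdim \<phi>) (rdim \<phi>) :: 'k mat)" by simp_all
    fix k l assume "k < dim_row (0\<^sub>m (rdim \<phi>) (rdim \<phi>) :: 'k mat)" "l < dim_col (0\<^sub>m (rdim \<phi>) (rdim \<phi>) :: 'k mat)"
    then have kl: "k < rdim \<phi>" "l < rdim \<phi>" by simp_all
    show "rrep \<phi> (a - b) $$ (k,l) = 0\<^sub>m (rdim \<phi>) (rdim \<phi>) $$ (k,l)"
      using rep_entry_diff[OF Irr_is_rep[OF I] assms(1,2) kl] assms(3)[OF I kl] kl by simp
  qed
  then have "a - b \<in> rad" unfolding rad_def using d by blast
  then show ?thesis using radical_zero by simp
qed

lemma munit_frame:
  "frame A (Sigma Irr (\<lambda>\<phi>. {..<rdim \<phi>} \<times> {..<rdim \<phi>}))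
     (\<lambda>(\<phi>,i,j). munit \<phi> i j) (\<lambda>(\<phi>,i,j) a. rrep \<phi> a $$ (i,j))"
proof -
  let ?K = "Sigma Irr (\<lambda>\<phi>. {..<rdim \<phi>} \<times> {..<rdim \<phi>})"
  have fK: "finite ?K" using finite_Irr by simp
  have "a = (\<Sum>(\<phi>,i,j)\<in>?K. sc (rrep \<phi> a $$ (i,j)) (munit \<phi> i j))" if a: "a \<in> A" for a
  proof (rule ss_eqI[OF a])
    show "(\<Sum>(\<phi>,i,j)\<in>?K. sc (rrep \<phi> a $$ (i,j)) (munit \<phi> i j)) \<in> A"
      by (intro sum_A) (clarsimp simp: scale_A munit_A)
    fix \<psi> k l assume ps: "\<psi> \<in> Irr" "k < rdim \<psi>" "l < rdim \<psi>"
    have "rrep \<psi> (\<Sum>p\<in>?K. sc (rrep (fst p) a $$ (snd p)) (munit (fst p) (fst (snd p)) (snd (snd p)))) $$ (k,l)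
      = (\<Sum>p\<in>?K. rrep (fst p) a $$ (snd p) * rrep \<psi> (munit (fst p) (fst (snd p)) (snd (snd p))) $$ (k,l))"
      by (rule rep_entry_sum[OF Irr_is_rep[OF ps(1)] fK munit_A ps(2,3)])
    also have "\<dots> = (\<Sum>p\<in>?K. if p = (\<psi>,k,l) then rrep \<psi> a $$ (k,l) else 0)"
      by (intro sum.cong refl) (auto simp: rrep_munit[OF ps] prod_eq_iff)
    also have "\<dots> = rrep \<psi> a $$ (k,l)" using fK ps by simp
    finally show "rrep \<psi> a $$ (k,l) = rrep \<psi> (\<Sum>(\<phi>,i,j)\<in>?K. sc (rrep \<phi> a $$ (i,j)) (munit \<phi> i j)) $$ (k,l)"
      by (simp add: case_prod_beta)
  qed
  then show ?thesis unfolding frame_def using fK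
    by (auto simp: munit_A rep_entry_lin[OF Irr_is_rep] case_prod_beta)
qed

text \<open>The regular bimodule: both the multiplicities of the irreducible characters in the regular
  character and the characters of the left ideals generated by idempotents are read off from it.\<close>

lemma trace_left_right:
  assumes a: "a \<in> A" and b: "b \<in> A"
  shows "op_trace A (\<lambda>x. a * x * b) = (\<Sum>\<phi>\<in>Irr. \<phi> a * \<phi> b)"
proof -
  have e: "endo_on sc A (\<lambda>x. a * x * b)" unfolding endo_on_def
    using a b by (simp add: mult_A algebra_simps sc_mult_left[symmetric] sc_mult_right[symmetric])
  have "op_trace A (\<lambda>x. a * x * b) = (\<Sum>(\<phi>,i,j)\<in>Sigma Irr (\<lambda>\<phi>. {..<rdim \<phi>} \<times> {..<rdim \<phi>}). rrep \<phi> (a * munit \<phi> i j * b) $$ (i,j))"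
    using op_trace_frame[OF subspace_A munit_frame e] by (simp add: case_prod_beta)
  also have "\<dots> = (\<Sum>(\<phi>,i,j)\<in>Sigma Irr (\<lambda>\<phi>. {..<rdim \<phi>} \<times> {..<rdim \<phi>}). rrep \<phi> a $$ (i,i) * rrep \<phi> b $$ (j,j))"
  proof (rule sum.cong[OF refl], clarify)
    fix \<phi> i j assume I: "\<phi> \<in> Irr" and ij: "i < rdim \<phi>" "j < rdim \<phi>"
    have "rrep \<phi> (a * munit \<phi> i j * b) $$ (i,j) = (\<Sum>r<rdim \<phi>. rrep \<phi> (a * munit \<phi> i j) $$ (i,r) * rrep \<phi> b $$ (r,j))"
      by (rule rep_entry_mult[OF Irr_is_rep[OF I] mult_A[OF a munit_A] b ij])
    also have "\<dots> = (\<Sum>r<rdim \<phi>. if r = j then rrep \<phi> a $$ (i,i) * rrep \<phi> b $$ (r,j) else 0)"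
      by (intro sum.cong refl) (simp add: rrep_munit_right[OF a I ij(1) _ ij(1)])
    finally show "rrep \<phi> (a * munit \<phi> i j * b) $$ (i,j) = rrep \<phi> a $$ (i,i) * rrep \<phi> b $$ (j,j)" using ij by simp
  qed
  also have "\<dots> = (\<Sum>\<phi>\<in>Irr. \<Sum>(i,j)\<in>{..<rdim \<phi>} \<times> {..<rdim \<phi>}. rrep \<phi> a $$ (i,i) * rrep \<phi> b $$ (j,j))"
    by (subst sum.Sigma) (simp_all add: finite_Irr)
  also have "\<dots> = (\<Sum>\<phi>\<in>Irr. \<phi> a * \<phi> b)"
    by (intro sum.cong refl) (simp add: Irr_trace a b sum_product sum.cartesian_product)
  finally show ?thesis .
qed

lemma one_eq_sum_cidem: "1 = (\<Sum>\<phi>\<in>Irr. cidem \<phi>)"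
proof (rule ss_eqI[OF one_A])
  show "(\<Sum>\<phi>\<in>Irr. cidem \<phi>) \<in> A" by (intro sum_A cidem_A)
  fix \<psi> k l assume ps: "\<psi> \<in> Irr" "k < rdim \<psi>" "l < rdim \<psi>"
  have "rrep \<psi> (\<Sum>\<phi>\<in>Irr. cidem \<phi>) $$ (k,l) = (\<Sum>\<phi>\<in>Irr. rrep \<psi> (cidem \<phi>) $$ (k,l))"
    by (rule rep_entry_sum'[OF Irr_is_rep[OF ps(1)] finite_Irr cidem_A ps(2,3)])
  also have "\<dots> = (\<Sum>\<phi>\<in>Irr. if \<phi> = \<psi> then (if k = l then 1 else 0) else 0)"
    by (intro sum.cong refl) (auto simp: rrep_cidem[OF ps])
  also have "\<dots> = (if k = l then 1 else 0)" using ps finite_Irr by simp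
  finally show "rrep \<psi> 1 $$ (k,l) = rrep \<psi> (\<Sum>\<phi>\<in>Irr. cidem \<phi>) $$ (k,l)"
    using rep_one[OF Irr_is_rep[OF ps(1)]] ps by simp
qed

subsection \<open>Central idempotents\<close>

lemma cidem_central: "a \<in> A \<Longrightarrow> cidem \<phi> * a = a * cidem \<phi>"
  by (rule ss_eqI) (simp_all add: cidem_A mult_A rrep_cidem_mult)

lemma central_scalar:
  assumes z: "z \<in> alg_centre A" and I: "\<phi> \<in> Irr"
  obtains c where "rrep \<phi> z = c \<cdot>\<^sub>m 1\<^sub>m (rdim \<phi>)"
proof (rule schur_scalar[OF Irr_rep(1)[OF I], of "rrep \<phi> z"])
  have zA: "z \<in> A" "\<And>a. a \<in> A \<Longrightarrow> z * a = a * z" using z unfolding alg_centre_def by blast+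
  show "rrep \<phi> z \<in> carrier_mat (rdim \<phi>) (rdim \<phi>)" by (rule rep_carrier[OF Irr_is_rep[OF I] zA(1)])
  show "rrep \<phi> a * rrep \<phi> z = rrep \<phi> z * rrep \<phi> a" if "a \<in> A" for a
    using zA(2)[OF that] rep_mult[OF Irr_is_rep[OF I]] zA(1) that by metis
qed (rule that)

lemma cidem_idem: "cidem \<phi> * cidem \<phi> = cidem \<phi>"
  by (rule ss_eqI) (auto simp add: cidem_A mult_A rrep_cidem_mult rrep_cidem)

lemma cidem_nonzero: assumes "\<phi> \<in> Irr" shows "cidem \<phi> \<noteq> 0"
proof
  assume "cidem \<phi> = 0"
  then have "rrep \<phi> (cidem \<phi>) $$ (0,0) = 0"
    using rep_entry_zero[OF Irr_is_rep[OF assms] Irr_pos[OF assms] Irr_pos[OF assms]] by metis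
  then show False using rrep_cidem[OF assms Irr_pos[OF assms] Irr_pos[OF assms], of \<phi>] by simp
qed

lemma central_part:
  assumes f: "f \<in> alg_centre A" "f * f = f" "f * cidem \<phi> = f" and I: "\<phi> \<in> Irr"
  shows "f = 0 \<or> f = cidem \<phi>"
proof -
  have fA: "f \<in> A" using f(1) unfolding alg_centre_def by blast
  obtain c where c: "rrep \<phi> f = c \<cdot>\<^sub>m 1\<^sub>m (rdim \<phi>)" by (rule central_scalar[OF f(1) I])
  have ent: "rrep \<phi> f $$ (k,l) = (if k = l then c else 0)" if "k < rdim \<phi>" "l < rdim \<phi>" for k l
    using c that by simp
  have "rrep \<phi> (f * f) $$ (0,0) = (\<Sum>r<rdim \<phi>. rrep \<phi> f $$ (0,r) * rrep \<phi> f $$ (r,0))"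
    by (rule rep_entry_mult[OF Irr_is_rep[OF I] fA fA Irr_pos[OF I] Irr_pos[OF I]])
  also have "\<dots> = (\<Sum>r<rdim \<phi>. if r = 0 then c * c else 0)"
    using ent Irr_pos[OF I] by (intro sum.cong refl) auto
  finally have "c * c = c" using f(2) ent Irr_pos[OF I] by simp
  then have cc: "c = 0 \<or> c = 1" by auto
  have out: "rrep \<psi> f $$ (k,l) = 0" if "\<psi> \<in> Irr" "k < rdim \<psi>" "l < rdim \<psi>" "\<psi> \<noteq> \<phi>" for \<psi> k l
    using rrep_cidem_mult(2)[OF that(1-3) fA, of \<phi>] f(3) that(4) by simp
  from cc show ?thesis
  proof
    assume "c = 0"
    have "f = 0"
    proof (rule ss_eqI[OF fA zero_A])
      fix \<psi> k l assume ps: "\<psi> \<in> Irr" "k < rdim \<psi>" "l < rdim \<psi>"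
      show "rrep \<psi> f $$ (k,l) = rrep \<psi> 0 $$ (k,l)"
        using out[OF ps] ent ps \<open>c = 0\<close> rep_entry_zero[OF Irr_is_rep[OF ps(1)] ps(2,3)] by (cases "\<psi> = \<phi>") auto
    qed
    then show ?thesis ..
  next
    assume "c = 1"
    have "f = cidem \<phi>"
    proof (rule ss_eqI[OF fA cidem_A])
      fix \<psi> k l assume ps: "\<psi> \<in> Irr" "k < rdim \<psi>" "l < rdim \<psi>"
      show "rrep \<psi> f $$ (k,l) = rrep \<psi> (cidem \<phi>) $$ (k,l)"
        using out[OF ps] ent ps \<open>c = 1\<close> rrep_cidem[OF ps] by (cases "\<psi> = \<phi>") auto
    qed
    then show ?thesis ..
  qed
qed

lemma cidem_in_centre: "cidem \<phi> \<in> alg_centre A"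
  unfolding alg_centre_def using cidem_A cidem_central by blast

lemma central_idem_eq_cidem:
  assumes I: "\<phi> \<in> Irr" shows "central_idem sc A \<phi> = cidem \<phi>"
  unfolding central_idem_def
proof (rule the_equality)
  have prim: "primitive_idem (alg_centre A) (cidem \<phi>)" unfolding primitive_idem_def
  proof (intro conjI ballI impI)
    show "cidem \<phi> \<in> alg_centre A" "cidem \<phi> \<noteq> 0" "cidem \<phi> * cidem \<phi> = cidem \<phi>"
      using cidem_in_centre cidem_nonzero[OF I] cidem_idem by blast+
    fix f g assume f: "f \<in> alg_centre A" and h: "f * f = f \<and> g * g = g \<and> f * g = 0 \<and> g * f = 0 \<and> cidem \<phi> = f + g"
    have ff: "f * f = f" and fg: "f * g = 0" and s: "cidem \<phi> = f + g" using h by blast+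
    have "f * cidem \<phi> = f" unfolding s by (simp add: distrib_left ff fg)
    from central_part[OF f ff this I] show "f = 0 \<or> g = 0" using s by auto
  qed
  have act: "\<rho> (cidem \<phi>) = 1\<^sub>m d" if "irreducible_rep sc A d \<rho>" "character A \<rho> = \<phi>" for d \<rho>
  proof (rule irred_acts_like[OF that(1) cidem_A])
    have "rrep \<phi> (cidem \<phi>) = 1\<^sub>m (rdim \<phi>)"
    proof (rule eq_matI)
      show "dim_row (rrep \<phi> (cidem \<phi>)) = dim_row (1\<^sub>m (rdim \<phi>) :: 'k mat)" "dim_col (rrep \<phi> (cidem \<phi>)) = dim_col (1\<^sub>m (rdim \<phi>) :: 'k mat)"
        using rep_carrier[OF Irr_is_rep[OF I] cidem_A[of \<phi>]] by simp_all
    qed (simp add: rrep_cidem[OF I])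
    then show "rrep (character A \<rho>) (cidem \<phi>) = 1\<^sub>m (rdim (character A \<rho>))" unfolding that(2) .
  qed
  show "primitive_idem (alg_centre A) (cidem \<phi>) \<and> (\<forall>d \<rho>. irreducible_rep sc A d \<rho> \<and> character A \<rho> = \<phi> \<longrightarrow> \<rho> (cidem \<phi>) = 1\<^sub>m d)"
    by (intro conjI prim allI impI act) (elim conjE, assumption)+
  fix T assume T: "primitive_idem (alg_centre A) T \<and> (\<forall>d \<rho>. irreducible_rep sc A d \<rho> \<and> character A \<rho> = \<phi> \<longrightarrow> \<rho> T = 1\<^sub>m d)"
  note Tp = conjunct1[OF T, unfolded primitive_idem_def]
  note TA = conjunct1[OF Tp] conjunct1[OF conjunct2[OF conjunct2[OF Tp]]]
  have TA': "T \<in> A" "\<And>a. a \<in> A \<Longrightarrow> T * a = a * T" using TA(1) unfolding alg_centre_def by blast+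
  let ?f = "T * cidem \<phi>" and ?g = "T - T * cidem \<phi>"
  have comm: "cidem \<phi> * T = T * cidem \<phi>" by (rule cidem_central[OF TA'(1)])
  have ff: "?f * ?f = ?f"
  proof -
    have "?f * ?f = T * (cidem \<phi> * T) * cidem \<phi>" by (simp only: mult.assoc)
    also have "\<dots> = (T * T) * (cidem \<phi> * cidem \<phi>)" unfolding comm by (simp only: mult.assoc)
    finally show ?thesis unfolding TA(2) cidem_idem .
  qed
  have Tf: "T * ?f = ?f" using TA(2) by (simp add: mult.assoc[symmetric])
  have fT: "?f * T = ?f" using comm Tf by (simp add: mult.assoc)
  have cen: "?f \<in> alg_centre A"
    unfolding alg_centre_def
  proof (intro CollectI conjI ballI)
    show "?f \<in> A" by (rule mult_A[OF TA'(1) cidem_A])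
    fix a assume a: "a \<in> A"
    have "?f * a = T * (cidem \<phi> * a)" by (rule mult.assoc)
    also have "\<dots> = T * (a * cidem \<phi>)" using cidem_central[OF a] by simp
    also have "\<dots> = (T * a) * cidem \<phi>" by (rule mult.assoc[symmetric])
    also have "\<dots> = a * ?f" using TA'(2)[OF a] by (simp add: mult.assoc)
    finally show "?f * a = a * ?f" .
  qed
  then have cen2: "?g \<in> alg_centre A"
    using TA(1) unfolding alg_centre_def by (simp add: left_diff_distrib right_diff_distrib diff_A)
  have "?f * ?f = ?f \<and> ?g * ?g = ?g \<and> ?f * ?g = 0 \<and> ?g * ?f = 0 \<and> T = ?f + ?g"
    by (simp add: left_diff_distrib right_diff_distrib ff Tf fT TA(2))
  moreover have "\<forall>f\<in>alg_centre A. \<forall>g\<in>alg_centre A. f * f = f \<and> g * g = g \<and> f * g = 0 \<and> g * f = 0 \<and> T = f + g \<longrightarrow> f = 0 \<or> g = 0"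
    by (rule conjunct2[OF conjunct2[OF conjunct2[OF Tp]]])
  ultimately have alt: "?f = 0 \<or> ?g = 0" using cen cen2 by blast
  have rT: "rrep \<phi> T = 1\<^sub>m (rdim \<phi>)" using conjunct2[OF T] Irr_rep[OF I] by blast
  have "?f \<noteq> 0"
  proof
    assume "?f = 0"
    then have "rrep \<phi> (T * cidem \<phi>) $$ (0,0) = 0" using rep_entry_zero[OF Irr_is_rep[OF I] Irr_pos[OF I] Irr_pos[OF I]] by metis
    then show False using rrep_cidem_mult(2)[OF I Irr_pos[OF I] Irr_pos[OF I] TA'(1), of \<phi>] rT Irr_pos[OF I] by simp
  qed
  then have Te: "T * cidem \<phi> = T" using alt by simp
  then have "T \<noteq> 0" using \<open>?f \<noteq> 0\<close> by simp
  then show "T = cidem \<phi>" using central_part[OF TA Te I] by blast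
qed

end


lemma mat_trace_four_block:
  assumes "A \<in> carrier_mat n n" "D \<in> carrier_mat m m"
  shows "mat_trace (four_block_mat A B C D) = mat_trace A + mat_trace (D :: 'k::field mat)"
  using assms unfolding mat_trace_def by (simp add: sum_lessThan_add)

lemma mat_trace_diag_block:
  assumes "\<And>M. M \<in> set Ms \<Longrightarrow> dim_row M = dim_col M"
  shows "mat_trace (diag_block_mat Ms) = (\<Sum>M\<leftarrow>Ms. mat_trace (M :: 'k::field mat))"
  using assms
proof (induction Ms)
  case Nil then show ?case by (simp add: mat_trace_def)
next
  case (Cons M Ms)
  have sq: "dim_row (diag_block_mat Ms) = dim_col (diag_block_mat Ms)"
    unfolding dim_diag_block_mat by (rule arg_cong[where f=sum_list], rule map_cong[OF refl], rule Cons.prems) simp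
  have cM: "M \<in> carrier_mat (dim_row M) (dim_row M)"
    by (rule carrier_matI[OF refl], rule Cons.prems[symmetric]) simp
  have cD: "diag_block_mat Ms \<in> carrier_mat (dim_row (diag_block_mat Ms)) (dim_row (diag_block_mat Ms))"
    by (rule carrier_matI[OF refl sq[symmetric]])
  have "mat_trace (diag_block_mat (M # Ms)) = mat_trace M + mat_trace (diag_block_mat Ms)"
    unfolding diag_block_mat.simps Let_def by (rule mat_trace_four_block[OF cM cD])
  moreover have "mat_trace (diag_block_mat Ms) = (\<Sum>M\<leftarrow>Ms. mat_trace M)"
    by (rule Cons.IH, rule Cons.prems) simp
  ultimately show ?case by (simp del: diag_block_mat.simps)
qed

lemma mat_trace_similar:
  assumes "similar_mat_wit A B P Q" shows "mat_trace A = mat_trace (B :: 'k::field mat)"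
proof -
  note w = similar_mat_witD[OF refl assms]
  have "mat_trace (P * B * Q) = mat_trace (Q * (P * B))" by (rule mat_trace_comm[OF mult_carrier_mat[OF w(6,5)] w(7)])
  also have "Q * (P * B) = (Q * P) * B" by (rule assoc_mult_mat[OF w(7,6,5), symmetric])
  also have "\<dots> = B" unfolding w(2) by (rule left_mult_one_mat[OF w(5)])
  finally show ?thesis unfolding w(3)[symmetric] .
qed

lemma mat_trace_one: "mat_trace (1\<^sub>m n :: 'k::field mat) = of_nat n" unfolding mat_trace_def by simp

context fd_subalgebra
begin

subsection \<open>One-dimensional representations and integrals\<close>

context
  fixes \<epsilon> :: "'h \<Rightarrow> 'k"
  assumes eps_add: "\<And>x y. \<epsilon> (x + y) = \<epsilon> x + \<epsilon> y" and eps_scale: "\<And>c x. \<epsilon> (sc c x) = c * \<epsilon> x"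
    and eps_mult: "\<And>x y. \<epsilon> (x * y) = \<epsilon> x * \<epsilon> y" and eps_one: "\<epsilon> 1 = 1"
begin

lemma one_dim_Irr:
  shows "restrict \<epsilon> A \<in> Irr" "rdim (restrict \<epsilon> A) = 1"
    "a \<in> A \<Longrightarrow> rrep (restrict \<epsilon> A) a $$ (0,0) = \<epsilon> a"
proof -
  define \<rho> where "\<rho> a = mat 1 1 (\<lambda>_. \<epsilon> a)" for a
  have rep: "is_rep sc A 1 \<rho>" unfolding is_rep_def
  proof (intro conjI ballI allI)
    show "\<rho> a \<in> carrier_mat 1 1" for a unfolding \<rho>_def by simp
    show "\<rho> 1 = 1\<^sub>m 1" unfolding \<rho>_def by (rule eq_matI) (simp_all add: eps_one)
    show "\<rho> (a + b) = \<rho> a + \<rho> b" for a b unfolding \<rho>_def by (rule eq_matI) (simp_all add: eps_add)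
    show "\<rho> (a * b) = \<rho> a * \<rho> b" for a b unfolding \<rho>_def by (rule eq_matI) (simp_all add: eps_mult scalar_prod_def)
    show "\<rho> (sc c a) = c \<cdot>\<^sub>m \<rho> a" for c a unfolding \<rho>_def by (rule eq_matI) (simp_all add: eps_scale)
  qed
  have "irreducible_rep sc A 1 \<rho>" unfolding irreducible_rep_def
  proof (intro conjI allI impI rep)
    fix W assume W: "invariant_subspace A 1 \<rho> W"
    have W1: "W \<subseteq> carrier_vec 1" "0\<^sub>v 1 \<in> W" and W2: "\<And>c v. v \<in> W \<Longrightarrow> c \<cdot>\<^sub>v v \<in> W"
      using W unfolding invariant_subspace_def by blast+
    show "W = {0\<^sub>v 1} \<or> W = carrier_vec 1"
    proof (cases "W \<subseteq> {0\<^sub>v 1}")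
      case True then show ?thesis using W1(2) by blast
    next
      case False
      then obtain v where v: "v \<in> W" "v \<noteq> 0\<^sub>v 1" by blast
      have vc: "v \<in> carrier_vec 1" using v W1 by blast
      have v0: "v $ 0 \<noteq> 0"
      proof
        assume "v $ 0 = 0"
        then have "v = 0\<^sub>v 1" using vc by (intro eq_vecI) auto
        then show False using v by blast
      qed
      have "w \<in> W" if w: "w \<in> carrier_vec 1" for w
      proof -
        have "w = (w $ 0 / v $ 0) \<cdot>\<^sub>v v" using w vc v0 by (intro eq_vecI) auto
        then show ?thesis using W2[OF v(1), of "w $ 0 / v $ 0"] by simp
      qed
      then show ?thesis using W1 by blast
    qed
  qed simp
  moreover have ch: "character A \<rho> = restrict \<epsilon> A"
    unfolding character_def \<rho>_def mat_trace_def by (simp add: fun_eq_iff restrict_def)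
  ultimately show I: "restrict \<epsilon> A \<in> Irr" using IrrI by metis
  have "(of_nat (rdim (restrict \<epsilon> A)) :: 'k) = of_nat 1" using Irr_one[OF I] one_A eps_one by simp
  then show r: "rdim (restrict \<epsilon> A) = 1" by (simp only: of_nat_eq_iff)
  show "rrep (restrict \<epsilon> A) a $$ (0,0) = \<epsilon> a" if "a \<in> A" using Irr_trace[OF I that] that r by simp
qed

end

end

context ss_algebra
begin

context
  fixes \<epsilon> :: "'h \<Rightarrow> 'k"
  assumes eps_add: "\<And>x y. \<epsilon> (x + y) = \<epsilon> x + \<epsilon> y" and eps_scale: "\<And>c x. \<epsilon> (sc c x) = c * \<epsilon> x"
    and eps_mult: "\<And>x y. \<epsilon> (x * y) = \<epsilon> x * \<epsilon> y" and eps_one: "\<epsilon> 1 = 1"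
begin

lemmas oneD = one_dim_Irr[OF eps_add eps_scale eps_mult eps_one]

lemma cidem_integral:
  assumes a: "a \<in> A"
  shows "a * cidem (restrict \<epsilon> A) = sc (\<epsilon> a) (cidem (restrict \<epsilon> A))"
    "cidem (restrict \<epsilon> A) * a = sc (\<epsilon> a) (cidem (restrict \<epsilon> A))"
proof -
  show 1: "a * cidem (restrict \<epsilon> A) = sc (\<epsilon> a) (cidem (restrict \<epsilon> A))"
  proof (rule ss_eqI[OF mult_A[OF a cidem_A] scale_A[OF cidem_A]])
    fix \<phi> k l assume p: "\<phi> \<in> Irr" "k < rdim \<phi>" "l < rdim \<phi>"
    show "rrep \<phi> (a * cidem (restrict \<epsilon> A)) $$ (k,l) = rrep \<phi> (sc (\<epsilon> a) (cidem (restrict \<epsilon> A))) $$ (k,l)"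
      unfolding rrep_cidem_mult(2)[OF p a] rep_entry_scale[OF Irr_is_rep[OF p(1)] cidem_A p(2,3)] rrep_cidem[OF p]
      using oneD(2) oneD(3)[OF a] p by (cases "\<phi> = restrict \<epsilon> A") auto
  qed
  then show "cidem (restrict \<epsilon> A) * a = sc (\<epsilon> a) (cidem (restrict \<epsilon> A))" using cidem_central[OF a] by simp
qed

lemma eps_cidem: "\<epsilon> (cidem (restrict \<epsilon> A)) = 1"
  using oneD(3)[OF cidem_A[of "restrict \<epsilon> A"]] rrep_cidem[OF oneD(1), of 0 0 "restrict \<epsilon> A"] oneD(2) by simp

lemma idem_integral_eq: "idem_integral sc \<epsilon> A = cidem (restrict \<epsilon> A)"
  unfolding idem_integral_def
proof (rule the_equality)
  show "cidem (restrict \<epsilon> A) \<in> A \<and> (\<forall>a\<in>A. a * cidem (restrict \<epsilon> A) = sc (\<epsilon> a) (cidem (restrict \<epsilon> A)) \<and>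
      cidem (restrict \<epsilon> A) * a = sc (\<epsilon> a) (cidem (restrict \<epsilon> A))) \<and> \<epsilon> (cidem (restrict \<epsilon> A)) = 1"
    using cidem_A cidem_integral eps_cidem by blast
  fix L assume L: "L \<in> A \<and> (\<forall>a\<in>A. a * L = sc (\<epsilon> a) L \<and> L * a = sc (\<epsilon> a) L) \<and> \<epsilon> L = 1"
  have "cidem (restrict \<epsilon> A) * L = sc 1 L" using L cidem_A eps_cidem by metis
  moreover have "cidem (restrict \<epsilon> A) * L = sc 1 (cidem (restrict \<epsilon> A))" using L cidem_integral(2) by metis
  ultimately show "L = cidem (restrict \<epsilon> A)" by simp
qed

end

subsection \<open>Primitive idempotents\<close>

text \<open>A primitive idempotent lives in a single matrix block, and there it dominates a projection
  of rank one; primitivity makes it equal to that projection.\<close>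

lemma primitive_char:
  assumes prim: "primitive_idem A t" and I: "\<phi> \<in> Irr"
    and cen: "\<forall>\<psi>\<in>Irr. central_idem sc A \<psi> * t = (if \<psi> = \<phi> then t else 0)" and J: "\<psi> \<in> Irr"
  shows "\<psi> t = (if \<psi> = \<phi> then 1 else 0)"
proof -
  note pr = prim[unfolded primitive_idem_def]
  have tA: "t \<in> A" and t0: "t \<noteq> 0" and tt: "t * t = t" using pr by blast+
  have ct: "cidem \<psi> * t = (if \<psi> = \<phi> then t else 0)" if "\<psi> \<in> Irr" for \<psi>
    using cen that central_idem_eq_cidem by metis
  have out: "rrep \<psi> t $$ (k,l) = 0" if "\<psi> \<in> Irr" "k < rdim \<psi>" "l < rdim \<psi>" "\<psi> \<noteq> \<phi>" for \<psi> k l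
    using rrep_cidem_mult(1)[OF that(1-3) tA, of \<psi>] ct[OF that(1)] that(4) rep_entry_zero[OF Irr_is_rep[OF that(1)] that(2,3)] by simp
  show ?thesis
  proof (cases "\<psi> = \<phi>")
    case False
    then show ?thesis using Irr_trace[OF J tA] out[OF J] by simp
  next
    case True
    have "\<exists>k0 j0. k0 < rdim \<phi> \<and> j0 < rdim \<phi> \<and> rrep \<phi> t $$ (k0,j0) \<noteq> 0"
    proof (rule ccontr)
      assume n: "\<not> ?thesis"
      have "t = 0"
      proof (rule ss_eqI[OF tA zero_A])
        fix \<psi> k l assume p: "\<psi> \<in> Irr" "k < rdim \<psi>" "l < rdim \<psi>"
        show "rrep \<psi> t $$ (k,l) = rrep \<psi> 0 $$ (k,l)"
          using n out[OF p] p rep_entry_zero[OF Irr_is_rep[OF p(1)] p(2,3)] by (cases "\<psi> = \<phi>") auto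
      qed
      then show False using t0 by blast
    qed
    then obtain k0 j0 where kj: "k0 < rdim \<phi>" "j0 < rdim \<phi>" and nz: "rrep \<phi> t $$ (k0,j0) \<noteq> 0" by blast
    let ?F = "\<lambda>i j. rrep \<phi> t $$ (i,j)"
    define c where "c = 1 / ?F k0 j0"
    have c1: "c * ?F k0 j0 = 1" "?F k0 j0 * c = 1" unfolding c_def using nz by simp_all
    define F0 where "F0 i j = ?F i j0 * (c * ?F k0 j)" for i j
    have FF: "(\<Sum>j<rdim \<phi>. ?F i j * ?F j k) = ?F i k" if "i < rdim \<phi>" "k < rdim \<phi>" for i k
      using rep_entry_mult[OF Irr_is_rep[OF I] tA tA that] tt by simp
    have S1: "(\<Sum>r<rdim \<phi>. ?F k r * (?F r j0 * x)) = ?F k j0 * x" if "k < rdim \<phi>" for k x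
      unfolding mult.assoc[symmetric] sum_distrib_right[symmetric] FF[OF that kj(2)] ..
    have S2: "(\<Sum>r<rdim \<phi>. x * (?F k0 r * ?F r l)) = x * ?F k0 l" if "l < rdim \<phi>" for l x
      unfolding sum_distrib_left[symmetric] FF[OF kj(1) that] ..
    have S3: "(\<Sum>r<rdim \<phi>. x * (?F k0 r * (?F r j0 * y))) = x * (?F k0 j0 * y)" for x y
      unfolding sum_distrib_left[symmetric] S1[OF kj(1)] ..
    define f where "f = blk \<phi> F0"
    have fA: "f \<in> A" unfolding f_def by (rule blk_A)
    have entf: "rrep \<psi> f $$ (k,l) = (if \<psi> = \<phi> then F0 k l else 0)" if "\<psi> \<in> Irr" "k < rdim \<psi>" "l < rdim \<psi>" for \<psi> k l
      unfolding f_def by (rule rrep_blk[OF that])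
    have ef: "rrep \<phi> f $$ (k,l) = F0 k l" if "k < rdim \<phi>" "l < rdim \<phi>" for k l
      using entf[OF I that] by simp
    have tf: "t * f = f"
    proof (rule ss_eqI[OF mult_A[OF tA fA] fA])
      fix \<psi> k l assume p: "\<psi> \<in> Irr" "k < rdim \<psi>" "l < rdim \<psi>"
      have "rrep \<psi> (t * f) $$ (k,l) = (\<Sum>r<rdim \<psi>. rrep \<psi> t $$ (k,r) * rrep \<psi> f $$ (r,l))"
        by (rule rep_entry_mult[OF Irr_is_rep[OF p(1)] tA fA p(2,3)])
      also have "\<dots> = rrep \<psi> f $$ (k,l)"
      proof (cases "\<psi> = \<phi>")
        case True
        have "(\<Sum>r<rdim \<psi>. rrep \<psi> t $$ (k,r) * rrep \<psi> f $$ (r,l)) = (\<Sum>r<rdim \<phi>. ?F k r * (?F r j0 * (c * ?F k0 l)))"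
          using True p by (intro sum.cong) (simp_all add: ef F0_def)
        then show ?thesis using S1[of k "c * ?F k0 l"] True p entf[OF p] by (simp add: F0_def)
      qed (simp add: entf[OF p(1) _ p(3)] entf[OF p])
      finally show "rrep \<psi> (t * f) $$ (k,l) = rrep \<psi> f $$ (k,l)" .
    qed
    have ft: "f * t = f"
    proof (rule ss_eqI[OF mult_A[OF fA tA] fA])
      fix \<psi> k l assume p: "\<psi> \<in> Irr" "k < rdim \<psi>" "l < rdim \<psi>"
      have "rrep \<psi> (f * t) $$ (k,l) = (\<Sum>r<rdim \<psi>. rrep \<psi> f $$ (k,r) * rrep \<psi> t $$ (r,l))"
        by (rule rep_entry_mult[OF Irr_is_rep[OF p(1)] fA tA p(2,3)])
      also have "\<dots> = rrep \<psi> f $$ (k,l)"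
      proof (cases "\<psi> = \<phi>")
        case True
        have "(\<Sum>r<rdim \<psi>. rrep \<psi> f $$ (k,r) * rrep \<psi> t $$ (r,l)) = (\<Sum>r<rdim \<phi>. (?F k j0 * c) * (?F k0 r * ?F r l))"
          using True p by (intro sum.cong) (simp_all add: ef F0_def)
        then show ?thesis using S2[of l "?F k j0 * c"] True p entf[OF p] by (simp add: F0_def)
      qed (simp add: entf[OF p(1,2)] entf[OF p])
      finally show "rrep \<psi> (f * t) $$ (k,l) = rrep \<psi> f $$ (k,l)" .
    qed
    have ff: "f * f = f"
    proof (rule ss_eqI[OF mult_A[OF fA fA] fA])
      fix \<psi> k l assume p: "\<psi> \<in> Irr" "k < rdim \<psi>" "l < rdim \<psi>"
      have "rrep \<psi> (f * f) $$ (k,l) = (\<Sum>r<rdim \<psi>. rrep \<psi> f $$ (k,r) * rrep \<psi> f $$ (r,l))"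
        by (rule rep_entry_mult[OF Irr_is_rep[OF p(1)] fA fA p(2,3)])
      also have "\<dots> = rrep \<psi> f $$ (k,l)"
      proof (cases "\<psi> = \<phi>")
        case True
        have "(\<Sum>r<rdim \<psi>. rrep \<psi> f $$ (k,r) * rrep \<psi> f $$ (r,l)) = (\<Sum>r<rdim \<phi>. (?F k j0 * c) * (?F k0 r * (?F r j0 * (c * ?F k0 l))))"
          using True p by (intro sum.cong) (simp_all add: ef F0_def)
        also have "\<dots> = ?F k j0 * ((c * ?F k0 j0) * (c * ?F k0 l))" unfolding S3 by (simp only: mult.assoc)
        finally show ?thesis using True entf[OF p] by (simp add: F0_def c1)
      qed (simp add: entf[OF p(1,2)] entf[OF p])
      finally show "rrep \<psi> (f * f) $$ (k,l) = rrep \<psi> f $$ (k,l)" .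
    qed
    have "f * f = f \<and> (t - f) * (t - f) = t - f \<and> f * (t - f) = 0 \<and> (t - f) * f = 0 \<and> t = f + (t - f)"
      by (simp add: left_diff_distrib right_diff_distrib ff tf ft tt)
    moreover have "\<forall>f\<in>A. \<forall>g\<in>A. f * f = f \<and> g * g = g \<and> f * g = 0 \<and> g * f = 0 \<and> t = f + g \<longrightarrow> f = 0 \<or> g = 0"
      by (rule conjunct2[OF conjunct2[OF conjunct2[OF pr]]])
    ultimately have alt: "f = 0 \<or> t - f = 0" using fA diff_A[OF tA fA] by blast
    have "f \<noteq> 0"
    proof
      assume "f = 0"
      have "rrep \<phi> f $$ (k0,j0) = 0" unfolding \<open>f = 0\<close> by (rule rep_entry_zero[OF Irr_is_rep[OF I] kj])
      then show False using entf[OF I kj] nz c1 unfolding F0_def by simp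
    qed
    then have "t = f" using alt by simp
    then have "\<phi> t = (\<Sum>i<rdim \<phi>. rrep \<phi> f $$ (i,i))" using Irr_trace[OF I fA] by simp
    also have "\<dots> = (\<Sum>i<rdim \<phi>. c * (?F k0 i * ?F i j0))"
      by (intro sum.cong refl) (simp add: entf[OF I] F0_def mult_ac)
    also have "\<dots> = 1" unfolding S2[OF kj(2)] c1 ..
    finally show ?thesis using True by simp
  qed
qed

subsection \<open>Complete reducibility and multiplicities\<close>

text \<open>A nonzero entry of the matrix of a matrix unit \<open>munit \<phi> 0 0\<close> produces a copy of the irreducible
  representation \<open>rrep \<phi>\<close> together with an equivariant retraction.\<close>

lemma split_off:
  assumes rep: "is_rep sc A d \<rho>" and d: "d > 0"
  obtains \<phi> r P Q \<rho>2 where "\<phi> \<in> Irr" "r < d" "rdim \<phi> + r = d" "is_rep sc A r \<rho>2"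
    "\<And>a. a \<in> A \<Longrightarrow> similar_mat_wit (\<rho> a) (four_block_mat (rrep \<phi> a) (0\<^sub>m (rdim \<phi>) r) (0\<^sub>m r (rdim \<phi>)) (\<rho>2 a)) P Q"
proof -
  note rc = rep_carrier[OF rep] and rem = rep_entry_mult[OF rep]
  have m1: "munit \<phi> c 0 * munit \<phi> 0 0 * munit \<phi> 0 c = munit \<phi> c c" if "\<phi> \<in> Irr" "c < rdim \<phi>" for \<phi> c
    using that Irr_pos[OF that(1)]
    by (intro ss_eqI) (auto simp: mult_A munit_A rrep_munit_right rrep_munit)
  have "\<exists>\<phi>\<in>Irr. \<exists>i<d. \<exists>j<d. \<rho> (munit \<phi> 0 0) $$ (i,j) \<noteq> 0"
  proof (rule ccontr)
    assume n: "\<not> ?thesis"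
    have z: "\<rho> (munit \<phi> c c) $$ (0,0) = 0" if p: "\<phi> \<in> Irr" "c < rdim \<phi>" for \<phi> c
    proof -
      have "\<rho> (munit \<phi> c 0 * munit \<phi> 0 0) $$ (0,j) = 0" if "j < d" for j
        unfolding rem[OF munit_A munit_A d that] by (rule sum.neutral) (use n p that in auto)
      then have "\<rho> (munit \<phi> c 0 * munit \<phi> 0 0 * munit \<phi> 0 c) $$ (0,0) = 0"
        unfolding rem[OF mult_A[OF munit_A munit_A] munit_A d d] by simp
      then show ?thesis using m1[OF p] by simp
    qed
    have c1: "cidem \<phi> = (\<Sum>c<rdim \<phi>. munit \<phi> c c)" if p: "\<phi> \<in> Irr" for \<phi>
    proof (rule ss_eqI[OF cidem_A])
      show "(\<Sum>c<rdim \<phi>. munit \<phi> c c) \<in> A" by (intro sum_A munit_A)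
      fix \<psi> k l assume ps: "\<psi> \<in> Irr" "k < rdim \<psi>" "l < rdim \<psi>"
      have "rrep \<psi> (\<Sum>c<rdim \<phi>. munit \<phi> c c) $$ (k,l) = (\<Sum>c<rdim \<phi>. rrep \<psi> (munit \<phi> c c) $$ (k,l))"
        by (rule rep_entry_sum'[OF Irr_is_rep[OF ps(1)] _ munit_A ps(2,3)]) simp
      also have "\<dots> = (\<Sum>c<rdim \<phi>. if c = k then (if \<psi> = \<phi> \<and> k = l then 1 else 0) else 0)"
        by (intro sum.cong refl) (auto simp: rrep_munit[OF ps])
      also have "\<dots> = rrep \<psi> (cidem \<phi>) $$ (k,l)" using ps by (auto simp: rrep_cidem[OF ps])
      finally show "rrep \<psi> (cidem \<phi>) $$ (k,l) = rrep \<psi> (\<Sum>c<rdim \<phi>. munit \<phi> c c) $$ (k,l)" by simp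
    qed
    have "\<rho> 1 $$ (0,0) = (\<Sum>\<phi>\<in>Irr. \<rho> (cidem \<phi>) $$ (0,0))"
      by (subst one_eq_sum_cidem, rule rep_entry_sum'[OF rep finite_Irr cidem_A d d])
    also have "\<dots> = (\<Sum>\<phi>\<in>Irr. \<Sum>c<rdim \<phi>. \<rho> (munit \<phi> c c) $$ (0,0))"
    proof (rule sum.cong[OF refl])
      fix \<phi> assume p: "\<phi> \<in> Irr"
      show "\<rho> (cidem \<phi>) $$ (0,0) = (\<Sum>c<rdim \<phi>. \<rho> (munit \<phi> c c) $$ (0,0))"
        unfolding c1[OF p] by (rule rep_entry_sum'[OF rep _ munit_A d d]) simp
    qed
    also have "\<dots> = 0" using z by (intro sum.neutral ballI) simp
    finally show False using rep_one[OF rep] d by simp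
  qed
  then obtain \<phi> k0 j0 where I: "\<phi> \<in> Irr" and kj: "k0 < d" "j0 < d" and nz: "\<rho> (munit \<phi> 0 0) $$ (k0,j0) \<noteq> 0" by blast
  define n where "n = rdim \<phi>"
  have n0: "n > 0" unfolding n_def by (rule Irr_pos[OF I])
  define e where "e = \<rho> (munit \<phi> 0 0) $$ (k0,j0)"
  define \<iota> where "\<iota> = mat d n (\<lambda>(i,c). \<rho> (munit \<phi> c 0) $$ (i,j0) / e)"
  define \<kappa> where "\<kappa> = mat n d (\<lambda>(c,j). \<rho> (munit \<phi> 0 c) $$ (k0,j))"
  have ci: "\<iota> \<in> carrier_mat d n" and ck: "\<kappa> \<in> carrier_mat n d" unfolding \<iota>_def \<kappa>_def by simp_all
  have sc: "rrep \<phi> a \<in> carrier_mat n n" if "a \<in> A" for a unfolding n_def by (rule rep_carrier[OF Irr_is_rep[OF I] that])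
  have ki: "\<kappa> * \<iota> = 1\<^sub>m n"
  proof (rule eq_matI)
    fix c c' assume "c < dim_row (1\<^sub>m n :: 'k mat)" "c' < dim_col (1\<^sub>m n :: 'k mat)"
    then have c: "c < n" "c' < n" by simp_all
    have mm: "munit \<phi> 0 c * munit \<phi> c' 0 = (if c = c' then munit \<phi> 0 0 else 0)"
    proof (rule ss_eqI)
      show "munit \<phi> 0 c * munit \<phi> c' 0 \<in> A" by (rule mult_A[OF munit_A munit_A])
      show "(if c = c' then munit \<phi> 0 0 else 0) \<in> A" using munit_A zero_A by simp
      fix \<psi> k l assume ps: "\<psi> \<in> Irr" "k < rdim \<psi>" "l < rdim \<psi>"
      show "rrep \<psi> (munit \<phi> 0 c * munit \<phi> c' 0) $$ (k,l) = rrep \<psi> (if c = c' then munit \<phi> 0 0 else 0) $$ (k,l)"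
        using c ps I rep_entry_zero[OF Irr_is_rep[OF ps(1)] ps(2,3)] n0
        unfolding rrep_munit_left[OF munit_A ps c(1)[unfolded n_def]]
        by (cases "\<psi> = \<phi>") (auto simp: rrep_munit n_def)
    qed
    have "(\<kappa> * \<iota>) $$ (c,c') = (\<Sum>i<d. \<rho> (munit \<phi> 0 c) $$ (k0,i) * \<rho> (munit \<phi> c' 0) $$ (i,j0) / e)"
      using mult_mat_index[OF ck ci c] c unfolding \<iota>_def \<kappa>_def by simp
    also have "\<dots> = \<rho> (munit \<phi> 0 c * munit \<phi> c' 0) $$ (k0,j0) / e"
      unfolding rem[OF munit_A munit_A kj] sum_divide_distrib ..
    also have "\<dots> = (if c = c' then 1 else 0)" unfolding mm using nz rep_entry_zero[OF rep kj] unfolding e_def by simp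
    finally show "(\<kappa> * \<iota>) $$ (c,c') = 1\<^sub>m n $$ (c,c')" using c by simp
  qed (use ck ci in auto)
  have mcol: "a * munit \<phi> c 0 = (\<Sum>c'<n. sc (rrep \<phi> a $$ (c',c)) (munit \<phi> c' 0))" if a: "a \<in> A" and c: "c < n" for a c
  proof (rule ss_eqI[OF mult_A[OF a munit_A]])
    show "(\<Sum>c'<n. sc (rrep \<phi> a $$ (c',c)) (munit \<phi> c' 0)) \<in> A" by (intro sum_A scale_A munit_A)
    fix \<psi> k l assume ps: "\<psi> \<in> Irr" "k < rdim \<psi>" "l < rdim \<psi>"
    have "rrep \<psi> (\<Sum>c'<n. sc (rrep \<phi> a $$ (c',c)) (munit \<phi> c' 0)) $$ (k,l) = (\<Sum>c'<n. rrep \<phi> a $$ (c',c) * rrep \<psi> (munit \<phi> c' 0) $$ (k,l))"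
      by (rule rep_entry_sum[OF Irr_is_rep[OF ps(1)] _ munit_A ps(2,3)]) simp
    also have "\<dots> = (\<Sum>c'<n. if c' = k then (if \<psi> = \<phi> \<and> l = 0 then rrep \<phi> a $$ (k,c) else 0) else 0)"
      by (intro sum.cong refl) (auto simp: rrep_munit[OF ps])
    also have "\<dots> = rrep \<psi> (a * munit \<phi> c 0) $$ (k,l)"
      unfolding rrep_munit_right[OF a ps c[unfolded n_def]] using ps unfolding n_def by (cases "\<psi> = \<phi>") auto
    finally show "rrep \<psi> (a * munit \<phi> c 0) $$ (k,l) = rrep \<psi> (\<Sum>c'<n. sc (rrep \<phi> a $$ (c',c)) (munit \<phi> c' 0)) $$ (k,l)" by simp
  qed
  have mrow: "munit \<phi> 0 c * a = (\<Sum>c'<n. sc (rrep \<phi> a $$ (c,c')) (munit \<phi> 0 c'))" if a: "a \<in> A" and c: "c < n" for a c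
  proof (rule ss_eqI[OF mult_A[OF munit_A a]])
    show "(\<Sum>c'<n. sc (rrep \<phi> a $$ (c,c')) (munit \<phi> 0 c')) \<in> A" by (intro sum_A scale_A munit_A)
    fix \<psi> k l assume ps: "\<psi> \<in> Irr" "k < rdim \<psi>" "l < rdim \<psi>"
    have "rrep \<psi> (\<Sum>c'<n. sc (rrep \<phi> a $$ (c,c')) (munit \<phi> 0 c')) $$ (k,l) = (\<Sum>c'<n. rrep \<phi> a $$ (c,c') * rrep \<psi> (munit \<phi> 0 c') $$ (k,l))"
      by (rule rep_entry_sum[OF Irr_is_rep[OF ps(1)] _ munit_A ps(2,3)]) simp
    also have "\<dots> = (\<Sum>c'<n. if c' = l then (if \<psi> = \<phi> \<and> k = 0 then rrep \<phi> a $$ (c,l) else 0) else 0)"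
      by (intro sum.cong refl) (auto simp: rrep_munit[OF ps])
    also have "\<dots> = rrep \<psi> (munit \<phi> 0 c * a) $$ (k,l)"
      unfolding rrep_munit_left[OF a ps c[unfolded n_def]] using ps unfolding n_def by (cases "\<psi> = \<phi>") auto
    finally show "rrep \<psi> (munit \<phi> 0 c * a) $$ (k,l) = rrep \<psi> (\<Sum>c'<n. sc (rrep \<phi> a $$ (c,c')) (munit \<phi> 0 c')) $$ (k,l)" by simp
  qed
  have ai: "\<rho> a * \<iota> = \<iota> * rrep \<phi> a" if a: "a \<in> A" for a
  proof (rule eq_matI)
    fix i c assume "i < dim_row (\<iota> * rrep \<phi> a)" "c < dim_col (\<iota> * rrep \<phi> a)"
    then have ic: "i < d" "c < n" using ci sc[OF a] by simp_all
    have "(\<rho> a * \<iota>) $$ (i,c) = (\<Sum>k<d. \<rho> a $$ (i,k) * \<rho> (munit \<phi> c 0) $$ (k,j0) / e)"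
      using mult_mat_index[OF rc[OF a] ci ic] ic unfolding \<iota>_def by simp
    also have "\<dots> = \<rho> (a * munit \<phi> c 0) $$ (i,j0) / e"
      unfolding rem[OF a munit_A ic(1) kj(2)] sum_divide_distrib ..
    also have "\<rho> (a * munit \<phi> c 0) $$ (i,j0) = (\<Sum>c'<n. rrep \<phi> a $$ (c',c) * \<rho> (munit \<phi> c' 0) $$ (i,j0))"
      unfolding mcol[OF a ic(2)] by (rule rep_entry_sum[OF rep _ munit_A ic(1) kj(2)]) simp
    also have "\<dots> / e = (\<iota> * rrep \<phi> a) $$ (i,c)"
      using mult_mat_index[OF ci sc[OF a] ic] ic unfolding \<iota>_def by (simp add: sum_divide_distrib mult.commute)
    finally show "(\<rho> a * \<iota>) $$ (i,c) = (\<iota> * rrep \<phi> a) $$ (i,c)" .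
  qed (use rc[OF a] ci sc[OF a] in auto)
  have ka: "\<kappa> * \<rho> a = rrep \<phi> a * \<kappa>" if a: "a \<in> A" for a
  proof (rule eq_matI)
    fix c j assume "c < dim_row (rrep \<phi> a * \<kappa>)" "j < dim_col (rrep \<phi> a * \<kappa>)"
    then have cj: "c < n" "j < d" using ck sc[OF a] by simp_all
    have "(\<kappa> * \<rho> a) $$ (c,j) = (\<Sum>k<d. \<rho> (munit \<phi> 0 c) $$ (k0,k) * \<rho> a $$ (k,j))"
      using mult_mat_index[OF ck rc[OF a] cj] cj unfolding \<kappa>_def by simp
    also have "\<dots> = \<rho> (munit \<phi> 0 c * a) $$ (k0,j)" by (rule rem[OF munit_A a kj(1) cj(2), symmetric])
    also have "\<dots> = (\<Sum>c'<n. rrep \<phi> a $$ (c,c') * \<rho> (munit \<phi> 0 c') $$ (k0,j))"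
      unfolding mrow[OF a cj(1)] by (rule rep_entry_sum[OF rep _ munit_A kj(1) cj(2)]) simp
    also have "\<dots> = (rrep \<phi> a * \<kappa>) $$ (c,j)"
      using mult_mat_index[OF sc[OF a] ck cj] cj unfolding \<kappa>_def by simp
    finally show "(\<kappa> * \<rho> a) $$ (c,j) = (rrep \<phi> a * \<kappa>) $$ (c,j)" .
  qed (use rc[OF a] ck sc[OF a] in auto)
  define F where "F = 1\<^sub>m d - \<iota> * \<kappa>"
  have cE: "\<iota> * \<kappa> \<in> carrier_mat d d" using ci ck by simp
  have cF: "F \<in> carrier_mat d d" unfolding F_def by (rule minus_carrier_mat[OF cE])
  have EE: "(\<iota> * \<kappa>) * \<iota> = \<iota>" "\<kappa> * (\<iota> * \<kappa>) = \<kappa>"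
    using ki ci ck by (simp_all add: assoc_mult_mat[OF ci ck ci] assoc_mult_mat[OF ck ci ck, symmetric])
  have Fi: "F * \<iota> = 0\<^sub>m d n"
    unfolding F_def using EE ci cE minus_mult_distrib_mat[OF one_carrier_mat cE ci] by simp
  have kF: "\<kappa> * F = 0\<^sub>m n d"
    unfolding F_def using EE ck cE mult_minus_distrib_mat[OF ck one_carrier_mat cE] by simp
  have FF: "F * F = F"
  proof -
    have "F * F = F * 1\<^sub>m d - F * (\<iota> * \<kappa>)" by (subst (2) F_def) (rule mult_minus_distrib_mat[OF cF one_carrier_mat cE])
    also have "F * (\<iota> * \<kappa>) = 0\<^sub>m d d" using assoc_mult_mat[OF cF ci ck] Fi ck by simp
    also have "F * 1\<^sub>m d - 0\<^sub>m d d = F" using cF by (intro eq_matI) auto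
    finally show ?thesis .
  qed
  obtain r \<iota>' \<kappa>' where ci': "\<iota>' \<in> carrier_mat d r" and ck': "\<kappa>' \<in> carrier_mat r d" and ik': "\<iota>' * \<kappa>' = F" and ki': "\<kappa>' * \<iota>' = 1\<^sub>m r"
    by (rule idempotent_factor[OF cF FF])
  have Fi': "F * \<iota>' = \<iota>'" using assoc_mult_mat[OF ci' ck' ci'] ik' ki' ci' by simp
  have k'F: "\<kappa>' * F = \<kappa>'" using assoc_mult_mat[OF ck' ci' ck'] ik' ki' ck' by simp
  have ki'0: "\<kappa> * \<iota>' = 0\<^sub>m n r"
    using assoc_mult_mat[OF ck cF ci'] Fi' kF ci' by simp
  have k'i0: "\<kappa>' * \<iota> = 0\<^sub>m r n"
    using assoc_mult_mat[OF ck' cF ci] k'F Fi ck' by simp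
  define \<rho>2 where "\<rho>2 a = \<kappa>' * (\<rho> a * \<iota>')" for a
  have aF: "\<rho> a * F = F * \<rho> a" if a: "a \<in> A" for a
  proof -
    have "\<rho> a * (\<iota> * \<kappa>) = (\<iota> * rrep \<phi> a) * \<kappa>" using assoc_mult_mat[OF rc[OF a] ci ck] ai[OF a] by simp
    also have "\<dots> = \<iota> * (\<kappa> * \<rho> a)" using assoc_mult_mat[OF ci sc[OF a] ck] ka[OF a] by simp
    also have "\<dots> = (\<iota> * \<kappa>) * \<rho> a" using assoc_mult_mat[OF ci ck rc[OF a]] by simp
    finally have c: "\<rho> a * (\<iota> * \<kappa>) = (\<iota> * \<kappa>) * \<rho> a" .
    have "\<rho> a * F = \<rho> a * 1\<^sub>m d - \<rho> a * (\<iota> * \<kappa>)" unfolding F_def by (rule mult_minus_distrib_mat[OF rc[OF a] one_carrier_mat cE])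
    moreover have "F * \<rho> a = 1\<^sub>m d * \<rho> a - (\<iota> * \<kappa>) * \<rho> a" unfolding F_def by (rule minus_mult_distrib_mat[OF one_carrier_mat cE rc[OF a]])
    ultimately show ?thesis using c rc[OF a] by simp
  qed
  have c2: "\<rho>2 a \<in> carrier_mat r r" if "a \<in> A" for a unfolding \<rho>2_def using rc[OF that] ci' ck' by simp
  have ai': "\<rho> a * \<iota>' = \<iota>' * \<rho>2 a" if a: "a \<in> A" for a
  proof -
    have cai: "\<rho> a * \<iota>' \<in> carrier_mat d r" using rc[OF a] ci' by simp
    have "\<rho> a * \<iota>' = \<rho> a * (F * \<iota>')" using Fi' by simp
    also have "\<dots> = (\<rho> a * F) * \<iota>'" using assoc_mult_mat[OF rc[OF a] cF ci'] by simp
    also have "\<dots> = F * (\<rho> a * \<iota>')" unfolding aF[OF a] by (rule assoc_mult_mat[OF cF rc[OF a] ci'])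
    also have "\<dots> = \<iota>' * \<rho>2 a" unfolding \<rho>2_def ik'[symmetric] by (rule assoc_mult_mat[OF ci' ck' cai])
    finally show ?thesis .
  qed
  have rep2: "is_rep sc A r \<rho>2" unfolding is_rep_def
  proof (intro conjI ballI allI)
    show "\<rho>2 a \<in> carrier_mat r r" if "a \<in> A" for a by (rule c2[OF that])
    show "\<rho>2 1 = 1\<^sub>m r" unfolding \<rho>2_def rep_one[OF rep] using ci' ki' by simp
    fix a assume a: "a \<in> A"
    have cai: "\<rho> a * \<iota>' \<in> carrier_mat d r" using rc[OF a] ci' by simp
    show "\<rho>2 (sc c a) = c \<cdot>\<^sub>m \<rho>2 a" for c
      unfolding \<rho>2_def rep_scale[OF rep a] mult_smult_assoc_mat[OF rc[OF a] ci'] mult_smult_distrib[OF ck' cai] ..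
    fix b assume b: "b \<in> A"
    have cbi: "\<rho> b * \<iota>' \<in> carrier_mat d r" using rc[OF b] ci' by simp
    show "\<rho>2 (a + b) = \<rho>2 a + \<rho>2 b"
      unfolding \<rho>2_def rep_add[OF rep a b] add_mult_distrib_mat[OF rc[OF a] rc[OF b] ci'] mult_add_distrib_mat[OF ck' cai cbi] ..
    have "\<rho>2 (a * b) = \<kappa>' * (\<rho> a * (\<rho> b * \<iota>'))"
      unfolding \<rho>2_def rep_mult[OF rep a b] using assoc_mult_mat[OF rc[OF a] rc[OF b] ci'] by simp
    also have "\<dots> = \<kappa>' * ((\<rho> a * \<iota>') * \<rho>2 b)" unfolding ai'[OF b] using assoc_mult_mat[OF rc[OF a] ci' c2[OF b]] by simp
    also have "\<dots> = \<rho>2 a * \<rho>2 b" unfolding \<rho>2_def[of a] using assoc_mult_mat[OF ck' cai c2[OF b]] by simp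
    finally show "\<rho>2 (a * b) = \<rho>2 a * \<rho>2 b" .
  qed
  let ?P = "four_block_mat \<iota> \<iota>' (0\<^sub>m 0 n) (0\<^sub>m 0 r)" and ?Q = "four_block_mat \<kappa> (0\<^sub>m n 0) \<kappa>' (0\<^sub>m r 0)"
  have PQ: "?P * ?Q = 1\<^sub>m d"
  proof -
    have "X + (1\<^sub>m d - X) = 1\<^sub>m d" if "X \<in> carrier_mat d d" for X :: "'k mat"
      using that by (intro eq_matI) auto
    from this[OF cE] have "\<iota> * \<kappa> + F = 1\<^sub>m d" unfolding F_def .
    then have "?P * ?Q = four_block_mat (1\<^sub>m d) (0\<^sub>m d 0) (0\<^sub>m 0 d) (0\<^sub>m 0 0)"
      using mult_four_block_mat[OF ci ci' zero_carrier_mat[of 0 n] zero_carrier_mat[of 0 r] ck zero_carrier_mat[of n 0] ck' zero_carrier_mat[of r 0]]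
        ci ci' ck ck' ik' by simp
    also have "\<dots> = 1\<^sub>m d" by (rule eq_matI) auto
    finally show ?thesis .
  qed
  have QP: "?Q * ?P = 1\<^sub>m (n + r)"
    using mult_four_block_mat[OF ck zero_carrier_mat[of n 0] ck' zero_carrier_mat[of r 0] ci ci' zero_carrier_mat[of 0 n] zero_carrier_mat[of 0 r]]
      ki ki' ki'0 k'i0 by (simp add: four_block_one_mat)
  have cP: "?P \<in> carrier_mat d (n + r)" using ci ci' by (intro carrier_matI) auto
  have cQ: "?Q \<in> carrier_mat (n + r) d" using ck ck' by (intro carrier_matI) auto
  have "(of_nat d :: 'k) = of_nat (n + r)"
    using mat_trace_comm[OF cP cQ] unfolding PQ QP mat_trace_one .
  then have dn: "d = n + r" by (simp only: of_nat_eq_iff)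
  have sim: "similar_mat_wit (\<rho> a) (four_block_mat (rrep \<phi> a) (0\<^sub>m n r) (0\<^sub>m r n) (\<rho>2 a)) ?P ?Q" if a: "a \<in> A" for a
  proof -
    let ?B = "four_block_mat (rrep \<phi> a) (0\<^sub>m n r) (0\<^sub>m r n) (\<rho>2 a)"
    have cB: "?B \<in> carrier_mat (n + r) (n + r)" using sc[OF a] c2[OF a] by simp
    have re: "\<rho> a = four_block_mat (\<rho> a) (0\<^sub>m d 0) (0\<^sub>m 0 d) (0\<^sub>m 0 0)" using rc[OF a] by (intro eq_matI) auto
    have "four_block_mat (\<rho> a) (0\<^sub>m d 0) (0\<^sub>m 0 d) (0\<^sub>m 0 0) * ?P = four_block_mat (\<rho> a * \<iota>) (\<rho> a * \<iota>') (0\<^sub>m 0 n) (0\<^sub>m 0 r)"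
      using mult_four_block_mat[OF rc[OF a] zero_carrier_mat[of d 0] zero_carrier_mat[of 0 d] zero_carrier_mat[of 0 0] ci ci' zero_carrier_mat[of 0 n] zero_carrier_mat[of 0 r]]
        rc[OF a] ci ci' by simp
    moreover have "?P * ?B = four_block_mat (\<iota> * rrep \<phi> a) (\<iota>' * \<rho>2 a) (0\<^sub>m 0 n) (0\<^sub>m 0 r)"
      using mult_four_block_mat[OF ci ci' zero_carrier_mat[of 0 n] zero_carrier_mat[of 0 r] sc[OF a] zero_carrier_mat[of n r] zero_carrier_mat[of r n] c2[OF a]]
        ci ci' sc[OF a] c2[OF a] by simp
    ultimately have eq: "\<rho> a * ?P = ?P * ?B" using re ai[OF a] ai'[OF a] by simp
    have "\<rho> a = \<rho> a * (?P * ?Q)" unfolding PQ using rc[OF a] by simp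
    also have "\<dots> = (\<rho> a * ?P) * ?Q" by (rule assoc_mult_mat[symmetric, OF rc[OF a] cP cQ])
    also have "\<dots> = ?P * ?B * ?Q" unfolding eq ..
    finally have id: "\<rho> a = ?P * ?B * ?Q" .
    show ?thesis
      by (rule similar_mat_witI[of _ _ d]) (use PQ QP id rc[OF a] cB cP cQ dn in simp_all)
  qed
  show ?thesis
    by (rule that[OF I, of r \<rho>2 ?P ?Q, folded n_def]) (use dn n0 rep2 sim in auto)
qed

lemma decomposition_exists:
  assumes "is_rep sc A d \<rho>"
  shows "\<exists>rs. decomposition sc A \<rho> rs"
  using assms
proof (induction d arbitrary: \<rho> rule: less_induct)
  case (less d)
  show ?case
  proof (cases "d = 0")
    case True
    have "similar_mat_wit (\<rho> a) (0\<^sub>m 0 0) (1\<^sub>m 0) (1\<^sub>m 0)" if "a \<in> A" for a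
    proof -
      have "\<rho> a = 0\<^sub>m 0 0" using rep_carrier[OF less.prems that] True by (intro eq_matI) auto
      then show ?thesis using similar_mat_wit_refl[of "0\<^sub>m 0 0 :: 'k mat" 0] by simp
    qed
    then show ?thesis unfolding decomposition_def by (intro exI[of _ "[]"]) auto
  next
    case False
    then have d: "d > 0" by simp
    obtain \<phi> r P Q \<rho>2 where s: "\<phi> \<in> Irr" "r < d" "rdim \<phi> + r = d" "is_rep sc A r \<rho>2"
      "\<And>a. a \<in> A \<Longrightarrow> similar_mat_wit (\<rho> a) (four_block_mat (rrep \<phi> a) (0\<^sub>m (rdim \<phi>) r) (0\<^sub>m r (rdim \<phi>)) (\<rho>2 a)) P Q"
    proof (rule split_off[OF less.prems d], goal_cases)
      case (1 \<phi> r P Q \<rho>2)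
      show ?case by (rule 1(1)[OF 1(2-)])
    qed
    obtain rs where "decomposition sc A \<rho>2 rs" using less.IH[OF s(2,4)] ..
    then have irs: "\<forall>(e,\<sigma>)\<in>set rs. irreducible_rep sc A e \<sigma>"
      and "\<exists>P Q. \<forall>a\<in>A. similar_mat_wit (\<rho>2 a) (diag_block_mat (map (\<lambda>(e, \<sigma>). \<sigma> a) rs)) P Q"
      unfolding decomposition_def by blast+
    then obtain P2 Q2 where w: "\<forall>a\<in>A. similar_mat_wit (\<rho>2 a) (diag_block_mat (map (\<lambda>(e, \<sigma>). \<sigma> a) rs)) P2 Q2" by blast
    let ?n = "rdim \<phi>"
    let ?P = "P * four_block_mat (1\<^sub>m ?n) (0\<^sub>m ?n r) (0\<^sub>m r ?n) P2" and ?Q = "four_block_mat (1\<^sub>m ?n) (0\<^sub>m ?n r) (0\<^sub>m r ?n) Q2 * Q"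
    have "similar_mat_wit (\<rho> a) (diag_block_mat (map (\<lambda>(e, \<sigma>). \<sigma> a) ((?n, rrep \<phi>) # rs))) ?P ?Q" if a: "a \<in> A" for a
    proof -
      let ?D = "diag_block_mat (map (\<lambda>(e, \<sigma>). \<sigma> a) rs)"
      have w1: "similar_mat_wit (\<rho>2 a) ?D P2 Q2" using w a by blast
      have ca: "rrep \<phi> a \<in> carrier_mat ?n ?n" by (rule rep_carrier[OF Irr_is_rep[OF s(1)] a])
      have c2: "\<rho>2 a \<in> carrier_mat r r" by (rule rep_carrier[OF s(4) a])
      note wD = similar_mat_witD2[OF c2 w1]
      have cD: "?D \<in> carrier_mat r r" by (rule wD(5))
      have z1: "0\<^sub>m ?n r = 1\<^sub>m ?n * 0\<^sub>m ?n r * Q2" "0\<^sub>m r ?n = P2 * 0\<^sub>m r ?n * 1\<^sub>m ?n"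
        using wD(6,7) by simp_all
      have "similar_mat_wit (four_block_mat (rrep \<phi> a) (0\<^sub>m ?n r) (0\<^sub>m r ?n) (\<rho>2 a))
          (four_block_mat (rrep \<phi> a) (0\<^sub>m ?n r) (0\<^sub>m r ?n) ?D)
          (four_block_mat (1\<^sub>m ?n) (0\<^sub>m ?n r) (0\<^sub>m r ?n) P2) (four_block_mat (1\<^sub>m ?n) (0\<^sub>m ?n r) (0\<^sub>m r ?n) Q2)"
        by (rule similar_mat_wit_four_block[OF similar_mat_wit_refl[OF ca] w1 z1 ca c2 zero_carrier_mat zero_carrier_mat])
      from similar_mat_wit_trans[OF s(5)[OF a] this]
      have "similar_mat_wit (\<rho> a) (four_block_mat (rrep \<phi> a) (0\<^sub>m ?n r) (0\<^sub>m r ?n) ?D) ?P ?Q" .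
      moreover have "diag_block_mat (map (\<lambda>(e, \<sigma>). \<sigma> a) ((?n, rrep \<phi>) # rs)) = four_block_mat (rrep \<phi> a) (0\<^sub>m ?n r) (0\<^sub>m r ?n) ?D"
        using carrier_matD[OF ca] carrier_matD[OF cD] by (simp add: Let_def)
      ultimately show ?thesis by simp
    qed
    then have "\<exists>P Q. \<forall>a\<in>A. similar_mat_wit (\<rho> a) (diag_block_mat (map (\<lambda>(e, \<sigma>). \<sigma> a) ((?n, rrep \<phi>) # rs))) P Q" by blast
    moreover have "\<forall>(e,\<sigma>)\<in>set ((?n, rrep \<phi>) # rs). irreducible_rep sc A e \<sigma>" using irs Irr_rep(1)[OF s(1)] by simp
    ultimately show ?thesis unfolding decomposition_def by blast
  qed
qed

lemma decomposition_count:
  assumes rep: "is_rep sc A d \<rho>" and dec: "decomposition sc A \<rho> rs"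
    and t: "t \<in> A" "\<And>\<psi>. \<psi> \<in> Irr \<Longrightarrow> \<psi> t = (if \<psi> = \<phi> then 1 else 0)"
  shows "character A \<rho> t = of_nat (length (filter (\<lambda>(e, \<sigma>). character A \<sigma> = \<phi>) rs))"
proof -
  obtain P Q where w: "\<forall>a\<in>A. similar_mat_wit (\<rho> a) (diag_block_mat (map (\<lambda>(e, \<sigma>). \<sigma> a) rs)) P Q"
    and irs: "\<forall>(e,\<sigma>)\<in>set rs. irreducible_rep sc A e \<sigma>" using dec unfolding decomposition_def by blast
  have sq: "dim_row M = dim_col M" if M: "M \<in> set (map (\<lambda>(e, \<sigma>). \<sigma> t) rs)" for M
  proof -
    obtain e \<sigma> where es: "(e,\<sigma>) \<in> set rs" "M = \<sigma> t" using M by auto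
    have "irreducible_rep sc A e \<sigma>" using irs es(1) by blast
    from rep_carrier[OF irred_rep[OF this] t(1)] show ?thesis unfolding es(2) by simp
  qed
  have "character A \<rho> t = mat_trace (diag_block_mat (map (\<lambda>(e, \<sigma>). \<sigma> t) rs))"
    using mat_trace_similar[OF bspec[OF w t(1)]] t(1) unfolding character_def by simp
  also have "\<dots> = (\<Sum>M\<leftarrow>map (\<lambda>(e, \<sigma>). \<sigma> t) rs. mat_trace M)" by (rule mat_trace_diag_block[OF sq])
  also have "\<dots> = of_nat (length (filter (\<lambda>(e, \<sigma>). character A \<sigma> = \<phi>) rs))"
    using irs
  proof (induction rs)
    case (Cons p rs)
    obtain e \<sigma> where p: "p = (e,\<sigma>)" by (cases p)
    have "character A \<sigma> \<in> Irr" using Cons.prems p IrrI by auto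
    then have "mat_trace (\<sigma> t) = (if character A \<sigma> = \<phi> then 1 else 0)"
      using t unfolding character_def by force
    then show ?case using Cons p by simp
  qed simp
  finally show ?thesis .
qed

lemma mult_in_eq:
  assumes rep: "is_rep sc A d \<rho>" "character A \<rho> = \<chi>"
    and t: "t \<in> A" "\<And>\<psi>. \<psi> \<in> Irr \<Longrightarrow> \<psi> t = (if \<psi> = \<phi> then 1 else 0)"
  shows "of_nat (mult_in sc A \<phi> \<chi>) = \<chi> t"
proof -
  obtain rs where rs: "decomposition sc A \<rho> rs" using decomposition_exists[OF rep(1)] ..
  let ?m = "length (filter (\<lambda>(e, \<sigma>). character A \<sigma> = \<phi>) rs)"
  have m: "\<chi> t = of_nat ?m" using decomposition_count[OF rep(1) rs t] rep(2) by simp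
  have "mult_in sc A \<phi> \<chi> = ?m" unfolding mult_in_def
  proof (rule the_equality)
    show "\<exists>d \<rho> rs. is_rep sc A d \<rho> \<and> character A \<rho> = \<chi> \<and> decomposition sc A \<rho> rs \<and> ?m = length (filter (\<lambda>(e, \<sigma>). character A \<sigma> = \<phi>) rs)"
      using rep rs by blast
    fix m assume "\<exists>d \<rho> rs. is_rep sc A d \<rho> \<and> character A \<rho> = \<chi> \<and> decomposition sc A \<rho> rs \<and> m = length (filter (\<lambda>(e, \<sigma>). character A \<sigma> = \<phi>) rs)"
    then obtain d' \<rho>' rs' where h: "is_rep sc A d' \<rho>'" "character A \<rho>' = \<chi>" "decomposition sc A \<rho>' rs'"
      "m = length (filter (\<lambda>(e, \<sigma>). character A \<sigma> = \<phi>) rs')" by blast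
    have "(of_nat m :: 'k) = of_nat ?m" using decomposition_count[OF h(1,3) t] h(2,4) m by simp
    then show "m = ?m" by (simp only: of_nat_eq_iff)
  qed
  then show ?thesis using m by simp
qed

end


section \<open>Sweedler calculus\<close>

context vspace
begin

definition lin_ext :: "('i \<Rightarrow> 'b) \<Rightarrow> ('i \<Rightarrow>\<^sub>0 'a) \<Rightarrow> 'b" where
  "lin_ext F f = (\<Sum>w\<in>Poly_Mapping.keys f. scale (Poly_Mapping.lookup f w) (F w))"

lemma lin_ext_superset:
  assumes "finite K" "Poly_Mapping.keys f \<subseteq> K"
  shows "lin_ext F f = (\<Sum>w\<in>K. scale (Poly_Mapping.lookup f w) (F w))"
  unfolding lin_ext_def by (rule sum.mono_neutral_left[OF assms]) (simp add: in_keys_iff)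

lemma lin_ext_add: "lin_ext F (f + g) = lin_ext F f + lin_ext F g"
proof -
  let ?K = "Poly_Mapping.keys f \<union> Poly_Mapping.keys g"
  have "lin_ext F (f + g) = (\<Sum>w\<in>?K. scale (Poly_Mapping.lookup (f + g) w) (F w))"
    by (rule lin_ext_superset) (simp_all add: Poly_Mapping.keys_add)
  moreover have "lin_ext F f = (\<Sum>w\<in>?K. scale (Poly_Mapping.lookup f w) (F w))" by (rule lin_ext_superset) simp_all
  moreover have "lin_ext F g = (\<Sum>w\<in>?K. scale (Poly_Mapping.lookup g w) (F w))" by (rule lin_ext_superset) simp_all
  ultimately show ?thesis by (simp add: lookup_add scale_left_distrib sum.distrib)
qed

lemma lin_ext_scale: "lin_ext F (free_scale c f) = scale c (lin_ext F f)"
proof -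
  have "Poly_Mapping.keys (free_scale c f) \<subseteq> Poly_Mapping.keys f"
    by (auto simp: in_keys_iff lookup_free_scale)
  then have "lin_ext F (free_scale c f) = (\<Sum>w\<in>Poly_Mapping.keys f. scale (Poly_Mapping.lookup (free_scale c f) w) (F w))"
    by (intro lin_ext_superset) simp_all
  then show ?thesis by (simp add: lookup_free_scale lin_ext_def scale_sum_right)
qed

lemma lin_ext_single: "lin_ext F (Poly_Mapping.single w c) = scale c (F w)"
  unfolding lin_ext_def by (cases "c = 0") simp_all

lemma lin_ext_zero: "lin_ext F 0 = 0" unfolding lin_ext_def by simp

lemma lin_ext_diff: "lin_ext F (f - g) = lin_ext F f - lin_ext F g"
  using lin_ext_add[of F "f - g" g] by (simp add: algebra_simps)

lemma lin_ext_sum_list: "lin_ext F (\<Sum>x\<leftarrow>xs. f x) = (\<Sum>x\<leftarrow>xs. lin_ext F (f x))"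
  by (induction xs) (simp_all add: lin_ext_zero lin_ext_add)

lemma lin_ext_span:
  assumes "\<And>g. g \<in> G \<Longrightarrow> lin_ext F g = 0" "f \<in> module.span free_scale G"
  shows "lin_ext F f = 0"
proof -
  interpret fs: vector_space "free_scale :: 'a \<Rightarrow> ('c \<Rightarrow>\<^sub>0 'a) \<Rightarrow> ('c \<Rightarrow>\<^sub>0 'a)" by (rule vector_space_free_scale)
  have "fs.subspace {f. lin_ext F f = 0}"
    unfolding fs.subspace_def by (simp add: lin_ext_zero lin_ext_add lin_ext_scale)
  moreover have "G \<subseteq> {f. lin_ext F f = 0}" using assms(1) by blast
  ultimately show ?thesis using assms(2) fs.span_minimal by blast
qed

end

definition bilin :: "('k::field \<Rightarrow> 'h \<Rightarrow> 'h) \<Rightarrow> ('k \<Rightarrow> 'v \<Rightarrow> 'v) \<Rightarrow> ('h::ab_group_add \<Rightarrow> 'h \<Rightarrow> 'v::ab_group_add) \<Rightarrow> bool" where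
  "bilin s sv \<beta> \<longleftrightarrow> (\<forall>x y z. \<beta> (x + y) z = \<beta> x z + \<beta> y z) \<and> (\<forall>x y z. \<beta> z (x + y) = \<beta> z x + \<beta> z y)
     \<and> (\<forall>c x y. \<beta> (s c x) y = sv c (\<beta> x y)) \<and> (\<forall>c x y. \<beta> x (s c y) = sv c (\<beta> x y))"

definition trilin :: "('k::field \<Rightarrow> 'h \<Rightarrow> 'h) \<Rightarrow> ('k \<Rightarrow> 'v \<Rightarrow> 'v) \<Rightarrow> ('h::ab_group_add \<Rightarrow> 'h \<Rightarrow> 'h \<Rightarrow> 'v::ab_group_add) \<Rightarrow> bool" where
  "trilin s sv \<tau> \<longleftrightarrow> (\<forall>z. bilin s sv (\<lambda>x y. \<tau> x y z)) \<and> (\<forall>x. bilin s sv (\<tau> x))"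

definition cop :: "('h \<Rightarrow> ('h \<times> 'h) list) \<Rightarrow> ('h \<Rightarrow> 'h \<Rightarrow> 'v::ab_group_add) \<Rightarrow> 'h \<Rightarrow> 'v" where
  "cop \<Delta> \<beta> h = (\<Sum>(a, b)\<leftarrow>\<Delta> h. \<beta> a b)"

lemma cop_plus: "cop \<Delta> (\<lambda>a b. f a b + g a b) h = cop \<Delta> f h + cop \<Delta> g h"
  unfolding cop_def by (induction "\<Delta> h") (simp_all add: case_prod_unfold sum_list_addf)

lemma cop_additive:
  assumes "\<And>x y. L (x + y) = L x + L y"
  shows "L (cop \<Delta> \<beta> h) = cop \<Delta> (\<lambda>a b. L (\<beta> a b)) h"
proof -
  have z: "L 0 = 0" using assms[of 0 0] by simp
  have "L (\<Sum>(a, b)\<leftarrow>xs. \<beta> a b) = (\<Sum>(a, b)\<leftarrow>xs. L (\<beta> a b))" for xs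
    by (induction xs) (auto simp: z assms)
  then show ?thesis unfolding cop_def .
qed

lemma cop_swap: "cop \<Delta> (\<lambda>a b. cop \<Delta>' (\<lambda>c d. \<tau> a b c d) y) x = cop \<Delta>' (\<lambda>c d. cop \<Delta> (\<lambda>a b. \<tau> a b c d) x) y"
proof -
  have "(\<Sum>(a, b)\<leftarrow>xs. \<Sum>(c, d)\<leftarrow>ys. \<tau> a b c d) = (\<Sum>(c, d)\<leftarrow>ys. \<Sum>(a, b)\<leftarrow>xs. \<tau> a b c d)" for xs ys
  proof (induction xs)
    case Nil show ?case by (simp add: case_prod_unfold)
  next
    case (Cons p xs)
    then show ?case by (simp add: case_prod_unfold sum_list_addf)
  qed
  then show ?thesis unfolding cop_def .
qed

context unital_algebra
begin

lemma tensor_eq_bilin: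
  assumes sv: "vspace sv" and eq: "tensor_eq sc f g" and b: "bilin sc sv \<beta>"
  shows "vspace.lin_ext sv (\<lambda>w. if length w = 2 then \<beta> (w ! 0) (w ! 1) else 0) f
       = vspace.lin_ext sv (\<lambda>w. if length w = 2 then \<beta> (w ! 0) (w ! 1) else 0) g"
proof -
  interpret v: vspace sv by (rule sv)
  let ?F = "\<lambda>w. if length w = 2 then \<beta> (w ! 0) (w ! 1) else 0"
  note b' = b[unfolded bilin_def]
  have len: "(length us = 0 \<and> length vs = 1) \<or> (length us = 1 \<and> length vs = 0) \<or> length us + Suc (length vs) \<noteq> 2" for us vs :: "'b list"
    by arith
  have A: "?F (us @ (x + y) # vs) = ?F (us @ x # vs) + ?F (us @ y # vs)" for us vs x y
    using len[of us vs] b' by (auto simp: length_Suc_conv nth_append)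
  have S: "?F (us @ sc c x # vs) = sv c (?F (us @ x # vs))" for us vs x c
    using len[of us vs] b' by (auto simp: length_Suc_conv nth_append)
  have "v.lin_ext ?F (f - g) = 0"
  proof (rule v.lin_ext_span)
    show "f - g \<in> module.span free_scale
     ({Poly_Mapping.single (us @ (x + y) # vs) 1 - Poly_Mapping.single (us @ x # vs) 1
         - Poly_Mapping.single (us @ y # vs) 1 | us vs x y. True}
      \<union> {Poly_Mapping.single (us @ sc c x # vs) 1 - Poly_Mapping.single (us @ x # vs) c
         | us vs x c. True})"
      using eq unfolding tensor_eq_def tensor_null_def .
  qed (elim UnE CollectE exE conjE, simp_all only: v.lin_ext_diff v.lin_ext_single A S v.scale_one add_diff_cancel_left' diff_self)
  then show ?thesis unfolding v.lin_ext_diff by simp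
qed

lemma tensor_eq_trilin:
  assumes sv: "vspace sv" and eq: "tensor_eq sc f g" and b: "trilin sc sv \<tau>"
  shows "vspace.lin_ext sv (\<lambda>w. if length w = 3 then \<tau> (w ! 0) (w ! 1) (w ! 2) else 0) f
       = vspace.lin_ext sv (\<lambda>w. if length w = 3 then \<tau> (w ! 0) (w ! 1) (w ! 2) else 0) g"
proof -
  interpret v: vspace sv by (rule sv)
  let ?F = "\<lambda>w. if length w = 3 then \<tau> (w ! 0) (w ! 1) (w ! 2) else 0"
  note b' = b[unfolded trilin_def bilin_def]
  have len: "(length us = 0 \<and> length vs = 2) \<or> (length us = 1 \<and> length vs = 1) \<or> (length us = 2 \<and> length vs = 0) \<or> length us + Suc (length vs) \<noteq> 3" for us vs :: "'b list"
    by arith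
  have A: "?F (us @ (x + y) # vs) = ?F (us @ x # vs) + ?F (us @ y # vs)" for us vs x y
    using len[of us vs] b' by (auto simp: length_Suc_conv numeral_2_eq_2 nth_append)
  have S: "?F (us @ sc c x # vs) = sv c (?F (us @ x # vs))" for us vs x c
    using len[of us vs] b' by (auto simp: length_Suc_conv numeral_2_eq_2 nth_append)
  have "v.lin_ext ?F (f - g) = 0"
  proof (rule v.lin_ext_span)
    show "f - g \<in> module.span free_scale
     ({Poly_Mapping.single (us @ (x + y) # vs) 1 - Poly_Mapping.single (us @ x # vs) 1
         - Poly_Mapping.single (us @ y # vs) 1 | us vs x y. True}
      \<union> {Poly_Mapping.single (us @ sc c x # vs) 1 - Poly_Mapping.single (us @ x # vs) c
         | us vs x c. True})"
      using eq unfolding tensor_eq_def tensor_null_def .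
  qed (elim UnE CollectE exE conjE, simp_all only: v.lin_ext_diff v.lin_ext_single A S v.scale_one add_diff_cancel_left' diff_self)
  then show ?thesis unfolding v.lin_ext_diff by simp
qed

end

lemma (in vspace) lin_ext_tensor_sum:
  "lin_ext (\<lambda>w. if length w = 2 then \<beta> (w ! 0) (w ! 1) else 0) (tensor_sum xs) = (\<Sum>(a, b)\<leftarrow>xs. \<beta> a b)"
  unfolding tensor_sum_def lin_ext_sum_list
  by (intro arg_cong[where f=sum_list] map_cong refl) (auto simp: lin_ext_single)

context hopf_algebra
begin

lemma cop_add: assumes "vspace sv" "bilin sc sv \<beta>" shows "cop \<Delta> \<beta> (x + y) = cop \<Delta> \<beta> x + cop \<Delta> \<beta> y"
proof -
  interpret v: vspace sv by fact
  from tensor_eq_bilin[OF assms(1) comult_add assms(2)] show ?thesis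
    unfolding v.lin_ext_add v.lin_ext_tensor_sum cop_def .
qed

lemma cop_scale: assumes "vspace sv" "bilin sc sv \<beta>" shows "cop \<Delta> \<beta> (sc c x) = sv c (cop \<Delta> \<beta> x)"
proof -
  interpret v: vspace sv by fact
  from tensor_eq_bilin[OF assms(1) comult_scale assms(2)] show ?thesis
    unfolding v.lin_ext_scale v.lin_ext_tensor_sum cop_def .
qed

lemma cop_one: assumes "vspace sv" "bilin sc sv \<beta>" shows "cop \<Delta> \<beta> 1 = \<beta> 1 1"
proof -
  interpret v: vspace sv by fact
  from tensor_eq_bilin[OF assms(1) comult_one assms(2)] show ?thesis
    unfolding v.lin_ext_single v.lin_ext_tensor_sum cop_def by simp
qed

lemma cop_mult: assumes "vspace sv" "bilin sc sv \<beta>"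
  shows "cop \<Delta> \<beta> (x * y) = cop \<Delta> (\<lambda>a b. cop \<Delta> (\<lambda>c d. \<beta> (a * c) (b * d)) y) x"
proof -
  interpret v: vspace sv by fact
  let ?F = "\<lambda>w. if length w = 2 then \<beta> (w ! 0) (w ! 1) else 0"
  have "v.lin_ext ?F (\<Sum>(a, b)\<leftarrow>\<Delta> x. \<Sum>(a', b')\<leftarrow>\<Delta> y. Poly_Mapping.single [a * a', b * b'] 1)
     = (\<Sum>(a, b)\<leftarrow>\<Delta> x. \<Sum>(a', b')\<leftarrow>\<Delta> y. \<beta> (a * a') (b * b'))"
    by (simp add: v.lin_ext_sum_list v.lin_ext_single case_prod_unfold)
  with tensor_eq_bilin[OF assms(1) comult_mult assms(2)] show ?thesis
    unfolding v.lin_ext_tensor_sum cop_def by simp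
qed

lemma cop_coassoc: assumes "vspace sv" "trilin sc sv \<tau>"
  shows "cop \<Delta> (\<lambda>a b. cop \<Delta> (\<lambda>c d. \<tau> c d b) a) x = cop \<Delta> (\<lambda>a b. cop \<Delta> (\<lambda>c d. \<tau> a c d) b) x"
proof -
  interpret v: vspace sv by fact
  let ?F = "\<lambda>w. if length w = 3 then \<tau> (w ! 0) (w ! 1) (w ! 2) else 0"
  have "v.lin_ext ?F (\<Sum>(a, b)\<leftarrow>\<Delta> x. \<Sum>(a1, a2)\<leftarrow>\<Delta> a. Poly_Mapping.single [a1, a2, b] 1)
     = (\<Sum>(a, b)\<leftarrow>\<Delta> x. \<Sum>(a1, a2)\<leftarrow>\<Delta> a. \<tau> a1 a2 b)"
    by (simp add: v.lin_ext_sum_list v.lin_ext_single case_prod_unfold)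
  moreover have "v.lin_ext ?F (\<Sum>(a, b)\<leftarrow>\<Delta> x. \<Sum>(b1, b2)\<leftarrow>\<Delta> b. Poly_Mapping.single [a, b1, b2] 1)
     = (\<Sum>(a, b)\<leftarrow>\<Delta> x. \<Sum>(b1, b2)\<leftarrow>\<Delta> b. \<tau> a b1 b2)"
    by (simp add: v.lin_ext_sum_list v.lin_ext_single case_prod_unfold)
  ultimately show ?thesis using tensor_eq_trilin[OF assms(1) coassoc assms(2)] unfolding cop_def by simp
qed

lemma cop_counit_left: "cop \<Delta> (\<lambda>a b. sc (\<epsilon> a) b) x = x" using counit_left[of x] unfolding cop_def .
lemma cop_counit_right: "cop \<Delta> (\<lambda>a b. sc (\<epsilon> b) a) x = x" using counit_right[of x] unfolding cop_def .
lemma cop_antipode_left: "cop \<Delta> (\<lambda>a b. S a * b) x = sc (\<epsilon> x) 1" using antipode_left[of x] unfolding cop_def .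
lemma cop_antipode_right: "cop \<Delta> (\<lambda>a b. a * S b) x = sc (\<epsilon> x) 1" using antipode_right[of x] unfolding cop_def .

lemma vspace_sc: "vspace sc" by unfold_locales

lemma cop_scale_out: "vspace sv \<Longrightarrow> cop \<Delta> (\<lambda>a b. sv c (\<beta> a b)) x = sv c (cop \<Delta> \<beta> x)"
  by (rule cop_additive[symmetric]) (metis vspace.axioms vector_space.vector_space_assms(1))

lemmas sc_out = sc_mult_left[symmetric] sc_mult_right[symmetric]

text \<open>Both \<open>(x, y) \<mapsto> S (x * y)\<close> and \<open>(x, y) \<mapsto> S y * S x\<close> are convolution inverses of the product.\<close>

lemma antipode_mult: "S (x * y) = S y * S x"
proof -
  let ?L = "\<lambda>x1 y1 x2 y2 x3 y3. S (x1 * y1) * ((x2 * y2) * (S y3 * S x3))"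
  have tri1: "trilin sc sc (\<lambda>a b c. ?L x1 a x2 b x3 c)" for x1 x2 x3
    unfolding trilin_def bilin_def by (simp add: algebra_simps antipode_add antipode_scale sc_out)
  have inner1: "cop \<Delta> (\<lambda>x2 x3. cop \<Delta> (\<lambda>y2 y3. (x2 * y2) * (S y3 * S x3)) y') x' = sc (\<epsilon> x' * \<epsilon> y') 1" for x' y'
  proof -
    have "cop \<Delta> (\<lambda>y2 y3. (x2 * y2) * (S y3 * S x3)) y' = sc (\<epsilon> y') (x2 * S x3)" for x2 x3
    proof -
      have "cop \<Delta> (\<lambda>y2 y3. x2 * (y2 * S y3) * S x3) y' = x2 * cop \<Delta> (\<lambda>y2 y3. y2 * S y3) y' * S x3"
        by (rule cop_additive[symmetric]) (simp add: algebra_simps)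
      then show ?thesis unfolding cop_antipode_right by (simp add: mult.assoc sc_out)
    qed
    then show ?thesis by (simp add: cop_scale_out[OF vspace_sc] cop_antipode_right mult.commute)
  qed
  have inner2: "cop \<Delta> (\<lambda>x1 x2. cop \<Delta> (\<lambda>y1 y2. S (x1 * y1) * (x2 * y2)) q) p = sc (\<epsilon> p * \<epsilon> q) 1" for p q
  proof -
    have "bilin sc sc (\<lambda>u v. S u * v)" unfolding bilin_def by (simp add: algebra_simps antipode_add antipode_scale sc_out)
    from cop_mult[OF vspace_sc this, of p q] show ?thesis unfolding cop_antipode_left counit_mult by simp
  qed
  let ?T = "cop \<Delta> (\<lambda>x1 x'. cop \<Delta> (\<lambda>x2 x3. cop \<Delta> (\<lambda>y1 y'. cop \<Delta> (\<lambda>y2 y3. ?L x1 y1 x2 y2 x3 y3) y') y) x') x"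
  have "?T = cop \<Delta> (\<lambda>x1 x'. cop \<Delta> (\<lambda>y1 y'. sc (\<epsilon> x' * \<epsilon> y') (S (x1 * y1))) y) x"
  proof (rule arg_cong[where f="\<lambda>b. cop \<Delta> b x"], intro ext)
    fix x1 x'
    have "cop \<Delta> (\<lambda>x2 x3. cop \<Delta> (\<lambda>y1 y'. cop \<Delta> (\<lambda>y2 y3. ?L x1 y1 x2 y2 x3 y3) y') y) x'
       = cop \<Delta> (\<lambda>y1 y'. cop \<Delta> (\<lambda>x2 x3. cop \<Delta> (\<lambda>y2 y3. ?L x1 y1 x2 y2 x3 y3) y') x') y" by (rule cop_swap)
    also have "\<dots> = cop \<Delta> (\<lambda>y1 y'. S (x1 * y1) * cop \<Delta> (\<lambda>x2 x3. cop \<Delta> (\<lambda>y2 y3. (x2 * y2) * (S y3 * S x3)) y') x') y"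
      by (intro arg_cong[where f="\<lambda>b. cop \<Delta> b y"] ext)
        (simp add: cop_additive[where L="\<lambda>z. S (x1 * _) * z"] distrib_left)
    also have "\<dots> = cop \<Delta> (\<lambda>y1 y'. sc (\<epsilon> x' * \<epsilon> y') (S (x1 * y1))) y"
      unfolding inner1 by (simp add: sc_out)
    finally show "cop \<Delta> (\<lambda>x2 x3. cop \<Delta> (\<lambda>y1 y'. cop \<Delta> (\<lambda>y2 y3. ?L x1 y1 x2 y2 x3 y3) y') y) x' = cop \<Delta> (\<lambda>y1 y'. sc (\<epsilon> x' * \<epsilon> y') (S (x1 * y1))) y" .
  qed
  also have "\<dots> = cop \<Delta> (\<lambda>x1 x'. sc (\<epsilon> x') (S (x1 * y))) x"
  proof (rule arg_cong[where f="\<lambda>b. cop \<Delta> b x"], intro ext)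
    fix x1 x'
    have "cop \<Delta> (\<lambda>y1 y'. sc (\<epsilon> x' * \<epsilon> y') (S (x1 * y1))) y = cop \<Delta> (\<lambda>y1 y'. sc (\<epsilon> x') (S (x1 * sc (\<epsilon> y') y1))) y"
      by (simp add: antipode_scale sc_out)
    also have "\<dots> = sc (\<epsilon> x') (S (x1 * cop \<Delta> (\<lambda>y1 y'. sc (\<epsilon> y') y1) y))"
      by (rule cop_additive[symmetric]) (simp add: algebra_simps antipode_add scale_right_distrib)
    finally show "cop \<Delta> (\<lambda>y1 y'. sc (\<epsilon> x' * \<epsilon> y') (S (x1 * y1))) y = sc (\<epsilon> x') (S (x1 * y))"
      unfolding cop_counit_right .
  qed
  also have "\<dots> = cop \<Delta> (\<lambda>x1 x'. S (sc (\<epsilon> x') x1 * y)) x" by (simp add: antipode_scale sc_out)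
  also have "\<dots> = S (cop \<Delta> (\<lambda>x1 x'. sc (\<epsilon> x') x1) x * y)"
    by (rule cop_additive[symmetric]) (simp add: algebra_simps antipode_add)
  finally have 1: "?T = S (x * y)" unfolding cop_counit_right .
  have "?T = cop \<Delta> (\<lambda>x1 x'. cop \<Delta> (\<lambda>x2 x3. cop \<Delta> (\<lambda>q y3. cop \<Delta> (\<lambda>y1 y2. ?L x1 y1 x2 y2 x3 y3) q) y) x') x"
    by (simp only: cop_coassoc[OF vspace_sc tri1])
  also have "\<dots> = cop \<Delta> (\<lambda>p x3. cop \<Delta> (\<lambda>x1 x2. cop \<Delta> (\<lambda>q y3. cop \<Delta> (\<lambda>y1 y2. ?L x1 y1 x2 y2 x3 y3) q) y) p) x"
  proof (rule cop_coassoc[OF vspace_sc, symmetric])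
    show "trilin sc sc (\<lambda>a b c. cop \<Delta> (\<lambda>q y3. cop \<Delta> (\<lambda>y1 y2. ?L a y1 b y2 c y3) q) y)"
      unfolding trilin_def bilin_def
      by (simp add: distrib_left distrib_right antipode_add antipode_scale sc_out cop_plus cop_scale_out[OF vspace_sc])
  qed
  also have "\<dots> = cop \<Delta> (\<lambda>p x3. cop \<Delta> (\<lambda>q y3. sc (\<epsilon> p * \<epsilon> q) (S y3 * S x3)) y) x"
  proof (rule arg_cong[where f="\<lambda>b. cop \<Delta> b x"], intro ext)
    fix p x3
    have "cop \<Delta> (\<lambda>x1 x2. cop \<Delta> (\<lambda>q y3. cop \<Delta> (\<lambda>y1 y2. ?L x1 y1 x2 y2 x3 y3) q) y) p
      = cop \<Delta> (\<lambda>q y3. cop \<Delta> (\<lambda>x1 x2. cop \<Delta> (\<lambda>y1 y2. ?L x1 y1 x2 y2 x3 y3) q) p) y" by (rule cop_swap)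
    also have "\<dots> = cop \<Delta> (\<lambda>q y3. cop \<Delta> (\<lambda>x1 x2. cop \<Delta> (\<lambda>y1 y2. S (x1 * y1) * (x2 * y2)) q) p * (S y3 * S x3)) y"
      by (intro arg_cong[where f="\<lambda>b. cop \<Delta> b y"] ext)
        (simp add: cop_additive[where L="\<lambda>z. z * (S _ * S x3)"] distrib_right mult.assoc)
    also have "\<dots> = cop \<Delta> (\<lambda>q y3. sc (\<epsilon> p * \<epsilon> q) (S y3 * S x3)) y"
      unfolding inner2 by (simp add: sc_out)
    finally show "cop \<Delta> (\<lambda>x1 x2. cop \<Delta> (\<lambda>q y3. cop \<Delta> (\<lambda>y1 y2. ?L x1 y1 x2 y2 x3 y3) q) y) p = cop \<Delta> (\<lambda>q y3. sc (\<epsilon> p * \<epsilon> q) (S y3 * S x3)) y" .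
  qed
  also have "\<dots> = cop \<Delta> (\<lambda>p x3. sc (\<epsilon> p) (S y * S x3)) x"
  proof (rule arg_cong[where f="\<lambda>b. cop \<Delta> b x"], intro ext)
    fix p x3
    have "cop \<Delta> (\<lambda>q y3. sc (\<epsilon> p * \<epsilon> q) (S y3 * S x3)) y = cop \<Delta> (\<lambda>q y3. sc (\<epsilon> p) (S (sc (\<epsilon> q) y3) * S x3)) y"
      by (simp add: antipode_scale sc_out)
    also have "\<dots> = sc (\<epsilon> p) (S (cop \<Delta> (\<lambda>q y3. sc (\<epsilon> q) y3) y) * S x3)"
      by (rule cop_additive[symmetric]) (simp add: distrib_right antipode_add scale_right_distrib)
    finally show "cop \<Delta> (\<lambda>q y3. sc (\<epsilon> p * \<epsilon> q) (S y3 * S x3)) y = sc (\<epsilon> p) (S y * S x3)" unfolding cop_counit_left .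
  qed
  also have "\<dots> = cop \<Delta> (\<lambda>p x3. S y * S (sc (\<epsilon> p) x3)) x" by (simp add: antipode_scale sc_out)
  also have "\<dots> = S y * S (cop \<Delta> (\<lambda>p x3. sc (\<epsilon> p) x3) x)"
    by (rule cop_additive[symmetric]) (simp add: distrib_left antipode_add)
  finally have "?T = S y * S x" unfolding cop_counit_left .
  with 1 show ?thesis by simp
qed

text \<open>Elements satisfying the left integral property transport left multiplication from one tensor
  factor of their coproduct to the other.\<close>

lemma left_integral_shift:
  assumes sv: "vspace sv" and b: "bilin sc sv \<beta>" and L: "\<And>h. h * L = sc (\<epsilon> h) L"
  shows "cop \<Delta> (\<lambda>a b. \<beta> (S h * a) b) L = cop \<Delta> (\<lambda>a b. \<beta> a (h * b)) L"
proof -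
  interpret v: vspace sv by (rule sv)
  note b' = b[unfolded bilin_def]
  have badd: "\<beta> (x + y) z = \<beta> x z + \<beta> y z" "\<beta> z (x + y) = \<beta> z x + \<beta> z y" for x y z using b' by blast+
  have bsc: "\<beta> (sc c x) y = sv c (\<beta> x y)" "\<beta> x (sc c y) = sv c (\<beta> x y)" for c x y using b' by blast+
  let ?X = "cop \<Delta> (\<lambda>h1 k. cop \<Delta> (\<lambda>u v. \<beta> (S h1 * u) v) (k * L)) h"
  have bil: "bilin sc sv (\<lambda>u v. \<beta> (x * u) (y * v))" for x y
    unfolding bilin_def by (simp add: distrib_left badd bsc sc_out)
  have bil1: "bilin sc sv (\<lambda>u v. \<beta> (x * u) v)" for x
    unfolding bilin_def by (simp add: distrib_left badd bsc sc_out)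
  have "?X = cop \<Delta> (\<lambda>h1 k. cop \<Delta> (\<lambda>u v. \<beta> (S (sc (\<epsilon> k) h1) * u) v) L) h"
    unfolding L cop_scale[OF sv bil1] by (simp add: antipode_scale sc_out bsc cop_scale_out[OF sv])
  also have "\<dots> = cop \<Delta> (\<lambda>u v. cop \<Delta> (\<lambda>h1 k. \<beta> (S (sc (\<epsilon> k) h1) * u) v) h) L" by (rule cop_swap)
  also have "\<dots> = cop \<Delta> (\<lambda>u v. \<beta> (S (cop \<Delta> (\<lambda>h1 k. sc (\<epsilon> k) h1) h) * u) v) L"
    by (intro arg_cong[where f="\<lambda>b. cop \<Delta> b L"] ext cop_additive[symmetric])
      (simp add: antipode_add distrib_right badd)
  finally have 1: "?X = cop \<Delta> (\<lambda>a b. \<beta> (S h * a) b) L" unfolding cop_counit_right .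
  have "?X = cop \<Delta> (\<lambda>h1 k. cop \<Delta> (\<lambda>k1 k2. cop \<Delta> (\<lambda>a b. \<beta> (S h1 * (k1 * a)) (k2 * b)) L) k) h"
    by (simp only: cop_mult[OF sv bil1])
  also have "\<dots> = cop \<Delta> (\<lambda>p k2. cop \<Delta> (\<lambda>h1 k1. cop \<Delta> (\<lambda>a b. \<beta> (S h1 * (k1 * a)) (k2 * b)) L) p) h"
  proof (rule cop_coassoc[OF sv, symmetric])
    show "trilin sc sv (\<lambda>x y z. cop \<Delta> (\<lambda>a b. \<beta> (S x * (y * a)) (z * b)) L)"
      unfolding trilin_def bilin_def
      by (simp add: distrib_left distrib_right antipode_add antipode_scale sc_out badd bsc cop_plus cop_scale_out[OF sv])
  qed
  also have "\<dots> = cop \<Delta> (\<lambda>p k2. cop \<Delta> (\<lambda>a b. \<beta> a (sc (\<epsilon> p) k2 * b)) L) h"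
  proof (rule arg_cong[where f="\<lambda>b. cop \<Delta> b h"], intro ext)
    fix p k2
    have "cop \<Delta> (\<lambda>h1 k1. cop \<Delta> (\<lambda>a b. \<beta> (S h1 * (k1 * a)) (k2 * b)) L) p = cop \<Delta> (\<lambda>a b. cop \<Delta> (\<lambda>h1 k1. \<beta> (S h1 * k1 * a) (k2 * b)) p) L"
      unfolding mult.assoc by (rule cop_swap)
    also have "\<dots> = cop \<Delta> (\<lambda>a b. \<beta> (cop \<Delta> (\<lambda>h1 k1. S h1 * k1) p * a) (k2 * b)) L"
      by (intro arg_cong[where f="\<lambda>b. cop \<Delta> b L"] ext cop_additive[symmetric]) (simp add: distrib_right badd)
    also have "\<dots> = cop \<Delta> (\<lambda>a b. \<beta> a (sc (\<epsilon> p) k2 * b)) L"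
      unfolding cop_antipode_left by (simp add: sc_out bsc)
    finally show "cop \<Delta> (\<lambda>h1 k1. cop \<Delta> (\<lambda>a b. \<beta> (S h1 * (k1 * a)) (k2 * b)) L) p = cop \<Delta> (\<lambda>a b. \<beta> a (sc (\<epsilon> p) k2 * b)) L" .
  qed
  also have "\<dots> = cop \<Delta> (\<lambda>a b. cop \<Delta> (\<lambda>p k2. \<beta> a (sc (\<epsilon> p) k2 * b)) h) L" by (rule cop_swap)
  also have "\<dots> = cop \<Delta> (\<lambda>a b. \<beta> a (cop \<Delta> (\<lambda>p k2. sc (\<epsilon> p) k2) h * b)) L"
    by (intro arg_cong[where f="\<lambda>b. cop \<Delta> b L"] ext cop_additive[symmetric]) (simp add: distrib_right badd)
  finally have "?X = cop \<Delta> (\<lambda>a b. \<beta> a (h * b)) L" unfolding cop_counit_left .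
  with 1 show ?thesis by simp
qed

end

section \<open>Semisimple Hopf algebras are finite-dimensional\<close>

context semisimple_hopf_algebra
begin

lemma left_integral_exists:
  obtains L where "\<And>h. h * L = sc (\<epsilon> h) L" "\<epsilon> L = 1"
proof -
  let ?I = "{h. \<epsilon> h = 0}"
  have e0: "\<epsilon> 0 = 0" using counit_scale[of 0 0] by simp
  have "left_ideal ?I" unfolding left_ideal_def by (simp add: counit_add counit_mult e0)
  from left_ideal_complement[OF this] obtain J where J: "left_ideal J" "?I \<inter> J = {0}" and dec: "\<forall>x. \<exists>a\<in>?I. \<exists>b\<in>J. x = a + b" by blast
  obtain a b where ab: "a \<in> ?I" "b \<in> J" "1 = a + b" using dec by blast
  have eb: "\<epsilon> b = 1" using counit_one unfolding ab(3) counit_add using ab(1) by simp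
  have "h * b = sc (\<epsilon> h) b" for h
  proof -
    have hJ: "(h - sc (\<epsilon> h) 1) * b \<in> J" using J(1) ab(2) unfolding left_ideal_def by blast
    have eq: "(h - sc (\<epsilon> h) 1) * b = h * b - sc (\<epsilon> h) b" by (simp add: left_diff_distrib sc_out)
    have "\<epsilon> (h * b - sc (\<epsilon> h) b) + \<epsilon> (sc (\<epsilon> h) b) = \<epsilon> (h * b)" unfolding counit_add[symmetric] by simp
    then have "\<epsilon> (h * b - sc (\<epsilon> h) b) = 0" by (simp add: counit_scale counit_mult eb)
    then have "h * b - sc (\<epsilon> h) b \<in> ?I \<inter> J" using hJ eq by simp
    then show ?thesis using J(2) by auto
  qed
  then show ?thesis using that eb by blast
qed

text \<open>The second tensor factors of the coproduct of a left integral \<open>L\<close> span a left ideal; it contains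
  \<open>\<epsilon>(L) 1\<close>, the product of the antipode of the first factor with the second.\<close>

lemma span_second_factors:
  assumes L: "\<And>h. h * L = sc (\<epsilon> h) L" "\<epsilon> L = 1"
  obtains E u where "finite E" "\<And>h e. e \<in> E \<Longrightarrow> h * u e \<in> span (snd ` set (\<Delta> L))"
    "\<And>h e. e \<in> E \<Longrightarrow> S h = 0 \<Longrightarrow> h * u e = 0" "1 = (\<Sum>e\<in>E. S e * u e)"
proof -
  interpret sv: vspace sc by (rule vspace_sc)
  obtain E where E: "E \<subseteq> fst ` set (\<Delta> L)" "independent E" "fst ` set (\<Delta> L) \<subseteq> span E"
    by (rule maximal_independent_subset[of "fst ` set (\<Delta> L)"])
  have fE: "finite E" using E(1) finite_subset by blast
  let ?G = "extend_basis E"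
  have G: "independent ?G" "span ?G = UNIV" "E \<subseteq> ?G"
    using independent_extend_basis[OF E(2)] span_extend_basis[OF E(2)] extend_basis_superset[OF E(2)] by blast+
  define q where "q e x = representation ?G x e" for e x
  have qadd: "q e (x + y) = q e x + q e y" and qsc: "q e (sc c x) = c * q e x" for e x y c
    unfolding q_def using G by (simp_all add: representation_add representation_scale)
  define u where "u e = cop \<Delta> (\<lambda>a b. sc (q e a) b) L" for e
  have bq: "bilin sc sc (\<lambda>a b. sc (q e a) b)" for e
    unfolding bilin_def by (simp add: qadd qsc scale_left_distrib scale_right_distrib mult.commute)
  have hu: "h * u e = cop \<Delta> (\<lambda>a b. sc (q e (S h * a)) b) L" for h e
  proof -
    have "h * u e = cop \<Delta> (\<lambda>a b. sc (q e a) (h * b)) L"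
      unfolding u_def by (subst cop_additive[where L="\<lambda>z. h * z"]) (simp_all add: distrib_left sc_out)
    then show ?thesis using left_integral_shift[OF vspace_sc bq L(1)] by simp
  qed
  have r1: "h * u e \<in> span (snd ` set (\<Delta> L))" for h e
  proof -
    have "(\<Sum>(a,b)\<leftarrow>xs. sc (q e (S h * a)) b) \<in> span (snd ` set xs)" for xs
    proof (induction xs)
      case (Cons p xs)
      have "span (snd ` set xs) \<subseteq> span (snd ` set (p # xs))" by (rule span_mono) auto
      then show ?case using Cons span_base[of "snd p" "snd ` set (p # xs)"]
        by (auto simp: case_prod_unfold intro!: span_add span_scale)
    qed (simp add: span_zero)
    then show ?thesis unfolding hu cop_def .
  qed
  have r2: "h * u e = 0" if "S h = 0" for h e
  proof -
    have "q e 0 = 0" using qsc[of e 0 0] by simp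
    then show ?thesis unfolding hu that cop_def by (simp add: case_prod_unfold)
  qed
  have r3: "1 = (\<Sum>e\<in>E. S e * u e)"
  proof -
    have ex: "a = (\<Sum>e\<in>E. sc (q e a) e)" if "a \<in> fst ` set (\<Delta> L)" for a
    proof -
      have "a \<in> span E" using that E(3) by blast
      then have "representation ?G a = representation E a"
        using G E(2) by (intro representation_extend) auto
      then show ?thesis unfolding q_def using sum_representation_eq[OF E(2) \<open>a \<in> span E\<close> fE subset_refl] by simp
    qed
    have "(\<Sum>(a,b)\<leftarrow>xs. S a * b) = (\<Sum>e\<in>E. S e * (\<Sum>(a,b)\<leftarrow>xs. sc (q e a) b))" if "set xs \<subseteq> set (\<Delta> L)" for xs
      using that
    proof (induction xs)
      case (Cons p xs)
      obtain a b where p: "p = (a,b)" by (cases p)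
      have "a \<in> fst ` set (\<Delta> L)" using Cons.prems p by force
      then have "S a = S (\<Sum>e\<in>E. sc (q e a) e)" using ex by simp
      also have "\<dots> = (\<Sum>e\<in>E. sc (q e a) (S e))"
      proof -
        have "S (\<Sum>e\<in>F. sc (q e a) e) = (\<Sum>e\<in>F. sc (q e a) (S e))" if "finite F" for F
          using that
        proof (induction F rule: finite_induct)
          case empty
          have "S 0 = 0" using antipode_scale[of 0 0] by simp
          then show ?case by simp
        qed (simp add: antipode_add antipode_scale)
        then show ?thesis using fE .
      qed
      finally have "S a * b = (\<Sum>e\<in>E. S e * sc (q e a) b)"
        by (simp add: sum_distrib_right sc_out)
      then show ?case using Cons p by (simp add: distrib_left sum.distrib)
    qed simp
    from this[OF subset_refl] have "cop \<Delta> (\<lambda>a b. S a * b) L = (\<Sum>e\<in>E. S e * u e)" unfolding u_def cop_def .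
    then show ?thesis unfolding cop_antipode_left L(2) by simp
  qed
  show ?thesis by (rule that[of E u, OF fE r1 r2 r3])
qed

lemma finite_dimensional:
  obtains F where "finite F" "span F = UNIV"
proof -
  obtain L where L: "\<And>h. h * L = sc (\<epsilon> h) L" "\<epsilon> L = 1"
  proof (rule left_integral_exists, goal_cases)
    case (1 L)
    show ?case by (rule 1(1)[OF 1(2-)])
  qed
  obtain E u where E: "finite E" "\<And>h e. e \<in> E \<Longrightarrow> h * u e \<in> span (snd ` set (\<Delta> L))"
    "\<And>h e. e \<in> E \<Longrightarrow> S h = 0 \<Longrightarrow> h * u e = 0" "1 = (\<Sum>e\<in>E. S e * u e)"
  proof (rule span_second_factors[OF L], goal_cases)
    case (1 E u)
    show ?case by (rule 1(1)[OF 1(2-)])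
  qed
  have "h \<in> span (snd ` set (\<Delta> L))" for h
  proof -
    have "h = h * (\<Sum>e\<in>E. S e * u e)" unfolding E(4)[symmetric] by simp
    also have "\<dots> = (\<Sum>e\<in>E. (h * S e) * u e)" by (simp add: sum_distrib_left mult.assoc)
    finally have "h = (\<Sum>e\<in>E. (h * S e) * u e)" .
    moreover have "(\<Sum>e\<in>E. (h * S e) * u e) \<in> span (snd ` set (\<Delta> L))" by (rule span_sum) (rule E(2))
    ultimately show ?thesis by simp
  qed
  then have "span (snd ` set (\<Delta> L)) = UNIV" by blast
  then show ?thesis by (intro that[of "snd ` set (\<Delta> L)"]) simp_all
qed

lemma antipode_inj: assumes "S h = 0" shows "h = 0"
proof -
  obtain L where L: "\<And>h. h * L = sc (\<epsilon> h) L" "\<epsilon> L = 1"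
  proof (rule left_integral_exists, goal_cases)
    case (1 L)
    show ?case by (rule 1(1)[OF 1(2-)])
  qed
  obtain E u where E: "finite E" "\<And>h e. e \<in> E \<Longrightarrow> h * u e \<in> span (snd ` set (\<Delta> L))"
    "\<And>h e. e \<in> E \<Longrightarrow> S h = 0 \<Longrightarrow> h * u e = 0" "1 = (\<Sum>e\<in>E. S e * u e)"
  proof (rule span_second_factors[OF L], goal_cases)
    case (1 E u)
    show ?case by (rule 1(1)[OF 1(2-)])
  qed
  have "h = h * (\<Sum>e\<in>E. S e * u e)" unfolding E(4)[symmetric] by simp
  also have "\<dots> = (\<Sum>e\<in>E. (h * S e) * u e)" by (simp add: sum_distrib_left mult.assoc)
  also have "\<dots> = 0"
  proof (intro sum.neutral ballI)
    fix e assume "e \<in> E"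
    moreover have "S (h * S e) = 0" using assms by (simp add: antipode_mult)
    ultimately show "h * S e * u e = 0" by (rule E(3))
  qed
  finally show ?thesis .
qed

end


context fd_subalgebra
begin

lemma rad_A: "a \<in> rad \<Longrightarrow> a \<in> A" unfolding rad_def by blast

lemma rad_Irr: "a \<in> rad \<Longrightarrow> \<phi> \<in> Irr \<Longrightarrow> \<phi> a = 0"
  using Irr_trace[of \<phi> a] unfolding rad_def by simp

lemma rad_subspace: "subspace rad"
  unfolding subspace_def
proof (intro conjI ballI allI)
  have z: "rrep \<phi> 0 = 0\<^sub>m (rdim \<phi>) (rdim \<phi>)" if I: "\<phi> \<in> Irr" for \<phi>
    using rep_carrier[OF Irr_is_rep[OF I] zero_A] by (intro eq_matI) (auto simp: rep_entry_zero[OF Irr_is_rep[OF I]])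
  then show "0 \<in> rad" unfolding rad_def using zero_A by blast
  fix x assume x: "x \<in> rad"
  show "x + y \<in> rad" if y: "y \<in> rad" for y
    using x y rep_add[OF Irr_is_rep] add_A unfolding rad_def by auto
  show "sc c x \<in> rad" for c
    using x rep_scale[OF Irr_is_rep] scale_A unfolding rad_def by auto
qed

lemma rad_mult: assumes "a \<in> A" "x \<in> rad" shows "a * x \<in> rad" "x * a \<in> rad"
proof -
  have xA: "x \<in> A" using assms rad_A by blast
  have "rrep \<phi> (a * x) = 0\<^sub>m (rdim \<phi>) (rdim \<phi>) \<and> rrep \<phi> (x * a) = 0\<^sub>m (rdim \<phi>) (rdim \<phi>)" if I: "\<phi> \<in> Irr" for \<phi>
  proof -
    have "rrep \<phi> x = 0\<^sub>m (rdim \<phi>) (rdim \<phi>)" using assms(2) I unfolding rad_def by blast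
    then show ?thesis unfolding rep_mult[OF Irr_is_rep[OF I] assms(1) xA] rep_mult[OF Irr_is_rep[OF I] xA assms(1)]
      using rep_carrier[OF Irr_is_rep[OF I] assms(1)] by simp
  qed
  then show "a * x \<in> rad" "x * a \<in> rad" unfolding rad_def using mult_A[OF assms(1) xA] mult_A[OF xA assms(1)] by blast+
qed

text \<open>In characteristic zero an idempotent is detected by its trace on a faithful module, while elements
  of the radical have trace zero on every module.\<close>

lemma rad_idem_zero:
  assumes j: "j \<in> rad" "j * j = j" and U: "fin_subspace UNIV"
  shows "j = 0"
proof -
  interpret m: fd_module sc A sc "\<lambda>a x. a * x" UNIV
    by unfold_locales (use U in \<open>auto simp: endo_on_def algebra_simps sc_mult_left[symmetric] sc_mult_right[symmetric]\<close>)
  have jA: "j \<in> A" using j rad_A by blast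
  obtain c :: "_ \<Rightarrow> nat" where "op_trace UNIV (\<lambda>x. j * x) = (\<Sum>\<phi>\<in>Irr. of_nat (c \<phi>) * \<phi> j)"
  proof (rule m.trace_decomposition, goal_cases)
    case (1 m)
    show ?case by (rule 1(1)[OF 1(2)[OF jA]])
  qed
  also have "\<dots> = 0"
  proof (rule sum.neutral, rule ballI)
    fix \<phi> assume "\<phi> \<in> Irr"
    then show "of_nat (c \<phi>) * \<phi> j = 0" unfolding rad_Irr[OF j(1) \<open>\<phi> \<in> Irr\<close>] by simp
  qed
  finally have t: "op_trace UNIV (\<lambda>x. j * x) = 0" .
  have e: "endo_on sc UNIV (\<lambda>x. j * x)" by (rule m.act_endo[OF jA])
  obtain n where n: "op_trace UNIV (\<lambda>x. j * x) = of_nat n" "n = 0 \<longleftrightarrow> (\<forall>v\<in>UNIV. j * v = 0)"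
  proof (rule op_trace_idem[OF U e], goal_cases)
    case (1 v)
    show ?case using j(2) by (simp add: mult.assoc[symmetric])
  next
    case (2 n)
    show ?case by (rule 2(1)[OF 2(2,3)])
  qed
  have "n = 0" using n(1) t by simp
  then have "j * 1 = 0" using n(2) by blast
  then show ?thesis by simp
qed

end

locale ss_hopf = semisimple_hopf_algebra sc \<Delta> \<epsilon> S
  for sc :: "'k::{alg_closed_field,field_char_0} \<Rightarrow> 'h::ring_1 \<Rightarrow> 'h"
    and \<Delta> :: "'h \<Rightarrow> ('h \<times> 'h) list" and \<epsilon> :: "'h \<Rightarrow> 'k" and S :: "'h \<Rightarrow> 'h"
begin

sublocale vspace sc by (rule vspace_sc)

lemma vspace_k: "vspace ((*) :: 'k \<Rightarrow> 'k \<Rightarrow> 'k)" by unfold_locales (simp_all add: algebra_simps)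

lemma fin_UNIV: "fin_subspace UNIV"
proof -
  obtain F where "finite F" "span F = UNIV" by (rule finite_dimensional)
  then show ?thesis unfolding fin_subspace_def by auto
qed

sublocale H: fd_subalgebra sc UNIV
  by unfold_locales (simp_all add: fin_UNIV)

text \<open>A complement of the radical would split it off by an idempotent.\<close>

lemma H_semisimple: "H.rad = {0}"
proof -
  have "left_ideal H.rad" unfolding left_ideal_def
    using H.rad_subspace H.rad_mult(1) subspace_0 subspace_add by blast
  from left_ideal_complement[OF this] obtain J where J: "left_ideal J" "H.rad \<inter> J = {0}"
    and dec: "\<forall>x. \<exists>a\<in>H.rad. \<exists>b\<in>J. x = a + b" by blast
  obtain j l where jl: "j \<in> H.rad" "l \<in> J" "1 = j + l" using dec by blast
  have jlJ: "j * l \<in> J" using J(1) jl(2) unfolding left_ideal_def by blast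
  have "j * (j + l) = j" unfolding jl(3)[symmetric] by simp
  then have e: "j * l = j - j * j" by (simp add: distrib_left eq_diff_eq add.commute)
  have "j * j \<in> H.rad" by (rule H.rad_mult(1)[OF UNIV_I jl(1)])
  then have "j * l \<in> H.rad" unfolding e using subspace_diff[OF H.rad_subspace jl(1)] by blast
  then have "j * l = 0" using jlJ J(2) by (metis IntI empty_iff insert_iff)
  then have "j * j = j" using e by (simp only: eq_iff_diff_eq_0[of j "j * j"] eq_commute[of "j * j" j])
  then have "j = 0" using H.rad_idem_zero[OF jl(1) _ fin_UNIV] by blast
  then have one: "1 \<in> J" using jl by simp
  have "x * 1 \<in> J" for x using J(1) one unfolding left_ideal_def by blast
  then have "J = UNIV" by auto
  then show ?thesis using J(2) by simp
qed

sublocale H: ss_algebra sc UNIV by unfold_locales (rule H_semisimple)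

definition lam :: "'h \<Rightarrow> 'k" where "lam h = op_trace UNIV (\<lambda>x. h * x)"

lemma lam_Irr: "lam h = (\<Sum>\<chi>\<in>H.Irr. \<chi> 1 * \<chi> h)"
  using H.trace_left_right[of h 1] unfolding lam_def by (simp add: mult.commute)

lemma lam_regular: "lam = regular_char sc"
  unfolding regular_char_def lam_Irr H.Irr_def by (rule refl)

lemma lam_add: "lam (x + y) = lam x + lam y"
proof -
  have "\<chi> 1 * \<chi> (x + y) = \<chi> 1 * \<chi> x + \<chi> 1 * \<chi> y" if "\<chi> \<in> H.Irr" for \<chi>
    using H.Irr_lin[OF that] unfolding lin_on_def by (simp only: UNIV_I distrib_left simp_thms ball_UNIV)
  then show ?thesis unfolding lam_Irr sum.distrib[symmetric] by (rule sum.cong[OF refl])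
qed

lemma lam_scale: "lam (sc c x) = c * lam x"
proof -
  have "\<chi> 1 * \<chi> (sc c x) = c * (\<chi> 1 * \<chi> x)" if "\<chi> \<in> H.Irr" for \<chi>
    using H.Irr_lin[OF that] unfolding lin_on_def by (simp only: UNIV_I mult.left_commute simp_thms ball_UNIV)
  then show ?thesis unfolding lam_Irr sum_distrib_left by (rule sum.cong[OF refl])
qed

lemma lam_comm: "lam (x * y) = lam (y * x)"
  unfolding lam_Irr by (intro sum.cong refl arg_cong2[of _ _ _ _ "(*)"] H.Irr_comm) simp_all

lemma lam_sum: "finite K \<Longrightarrow> lam (\<Sum>a\<in>K. f a) = (\<Sum>a\<in>K. lam (f a))"
proof (induction K rule: finite_induct)
  case empty
  have "lam (sc 0 0) = 0 * lam 0" by (rule lam_scale)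
  then show ?case by simp
qed (simp add: lam_add)

lemma antipode_zero: "S 0 = 0" using antipode_scale[of 0 0] by simp

lemma antipode_sum: "finite K \<Longrightarrow> S (\<Sum>a\<in>K. f a) = (\<Sum>a\<in>K. S (f a))"
  by (induction K rule: finite_induct) (simp_all add: antipode_zero antipode_add)

lemma antipode_diff: "S (x - y) = S x - S y"
  using antipode_add[of "x - y" y] by (simp add: algebra_simps)

lemma antipode_bij: "bij S"
proof -
  obtain \<beta> where b: "basis_of UNIV \<beta>" using fin_subspace_has_basis[OF fin_UNIV] by blast
  interpret fd: finite_dimensional_vector_space sc \<beta>
    using b unfolding basis_of_def by unfold_locales auto
  have "inj S"
  proof
    fix x y assume "S x = S y"
    then have "S (x - y) = 0" by (simp add: antipode_diff)
    then show "x = y" using antipode_inj by fastforce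
  qed
  moreover have "Vector_Spaces.linear sc sc S"
    unfolding Vector_Spaces.linear_iff using vector_space_axioms by (simp add: antipode_add antipode_scale)
  ultimately show ?thesis using fd.linear_inj_imp_surj unfolding bij_def by blast
qed

definition T :: "'h \<Rightarrow> 'h" where "T = inv_into UNIV S"

lemma T_S: "T (S x) = x" unfolding T_def using antipode_bij by (simp add: bij_is_inj)
lemma S_T: "S (T x) = x" unfolding T_def using antipode_bij by (simp add: bij_is_surj surj_f_inv_f)
lemma T_mult: "T (x * y) = T y * T x"
proof -
  have "S (T y * T x) = x * y" unfolding antipode_mult S_T ..
  then have "T (x * y) = T (S (T y * T x))" by (rule arg_cong[of _ _ T, OF sym])
  then show ?thesis unfolding T_S .
qed
lemma T_sum: "finite K \<Longrightarrow> T (\<Sum>a\<in>K. f a) = (\<Sum>a\<in>K. T (f a))"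
proof -
  assume K: "finite K"
  have "S (\<Sum>a\<in>K. T (f a)) = (\<Sum>a\<in>K. f a)" by (simp add: antipode_sum[OF K] S_T)
  then have "T (\<Sum>a\<in>K. f a) = T (S (\<Sum>a\<in>K. T (f a)))" by (rule arg_cong[of _ _ T, OF sym])
  then show ?thesis unfolding T_S .
qed
lemma T_one: "T 1 = 1"
proof -
  have "bilin sc sc (\<lambda>a b. S a * b)" unfolding bilin_def by (simp add: algebra_simps antipode_add antipode_scale sc_out)
  from cop_one[OF vspace_sc this] have "S 1 = 1" unfolding cop_antipode_left by (simp add: counit_one)
  then show ?thesis using T_S[of 1] by simp
qed
lemma T_zero: "T 0 = 0" using T_S[of 0] antipode_zero by simp

end

section \<open>Left coideal subalgebras\<close>

locale coideal_algebra = ss_hopf sc \<Delta> \<epsilon> S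
  for sc :: "'k::{alg_closed_field,field_char_0} \<Rightarrow> 'h::ring_1 \<Rightarrow> 'h"
    and \<Delta> :: "'h \<Rightarrow> ('h \<times> 'h) list" and \<epsilon> :: "'h \<Rightarrow> 'k" and S :: "'h \<Rightarrow> 'h" +
  fixes N :: "'h set" and BN B :: "'h set"
  assumes coideal: "left_coideal_subalgebra sc \<Delta> N"
    and BN: "basis_of N BN" and B: "basis_of UNIV B" and BNB: "BN \<subseteq> B"
begin

lemma N_sub: "1 \<in> N" "x \<in> N \<Longrightarrow> y \<in> N \<Longrightarrow> x + y \<in> N" "x \<in> N \<Longrightarrow> sc c x \<in> N" "x \<in> N \<Longrightarrow> y \<in> N \<Longrightarrow> x * y \<in> N"
  using coideal unfolding left_coideal_subalgebra_def by blast+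

sublocale N: fd_subalgebra sc N
proof unfold_locales
  show "fin_subspace N" using fin_subspace_subset[OF fin_UNIV basis_of_subspace[OF BN]] by simp
qed (simp_all add: N_sub)

lemma B': "finite B" "independent B" "span B = UNIV" and BN': "finite BN" "independent BN" "span BN = N"
  using B BN unfolding basis_of_def by blast+

lemma BN_N: "b \<in> BN \<Longrightarrow> b \<in> N" using basis_of_subset[OF BN] by blast

definition \<xi> :: "'h \<Rightarrow> 'h \<Rightarrow> 'k" where "\<xi> b h = representation B h b"

lemma xi_add: "\<xi> b (x + y) = \<xi> b x + \<xi> b y" and xi_scale: "\<xi> b (sc c x) = c * \<xi> b x"
  unfolding \<xi>_def using B' by (simp_all add: representation_add representation_scale)

lemma xi_zero: "\<xi> b 0 = 0" using xi_scale[of b 0 0] by simp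

lemma xi_sum: "finite K \<Longrightarrow> \<xi> b (\<Sum>a\<in>K. f a) = (\<Sum>a\<in>K. \<xi> b (f a))"
  by (induction K rule: finite_induct) (simp_all add: xi_zero xi_add)

lemma xi_expand: "(\<Sum>b\<in>B. sc (\<xi> b h) b) = h"
  unfolding \<xi>_def using sum_representation_eq[OF B'(2) _ B'(1) subset_refl] B'(3) by simp

lemma xi_N: assumes "n \<in> N" shows "(\<Sum>b\<in>BN. sc (\<xi> b n) b) = n"
proof -
  have "representation B n = representation BN n"
    using assms BN' B' BNB by (intro representation_extend) auto
  then show ?thesis unfolding \<xi>_def using sum_representation_eq[OF BN'(2) _ BN'(1) subset_refl] assms BN'(3) by simp
qed

lemma xi_basis: "b \<in> B \<Longrightarrow> \<xi> a b = (if a = b then 1 else 0)"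
  unfolding \<xi>_def using representation_basis[OF B'(2)] by simp

lemma xi_frame: "frame UNIV B (\<lambda>b. b) \<xi>"
  using basis_frame[OF B] unfolding \<xi>_def .

lemma lam_xi: "lam h = (\<Sum>b\<in>B. \<xi> b (h * b))"
  unfolding lam_def by (rule op_trace_frame[OF subspace_UNIV xi_frame])
    (simp add: endo_on_def distrib_left sc_out)

definition del :: "'h \<Rightarrow> 'h \<Rightarrow> 'h" where "del a h = cop \<Delta> (\<lambda>u v. sc (\<xi> a u) v) h"

lemma del_bilin: "bilin sc sc (\<lambda>u v. sc (\<xi> a u) v)"
  unfolding bilin_def by (simp add: xi_add xi_scale scale_left_distrib scale_right_distrib mult.commute)

lemma del_add: "del a (x + y) = del a x + del a y" and del_scale: "del a (sc c x) = sc c (del a x)"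
  unfolding del_def using cop_add[OF vspace_sc del_bilin] cop_scale[OF vspace_sc del_bilin] by blast+

lemma del_zero: "del a 0 = 0" using del_scale[of a 0 0] by simp

lemma del_sum: "finite K \<Longrightarrow> del a (\<Sum>i\<in>K. f i) = (\<Sum>i\<in>K. del a (f i))"
  by (induction K rule: finite_induct) (simp_all add: del_zero del_add)

lemma del_N: assumes "n \<in> N" shows "del a n \<in> N"
proof -
  obtain ys where ys: "set ys \<subseteq> UNIV \<times> N" "tensor_eq sc (tensor_sum (\<Delta> n)) (tensor_sum ys)"
    using coideal assms unfolding left_coideal_subalgebra_def by blast
  from tensor_eq_bilin[OF vspace_sc ys(2) del_bilin[of a]]
  have "del a n = (\<Sum>(u, v)\<leftarrow>ys. sc (\<xi> a u) v)"
    unfolding lin_ext_tensor_sum[of "\<lambda>u v. sc (\<xi> a u) v"] del_def cop_def .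
  moreover have "(\<Sum>(u, v)\<leftarrow>ys. sc (\<xi> a u) v) \<in> N" using ys(1)
    by (induction ys) (auto simp: N.zero_A intro!: N_sub)
  ultimately show ?thesis by simp
qed

lemma bilin_sum_left: assumes "bilin sc sv \<beta>" "vspace sv" "finite K" shows "\<beta> (\<Sum>a\<in>K. sc (c a) (f a)) y = (\<Sum>a\<in>K. sv (c a) (\<beta> (f a) y))"
proof -
  interpret v: vspace sv by fact
  note b = assms(1)[unfolded bilin_def]
  have "\<beta> (sc 0 0) y = sv 0 (\<beta> 0 y)" using b by blast
  then have z: "\<beta> 0 y = 0" by simp
  show ?thesis using assms(3) by (induction K rule: finite_induct) (use b z in simp_all)
qed

lemma bilin_sum_right: assumes "bilin sc sv \<beta>" "vspace sv" "finite K" shows "\<beta> y (\<Sum>a\<in>K. sc (c a) (f a)) = (\<Sum>a\<in>K. sv (c a) (\<beta> y (f a)))"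
proof -
  interpret v: vspace sv by fact
  note b = assms(1)[unfolded bilin_def]
  have "\<beta> y (sc 0 0) = sv 0 (\<beta> y 0)" using b by blast
  then have z: "\<beta> y 0 = 0" by simp
  show ?thesis using assms(3) by (induction K rule: finite_induct) (use b z in simp_all)
qed

lemma cop_del: assumes sv: "vspace sv" and b: "bilin sc sv \<beta>" shows "cop \<Delta> \<beta> h = (\<Sum>a\<in>B. \<beta> a (del a h))"
proof -
  interpret v: vspace sv by fact
  note b' = b[unfolded bilin_def]
  have "\<beta> = (\<lambda>u w. \<Sum>a\<in>B. \<beta> a (sc (\<xi> a u) w))"
  proof (intro ext)
    fix u w
    have "\<beta> u w = \<beta> (\<Sum>a\<in>B. sc (\<xi> a u) a) w" unfolding xi_expand ..
    also have "\<dots> = (\<Sum>a\<in>B. sv (\<xi> a u) (\<beta> a w))" by (rule bilin_sum_left[OF b sv B'(1)])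
    also have "\<dots> = (\<Sum>a\<in>B. \<beta> a (sc (\<xi> a u) w))" using b' by simp
    finally show "\<beta> u w = (\<Sum>a\<in>B. \<beta> a (sc (\<xi> a u) w))" .
  qed
  then have "cop \<Delta> \<beta> h = cop \<Delta> (\<lambda>u w. \<Sum>a\<in>B. \<beta> a (sc (\<xi> a u) w)) h" by (rule arg_cong[of _ _ "\<lambda>f. cop \<Delta> f h"])
  also have "\<dots> = (\<Sum>a\<in>B. cop \<Delta> (\<lambda>u w. \<beta> a (sc (\<xi> a u) w)) h)"
  proof -
    have "cop \<Delta> (\<lambda>u w. \<Sum>a\<in>K. \<beta> a (sc (\<xi> a u) w)) h = (\<Sum>a\<in>K. cop \<Delta> (\<lambda>u w. \<beta> a (sc (\<xi> a u) w)) h)" if "finite K" for K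
      using that
    proof (induction K rule: finite_induct)
      case empty
      show ?case unfolding cop_def by (simp add: case_prod_unfold)
    qed (simp add: cop_plus)
    then show ?thesis using B'(1) .
  qed
  also have "\<dots> = (\<Sum>a\<in>B. \<beta> a (del a h))"
  proof (rule sum.cong[OF refl])
    fix a
    have add: "\<beta> a (x + y) = \<beta> a x + \<beta> a y" for x y using b' by blast
    show "cop \<Delta> (\<lambda>u w. \<beta> a (sc (\<xi> a u) w)) h = \<beta> a (del a h)"
      unfolding del_def by (rule cop_additive[symmetric, OF add])
  qed
  finally show ?thesis .
qed

lemma del_mult: assumes sv: "vspace sv" and b: "bilin sc sv \<beta>"
  shows "(\<Sum>a\<in>B. \<beta> a (del a (h * g))) = (\<Sum>a\<in>B. \<Sum>e\<in>B. \<beta> (a * e) (del a h * del e g))"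
proof -
  interpret v: vspace sv by fact
  note b' = b[unfolded bilin_def]
  have b1: "bilin sc sv (\<lambda>c d. \<beta> (a * c) (x * d))" for a x
    unfolding bilin_def using b' by (simp add: distrib_left sc_out)
  have b2: "bilin sc sv (\<lambda>a x. \<Sum>e\<in>B. \<beta> (a * e) (x * del e g))"
    unfolding bilin_def using b' by (simp add: distrib_right sc_out sum.distrib v.scale_sum_right)
  have "(\<Sum>a\<in>B. \<beta> a (del a (h * g))) = cop \<Delta> \<beta> (h * g)" by (rule cop_del[OF sv b, symmetric])
  also have "\<dots> = cop \<Delta> (\<lambda>a x. \<Sum>e\<in>B. \<beta> (a * e) (x * del e g)) h"
    unfolding cop_mult[OF sv b] cop_del[OF sv b1] ..
  also have "\<dots> = (\<Sum>a\<in>B. \<Sum>e\<in>B. \<beta> (a * e) (del a h * del e g))" by (rule cop_del[OF sv b2])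
  finally show ?thesis .
qed

lemma del_coassoc: assumes sv: "vspace sv" and t: "trilin sc sv \<tau>"
  shows "(\<Sum>a\<in>B. \<Sum>e\<in>B. \<tau> e (del e a) (del a h)) = (\<Sum>a\<in>B. \<Sum>e\<in>B. \<tau> a e (del e (del a h)))"
proof -
  interpret v: vspace sv by fact
  note t' = t[unfolded trilin_def]
  note tb = t'[THEN conjunct1, rule_format] t'[THEN conjunct2, rule_format]
  note q1 = tb(1)[unfolded bilin_def] and q2 = tb(2)[unfolded bilin_def]
  note tt = q1[THEN conjunct1, rule_format] q1[THEN conjunct2, THEN conjunct1, rule_format] q2[THEN conjunct2, THEN conjunct1, rule_format]
    q1[THEN conjunct2, THEN conjunct2, THEN conjunct1, rule_format] q1[THEN conjunct2, THEN conjunct2, THEN conjunct2, rule_format]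
    q2[THEN conjunct2, THEN conjunct2, THEN conjunct2, rule_format]
  have b1: "bilin sc sv (\<lambda>a w. \<Sum>e\<in>B. \<tau> e (del e a) w)" and b2: "bilin sc sv (\<lambda>a w. \<Sum>e\<in>B. \<tau> a e (del e w))"
    unfolding bilin_def by (simp_all add: tt del_add del_scale sum.distrib v.scale_sum_right)
  show ?thesis using cop_coassoc[OF sv t, of h] unfolding cop_del[OF sv tb(1)] cop_del[OF sv tb(2)] cop_del[OF sv b1] cop_del[OF sv b2] .
qed


lemma eps_zero: "\<epsilon> 0 = 0" using counit_scale[of 0 0] by simp

lemma eps_sum: "finite K \<Longrightarrow> \<epsilon> (\<Sum>a\<in>K. f a) = (\<Sum>a\<in>K. \<epsilon> (f a))"
  by (induction K rule: finite_induct) (simp_all add: eps_zero counit_add)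

lemma del_counit_left: "(\<Sum>a\<in>B. sc (\<epsilon> a) (del a h)) = h"
proof -
  have "bilin sc sc (\<lambda>a b. sc (\<epsilon> a) b)" unfolding bilin_def
    by (simp add: counit_add counit_scale scale_left_distrib scale_right_distrib mult.commute)
  from cop_del[OF vspace_sc this, of h] show ?thesis unfolding cop_counit_left by (rule sym)
qed

lemma del_counit_right: "(\<Sum>a\<in>B. sc (\<epsilon> (del a h)) a) = h"
proof -
  have "bilin sc sc (\<lambda>a b. sc (\<epsilon> b) a)" unfolding bilin_def
    by (simp add: counit_add counit_scale scale_left_distrib scale_right_distrib mult.commute)
  from cop_del[OF vspace_sc this, of h] show ?thesis unfolding cop_counit_right by (rule sym)
qed

lemma del_antipode_left: "(\<Sum>a\<in>B. S a * del a h) = sc (\<epsilon> h) 1"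
proof -
  have "bilin sc sc (\<lambda>a b. S a * b)" unfolding bilin_def
    by (simp add: antipode_add antipode_scale distrib_left distrib_right sc_out)
  from cop_del[OF vspace_sc this, of h] show ?thesis unfolding cop_antipode_left by (rule sym)
qed

lemma del_antipode_right: "(\<Sum>a\<in>B. a * S (del a h)) = sc (\<epsilon> h) 1"
proof -
  have "bilin sc sc (\<lambda>a b. a * S b)" unfolding bilin_def
    by (simp add: antipode_add antipode_scale distrib_left distrib_right sc_out)
  from cop_del[OF vspace_sc this, of h] show ?thesis unfolding cop_antipode_right by (rule sym)
qed

lemma del_one: assumes "vspace sv" "bilin sc sv \<beta>" shows "(\<Sum>a\<in>B. \<beta> a (del a 1)) = \<beta> 1 1"
  unfolding cop_del[OF assms, symmetric] by (rule cop_one[OF assms])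

subsection \<open>Tensoring the regular module of the coideal subalgebra\<close>

text \<open>The matrix \<open>cmat\<close> of the coaction on \<open>N\<close> conjugates the diagonal action of \<open>n \<in> N\<close> on \<open>H \<otimes> N\<close>
  into its action on the second factor alone. Hence the character of \<open>H \<otimes> N\<close> is \<open>dim H\<close> times
  the regular character of \<open>N\<close>.\<close>

definition cmat :: "'h \<Rightarrow> 'h \<Rightarrow> 'h" where "cmat b b' = (\<Sum>a\<in>B. sc (\<xi> b' (del a b)) a)"

definition rhoN :: "'h \<Rightarrow> 'k" where "rhoN n = (\<Sum>b\<in>BN. \<xi> b (n * b))"

lemma rhoN_trace: assumes "n \<in> N" shows "op_trace N (\<lambda>x. n * x) = rhoN n"
proof -
  have "frame N BN (\<lambda>b. b) \<xi>" unfolding frame_def lin_on_def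
    using BN'(1) BN_N xi_N by (auto simp: xi_add xi_scale)
  moreover have "endo_on sc N (\<lambda>x. n * x)" unfolding endo_on_def using assms by (simp add: N_sub distrib_left sc_out)
  ultimately show ?thesis unfolding rhoN_def using op_trace_frame[OF N.subspace_A] by blast
qed

lemma cmat_coaction:
  assumes sv: "vspace sv" and b: "bilin sc sv \<beta>" and e: "e \<in> N"
  shows "(\<Sum>a\<in>B. \<beta> a (del a e)) = (\<Sum>b'\<in>BN. \<beta> (cmat e b') b')"
proof -
  interpret v: vspace sv by fact
  have "(\<Sum>a\<in>B. \<beta> a (del a e)) = (\<Sum>a\<in>B. \<beta> a (\<Sum>b'\<in>BN. sc (\<xi> b' (del a e)) b'))"
    using xi_N[OF del_N[OF e]] by simp
  also have "\<dots> = (\<Sum>a\<in>B. \<Sum>b'\<in>BN. sv (\<xi> b' (del a e)) (\<beta> a b'))"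
    by (intro sum.cong refl bilin_sum_right[OF b sv BN'(1)])
  also have "\<dots> = (\<Sum>b'\<in>BN. \<Sum>a\<in>B. sv (\<xi> b' (del a e)) (\<beta> a b'))" by (rule sum.swap)
  also have "\<dots> = (\<Sum>b'\<in>BN. \<beta> (cmat e b') b')"
    unfolding cmat_def by (intro sum.cong refl bilin_sum_left[OF b sv B'(1), symmetric])
  finally show ?thesis .
qed

lemma cmat_antipode_right:
  assumes e: "e \<in> BN" and b': "b' \<in> BN"
  shows "(\<Sum>b\<in>BN. cmat e b * S (cmat b b')) = (if e = b' then 1 else 0)"
proof -
  let ?\<beta> = "\<lambda>u v. u * S (\<Sum>a\<in>B. sc (\<xi> b' (del a v)) a)"
  have bb: "bilin sc sc ?\<beta>" unfolding bilin_def
    by (simp add: del_add del_scale xi_add xi_scale scale_left_distrib sum.distrib antipode_add distrib_left distrib_right sc_out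
        scale_scale[symmetric] scale_sum_right[symmetric] antipode_scale del: scale_scale)
  have tt: "trilin sc sc (\<lambda>x y z. sc (\<xi> b' z) (x * S y))" unfolding trilin_def bilin_def
    by (simp add: xi_add xi_scale scale_left_distrib scale_right_distrib antipode_add antipode_scale distrib_left distrib_right sc_out mult.commute)
  have "(\<Sum>b\<in>BN. cmat e b * S (cmat b b')) = (\<Sum>b\<in>BN. ?\<beta> (cmat e b) b)" unfolding cmat_def[of _ b'] ..
  also have "\<dots> = (\<Sum>a\<in>B. ?\<beta> a (del a e))" by (rule cmat_coaction[OF vspace_sc bb BN_N[OF e], symmetric])
  also have "\<dots> = (\<Sum>a\<in>B. \<Sum>a'\<in>B. sc (\<xi> b' (del a' (del a e))) (a * S a'))"
    by (simp add: antipode_sum[OF B'(1)] antipode_scale sum_distrib_left sc_out)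
  also have "\<dots> = (\<Sum>a\<in>B. \<Sum>a'\<in>B. sc (\<xi> b' (del a e)) (a' * S (del a' a)))"
    by (rule del_coassoc[OF vspace_sc tt, symmetric])
  also have "\<dots> = (\<Sum>a\<in>B. sc (\<xi> b' (sc (\<epsilon> a) (del a e))) 1)"
    by (simp add: scale_sum_right[symmetric] del_antipode_right xi_scale mult.commute)
  also have "\<dots> = sc (\<xi> b' (\<Sum>a\<in>B. sc (\<epsilon> a) (del a e))) 1" by (simp add: xi_sum[OF B'(1)] scale_sum_left)
  also have "\<dots> = (if e = b' then 1 else 0)" unfolding del_counit_left using xi_basis[of e b'] e BNB by auto
  finally show ?thesis .
qed

lemma cmat_antipode_left:
  assumes e: "e \<in> BN" and b': "b' \<in> BN"
  shows "(\<Sum>b\<in>BN. S (cmat e b) * cmat b b') = (if e = b' then 1 else 0)"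
proof -
  let ?\<beta> = "\<lambda>u v. S u * (\<Sum>a\<in>B. sc (\<xi> b' (del a v)) a)"
  have bb: "bilin sc sc ?\<beta>" unfolding bilin_def
    by (simp add: del_add del_scale xi_add xi_scale scale_left_distrib sum.distrib antipode_add distrib_left distrib_right sc_out
        scale_scale[symmetric] scale_sum_right[symmetric] antipode_scale del: scale_scale)
  have tt: "trilin sc sc (\<lambda>x y z. sc (\<xi> b' z) (S x * y))" unfolding trilin_def bilin_def
    by (simp add: xi_add xi_scale scale_left_distrib scale_right_distrib antipode_add antipode_scale distrib_left distrib_right sc_out mult.commute)
  have "(\<Sum>b\<in>BN. S (cmat e b) * cmat b b') = (\<Sum>b\<in>BN. ?\<beta> (cmat e b) b)" unfolding cmat_def[of _ b'] ..
  also have "\<dots> = (\<Sum>a\<in>B. ?\<beta> a (del a e))" by (rule cmat_coaction[OF vspace_sc bb BN_N[OF e], symmetric])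
  also have "\<dots> = (\<Sum>a\<in>B. \<Sum>a'\<in>B. sc (\<xi> b' (del a' (del a e))) (S a * a'))"
    by (simp add: sum_distrib_left sc_out)
  also have "\<dots> = (\<Sum>a\<in>B. \<Sum>a'\<in>B. sc (\<xi> b' (del a e)) (S a' * del a' a))"
    by (rule del_coassoc[OF vspace_sc tt, symmetric])
  also have "\<dots> = (\<Sum>a\<in>B. sc (\<xi> b' (sc (\<epsilon> a) (del a e))) 1)"
    by (simp add: scale_sum_right[symmetric] del_antipode_left xi_scale mult.commute)
  also have "\<dots> = sc (\<xi> b' (\<Sum>a\<in>B. sc (\<epsilon> a) (del a e))) 1" by (simp add: xi_sum[OF B'(1)] scale_sum_left)
  also have "\<dots> = (if e = b' then 1 else 0)" unfolding del_counit_left using xi_basis[of e b'] e BNB by auto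
  finally show ?thesis .
qed

lemma lam_one: "lam 1 = of_nat (card B)"
  unfolding lam_xi by (simp add: xi_basis)

lemma conv_rhoN:
  assumes n: "n \<in> N"
  shows "(\<Sum>a\<in>B. lam a * rhoN (del a n)) = of_nat (card B) * rhoN n"
proof -
  define W where "W x b' = (\<Sum>a\<in>B. sc (\<xi> x (del a n * b')) a)" for x b'
  define \<nu> where "\<nu> b' b = \<xi> b' (n * b)" for b' b
  have WC: "(\<Sum>b'\<in>BN. W x b' * cmat b b') = (\<Sum>b'\<in>BN. sc (\<nu> b' b) (cmat b' x))" if b: "b \<in> BN" for x b
  proof -
    let ?\<beta> = "\<lambda>u v. \<Sum>a\<in>B. sc (\<xi> x (del a n * v)) (a * u)"
    have bb: "bilin sc sc ?\<beta>" unfolding bilin_def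
      by (simp add: distrib_left xi_add xi_scale scale_left_distrib scale_right_distrib sum.distrib sc_out scale_sum_right mult.commute)
    have b2: "bilin sc sc (\<lambda>u v. sc (\<xi> x v) u)" unfolding bilin_def
      by (simp add: xi_add xi_scale scale_left_distrib scale_right_distrib mult.commute)
    have "(\<Sum>b'\<in>BN. W x b' * cmat b b') = (\<Sum>b'\<in>BN. ?\<beta> (cmat b b') b')" unfolding W_def by (simp add: sum_distrib_right sc_out)
    also have "\<dots> = (\<Sum>e\<in>B. ?\<beta> e (del e b))" by (rule cmat_coaction[OF vspace_sc bb BN_N[OF b], symmetric])
    also have "\<dots> = (\<Sum>a\<in>B. \<Sum>e\<in>B. sc (\<xi> x (del a n * del e b)) (a * e))" by (rule sum.swap)
    also have "\<dots> = (\<Sum>a\<in>B. sc (\<xi> x (del a (n * b))) a)" by (rule del_mult[OF vspace_sc b2, symmetric])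
    also have "\<dots> = (\<Sum>a\<in>B. \<Sum>b'\<in>BN. sc (\<nu> b' b) (sc (\<xi> x (del a b')) a))"
    proof (rule sum.cong[OF refl])
      fix a
      have "\<xi> x (del a (n * b)) = \<xi> x (del a (\<Sum>b'\<in>BN. sc (\<xi> b' (n * b)) b'))" using xi_N[of "n * b"] n BN_N[OF b] N_sub by simp
      also have "\<dots> = (\<Sum>b'\<in>BN. \<nu> b' b * \<xi> x (del a b'))" unfolding \<nu>_def by (simp add: del_sum[OF BN'(1)] xi_sum[OF BN'(1)] del_scale xi_scale)
      finally show "sc (\<xi> x (del a (n * b))) a = (\<Sum>b'\<in>BN. sc (\<nu> b' b) (sc (\<xi> x (del a b')) a))" by (simp add: scale_sum_left)
    qed
    also have "\<dots> = (\<Sum>b'\<in>BN. sc (\<nu> b' b) (cmat b' x))" unfolding cmat_def by (subst sum.swap) (simp only: scale_sum_right)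
    finally show ?thesis .
  qed
  define Y where "Y b e = T (cmat e b)" for b e
  have CY: "(\<Sum>b\<in>BN. cmat b b' * Y b e) = (if e = b' then 1 else 0)" if "e \<in> BN" "b' \<in> BN" for e b'
  proof -
    have "(\<Sum>b\<in>BN. cmat b b' * Y b e) = T (\<Sum>b\<in>BN. cmat e b * S (cmat b b'))"
      unfolding Y_def T_sum[OF BN'(1)] T_mult T_S ..
    then show ?thesis unfolding cmat_antipode_right[OF that] by (simp add: T_one T_zero)
  qed
  have YC: "(\<Sum>e\<in>BN. Y b e * cmat b' e) = (if b' = b then 1 else 0)" if "b \<in> BN" "b' \<in> BN" for b b'
  proof -
    have "(\<Sum>e\<in>BN. Y b e * cmat b' e) = T (\<Sum>e\<in>BN. S (cmat b' e) * cmat e b)"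
      unfolding Y_def T_sum[OF BN'(1)] T_mult T_S ..
    then show ?thesis unfolding cmat_antipode_left[OF that(2,1)] by (simp add: T_one T_zero)
  qed
  have WY: "W e e = (\<Sum>b\<in>BN. \<Sum>b'\<in>BN. sc (\<nu> b' b) (cmat b' e * Y b e))" if e: "e \<in> BN" for e
  proof -
    have "W e e = (\<Sum>b'\<in>BN. W e b' * (if e = b' then 1 else 0))" using BN'(1) e by (simp add: if_distrib[of "\<lambda>u. _ * u"] cong: if_cong)
    also have "\<dots> = (\<Sum>b'\<in>BN. W e b' * (\<Sum>b\<in>BN. cmat b b' * Y b e))" using CY[OF e] by (intro sum.cong refl) simp
    also have "\<dots> = (\<Sum>b\<in>BN. (\<Sum>b'\<in>BN. W e b' * cmat b b') * Y b e)"
      unfolding sum_distrib_left sum_distrib_right by (subst sum.swap) (simp only: mult.assoc)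
    also have "\<dots> = (\<Sum>b\<in>BN. \<Sum>b'\<in>BN. sc (\<nu> b' b) (cmat b' e * Y b e))"
      using WC by (intro sum.cong refl) (simp add: sum_distrib_right sc_out)
    finally show ?thesis .
  qed
  have "(\<Sum>e\<in>BN. lam (W e e)) = (\<Sum>e\<in>BN. \<Sum>b\<in>BN. \<Sum>b'\<in>BN. \<nu> b' b * lam (Y b e * cmat b' e))"
    using WY by (intro sum.cong refl) (simp add: lam_sum[OF BN'(1)] lam_scale lam_comm[of "Y _ _"])
  also have "\<dots> = (\<Sum>b\<in>BN. \<Sum>b'\<in>BN. \<nu> b' b * lam (\<Sum>e\<in>BN. Y b e * cmat b' e))"
    unfolding lam_sum[OF BN'(1)] sum_distrib_left
    by (rule trans[OF sum.swap], rule sum.cong[OF refl], rule sum.swap)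
  also have "\<dots> = (\<Sum>b\<in>BN. \<Sum>b'\<in>BN. if b' = b then \<nu> b b * of_nat (card B) else 0)"
  proof (intro sum.cong refl)
    fix b b' assume bb: "b \<in> BN" "b' \<in> BN"
    have "lam 0 = 0" using lam_scale[of 0 0] by simp
    then show "\<nu> b' b * lam (\<Sum>e\<in>BN. Y b e * cmat b' e) = (if b' = b then \<nu> b b * of_nat (card B) else 0)"
      unfolding YC[OF bb] by (simp add: lam_one)
  qed
  also have "\<dots> = of_nat (card B) * rhoN n" using BN'(1) unfolding rhoN_def \<nu>_def by (simp add: sum_distrib_left mult.commute)
  finally have 1: "(\<Sum>e\<in>BN. lam (W e e)) = of_nat (card B) * rhoN n" .
  have "(\<Sum>a\<in>B. lam a * rhoN (del a n)) = (\<Sum>e\<in>BN. lam (W e e))"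
    unfolding rhoN_def W_def lam_sum[OF B'(1)] lam_scale sum_distrib_left by (subst sum.swap) (simp add: mult.commute)
  then show ?thesis using 1 by simp
qed

end


section \<open>Tensoring representations of a coideal subalgebra with H\<close>

lemma sum_fun_apply: "(\<Sum>i\<in>K. f i) p = (\<Sum>i\<in>K. f i p)"
  by (induction K rule: infinite_finite_induct) simp_all

lemma sum_Times: "(\<Sum>p\<in>A \<times> C. F p) = (\<Sum>a\<in>A. \<Sum>c\<in>C. F (a,c))"
  by (simp add: sum.cartesian_product)

locale tensor_module = coideal_algebra sc \<Delta> \<epsilon> S N BN B
  for sc :: "'k::{alg_closed_field,field_char_0} \<Rightarrow> 'h::ring_1 \<Rightarrow> 'h"
    and \<Delta> :: "'h \<Rightarrow> ('h \<times> 'h) list" and \<epsilon> :: "'h \<Rightarrow> 'k" and S :: "'h \<Rightarrow> 'h" and N BN B +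
  fixes q :: nat and \<sigma> :: "'h \<Rightarrow> 'k mat"
  assumes \<sigma>: "is_rep sc N q \<sigma>"
begin

text \<open>The representation is extended linearly from \<open>N\<close> to \<open>H\<close>, so that it may be inserted into
  coproduct identities, which hold for maps defined on all of \<open>H\<close>.\<close>

definition sg :: "'h \<Rightarrow> nat \<Rightarrow> nat \<Rightarrow> 'k" where
  "sg v i j = \<sigma> (\<Sum>b\<in>BN. sc (\<xi> b v) b) $$ (i,j)"

lemma sg_expand: assumes "i < q" "j < q" shows "sg v i j = (\<Sum>b\<in>BN. \<xi> b v * \<sigma> b $$ (i,j))"
  unfolding sg_def by (rule N.rep_entry_sum[OF \<sigma> BN'(1) BN_N assms])

lemma sg_N: "n \<in> N \<Longrightarrow> sg n i j = \<sigma> n $$ (i,j)" unfolding sg_def by (simp add: xi_N)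

lemma sg_add: "i < q \<Longrightarrow> j < q \<Longrightarrow> sg (u + v) i j = sg u i j + sg v i j"
  and sg_scale: "i < q \<Longrightarrow> j < q \<Longrightarrow> sg (sc c u) i j = c * sg u i j"
  by (simp_all add: sg_expand xi_add xi_scale distrib_right sum.distrib sum_distrib_left mult.assoc)

lemma sg_mult: "n \<in> N \<Longrightarrow> m \<in> N \<Longrightarrow> i < q \<Longrightarrow> j < q \<Longrightarrow> sg (n * m) i j = (\<Sum>l<q. sg n i l * sg m l j)"
  using N_sub(4)[of n m] by (simp add: sg_N N.rep_entry_mult[OF \<sigma>])

lemma sg_one: "i < q \<Longrightarrow> j < q \<Longrightarrow> sg 1 i j = (if i = j then 1 else 0)"
  by (simp add: sg_N[OF N_sub(1)] N.rep_one[OF \<sigma>])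

text \<open>The module \<open>(H \<otimes> V)\<^sup>s\<close>, whose element \<open>x\<close> has the coordinates \<open>x (r, i) \<in> H\<close> with respect to the
  basis vector \<open>i\<close> of the \<open>r\<close>-th copy of \<open>V\<close>.\<close>

definition MM :: "nat \<Rightarrow> (nat \<times> nat \<Rightarrow> 'h) set" where
  "MM s = {x. \<forall>r i. \<not> (r < s \<and> i < q) \<longrightarrow> x (r,i) = 0}"

definition scx :: "'k \<Rightarrow> (nat \<times> nat \<Rightarrow> 'h) \<Rightarrow> nat \<times> nat \<Rightarrow> 'h" where "scx c x = (\<lambda>p. sc c (x p))"

definition tact :: "'h \<Rightarrow> (nat \<times> nat \<Rightarrow> 'h) \<Rightarrow> nat \<times> nat \<Rightarrow> 'h" where
  "tact n x = (\<lambda>(r,i). if i < q then \<Sum>a\<in>B. \<Sum>j<q. sc (sg (del a n) i j) (a * x (r,j)) else 0)"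

lemma tact_in: "i < q \<Longrightarrow> tact n x (r,i) = (\<Sum>a\<in>B. \<Sum>j<q. sc (sg (del a n) i j) (a * x (r,j)))"
  and tact_out: "\<not> i < q \<Longrightarrow> tact n x (r,i) = 0"
  unfolding tact_def by simp_all

sublocale X: vspace scx
  by unfold_locales (auto simp: scx_def fun_eq_iff scale_right_distrib scale_left_distrib)

lemma MM_0: "x \<in> MM s \<Longrightarrow> \<not> (r < s \<and> i < q) \<Longrightarrow> x (r,i) = 0" unfolding MM_def by blast

lemma MM_subspace: "X.subspace (MM s)"
  unfolding X.subspace_def MM_def scx_def by simp

lemma tact_MM: assumes "x \<in> MM s" shows "tact n x \<in> MM s"
  unfolding MM_def
proof (intro CollectI allI impI)
  fix r i assume o: "\<not> (r < s \<and> i < q)"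
  show "tact n x (r,i) = 0"
  proof (cases "i < q")
    case True
    then have "x (r,j) = 0" for j using o MM_0[OF assms] by blast
    then show ?thesis by (simp add: tact_in[OF True])
  qed (rule tact_out)
qed

lemma tact_add: "tact n (x + y) = tact n x + tact n y" and tact_scale: "tact n (scx c x) = scx c (tact n x)"
proof -
  show "tact n (x + y) = tact n x + tact n y"
  proof (rule ext, clarify)
    fix r i show "tact n (x + y) (r,i) = (tact n x + tact n y) (r,i)"
      by (cases "i < q") (simp_all add: tact_in tact_out distrib_left scale_right_distrib sum.distrib)
  qed
  show "tact n (scx c x) = scx c (tact n x)"
  proof (rule ext, clarify)
    fix r i show "tact n (scx c x) (r,i) = scx c (tact n x) (r,i)"
      by (cases "i < q") (simp_all add: tact_in tact_out scx_def sc_out scale_sum_right mult.commute)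
  qed
qed

lemma tact_bilin: "i < q \<Longrightarrow> bilin sc sc (\<lambda>a v. \<Sum>j<q. sc (sg v i j) (a * x (r,j)))"
  unfolding bilin_def
  by (simp add: sg_add sg_scale distrib_right scale_right_distrib scale_left_distrib sum.distrib sc_out scale_sum_right mult.commute)

lemma tact_mult: assumes n: "n \<in> N" "m \<in> N" shows "tact (n * m) x = tact n (tact m x)"
proof (rule ext, clarify)
  fix r i show "tact (n * m) x (r,i) = tact n (tact m x) (r,i)"
  proof (cases "i < q")
    case True
    have "tact (n * m) x (r,i) = (\<Sum>a\<in>B. \<Sum>e\<in>B. \<Sum>j<q. sc (sg (del a n * del e m) i j) (a * e * x (r,j)))"
      unfolding tact_in[OF True] by (rule del_mult[OF vspace_sc tact_bilin[OF True]])
    also have "\<dots> = (\<Sum>a\<in>B. \<Sum>e\<in>B. \<Sum>j<q. \<Sum>l<q. sc (sg (del a n) i l) (a * sc (sg (del e m) l j) (e * x (r,j))))"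
      using True by (intro sum.cong refl) (simp add: sg_mult del_N n scale_sum_left sc_out mult.assoc)
    also have "\<dots> = (\<Sum>a\<in>B. \<Sum>e\<in>B. \<Sum>l<q. \<Sum>j<q. sc (sg (del a n) i l) (a * sc (sg (del e m) l j) (e * x (r,j))))"
      by (rule sum.cong[OF refl], rule sum.cong[OF refl], rule sum.swap)
    also have "\<dots> = (\<Sum>a\<in>B. \<Sum>l<q. \<Sum>e\<in>B. \<Sum>j<q. sc (sg (del a n) i l) (a * sc (sg (del e m) l j) (e * x (r,j))))"
      by (rule sum.cong[OF refl], rule sum.swap)
    also have "\<dots> = tact n (tact m x) (r,i)"
      unfolding tact_in[OF True] by (intro sum.cong refl) (simp add: tact_in sum_distrib_left scale_sum_right)
    finally show ?thesis .
  qed (simp add: tact_out)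
qed

lemma tact_one: assumes "x \<in> MM s" shows "tact 1 x = x"
proof (rule ext, clarify)
  fix r i show "tact 1 x (r,i) = x (r,i)"
  proof (cases "i < q")
    case True
    have "tact 1 x (r,i) = (\<Sum>j<q. sc (sg 1 i j) (1 * x (r,j)))"
      unfolding tact_in[OF True] by (rule del_one[OF vspace_sc tact_bilin[OF True]])
    also have "\<dots> = (\<Sum>j<q. if j = i then x (r,j) else 0)" using True by (intro sum.cong refl) (simp add: sg_one)
    finally show ?thesis using True by simp
  qed (use MM_0[OF assms] in \<open>simp add: tact_out\<close>)
qed

lemma tact_plus: "tact (n + m) x = tact n x + tact m x" and tact_sc: "tact (sc c n) x = scx c (tact n x)"
proof -
  show "tact (n + m) x = tact n x + tact m x"
  proof (rule ext, clarify)
    fix r i show "tact (n + m) x (r,i) = (tact n x + tact m x) (r,i)"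
      by (cases "i < q") (simp_all add: tact_in tact_out del_add sg_add scale_left_distrib sum.distrib)
  qed
  show "tact (sc c n) x = scx c (tact n x)"
  proof (rule ext, clarify)
    fix r i show "tact (sc c n) x (r,i) = scx c (tact n x) (r,i)"
      by (cases "i < q") (simp_all add: tact_in tact_out del_scale sg_scale scx_def scale_sum_right)
  qed
qed

definition inj :: "nat \<times> nat \<Rightarrow> 'h \<Rightarrow> nat \<times> nat \<Rightarrow> 'h" where "inj p h = (\<lambda>p'. if p' = p then h else 0)"

lemma inj_lin: "inj p (h + g) = inj p h + inj p g" "inj p (sc c h) = scx c (inj p h)" "inj p 0 = 0"
  unfolding inj_def scx_def by (auto simp: fun_eq_iff)

lemma inj_MM: "p \<in> {..<s} \<times> {..<q} \<Longrightarrow> inj p h \<in> MM s" unfolding inj_def MM_def by auto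

lemma inj_sum: "finite K \<Longrightarrow> inj p (\<Sum>a\<in>K. f a) = (\<Sum>a\<in>K. inj p (f a))"
  by (induction K rule: finite_induct) (simp_all add: inj_lin)

lemma MM_expand: assumes "x \<in> MM s" shows "x = (\<Sum>p\<in>{..<s} \<times> {..<q}. inj p (x p))"
proof (rule ext, clarify)
  fix r i
  have "(\<Sum>p\<in>{..<s} \<times> {..<q}. inj p (x p)) (r,i) = (\<Sum>p\<in>{..<s} \<times> {..<q}. if p = (r,i) then x (r,i) else 0)"
    unfolding sum_fun_apply by (intro sum.cong refl) (auto simp: inj_def)
  also have "\<dots> = x (r,i)" using MM_0[OF assms, of r i] by auto
  finally show "x (r,i) = (\<Sum>p\<in>{..<s} \<times> {..<q}. inj p (x p)) (r,i)" ..
qed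

lemma MM_frame: "X.frame (MM s) (({..<s} \<times> {..<q}) \<times> B) (\<lambda>(p,b). inj p b) (\<lambda>(p,b) x. \<xi> b (x p))"
  unfolding X.frame_def
proof (intro conjI ballI)
  fix x assume x: "x \<in> MM s"
  have "x = (\<Sum>p\<in>{..<s} \<times> {..<q}. inj p (\<Sum>b\<in>B. sc (\<xi> b (x p)) b))" unfolding xi_expand by (rule MM_expand[OF x])
  also have "\<dots> = (\<Sum>p\<in>{..<s} \<times> {..<q}. \<Sum>b\<in>B. scx (\<xi> b (x p)) (inj p b))" unfolding inj_sum[OF B'(1)] inj_lin ..
  also have "\<dots> = (\<Sum>a\<in>({..<s} \<times> {..<q}) \<times> B. scx ((\<lambda>(p,b) x. \<xi> b (x p)) a x) ((\<lambda>(p,b). inj p b) a))"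
    unfolding sum.cartesian_product by (simp only: case_prod_unfold)
  finally show "x = (\<Sum>a\<in>({..<s} \<times> {..<q}) \<times> B. scx ((\<lambda>(p,b) x. \<xi> b (x p)) a x) ((\<lambda>(p,b). inj p b) a))" .
next
  fix a assume "a \<in> ({..<s} \<times> {..<q}) \<times> B"
  then show "(\<lambda>(p,b). inj p b) a \<in> MM s" by (auto intro!: inj_MM)
  show "lin_on scx (MM s) ((\<lambda>(p,b) x. \<xi> b (x p)) a)"
    unfolding lin_on_def case_prod_unfold by (simp add: xi_add xi_scale scx_def)
qed (use B' in simp)

lemma tact_endo: "endo_on scx (MM s) (tact n)"
  unfolding endo_on_def using tact_MM tact_add tact_scale by blast

lemma MM_module: "fd_module sc N scx tact (MM s)"
  by unfold_locales (use X.frame_fin_subspace[OF MM_subspace MM_frame] tact_endo tact_plus tact_sc tact_mult tact_one in auto)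

lemma MM_trace:
  assumes n: "n \<in> N"
  shows "X.op_trace (MM s) (tact n) = of_nat s * (\<Sum>a\<in>B. lam a * character N \<sigma> (del a n))"
proof -
  have e: "tact n (inj (r,i) b) (r,i) = (\<Sum>a\<in>B. sc (sg (del a n) i i) (a * b))" if "i < q" for r i b
  proof -
    have "tact n (inj (r,i) b) (r,i) = (\<Sum>a\<in>B. \<Sum>j<q. if j = i then sc (sg (del a n) i i) (a * b) else 0)"
      unfolding tact_in[OF that] by (intro sum.cong refl) (simp add: inj_def)
    then show ?thesis using that by simp
  qed
  have "X.op_trace (MM s) (tact n) = (\<Sum>a\<in>({..<s} \<times> {..<q}) \<times> B. (\<lambda>(p,b) x. \<xi> b (x p)) a (tact n ((\<lambda>(p,b). inj p b) a)))"
    by (rule X.op_trace_frame[OF MM_subspace MM_frame tact_endo])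
  also have "\<dots> = (\<Sum>r<s. \<Sum>i<q. \<Sum>b\<in>B. \<xi> b (tact n (inj (r,i) b) (r,i)))"
    unfolding sum_Times by simp
  also have "\<dots> = of_nat s * (\<Sum>i<q. \<Sum>b\<in>B. \<Sum>a\<in>B. sg (del a n) i i * \<xi> b (a * b))"
    by (simp add: e xi_sum[OF B'(1)] xi_scale)
  also have "(\<Sum>i<q. \<Sum>b\<in>B. \<Sum>a\<in>B. sg (del a n) i i * \<xi> b (a * b)) = (\<Sum>i<q. \<Sum>a\<in>B. sg (del a n) i i * lam a)"
    by (rule sum.cong[OF refl], rule trans[OF sum.swap]) (simp add: lam_xi sum_distrib_left)
  also have "\<dots> = (\<Sum>a\<in>B. lam a * (\<Sum>i<q. sg (del a n) i i))"
    by (subst sum.swap) (simp add: sum_distrib_left mult.commute)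
  also have "\<dots> = (\<Sum>a\<in>B. lam a * character N \<sigma> (del a n))"
    using del_N[OF n] by (intro sum.cong refl) (simp add: N.rep_trace[OF \<sigma>] sg_N)
  finally show ?thesis .
qed

lemma conv_character:
  obtains m :: "_ \<Rightarrow> nat" where
    "\<And>n. n \<in> N \<Longrightarrow> (\<Sum>a\<in>B. lam a * character N \<sigma> (del a n)) = (\<Sum>\<psi>\<in>N.Irr. of_nat (m \<psi>) * \<psi> n)"
proof (rule fd_module.trace_decomposition[OF MM_module[of 1]], goal_cases)
  case (1 m)
  show ?case by (rule 1(1)[of m]) (use 1(2) MM_trace[of _ 1] in simp)
qed

subsection \<open>The coaction\<close>

definition dl :: "'h \<Rightarrow> (nat \<times> nat \<Rightarrow> 'h) \<Rightarrow> nat \<times> nat \<Rightarrow> 'h" where "dl e x = (\<lambda>p. del e (x p))"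

lemma dl_MM: "x \<in> MM s \<Longrightarrow> dl e x \<in> MM s" unfolding dl_def MM_def by (simp add: del_zero)

lemma lin_inj:
  assumes f: "lin_on scx (MM s) f" and p: "p \<in> {..<s} \<times> {..<q}"
  shows "f (inj p (u + v)) = f (inj p u) + f (inj p v)" "f (inj p (sc c u)) = c * f (inj p u)"
  using f inj_MM[OF p] unfolding lin_on_def inj_lin by auto

lemma lin_MM_expand:
  assumes f: "lin_on scx (MM s) f" and x: "x \<in> MM s"
  shows "f x = (\<Sum>p\<in>{..<s} \<times> {..<q}. f (inj p (x p)))"
proof -
  have "f x = f (\<Sum>p\<in>{..<s} \<times> {..<q}. scx 1 (inj p (x p)))"
    using MM_expand[OF x] by (simp only: X.scale_one)
  also have "\<dots> = (\<Sum>p\<in>{..<s} \<times> {..<q}. 1 * f (inj p (x p)))"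
    by (rule X.lin_on_sum[OF f MM_subspace _ inj_MM]) auto
  finally show ?thesis by simp
qed

text \<open>The coefficient in \<open>H\<close> of the functional \<open>f\<close> on the second factor of the coaction.\<close>

definition coef :: "((nat \<times> nat \<Rightarrow> 'h) \<Rightarrow> 'k) \<Rightarrow> (nat \<times> nat \<Rightarrow> 'h) \<Rightarrow> 'h" where
  "coef f x = (\<Sum>e\<in>B. sc (f (dl e x)) e)"

lemma coef_expand:
  assumes f: "lin_on scx (MM s) f" and x: "x \<in> MM s"
  shows "coef f x = (\<Sum>p\<in>{..<s} \<times> {..<q}. \<Sum>e\<in>B. sc (f (inj p (del e (x p)))) e)"
  unfolding coef_def lin_MM_expand[OF f dl_MM[OF x]] scale_sum_left by (subst sum.swap) (simp only: dl_def)

lemma coef_tact: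
  assumes f: "lin_on scx (MM s) f" and x: "x \<in> MM s" and n: "n \<in> N"
  shows "coef f (tact n x) = (\<Sum>a\<in>B. \<Sum>e\<in>B. sc (f (tact (del a n) (dl e x))) (a * e))"
proof -
  let ?P = "{..<s} \<times> {..<q}"
  have 1: "(\<Sum>e\<in>B. sc (f (inj (r,i) (del e (tact n x (r,i))))) e)
      = (\<Sum>a\<in>B. \<Sum>e\<in>B. sc (f (inj (r,i) (tact (del a n) (dl e x) (r,i)))) (a * e))" if p: "(r,i) \<in> ?P" for r i
  proof -
    have i: "i < q" using p by simp
    note L = lin_inj[OF f p]
    let ?\<beta> = "\<lambda>u v. sc (f (inj (r,i) v)) u"
    let ?\<tau> = "\<lambda>u v w. \<Sum>e\<in>B. \<Sum>j<q. sc (sg w i j * f (inj (r,i) (v * del e (x (r,j))))) (u * e)"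
    have b: "bilin sc sc ?\<beta>" unfolding bilin_def
      by (simp add: L scale_left_distrib scale_right_distrib mult.commute)
    have t: "trilin sc sc ?\<tau>" unfolding trilin_def bilin_def using i
      by (simp add: L sg_add sg_scale sc_out distrib_left distrib_right scale_left_distrib scale_right_distrib
          sum.distrib scale_sum_right mult.commute mult.left_commute mult.assoc)
    have fs: "f (inj (r,i) (\<Sum>a\<in>K. \<Sum>j<q. sc (c a j) (h a j))) = (\<Sum>a\<in>K. \<Sum>j<q. c a j * f (inj (r,i) (h a j)))"
      if "finite K" for K and c :: "'h \<Rightarrow> nat \<Rightarrow> 'k" and h :: "'h \<Rightarrow> nat \<Rightarrow> 'h"
    proof -
      have 0: "f (inj (r,i) 0) = 0" using L(2)[of 0 0] by simp
      have "f (inj (r,i) (\<Sum>j\<in>J. sc (c a j) (h a j))) = (\<Sum>j\<in>J. c a j * f (inj (r,i) (h a j)))" if "finite J" for a and J :: "nat set"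
        using that by (induction J rule: finite_induct) (simp_all add: 0 L)
      then have J: "f (inj (r,i) (\<Sum>j<q. sc (c a j) (h a j))) = (\<Sum>j<q. c a j * f (inj (r,i) (h a j)))" for a by blast
      show ?thesis using \<open>finite K\<close> by (induction K rule: finite_induct) (simp_all add: 0 L J)
    qed
    have dm: "(\<Sum>e\<in>B. sc (f (inj (r,i) (del e (a * y)))) e) = (\<Sum>c\<in>B. \<Sum>e\<in>B. sc (f (inj (r,i) (del c a * del e y))) (c * e))" for a y
      by (rule del_mult[OF vspace_sc b])
    have "(\<Sum>e\<in>B. sc (f (inj (r,i) (del e (tact n x (r,i))))) e)
        = (\<Sum>e\<in>B. \<Sum>a\<in>B. \<Sum>j<q. sc (sg (del a n) i j) (sc (f (inj (r,i) (del e (a * x (r,j))))) e))"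
      unfolding tact_in[OF i] by (simp add: del_sum[OF B'(1)] del_sum del_scale fs[OF B'(1)] scale_sum_left)
    also have "\<dots> = (\<Sum>a\<in>B. \<Sum>e\<in>B. \<Sum>j<q. sc (sg (del a n) i j) (sc (f (inj (r,i) (del e (a * x (r,j))))) e))"
      by (rule sum.swap)
    also have "\<dots> = (\<Sum>a\<in>B. \<Sum>j<q. \<Sum>e\<in>B. sc (sg (del a n) i j) (sc (f (inj (r,i) (del e (a * x (r,j))))) e))"
      by (rule sum.cong[OF refl], rule sum.swap)
    also have "\<dots> = (\<Sum>a\<in>B. \<Sum>j<q. \<Sum>c\<in>B. \<Sum>e\<in>B. sc (sg (del a n) i j * f (inj (r,i) (del c a * del e (x (r,j))))) (c * e))"
      unfolding scale_sum_right[symmetric] dm by (simp add: scale_sum_right)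
    also have "\<dots> = (\<Sum>a\<in>B. \<Sum>c\<in>B. \<Sum>e\<in>B. \<Sum>j<q. sc (sg (del a n) i j * f (inj (r,i) (del c a * del e (x (r,j))))) (c * e))"
      by (rule sum.cong[OF refl], rule trans[OF sum.swap], rule sum.cong[OF refl], rule sum.swap)
    also have "\<dots> = (\<Sum>a\<in>B. \<Sum>c\<in>B. \<Sum>e\<in>B. \<Sum>j<q. sc (sg (del c (del a n)) i j * f (inj (r,i) (c * del e (x (r,j))))) (a * e))"
      by (rule del_coassoc[OF vspace_sc t])
    also have "\<dots> = (\<Sum>a\<in>B. \<Sum>e\<in>B. \<Sum>c\<in>B. \<Sum>j<q. sc (sg (del c (del a n)) i j * f (inj (r,i) (c * del e (x (r,j))))) (a * e))"
      by (rule sum.cong[OF refl], rule sum.swap)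
    also have "\<dots> = (\<Sum>a\<in>B. \<Sum>e\<in>B. sc (f (inj (r,i) (tact (del a n) (dl e x) (r,i)))) (a * e))"
      unfolding tact_in[OF i] dl_def by (simp add: fs[OF B'(1)] scale_sum_left)
    finally show ?thesis .
  qed
  have "coef f (tact n x) = (\<Sum>p\<in>?P. \<Sum>a\<in>B. \<Sum>e\<in>B. sc (f (inj p (tact (del a n) (dl e x) p))) (a * e))"
    unfolding coef_expand[OF f tact_MM[OF x]]
  proof (rule sum.cong[OF refl])
    fix p assume p: "p \<in> ?P"
    obtain r i where ri: "p = (r,i)" by (cases p)
    show "(\<Sum>e\<in>B. sc (f (inj p (del e (tact n x p)))) e) = (\<Sum>a\<in>B. \<Sum>e\<in>B. sc (f (inj p (tact (del a n) (dl e x) p))) (a * e))"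
      unfolding ri by (rule 1[OF p[unfolded ri]])
  qed
  also have "\<dots> = (\<Sum>a\<in>B. \<Sum>e\<in>B. \<Sum>p\<in>?P. sc (f (inj p (tact (del a n) (dl e x) p))) (a * e))"
    by (rule trans[OF sum.swap], rule sum.cong[OF refl], rule sum.swap)
  also have "\<dots> = (\<Sum>a\<in>B. \<Sum>e\<in>B. sc (f (tact (del a n) (dl e x))) (a * e))"
    unfolding lin_MM_expand[OF f tact_MM[OF dl_MM[OF x]]] scale_sum_left ..
  finally show ?thesis .
qed

text \<open>The coaction of the second tensor factor is cancelled by the antipode, which is how an element is recovered from its
  coefficients.\<close>

lemma coef_antipode:
  assumes f: "lin_on scx (MM s) f" and x: "x \<in> MM s"
  shows "(\<Sum>e\<in>B. S e * coef f (dl e x)) = sc (f x) 1"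
proof -
  let ?P = "{..<s} \<times> {..<q}"
  have 1: "(\<Sum>a\<in>B. \<Sum>e\<in>B. sc (f (inj p (del e (del a (x p))))) (S a * e)) = sc (f (inj p (x p))) 1" if p: "p \<in> ?P" for p
  proof -
    note L = lin_inj[OF f p]
    have t: "trilin sc sc (\<lambda>u v w. sc (f (inj p w)) (S u * v))" unfolding trilin_def bilin_def
      by (simp add: L antipode_add antipode_scale sc_out distrib_left distrib_right scale_left_distrib scale_right_distrib mult.commute)
    have "(\<Sum>a\<in>B. \<Sum>e\<in>B. sc (f (inj p (del e (del a (x p))))) (S a * e))
       = (\<Sum>a\<in>B. \<Sum>e\<in>B. sc (f (inj p (del a (x p)))) (S e * del e a))"
      by (rule del_coassoc[OF vspace_sc t, symmetric])
    also have "\<dots> = (\<Sum>a\<in>B. sc (f (inj p (sc (\<epsilon> a) (del a (x p))))) 1)"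
      by (simp add: scale_sum_right[symmetric] del_antipode_left L mult.commute)
    also have "\<dots> = sc (f (inj p (\<Sum>a\<in>B. sc (\<epsilon> a) (del a (x p))))) 1"
    proof -
      have 0: "f (inj p 0) = 0" using L(2)[of 0 0] by simp
      have "f (inj p (\<Sum>a\<in>K. h a)) = (\<Sum>a\<in>K. f (inj p (h a)))" if "finite K" for K and h :: "'h \<Rightarrow> 'h"
        using that by (induction K rule: finite_induct) (simp_all add: 0 L)
      then show ?thesis using B'(1) by (simp add: scale_sum_left)
    qed
    finally show ?thesis unfolding del_counit_left .
  qed
  have "(\<Sum>e\<in>B. S e * coef f (dl e x)) = (\<Sum>a\<in>B. \<Sum>p\<in>?P. \<Sum>e\<in>B. sc (f (inj p (del e (del a (x p))))) (S a * e))"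
    unfolding coef_expand[OF f dl_MM[OF x]] by (simp add: sum_distrib_left sc_out dl_def)
  also have "\<dots> = (\<Sum>p\<in>?P. sc (f (inj p (x p))) 1)" by (subst sum.swap) (rule sum.cong[OF refl 1])
  also have "\<dots> = sc (f x) 1" unfolding lin_MM_expand[OF f x] scale_sum_left ..
  finally show ?thesis .
qed

end


section \<open>Costable ideals of a coideal subalgebra\<close>

context coideal_algebra
begin

lemma eps_character: "restrict \<epsilon> N \<in> N.Irr" "N.rdim (restrict \<epsilon> N) = 1"
  and eps_rrep: "n \<in> N \<Longrightarrow> N.rrep (restrict \<epsilon> N) n $$ (0,0) = \<epsilon> n"
  using N.one_dim_Irr[of \<epsilon>] counit_add counit_scale counit_mult counit_one by auto

lemma left_module_H: "fd_module sc N sc (\<lambda>a x. a * x) UNIV"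
  by unfold_locales (use fin_UNIV in \<open>auto simp: endo_on_def distrib_left distrib_right sc_out mult.assoc\<close>)

lemma left_module_ideal:
  assumes "subspace I" "I \<subseteq> N" "\<And>a q. a \<in> N \<Longrightarrow> q \<in> I \<Longrightarrow> a * q \<in> I"
  shows "fd_module sc N sc (\<lambda>a x. a * x) I"
  using fd_module.submodule_fd_module[OF left_module_H] assms
  unfolding fd_module.submodule_def[OF left_module_H] by blast

lemma rhoN_lam:
  obtains m :: "_ \<Rightarrow> nat" where "\<And>n. n \<in> N \<Longrightarrow> lam n = rhoN n + (\<Sum>\<phi>\<in>N.Irr. of_nat (m \<phi>) * \<phi> n)"
proof (rule fd_module.trace_diff[OF left_module_H, of N], goal_cases)
  case 1
  show ?case unfolding fd_module.submodule_def[OF left_module_H] using N.subspace_A N_sub by blast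
next
  case (2 m)
  show ?case by (rule 2(1)[of m]) (use 2(2) rhoN_trace in \<open>simp add: lam_def\<close>)
qed

lemma rhoN_eps:
  obtains m :: "_ \<Rightarrow> nat" where "\<And>n. n \<in> N \<Longrightarrow> rhoN n = \<epsilon> n + (\<Sum>\<phi>\<in>N.Irr. of_nat (m \<phi>) * \<phi> n)"
proof -
  define K where "K = {v \<in> N. \<epsilon> v = 0}"
  have KN: "K \<subseteq> N" unfolding K_def by blast
  have sK: "subspace K" unfolding subspace_def K_def using N.zero_A N_sub eps_zero counit_add counit_scale by auto
  have iK: "a * q \<in> K" if "a \<in> N" "q \<in> K" for a q using that N_sub(4) counit_mult unfolding K_def by auto
  obtain \<beta> where b: "basis_of K \<beta>" using fin_subspace_has_basis[OF fin_subspace_subset[OF fin_UNIV sK subset_UNIV]] by blast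
  have b': "finite \<beta>" "independent \<beta>" "span \<beta> = K" using b unfolding basis_of_def by auto
  have bK: "x \<in> K" if "x \<in> \<beta>" for x using basis_of_subset[OF b] that by blast
  have one: "1 \<notin> \<beta>" using bK[of 1] counit_one unfolding K_def by auto
  define p where "p v = v - sc (\<epsilon> v) 1" for v
  have pK: "p v \<in> K" if "v \<in> N" for v
    using that N.diff_A N_sub(1,3) counit_add[of "v - sc (\<epsilon> v) 1" "sc (\<epsilon> v) 1"] unfolding p_def K_def by (simp add: counit_scale counit_one)
  have p_lin: "p (u + v) = p u + p v" "p (sc c v) = sc c (p v)" for u v c
    unfolding p_def by (simp_all add: counit_add counit_scale scale_left_distrib scale_right_diff_distrib)
  define \<eta> where "\<eta> x v = (if x = 1 then \<epsilon> v else representation \<beta> (p v) x)" for x v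
  have fr: "frame N (insert 1 \<beta>) (\<lambda>x. x) \<eta>" unfolding frame_def
  proof (intro conjI ballI)
    show "finite (insert 1 \<beta>)" using b' by simp
    fix x assume "x \<in> insert 1 \<beta>"
    then show "x \<in> N" using N_sub(1) bK KN by blast
    show "lin_on sc N (\<eta> x)" unfolding lin_on_def \<eta>_def using pK b'
      by (simp add: p_lin representation_add representation_scale counit_add counit_scale)
  next
    fix v assume v: "v \<in> N"
    have "(\<Sum>x\<in>insert 1 \<beta>. sc (\<eta> x v) x) = sc (\<epsilon> v) 1 + (\<Sum>x\<in>\<beta>. sc (representation \<beta> (p v) x) x)"
      using one b'(1) unfolding \<eta>_def by (subst sum.insert) (auto intro!: sum.cong)
    also have "\<dots> = sc (\<epsilon> v) 1 + p v" using sum_representation_eq[OF b'(2) _ b'(1) subset_refl] pK[OF v] b'(3) by simp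
    finally show "v = (\<Sum>x\<in>insert 1 \<beta>. sc (\<eta> x v) x)" unfolding p_def by simp
  qed
  have main: "rhoN n = \<epsilon> n + op_trace K (\<lambda>x. n * x)" if n: "n \<in> N" for n
  proof -
    have e: "endo_on sc N (\<lambda>x. n * x)" "endo_on sc K (\<lambda>x. n * x)"
      unfolding endo_on_def using n iK[OF n] by (simp_all add: N_sub distrib_left sc_out)
    have "rhoN n = (\<Sum>x\<in>insert 1 \<beta>. \<eta> x (n * x))"
      unfolding rhoN_trace[OF n, symmetric] by (rule op_trace_frame[OF N.subspace_A fr e(1)])
    also have "\<dots> = \<epsilon> n + (\<Sum>x\<in>\<beta>. representation \<beta> (n * x) x)"
    proof -
      have "\<eta> x (n * x) = representation \<beta> (n * x) x" if "x \<in> \<beta>" for x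
      proof -
        have "\<epsilon> (n * x) = 0" "x \<noteq> 1" using bK[OF that] one that unfolding K_def by (auto simp: counit_mult)
        then show ?thesis unfolding \<eta>_def p_def by simp
      qed
      then show ?thesis using one b'(1) by (subst sum.insert) (auto simp: \<eta>_def intro!: sum.cong)
    qed
    also have "(\<Sum>x\<in>\<beta>. representation \<beta> (n * x) x) = op_trace K (\<lambda>x. n * x)"
      by (rule op_trace_frame[OF sK basis_frame[OF b] e(2), symmetric])
    finally show ?thesis .
  qed
  show ?thesis
  proof (rule fd_module.trace_decomposition[OF left_module_ideal[OF sK KN iK]], goal_cases)
    case (3 m)
    show ?case by (rule that[of m]) (simp add: main 3)
  qed auto
qed

lemma lin_N_expand: assumes "lin_on sc N \<phi>" "n \<in> N" shows "\<phi> n = (\<Sum>b\<in>BN. \<xi> b n * \<phi> b)"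
proof -
  have "\<phi> (\<Sum>b\<in>BN. sc (\<xi> b n) b) = (\<Sum>b\<in>BN. \<xi> b n * \<phi> b)"
    by (rule lin_on_sum[OF assms(1) N.subspace_A BN'(1) BN_N])
  then show ?thesis unfolding xi_N[OF assms(2)] .
qed

lemma conv_one: assumes "lin_on sc N \<phi>" shows "(\<Sum>a\<in>B. lam a * \<phi> (del a 1)) = of_nat (card B) * \<phi> 1"
proof -
  have b: "bilin sc (*) (\<lambda>u v. lam u * (\<Sum>b\<in>BN. \<xi> b v * \<phi> b))" unfolding bilin_def
    by (simp add: lam_add lam_scale xi_add xi_scale distrib_left distrib_right sum.distrib sum_distrib_left mult.assoc mult.left_commute)
  show ?thesis using del_one[OF vspace_k b]
    unfolding lin_N_expand[OF assms N_sub(1), symmetric] lam_one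
    by (simp only: lin_N_expand[OF assms del_N[OF N_sub(1)]])
qed

text \<open>A costable ideal \<open>I \<noteq> 0\<close> has an element \<open>z\<close> acting as the identity in every irreducible
  representation that \<open>I\<close> does not kill, and it does not kill the counit. Comparing the two sides of the
  convolution formula for the regular character at \<open>1 - z\<close>, the summands of the representations killed by \<open>I\<close>
  agree, and nonnegativity of the multiplicities forces the value there of the regular character of \<open>H\<close> to
  vanish. That value is at least the dimension of \<open>N / I\<close>.\<close>

lemma costable_ideal_zero:
  assumes I: "I \<subseteq> N" "subspace I" "\<And>a q. a \<in> N \<Longrightarrow> q \<in> I \<Longrightarrow> a * q \<in> I" "\<And>a q. a \<in> N \<Longrightarrow> q \<in> I \<Longrightarrow> q * a \<in> I"
    and st: "\<And>a q. a \<in> B \<Longrightarrow> q \<in> I \<Longrightarrow> del a q \<in> I" and ne: "I \<noteq> N"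
  shows "I = {0}"
proof (rule ccontr)
  assume "I \<noteq> {0}"
  then obtain y where y: "y \<in> I" "y \<noteq> 0" using subspace_0[OF I(2)] by blast
  have "\<exists>x\<in>I. \<epsilon> x \<noteq> 0"
  proof (rule ccontr)
    assume "\<not> (\<exists>x\<in>I. \<epsilon> x \<noteq> 0)"
    then have "\<epsilon> (del a y) = 0" if "a \<in> B" for a using st[OF that y(1)] by blast
    then have "y = 0" using del_counit_right[of y] by simp
    then show False using y by simp
  qed
  then obtain x1 where x1: "x1 \<in> I" "\<epsilon> x1 \<noteq> 0" by blast
  define L where "L = {\<phi>\<in>N.Irr. \<forall>q\<in>I. N.rrep \<phi> q = 0\<^sub>m (N.rdim \<phi>) (N.rdim \<phi>)}"
  obtain z where z: "z \<in> I" "\<forall>\<phi>. \<phi> \<in> N.Irr \<longrightarrow> \<phi> \<notin> L \<longrightarrow> N.rrep \<phi> z = 1\<^sub>m (N.rdim \<phi>)"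
  proof (rule N.ideal_identity[OF I], goal_cases)
    case (5 z)
    show ?case by (rule 5(1)[OF 5(2)]) (use 5(3) L_def in blast)
  qed auto
  define w where "w = 1 - z"
  have zN: "z \<in> N" and wN: "w \<in> N" using z(1) I(1) N_sub(1) N.diff_A unfolding w_def by auto
  have split: "\<psi> w = \<psi> 1 - \<psi> z" if "lin_on sc N \<psi>" for \<psi>
  proof -
    have "\<psi> (w + z) = \<psi> w + \<psi> z" using that wN zN unfolding lin_on_def by blast
    then show ?thesis unfolding w_def by simp
  qed
  have phz: "\<phi> z = (if \<phi> \<in> L then 0 else of_nat (N.rdim \<phi>))" if "\<phi> \<in> N.Irr" for \<phi>
    using N.Irr_trace[OF that zN] z that unfolding L_def by auto
  have phw: "\<phi> w = (if \<phi> \<in> L then of_nat (N.rdim \<phi>) else 0)" if "\<phi> \<in> N.Irr" for \<phi>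
    using split[OF N.Irr_lin[OF that]] phz[OF that] N.Irr_one[OF that] by simp
  define cv where "cv \<phi> n = (\<Sum>a\<in>B. lam a * \<phi> (del a n))" for \<phi> n
  have cvk: "\<exists>k::nat. cv \<phi> w = of_nat (card B) * \<phi> w + of_nat k" if I1: "\<phi> \<in> N.Irr" for \<phi>
  proof (cases "\<phi> \<in> L")
    case True
    have l: "lin_on sc N \<phi>" by (rule N.Irr_lin[OF I1])
    have "\<phi> (del a z) = 0" if "a \<in> B" for a
      using N.Irr_trace[OF I1, of "del a z"] st[OF that z(1)] I(1) True unfolding L_def by auto
    then have cz: "cv \<phi> z = 0" unfolding cv_def by simp
    have lcv: "lin_on sc N (cv \<phi>)" unfolding lin_on_def
    proof (intro conjI ballI allI)
      fix u assume u: "u \<in> N"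
      show "cv \<phi> (u + v) = cv \<phi> u + cv \<phi> v" if v: "v \<in> N" for v
        using l del_N[OF u] del_N[OF v] unfolding cv_def lin_on_def by (simp add: del_add distrib_left sum.distrib)
      show "cv \<phi> (sc c u) = c * cv \<phi> u" for c
        using l del_N[OF u] unfolding cv_def lin_on_def by (simp add: del_scale sum_distrib_left mult.left_commute)
    qed
    have "cv \<phi> w = cv \<phi> 1" using split[OF lcv] cz by simp
    also have "\<dots> = of_nat (card B) * \<phi> w" unfolding cv_def conv_one[OF l] using phw[OF I1] N.Irr_one[OF I1] True by simp
    finally show ?thesis by (intro exI[of _ 0]) simp
  next
    case False
    interpret t: tensor_module sc \<Delta> \<epsilon> S N BN B "N.rdim \<phi>" "N.rrep \<phi>"
      by unfold_locales (rule N.Irr_is_rep[OF I1])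
    obtain m :: "_ \<Rightarrow> nat" where m: "cv \<phi> w = (\<Sum>\<psi>\<in>N.Irr. of_nat (m \<psi>) * \<psi> w)"
    proof (rule t.conv_character, goal_cases)
      case (1 m)
      show ?case by (rule 1(1)[of m]) (use 1(2)[OF wN] N.Irr_rep(2)[OF I1] in \<open>simp add: cv_def\<close>)
    qed
    have "cv \<phi> w = of_nat (\<Sum>\<psi>\<in>N.Irr. m \<psi> * (if \<psi> \<in> L then N.rdim \<psi> else 0))"
      unfolding m of_nat_sum of_nat_mult
    proof (rule sum.cong[OF refl])
      fix \<psi> assume "\<psi> \<in> N.Irr"
      from phw[OF this] show "of_nat (m \<psi>) * \<psi> w = of_nat (m \<psi>) * of_nat (if \<psi> \<in> L then N.rdim \<psi> else 0)" by simp
    qed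
    then show ?thesis using phw[OF I1] False by (intro exI[of _ "\<Sum>\<psi>\<in>N.Irr. m \<psi> * (if \<psi> \<in> L then N.rdim \<psi> else 0)"]) simp
  qed
  then obtain k where k: "\<forall>\<phi>\<in>N.Irr. cv \<phi> w = of_nat (card B) * \<phi> w + of_nat (k \<phi> :: nat)"
    using bchoice[of N.Irr "\<lambda>\<phi> k. cv \<phi> w = of_nat (card B) * \<phi> w + of_nat k"] by blast
  obtain c :: "_ \<Rightarrow> nat" where c: "\<forall>n\<in>N. rhoN n = \<epsilon> n + (\<Sum>\<phi>\<in>N.Irr. of_nat (c \<phi>) * \<phi> n)"
  proof (rule rhoN_eps, goal_cases)
    case (1 m)
    show ?case by (rule 1(1)[of m]) (use 1(2) in blast)
  qed
  have epw: "\<epsilon> w = 0"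
  proof -
    have "restrict \<epsilon> N \<notin> L"
    proof
      assume "restrict \<epsilon> N \<in> L"
      then have "N.rrep (restrict \<epsilon> N) x1 = 0\<^sub>m 1 1" using x1 unfolding L_def eps_character(2) by (auto simp: eps_character(2))
      then have "\<epsilon> x1 = 0" using eps_rrep[of x1] x1(1) I(1) by auto
      then show False using x1 by simp
    qed
    then show ?thesis using phw[OF eps_character(1)] wN by simp
  qed
  have "(\<Sum>a\<in>B. lam a * rhoN (del a w)) = (\<Sum>a\<in>B. lam (sc (\<epsilon> (del a w)) a)) + (\<Sum>a\<in>B. \<Sum>\<phi>\<in>N.Irr. of_nat (c \<phi>) * (lam a * \<phi> (del a w)))"
    using c del_N[OF wN] by (simp add: distrib_left sum.distrib sum_distrib_left lam_scale mult.commute mult.left_commute)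
  also have "\<dots> = lam w + (\<Sum>\<phi>\<in>N.Irr. of_nat (c \<phi>) * cv \<phi> w)"
    unfolding lam_sum[OF B'(1), symmetric] del_counit_right cv_def sum_distrib_left
    by (rule arg_cong[of _ _ "(+) (lam w)"], rule sum.swap)
  also have "(\<Sum>\<phi>\<in>N.Irr. of_nat (c \<phi>) * cv \<phi> w) = of_nat (card B) * (\<Sum>\<phi>\<in>N.Irr. of_nat (c \<phi>) * \<phi> w) + of_nat (\<Sum>\<phi>\<in>N.Irr. c \<phi> * k \<phi>)"
    unfolding sum_distrib_left of_nat_sum of_nat_mult sum.distrib[symmetric] using k by (intro sum.cong refl) (simp add: algebra_simps)
  also have "(\<Sum>a\<in>B. lam a * rhoN (del a w)) = of_nat (card B) * (\<Sum>\<phi>\<in>N.Irr. of_nat (c \<phi>) * \<phi> w)"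
    unfolding conv_rhoN[OF wN] using c wN epw by simp
  finally have lw: "lam w + of_nat (\<Sum>\<phi>\<in>N.Irr. c \<phi> * k \<phi>) = 0" by (simp add: add.left_commute)
  obtain m1 :: "_ \<Rightarrow> nat" where m1: "\<forall>n\<in>N. lam n = rhoN n + (\<Sum>\<phi>\<in>N.Irr. of_nat (m1 \<phi>) * \<phi> n)"
  proof (rule rhoN_lam, goal_cases)
    case (1 m)
    show ?case by (rule 1(1)[of m]) (use 1(2) in blast)
  qed
  have modN: "fd_module sc N sc (\<lambda>a x. a * x) N" by (rule left_module_ideal[OF N.subspace_A subset_refl N_sub(4)])
  have modI: "fd_module sc N sc (\<lambda>a x. a * x) I" by (rule left_module_ideal[OF I(2,1,3)])
  obtain m2 :: "_ \<Rightarrow> nat" where m2: "\<forall>n\<in>N. rhoN n = op_trace I (\<lambda>x. n * x) + (\<Sum>\<phi>\<in>N.Irr. of_nat (m2 \<phi>) * \<phi> n)"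
  proof (rule fd_module.trace_diff[OF modN, of I], goal_cases)
    case 1
    show ?case unfolding fd_module.submodule_def[OF modN] using I(1,2,3) by blast
  next
    case (2 m)
    show ?case by (rule 2(1)[of m]) (use 2(2) rhoN_trace in simp)
  qed
  obtain m3 :: "_ \<Rightarrow> nat" where m3: "\<forall>n\<in>N. op_trace I (\<lambda>x. n * x) = (\<Sum>\<phi>\<in>N.Irr. of_nat (m3 \<phi>) * \<phi> n)"
  proof (rule fd_module.trace_decomposition[OF modI], goal_cases)
    case (1 m)
    show ?case by (rule 1(1)[of m]) (use 1(2) in blast)
  qed
  let ?nat = "\<lambda>m. \<Sum>\<phi>\<in>N.Irr. m \<phi> * (if \<phi> \<in> L then N.rdim \<phi> else 0)"
  have natw: "(\<Sum>\<phi>\<in>N.Irr. of_nat (m \<phi>) * \<phi> w) = (of_nat (?nat m) :: 'k)" for m :: "_ \<Rightarrow> nat"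
    unfolding of_nat_sum of_nat_mult
  proof (rule sum.cong[OF refl])
    fix \<psi> assume "\<psi> \<in> N.Irr"
    from phw[OF this] show "of_nat (m \<psi>) * \<psi> w = of_nat (m \<psi>) * of_nat (if \<psi> \<in> L then N.rdim \<psi> else 0)" by simp
  qed
  have fI: "fin_subspace I" by (rule fin_subspace_subset[OF fin_UNIV I(2) subset_UNIV])
  obtain \<beta> where b: "basis_of I \<beta>" using fin_subspace_has_basis[OF fI] by blast
  have cards: "card \<beta> < card BN"
  proof -
    have "dim I < dim N" by (rule dim_strict_mono[OF N.fin_A I(2)]) (use I(1) ne in blast)
    moreover have "dim I = card \<beta>" using b dim_eq_card[of \<beta> I] unfolding basis_of_def by (metis span_span)
    moreover have "dim N = card BN" using BN' dim_eq_card[of BN N] by (metis span_span)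
    ultimately show ?thesis by simp
  qed
  have tz: "op_trace N (\<lambda>x. z * x) = op_trace I (\<lambda>x. z * x)"
    by (rule op_trace_sub[OF N.fin_A fI I(1)]) (use zN z(1) I(4) in \<open>auto simp: endo_on_def N_sub distrib_left sc_out\<close>)
  have "(\<Sum>\<phi>\<in>N.Irr. of_nat (m2 \<phi>) * \<phi> z) = 0"
    using m2 zN tz rhoN_trace[OF zN] by simp
  moreover have one: "of_nat (card BN) = of_nat (card \<beta>) + (\<Sum>\<phi>\<in>N.Irr. of_nat (m2 \<phi>) * \<phi> 1)"
    using m2 N_sub(1) op_trace_id[OF b] op_trace_id[OF BN] rhoN_trace[OF N_sub(1)] by simp
  moreover have "(\<Sum>\<phi>\<in>N.Irr. of_nat (m2 \<phi>) * \<phi> w) = (\<Sum>\<phi>\<in>N.Irr. of_nat (m2 \<phi>) * \<phi> 1) - (\<Sum>\<phi>\<in>N.Irr. of_nat (m2 \<phi>) * \<phi> z)"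
    unfolding sum_subtractf[symmetric] right_diff_distrib[symmetric]
  proof (rule sum.cong[OF refl])
    fix \<psi> assume "\<psi> \<in> N.Irr"
    from split[OF N.Irr_lin[OF this]] show "of_nat (m2 \<psi>) * \<psi> w = of_nat (m2 \<psi>) * (\<psi> 1 - \<psi> z)" by simp
  qed
  ultimately have "of_nat (card BN) = (of_nat (card \<beta> + ?nat m2) :: 'k)" using natw[of m2] by simp
  then have pos: "?nat m2 > 0" using cards of_nat_eq_iff[of "card BN" "card \<beta> + ?nat m2", where 'a='k] by linarith
  have "lam w = of_nat (?nat m3 + ?nat m2 + ?nat m1)"
    using m1 m2 m3 wN natw by simp
  then have "(of_nat (?nat m3 + ?nat m2 + ?nat m1 + (\<Sum>\<phi>\<in>N.Irr. c \<phi> * k \<phi>)) :: 'k) = 0" using lw by simp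
  then have "?nat m3 + ?nat m2 + ?nat m1 + (\<Sum>\<phi>\<in>N.Irr. c \<phi> * k \<phi>) = 0" by (simp only: of_nat_eq_0_iff)
  then show False using pos by linarith
qed

lemma del_expand: "(\<Sum>u\<in>B. sc (\<xi> a u) (del u h)) = del a h" if a: "a \<in> B"
proof -
  have "(\<Sum>u\<in>B. sc (\<xi> a u) (del u h)) = (\<Sum>u\<in>B. if u = a then del a h else 0)"
    by (rule sum.cong[OF refl]) (simp add: xi_basis)
  then show ?thesis using a B'(1) by simp
qed

lemma del_mult_expand: "a \<in> B \<Longrightarrow> del a (h * g) = (\<Sum>u\<in>B. \<Sum>e\<in>B. sc (\<xi> a (u * e)) (del u h * del e g))"
  using del_mult[OF vspace_sc del_bilin[of a], of h g] by (simp only: del_expand)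

lemma del_del_expand: assumes a: "a \<in> B" and e: "e \<in> B"
  shows "del e (del a h) = (\<Sum>u\<in>B. sc (\<Sum>v\<in>B. \<xi> a v * \<xi> e (del v u)) (del u h))"
proof -
  have t: "trilin sc sc (\<lambda>u v w. sc (\<xi> a u * \<xi> e v) w)" unfolding trilin_def bilin_def
    by (simp add: xi_add xi_scale distrib_left distrib_right scale_left_distrib scale_right_distrib mult.assoc mult.left_commute mult.commute)
  have "(\<Sum>u\<in>B. \<Sum>v\<in>B. sc (\<xi> a u * \<xi> e v) (del v (del u h))) = (\<Sum>u\<in>B. sc (\<xi> a u) (del e (del u h)))"
    by (simp only: scale_scale[symmetric] scale_sum_right[symmetric] del_expand[OF e])
  also have "\<dots> = del e (\<Sum>u\<in>B. sc (\<xi> a u) (del u h))" by (simp add: del_sum[OF B'(1)] del_scale)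
  finally show ?thesis using del_coassoc[OF vspace_sc t, of h] unfolding del_expand[OF a] by (simp only: scale_sum_left)
qed

text \<open>An irreducible representation tensored with \<open>H\<close> is faithful.\<close>

lemma tensor_faithful:
  assumes j: "\<phi> \<in> N.Irr" and n: "n \<in> N"
    and zero: "\<And>a c c'. \<lbrakk>a \<in> B; c < N.rdim \<phi>; c' < N.rdim \<phi>\<rbrakk> \<Longrightarrow> N.rrep \<phi> (del a n) $$ (c,c') = 0"
  shows "n = 0"
proof -
  note r = N.Irr_is_rep[OF j]
  let ?d = "N.rdim \<phi>"
  define I where "I = {n\<in>N. \<forall>a\<in>B. \<forall>c<?d. \<forall>c'<?d. N.rrep \<phi> (del a n) $$ (c,c') = 0}"
  have IN: "I \<subseteq> N" unfolding I_def by blast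
  have Iz: "N.rrep \<phi> (del a x) $$ (c,c') = 0" if "x \<in> I" "a \<in> B" "c < ?d" "c' < ?d" for x a c c' using that unfolding I_def by blast
  have II: "x \<in> I" if "x \<in> N" "\<And>a c c'. \<lbrakk>a \<in> B; c < ?d; c' < ?d\<rbrakk> \<Longrightarrow> N.rrep \<phi> (del a x) $$ (c,c') = 0" for x using that unfolding I_def by blast
  have "subspace I" unfolding subspace_def
  proof (intro conjI ballI allI)
    show "0 \<in> I" by (rule II[OF N.zero_A]) (simp add: del_zero N.rep_entry_zero[OF r])
    fix x assume x: "x \<in> I"
    show "x + y \<in> I" if y: "y \<in> I" for y
      by (rule II) (use x y IN in \<open>auto simp: del_add N.rep_entry_add[OF r] del_N Iz N_sub subset_iff\<close>)
    show "sc c x \<in> I" for c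
      by (rule II) (use x IN in \<open>auto simp: del_scale N.rep_entry_scale[OF r] del_N Iz N_sub subset_iff\<close>)
  qed
  moreover have ideal: "x * y \<in> I" if xy: "x \<in> N" "y \<in> N" "x \<in> I \<or> y \<in> I" for x y
  proof (rule II[OF N_sub(4)[OF xy(1,2)]])
    fix a c c' assume a: "a \<in> B" and cc: "c < ?d" "c' < ?d"
    have "N.rrep \<phi> (del u x * del e y) $$ (c,c') = 0" if "u \<in> B" "e \<in> B" for u e
    proof -
      have "N.rrep \<phi> (del u x) $$ (c,l) * N.rrep \<phi> (del e y) $$ (l,c') = 0" if "l < ?d" for l
        using xy(3) Iz[of x u c l] Iz[of y e l c'] \<open>u \<in> B\<close> \<open>e \<in> B\<close> cc that by auto
      then show ?thesis unfolding N.rep_entry_mult[OF r del_N[OF xy(1)] del_N[OF xy(2)] cc]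
        by (intro sum.neutral ballI) simp
    qed
    note z = this
    have m: "del u x * del e y \<in> N" for u e using del_N xy N_sub(4) by blast
    have "N.rrep \<phi> (\<Sum>u\<in>B. \<Sum>e\<in>B. sc (\<xi> a (u * e)) (del u x * del e y)) $$ (c,c')
       = (\<Sum>u\<in>B. N.rrep \<phi> (\<Sum>e\<in>B. sc (\<xi> a (u * e)) (del u x * del e y)) $$ (c,c'))"
      by (rule N.rep_entry_sum'[OF r B'(1) _ cc]) (rule subspace_sum[OF N.subspace_A], rule N_sub(3), rule m)
    also have "\<dots> = (\<Sum>u\<in>B. \<Sum>e\<in>B. \<xi> a (u * e) * N.rrep \<phi> (del u x * del e y) $$ (c,c'))"
      by (intro sum.cong refl N.rep_entry_sum[OF r B'(1) m cc])
    also have "\<dots> = 0" using z by simp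
    finally show "N.rrep \<phi> (del a (x * y)) $$ (c,c') = 0" unfolding del_mult_expand[OF a] .
  qed
  moreover have "del e x \<in> I" if e: "e \<in> B" and x: "x \<in> I" for e x
  proof (rule II)
    have xN: "x \<in> N" using x IN by blast
    then show "del e x \<in> N" by (rule del_N)
    fix a c c' assume a: "a \<in> B" and cc: "c < ?d" "c' < ?d"
    show "N.rrep \<phi> (del a (del e x)) $$ (c,c') = 0"
      unfolding del_del_expand[OF e a] N.rep_entry_sum[OF r B'(1) del_N[OF xN] cc]
      using Iz[OF x _ cc] by simp
  qed
  moreover have "I \<noteq> N"
  proof
    assume "I = N"
    then have o: "1 \<in> I" using N_sub(1) by simp
    have d: "0 < ?d" by (rule N.Irr_pos[OF j])
    have "N.rrep \<phi> (\<Sum>a\<in>B. sc (\<epsilon> a) (del a 1)) $$ (0,0) = (\<Sum>a\<in>B. \<epsilon> a * N.rrep \<phi> (del a 1) $$ (0,0))"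
      by (rule N.rep_entry_sum[OF r B'(1) del_N[OF N_sub(1)] d d])
    also have "\<dots> = 0" using Iz[OF o _ d d] by simp
    finally show False unfolding del_counit_left using N.rep_one[OF r] d by simp
  qed
  ultimately have "I = {0}"
    using IN by (intro costable_ideal_zero) auto
  moreover have "n \<in> I" by (rule II[OF n zero])
  ultimately show ?thesis by simp
qed

end


section \<open>Freeness of tensor modules over a coideal subalgebra\<close>

context coideal_algebra
begin

lemma xi_coeffs: assumes "a \<in> B" shows "\<xi> a (\<Sum>u\<in>B. sc (r u) u) = r a"
proof -
  have "\<xi> a (\<Sum>u\<in>B. sc (r u) u) = (\<Sum>u\<in>B. if u = a then r a else 0)"
    unfolding xi_sum[OF B'(1)] xi_scale by (rule sum.cong[OF refl]) (auto simp: xi_basis)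
  then show ?thesis using assms B'(1) by simp
qed

text \<open>Square matrices over the finite-dimensional algebra \<open>H\<close> act by right multiplication on rows, and are
  thereby embedded into square matrices over the field.\<close>

lemma algebra_matrix_left_right_inverse:
  fixes Y G :: "'i \<Rightarrow> 'i \<Rightarrow> 'h"
  assumes fin: "finite P"
    and YG: "\<And>i j. i \<in> P \<Longrightarrow> j \<in> P \<Longrightarrow> (\<Sum>k\<in>P. Y i k * G k j) = (if i = j then 1 else 0)"
    and ij: "i \<in> P" "j \<in> P"
  shows "(\<Sum>k\<in>P. G i k * Y k j) = (if i = j then 1 else 0)"
proof -
  define mt where "mt F p p' = \<xi> (snd p') (snd p * F (fst p) (fst p'))" for F :: "'i \<Rightarrow> 'i \<Rightarrow> 'h" and p p' :: "'i \<times> 'h"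
  have comp: "(\<Sum>k\<in>P \<times> B. mt F p k * mt F' k p') = \<xi> (snd p') (snd p * (\<Sum>k\<in>P. F (fst p) k * F' k (fst p')))" for F F' p p'
  proof -
    have "(\<Sum>e\<in>B. \<xi> e (u * v) * \<xi> b (e * w)) = \<xi> b (u * (v * w))" for u v w b
    proof -
      have "(\<Sum>e\<in>B. \<xi> e (u * v) * \<xi> b (e * w)) = \<xi> b ((\<Sum>e\<in>B. sc (\<xi> e (u * v)) e) * w)"
        by (simp add: sum_distrib_right xi_sum[OF B'(1)] xi_scale sc_out)
      then show ?thesis unfolding xi_expand mult.assoc .
    qed
    then show ?thesis unfolding mt_def sum_Times fst_conv snd_conv sum_distrib_left xi_sum[OF fin] by simp
  qed
  have left: "(\<Sum>k\<in>P \<times> B. mt Y p k * mt G k p') = (if p = p' then 1 else 0)" if "p \<in> P \<times> B" "p' \<in> P \<times> B" for p p'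
    using that YG[of "fst p" "fst p'"] unfolding comp by (cases "fst p = fst p'") (auto simp: xi_basis xi_zero mem_Times_iff prod_eq_iff)
  have right: "(\<Sum>k\<in>P \<times> B. mt G p k * mt Y k p') = (if p = p' then 1 else 0)" if "p \<in> P \<times> B" "p' \<in> P \<times> B" for p p'
    by (rule fun_matrix_left_right_inverse[OF finite_cartesian_product[OF fin B'(1)] left that])
  let ?C = "\<Sum>k\<in>P. G i k * Y k j"
  have 1: "\<xi> b' (b * ?C) = (if i = j \<and> b = b' then 1 else 0)" if "b \<in> B" "b' \<in> B" for b b'
    using right[of "(i,b)" "(j,b')"] that ij unfolding comp by simp
  have "\<xi> b' ?C = (if i = j then \<xi> b' 1 else 0)" if b': "b' \<in> B" for b'
  proof -
    have "\<xi> b' ((\<Sum>b\<in>B. sc (\<xi> b 1) b) * ?C) = (\<Sum>b\<in>B. \<xi> b 1 * \<xi> b' (b * ?C))"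
      unfolding sum_distrib_right xi_sum[OF B'(1)] by (simp only: sc_out xi_scale)
    also have "\<dots> = (\<Sum>b\<in>B. if b = b' then (if i = j then \<xi> b' 1 else 0) else 0)"
      by (rule sum.cong[OF refl]) (simp add: 1[OF _ b'])
    finally show ?thesis unfolding xi_expand using b' B'(1) by simp
  qed
  then have "(\<Sum>b\<in>B. sc (\<xi> b ?C) b) = (\<Sum>b\<in>B. sc (\<xi> b (if i = j then 1 else 0)) b)"
    by (intro sum.cong refl) (simp add: xi_zero)
  then show ?thesis unfolding xi_expand .
qed

end

context tensor_module
begin

definition cmp :: "nat \<Rightarrow> (nat \<times> nat \<Rightarrow> 'h) \<Rightarrow> nat \<times> nat \<Rightarrow> 'h" where
  "cmp r x = (\<lambda>(r',i). if r' = 0 then x (r,i) else 0)"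
definition put :: "nat \<Rightarrow> (nat \<times> nat \<Rightarrow> 'h) \<Rightarrow> nat \<times> nat \<Rightarrow> 'h" where
  "put r x = (\<lambda>(r',i). if r' = r then x (0,i) else 0)"

lemma cmp_MM: "x \<in> MM s \<Longrightarrow> cmp r x \<in> MM 1" unfolding MM_def cmp_def by auto
lemma put_MM: "r < s \<Longrightarrow> x \<in> MM 1 \<Longrightarrow> put r x \<in> MM s" unfolding MM_def put_def by auto
lemma cmp_lin: "cmp r (x + y) = cmp r x + cmp r y" "cmp r (scx c x) = scx c (cmp r x)"
  unfolding cmp_def scx_def by (auto simp: fun_eq_iff)
lemma put_lin: "put r (x + y) = put r x + put r y" "put r (scx c x) = scx c (put r x)"
  unfolding put_def scx_def by (auto simp: fun_eq_iff)
lemma cmp_tact: "cmp r (tact n x) = tact n (cmp r x)" unfolding cmp_def tact_def by (auto simp: fun_eq_iff)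
lemma put_tact: "put r (tact n x) = tact n (put r x)" unfolding put_def tact_def by (auto simp: fun_eq_iff)
lemma cmp_put: "x \<in> MM 1 \<Longrightarrow> cmp r (put r' x) = (if r = r' then x else 0)"
  unfolding cmp_def put_def MM_def by (auto simp: fun_eq_iff)

lemma put_cmp_expand: assumes "x \<in> MM s" shows "x = (\<Sum>r<s. put r (cmp r x))"
proof (rule ext, clarify)
  fix r i
  have "(\<Sum>r'<s. put r' (cmp r' x)) (r,i) = (\<Sum>r'<s. if r' = r then x (r,i) else 0)"
    unfolding sum_fun_apply by (intro sum.cong refl) (auto simp: put_def cmp_def)
  also have "\<dots> = x (r,i)" using MM_0[OF assms, of r i] by auto
  finally show "x (r,i) = (\<Sum>r<s. put r (cmp r x)) (r,i)" ..
qed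

lemma tact_zero: "tact 0 x = 0" using tact_sc[of 0 0 x] by simp

lemma MM_sum: "(\<And>k. k \<in> K \<Longrightarrow> y k \<in> MM s) \<Longrightarrow> (\<Sum>k\<in>K. y k) \<in> MM s"
  by (rule X.subspace_sum[OF MM_subspace])

lemma lin_sum: assumes "lin_on scx (MM s) h" "finite K" "\<And>k. k \<in> K \<Longrightarrow> y k \<in> MM s" shows "h (\<Sum>k\<in>K. y k) = (\<Sum>k\<in>K. h (y k))"
  using X.lin_on_sum[OF assms(1) MM_subspace assms(2,3), where c="\<lambda>_. 1"] by simp

lemma lin_0: assumes "lin_on scx (MM s) h" shows "h 0 = 0" using lin_sum[OF assms, of "{}"] by simp

lemma coef_sum: assumes h: "lin_on scx (MM s) h" "finite K" "\<And>k. k \<in> K \<Longrightarrow> y k \<in> MM s"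
  shows "coef h (\<Sum>k\<in>K. y k) = (\<Sum>k\<in>K. coef h (y k))"
proof -
  have "dl e (\<Sum>k\<in>K. y k) = (\<Sum>k\<in>K. dl e (y k))" for e
    unfolding dl_def fun_eq_iff sum_fun_apply by (simp add: del_sum[OF h(2)])
  then have "coef h (\<Sum>k\<in>K. y k) = (\<Sum>e\<in>B. \<Sum>k\<in>K. sc (h (dl e (y k))) e)"
    unfolding coef_def by (simp add: lin_sum[OF h(1,2) dl_MM[OF h(3)]] scale_sum_left)
  also have "\<dots> = (\<Sum>k\<in>K. coef h (y k))" unfolding coef_def by (rule sum.swap)
  finally show ?thesis .
qed

definition hom :: "nat \<Rightarrow> ('h \<Rightarrow> 'k) \<Rightarrow> ((nat \<times> nat \<Rightarrow> 'h) \<Rightarrow> nat \<Rightarrow> 'k) \<Rightarrow> bool" where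
  "hom s \<phi> f \<longleftrightarrow> (\<forall>c<N.rdim \<phi>. lin_on scx (MM s) (\<lambda>x. f x c)) \<and>
     (\<forall>n\<in>N. \<forall>x\<in>MM s. \<forall>c<N.rdim \<phi>. f (tact n x) c = (\<Sum>c'<N.rdim \<phi>. N.rrep \<phi> n $$ (c,c') * f x c'))"

lemma hom_lin: "hom s \<phi> f \<Longrightarrow> c < N.rdim \<phi> \<Longrightarrow> lin_on scx (MM s) (\<lambda>x. f x c)" unfolding hom_def by blast
lemma hom_act: "hom s \<phi> f \<Longrightarrow> n \<in> N \<Longrightarrow> x \<in> MM s \<Longrightarrow> c < N.rdim \<phi> \<Longrightarrow>
    f (tact n x) c = (\<Sum>c'<N.rdim \<phi>. N.rrep \<phi> n $$ (c,c') * f x c')" unfolding hom_def by blast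

lemma hom_munit:
  assumes h: "hom s \<phi> h" and phi: "\<phi> \<in> N.Irr" and x: "x \<in> MM s" and cc: "c < N.rdim \<phi>" "l < N.rdim \<phi>"
  shows "h (tact (N.munit \<psi> i l) x) c = (if \<psi> = \<phi> \<and> c = i then h x l else 0)"
proof -
  have "h (tact (N.munit \<psi> i l) x) c = (\<Sum>c'<N.rdim \<phi>. if c' = l then (if \<psi> = \<phi> \<and> c = i then h x l else 0) else 0)"
    unfolding hom_act[OF h N.munit_A x cc(1)] by (rule sum.cong[OF refl]) (use cc phi in \<open>auto simp: N.rrep_munit\<close>)
  then show ?thesis using cc(2) by simp
qed

lemma hom_cmp: assumes "hom 1 \<phi> f" shows "hom s \<phi> (\<lambda>x. f (cmp r x))"
  using assms cmp_MM unfolding hom_def lin_on_def by (simp add: cmp_lin cmp_tact)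

lemma hom_put: assumes "hom s \<phi> f" "r < s" shows "hom 1 \<phi> (\<lambda>x. f (put r x))"
  using assms(1) put_MM[OF assms(2)] unfolding hom_def lin_on_def by (simp add: put_lin put_tact)

lemma hom_quotient:
  assumes Q: "X.subspace Q" "Q \<subseteq> MM s" "\<And>n x. n \<in> N \<Longrightarrow> x \<in> Q \<Longrightarrow> tact n x \<in> Q" "Q \<noteq> MM s"
  obtains \<phi> h where "\<phi> \<in> N.Irr" "hom s \<phi> h" "\<exists>x\<in>MM s. \<exists>c<N.rdim \<phi>. h x c \<noteq> 0"
    "\<And>y c. y \<in> Q \<Longrightarrow> c < N.rdim \<phi> \<Longrightarrow> h y c = 0"
proof (rule fd_module.simple_quotient[OF MM_module[of s] _ Q(4)], goal_cases)
  case 1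
  show ?case unfolding fd_module.submodule_def[OF MM_module] using Q(1-3) by blast
next
  case (2 Y \<phi> f)
  obtain x where x: "x \<in> MM s" "x \<notin> Y" using 2(4) by blast
  show ?case
  proof (rule 2(1)[OF 2(5), of f])
    show "hom s \<phi> f" using 2(6) unfolding fd_module.module_hom_to_def[OF MM_module] hom_def .
    show "\<exists>x\<in>MM s. \<exists>c<N.rdim \<phi>. f x c \<noteq> 0" using x 2(7)[of x] by blast
    show "f y c = 0" if "y \<in> Q" "c < N.rdim \<phi>" for y c using that 2(3) 2(7)[of y] Q(2) by blast
  qed
qed

subsection \<open>Maximal families of independent homomorphisms\<close>

text \<open>Homomorphisms to the irreducible module of \<open>\<phi>\<close> together with elements dual to them. The last condition
  imitates multiplication by the matrix unit with both indices zero; as matrix units multiply correctly only modulo the radical, it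
  is imposed on the values of all homomorphisms instead of on the elements themselves.\<close>

definition family :: "('h \<Rightarrow> 'k) \<Rightarrow> nat \<Rightarrow> (nat \<Rightarrow> (nat \<times> nat \<Rightarrow> 'h) \<Rightarrow> nat \<Rightarrow> 'k) \<Rightarrow> (nat \<Rightarrow> nat \<times> nat \<Rightarrow> 'h) \<Rightarrow> bool" where
  "family \<phi> b f x \<longleftrightarrow> (\<forall>a<b. hom 1 \<phi> (f a) \<and> x a \<in> MM 1) \<and>
     (\<forall>a<b. \<forall>a'<b. f a (x a') 0 = (if a = a' then 1 else 0)) \<and>
     (\<forall>a<b. \<forall>g c. hom 1 \<phi> g \<longrightarrow> c < N.rdim \<phi> \<longrightarrow> c \<noteq> 0 \<longrightarrow> g (x a) c = 0)"

lemma family_bound: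
  assumes F: "family \<phi> b f x" and phi: "\<phi> \<in> N.Irr"
  shows "b \<le> card (({..<1::nat} \<times> {..<q}) \<times> B)"
proof -
  let ?K = "({..<1::nat} \<times> {..<q}) \<times> B"
  let ?t = "(\<lambda>(p,b). inj p b) ` ?K"
  have d: "0 < N.rdim \<phi>" by (rule N.Irr_pos[OF phi])
  have dual: "f a (x a') 0 = (if a = a' then 1 else 0)" if "a < b" "a' < b" for a a' using F that unfolding family_def by blast
  have xM: "x a \<in> MM 1" and fh: "hom 1 \<phi> (f a)" if "a < b" for a using F that unfolding family_def by blast+
  have inj: "inj_on x {..<b}"
  proof (rule inj_onI)
    fix a a' assume a: "a \<in> {..<b}" "a' \<in> {..<b}" "x a = x a'"
    then have "f a (x a) 0 = f a (x a') 0" by simp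
    then show "a = a'" using dual[of a a] dual[of a a'] a by (simp split: if_splits)
  qed
  have "X.independent (x ` {..<b})"
  proof (rule X.independent_if_scalars_zero)
    show "finite (x ` {..<b})" by simp
    fix u y assume u: "(\<Sum>v\<in>x ` {..<b}. scx (u v) v) = 0" and "y \<in> x ` {..<b}"
    then obtain a0 where a0: "a0 < b" "y = x a0" by blast
    have l: "lin_on scx (MM 1) (\<lambda>v. f a0 v 0)" by (rule hom_lin[OF fh[OF a0(1)] d])
    have "0 = f a0 (\<Sum>a<b. scx (u (x a)) (x a)) 0" using u lin_0[OF l] by (simp add: sum.reindex[OF inj])
    also have "\<dots> = (\<Sum>a<b. u (x a) * f a0 (x a) 0)" by (rule X.lin_on_sum[OF l MM_subspace]) (use xM in auto)
    also have "\<dots> = (\<Sum>a<b. if a = a0 then u (x a0) else 0)" by (rule sum.cong[OF refl]) (use dual[OF a0(1)] in auto)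
    finally show "u y = 0" using a0 by simp
  qed
  moreover have "x ` {..<b} \<subseteq> X.span ?t"
  proof
    fix y assume "y \<in> x ` {..<b}"
    then have "y \<in> MM 1" using xM by blast
    then have eq: "y = (\<Sum>a\<in>?K. scx ((\<lambda>(p,b) x. \<xi> b (x p)) a y) ((\<lambda>(p,b). inj p b) a))" using MM_frame[of 1] unfolding X.frame_def by blast
    have "(\<Sum>a\<in>?K. scx ((\<lambda>(p,b) x. \<xi> b (x p)) a y) ((\<lambda>(p,b). inj p b) a)) \<in> X.span ?t"
      by (intro X.span_sum X.span_scale X.span_base imageI)
    from back_subst[of "\<lambda>v. v \<in> X.span ?t", OF this eq[symmetric]] show "y \<in> X.span ?t" .
  qed
  moreover have ft: "finite ?t" using B'(1) by simp
  ultimately have "card (x ` {..<b}) \<le> card ?t" using X.independent_span_bound by blast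
  moreover have "card ?t \<le> card ?K" using B'(1) by (intro card_image_le) simp
  ultimately show ?thesis using card_image[OF inj] by simp
qed

text \<open>A family of largest size detects all homomorphisms: one that vanishes on the dual elements could be
  adjoined to it, after correcting a suitable element by the members of the family.\<close>

lemma complete_family:
  assumes phi: "\<phi> \<in> N.Irr"
  obtains b f x where "family \<phi> b f x"
    "\<And>g y c. \<lbrakk>hom 1 \<phi> g; \<forall>a<b. g (x a) 0 = 0; y \<in> MM 1; c < N.rdim \<phi>\<rbrakk> \<Longrightarrow> g y c = 0"
proof -
  let ?P = "\<lambda>b. \<exists>f x. family \<phi> b f x"
  have d: "0 < N.rdim \<phi>" by (rule N.Irr_pos[OF phi])
  have P0: "?P 0" unfolding family_def by simp
  have bnd: "\<And>y. ?P y \<Longrightarrow> y \<le> card (({..<1::nat} \<times> {..<q}) \<times> B)" using family_bound[OF _ phi] by blast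
  define b where "b = Greatest ?P"
  have "?P b" unfolding b_def by (rule GreatestI_nat[of ?P 0, OF P0 bnd])
  have max: "b' \<le> b" if "?P b'" for b' unfolding b_def by (rule Greatest_le_nat[of ?P b', OF that bnd])
  obtain f x where F: "family \<phi> b f x" using \<open>?P b\<close> by blast
  have dual: "f a (x a') 0 = (if a = a' then 1 else 0)" if "a < b" "a' < b" for a a' using F that unfolding family_def by blast
  have xM: "x a \<in> MM 1" and fh: "hom 1 \<phi> (f a)" if "a < b" for a using F that unfolding family_def by blast+
  have nrm: "g (x a) c = 0" if "a < b" "hom 1 \<phi> g" "c < N.rdim \<phi>" "c \<noteq> 0" for a g c using F that unfolding family_def by blast
  have "g y c = 0" if g: "hom 1 \<phi> g" "\<forall>a<b. g (x a) 0 = 0" and y: "y \<in> MM 1" and c: "c < N.rdim \<phi>" for g y c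
  proof (rule ccontr)
    assume nz: "g y c \<noteq> 0"
    define y1 where "y1 = scx (1 / g y c) (tact (N.munit \<phi> 0 c) y)"
    define z where "z = y1 + (\<Sum>a<b. scx (- f a y1 0) (x a))"
    have tM: "tact (N.munit \<phi> 0 c) y \<in> MM 1" by (rule tact_MM[OF y])
    have y1M: "y1 \<in> MM 1" unfolding y1_def by (rule X.subspace_scale[OF MM_subspace tM])
    have smM: "(\<Sum>a<b. scx (- f a y1 0) (x a)) \<in> MM 1" by (rule MM_sum, rule X.subspace_scale[OF MM_subspace], rule xM) simp
    have zM: "z \<in> MM 1" unfolding z_def by (rule X.subspace_add[OF MM_subspace y1M smM])
    have hy1: "h y1 c' = (if c' = 0 then h y c / g y c else 0)" if h: "hom 1 \<phi> h" "c' < N.rdim \<phi>" for h c'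
    proof -
      have "h y1 c' = 1 / g y c * h (tact (N.munit \<phi> 0 c) y) c'"
        using hom_lin[OF h] tM unfolding y1_def lin_on_def by blast
      then show ?thesis unfolding hom_munit[OF h(1) phi y h(2) c] by simp
    qed
    have hz: "h z c' = h y1 c' + (\<Sum>a<b. - f a y1 0 * h (x a) c')" if h: "hom 1 \<phi> h" "c' < N.rdim \<phi>" for h c'
    proof -
      have "h z c' = h y1 c' + h (\<Sum>a<b. scx (- f a y1 0) (x a)) c'"
        using hom_lin[OF h] y1M smM unfolding z_def lin_on_def by blast
      also have "h (\<Sum>a<b. scx (- f a y1 0) (x a)) c' = (\<Sum>a<b. - f a y1 0 * h (x a) c')"
        by (rule X.lin_on_sum[OF hom_lin[OF h] MM_subspace]) (use xM in auto)
      finally show ?thesis .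
    qed
    have gz: "g z 0 = 1" unfolding hz[OF g(1) d] hy1[OF g(1) d] using g(2) nz by simp
    have fz: "f a z 0 = 0" if a: "a < b" for a
    proof -
      have "(\<Sum>a'<b. - f a' y1 0 * f a (x a') 0) = (\<Sum>a'<b. if a' = a then - f a y1 0 else 0)"
        by (rule sum.cong[OF refl]) (use dual[OF a] in auto)
      then show ?thesis unfolding hz[OF fh[OF a] d] using a by simp
    qed
    have nz': "h z c' = 0" if h: "hom 1 \<phi> h" "c' < N.rdim \<phi>" "c' \<noteq> 0" for h c'
      unfolding hz[OF h(1,2)] hy1[OF h(1,2)] using nrm[OF _ h] h(3) by simp
    have "family \<phi> (Suc b) (f(b := g)) (x(b := z))" unfolding family_def
    proof (intro conjI allI impI)
      fix a assume a: "a < Suc b"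
      show "hom 1 \<phi> ((f(b := g)) a)" "(x(b := z)) a \<in> MM 1"
        using a fh g(1) xM zM by (auto simp add: less_Suc_eq simp del: One_nat_def)
      show "(f(b := g)) a ((x(b := z)) a') 0 = (if a = a' then 1 else 0)" if "a' < Suc b" for a'
        using a that gz fz dual g(2) by (auto simp add: less_Suc_eq simp del: One_nat_def)
      show "h ((x(b := z)) a) c' = 0" if "hom 1 \<phi> h" "c' < N.rdim \<phi>" "c' \<noteq> 0" for h c'
        using a that nz' nrm by (auto simp add: less_Suc_eq simp del: One_nat_def)
    qed
    then have "Suc b \<le> b" by (intro max exI)
    then show False by simp
  qed
  then show ?thesis by (rule that[OF F])
qed

subsection \<open>Generators\<close>

text \<open>If the irreducible module of \<open>\<phi>\<close> occurs \<open>b \<phi>\<close> times in the head of \<open>H \<otimes> V\<close>, and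
  \<open>b \<phi> / rdim \<phi>\<close> is largest for \<open>\<phi> = j\<close>, then \<open>(H \<otimes> V)\<^sup>s\<close> with \<open>s = rdim j\<close> is generated by \<open>R = b j\<close>
  elements, because \<open>s b \<phi> \<le> R rdim \<phi>\<close> for all \<open>\<phi>\<close>. For \<open>j\<close> there is equality, whence the square
  matrix of the coefficients in \<open>H\<close> of the homomorphisms to the module of \<open>j\<close> on the generators.\<close>

lemma generators:
  obtains j R g f x where "j \<in> N.Irr" and
    "\<And>i. i < (R::nat) \<Longrightarrow> g i \<in> MM (N.rdim j)" "family j R f x"
    "\<And>y. y \<in> MM (N.rdim j) \<Longrightarrow> \<exists>\<nu>. (\<forall>i. \<nu> i \<in> N) \<and> y = (\<Sum>i<R. tact (\<nu> i) (g i))"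
proof -
  let ?cf = "\<lambda>\<phi> t. family \<phi> (fst t) (fst (snd t)) (snd (snd t)) \<and>
    (\<forall>g y c. hom 1 \<phi> g \<longrightarrow> (\<forall>a<fst t. g (snd (snd t) a) 0 = 0) \<longrightarrow> y \<in> MM 1 \<longrightarrow> c < N.rdim \<phi> \<longrightarrow> g y c = 0)"
  have "\<forall>\<phi>\<in>N.Irr. \<exists>t. ?cf \<phi> t"
  proof
    fix \<phi> assume phi: "\<phi> \<in> N.Irr"
    show "\<exists>t. ?cf \<phi> t"
    proof (rule complete_family[OF phi], goal_cases)
      case (1 b f x)
      show ?case by (rule exI[of _ "(b,f,x)"]) (use 1 in simp)
    qed
  qed
  from bchoice[OF this] obtain t where t: "\<forall>\<phi>\<in>N.Irr. ?cf \<phi> (t \<phi>)" ..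
  define b f x where "b \<phi> = fst (t \<phi>)" and "f \<phi> = fst (snd (t \<phi>))" and "x \<phi> = snd (snd (t \<phi>))" for \<phi>
  have fam: "family \<phi> (b \<phi>) (f \<phi>) (x \<phi>)" if "\<phi> \<in> N.Irr" for \<phi> using t that unfolding b_def f_def x_def by blast
  have compl: "g y c = 0" if "\<phi> \<in> N.Irr" "hom 1 \<phi> g" "\<forall>a<b \<phi>. g (x \<phi> a) 0 = 0" "y \<in> MM 1" "c < N.rdim \<phi>" for \<phi> g y c
    by (rule conjunct2[OF bspec[OF t that(1)], rule_format, OF that(2) _ that(4,5)]) (use that(3) in \<open>simp add: b_def x_def\<close>)
  have xM: "x \<phi> a \<in> MM 1" if "\<phi> \<in> N.Irr" "a < b \<phi>" for \<phi> a using fam[OF that(1)] that(2) unfolding family_def by blast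
  let ?r = "\<lambda>\<phi>. real (b \<phi>) / real (N.rdim \<phi>)"
  have "Max (?r ` N.Irr) \<in> ?r ` N.Irr" using eps_character(1) N.finite_Irr by (intro Max_in) auto
  then obtain j where j: "j \<in> N.Irr" "?r j = Max (?r ` N.Irr)" by fastforce
  have ratio: "b \<phi> * N.rdim j \<le> b j * N.rdim \<phi>" if phi: "\<phi> \<in> N.Irr" for \<phi>
  proof -
    have "?r \<phi> \<le> ?r j" unfolding j(2) using phi N.finite_Irr by (intro Max_ge) auto
    then have "real (b \<phi>) * real (N.rdim j) \<le> real (b j) * real (N.rdim \<phi>)"
      using N.Irr_pos[OF phi] N.Irr_pos[OF j(1)] by (simp add: divide_le_eq le_divide_eq field_simps)
    then show ?thesis by (simp only: of_nat_mult[symmetric] of_nat_le_iff)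
  qed
  define s where "s = N.rdim j"
  define R' where "R' = b j"
  define D where "D \<phi> = {..<s} \<times> {..<b \<phi>}" for \<phi>
  have fD: "finite (D \<phi>)" for \<phi> unfolding D_def by simp
  have "\<forall>\<phi>\<in>N.Irr. \<exists>h. h ` D \<phi> \<subseteq> {..<R'} \<times> {..<N.rdim \<phi>} \<and> inj_on h (D \<phi>)"
    using ratio by (intro ballI card_le_inj) (auto simp: D_def s_def R'_def card_cartesian_product mult.commute)
  from bchoice[OF this] obtain \<iota> where \<iota>: "\<forall>\<phi>\<in>N.Irr. \<iota> \<phi> ` D \<phi> \<subseteq> {..<R'} \<times> {..<N.rdim \<phi>} \<and> inj_on (\<iota> \<phi>) (D \<phi>)" ..
  define trm where "trm \<phi> p = tact (N.munit \<phi> (snd (\<iota> \<phi> p)) 0) (put (fst p) (x \<phi> (snd p)))" for \<phi> p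
  define g where "g i = (\<Sum>\<phi>\<in>N.Irr. \<Sum>p\<in>D \<phi>. if fst (\<iota> \<phi> p) = i then trm \<phi> p else 0)" for i
  have pM: "put (fst p) (x \<phi> (snd p)) \<in> MM s" if "\<phi> \<in> N.Irr" "p \<in> D \<phi>" for \<phi> p
    using that xM[of \<phi> "snd p"] put_MM[of "fst p" s] unfolding D_def by auto
  have tM: "(if fst (\<iota> \<phi> p) = i then trm \<phi> p else 0) \<in> MM s" if "\<phi> \<in> N.Irr" "p \<in> D \<phi>" for \<phi> p i
    using tact_MM[OF pM[OF that]] X.subspace_0[OF MM_subspace] unfolding trm_def by simp
  have gM: "g i \<in> MM s" for i unfolding g_def by (intro MM_sum tM)
  have hg: "h (g (fst (\<iota> \<phi> p0))) (snd (\<iota> \<phi> p0)) = h (put (fst p0) (x \<phi> (snd p0))) 0"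
    if phi: "\<phi> \<in> N.Irr" and h: "hom s \<phi> h" and p0: "p0 \<in> D \<phi>" for \<phi> h p0
  proof -
    let ?i = "fst (\<iota> \<phi> p0)" and ?c = "snd (\<iota> \<phi> p0)" and ?v = "h (put (fst p0) (x \<phi> (snd p0))) 0"
    have "\<iota> \<phi> p0 \<in> {..<R'} \<times> {..<N.rdim \<phi>}" using \<iota> phi p0 by blast
    then have c: "?c < N.rdim \<phi>" by auto
    have d: "0 < N.rdim \<phi>" by (rule N.Irr_pos[OF phi])
    have inj: "\<iota> \<phi> p = \<iota> \<phi> p0 \<longleftrightarrow> p = p0" if "p \<in> D \<phi>" for p
      using \<iota> phi p0 that unfolding inj_on_def by blast
    have l: "lin_on scx (MM s) (\<lambda>y. h y ?c)" by (rule hom_lin[OF h c])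
    have "h (g ?i) ?c = (\<Sum>\<psi>\<in>N.Irr. h (\<Sum>p\<in>D \<psi>. if fst (\<iota> \<psi> p) = ?i then trm \<psi> p else 0) ?c)"
      unfolding g_def by (rule lin_sum[OF l N.finite_Irr]) (intro MM_sum tM)
    also have "\<dots> = (\<Sum>\<psi>\<in>N.Irr. \<Sum>p\<in>D \<psi>. h (if fst (\<iota> \<psi> p) = ?i then trm \<psi> p else 0) ?c)"
      by (rule sum.cong[OF refl]) (rule lin_sum[OF l fD], rule tM)
    also have "\<dots> = (\<Sum>\<psi>\<in>N.Irr. \<Sum>p\<in>D \<psi>. if \<psi> = \<phi> \<and> p = p0 then ?v else 0)"
    proof (intro sum.cong refl)
      fix \<psi> p assume psi: "\<psi> \<in> N.Irr" and p: "p \<in> D \<psi>"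
      show "h (if fst (\<iota> \<psi> p) = ?i then trm \<psi> p else 0) ?c = (if \<psi> = \<phi> \<and> p = p0 then ?v else 0)"
      proof (cases "fst (\<iota> \<psi> p) = ?i")
        case True
        have "h (trm \<psi> p) ?c = (if \<psi> = \<phi> \<and> ?c = snd (\<iota> \<psi> p) then h (put (fst p) (x \<psi> (snd p))) 0 else 0)"
          unfolding trm_def by (rule hom_munit[OF h phi pM[OF psi p] c d])
        moreover have "p = p0" if "\<psi> = \<phi>" "?c = snd (\<iota> \<psi> p)" using inj[of p] p True that by (simp add: prod_eq_iff)
        ultimately show ?thesis using True by auto
      next
        case False
        then show ?thesis using lin_0[OF l] by auto
      qed
    qed
    also have "\<dots> = (\<Sum>\<psi>\<in>N.Irr. if \<psi> = \<phi> then ?v else 0)"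
    proof (rule sum.cong[OF refl])
      fix \<psi>
      show "(\<Sum>p\<in>D \<psi>. if \<psi> = \<phi> \<and> p = p0 then ?v else 0) = (if \<psi> = \<phi> then ?v else 0)"
        using p0 fD by (cases "\<psi> = \<phi>") simp_all
    qed
    also have "\<dots> = ?v" using phi N.finite_Irr by simp
    finally show ?thesis .
  qed
  define Q where "Q = {(\<Sum>i<R'. tact (\<nu> i) (g i)) | \<nu>. \<forall>i. \<nu> i \<in> N}"
  have QI: "(\<Sum>i<R'. tact (\<nu> i) (g i)) \<in> Q" if "\<forall>i. \<nu> i \<in> N" for \<nu> using that unfolding Q_def by blast
  have sQ: "X.subspace Q" unfolding X.subspace_def
  proof (intro conjI ballI allI)
    show "0 \<in> Q" using QI[of "\<lambda>_. 0"] N.zero_A by (simp add: tact_zero)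
    fix u assume "u \<in> Q"
    then obtain \<nu> where u: "u = (\<Sum>i<R'. tact (\<nu> i) (g i))" "\<forall>i. \<nu> i \<in> N" unfolding Q_def by blast
    show "u + v \<in> Q" if vQ: "v \<in> Q" for v
    proof -
      obtain \<mu> where v: "v = (\<Sum>i<R'. tact (\<mu> i) (g i))" "\<forall>i. \<mu> i \<in> N" using vQ unfolding Q_def by blast
      show ?thesis using QI[of "\<lambda>i. \<nu> i + \<mu> i"] u v N_sub(2) by (simp add: tact_plus sum.distrib)
    qed
    show "scx c u \<in> Q" for c
      using QI[of "\<lambda>i. sc c (\<nu> i)"] u N_sub(3) by (simp add: tact_sc X.scale_sum_right)
  qed
  have QM: "Q \<subseteq> MM s"
  proof
    fix y assume "y \<in> Q"
    then obtain \<nu> where y: "y = (\<Sum>i<R'. tact (\<nu> i) (g i))" unfolding Q_def by blast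
    show "y \<in> MM s" unfolding y by (rule MM_sum, rule tact_MM, rule gM)
  qed
  have Qact: "tact n u \<in> Q" if n: "n \<in> N" and uQ: "u \<in> Q" for n u
  proof -
    obtain \<nu> where u: "u = (\<Sum>i<R'. tact (\<nu> i) (g i))" "\<forall>i. \<nu> i \<in> N" using uQ unfolding Q_def by blast
    have t0: "tact n 0 = 0" using tact_scale[of n 0 0] by simp
    have "tact n (\<Sum>i\<in>K. tact (\<nu> i) (g i)) = (\<Sum>i\<in>K. tact (n * \<nu> i) (g i))" if "finite K" for K
      using that
    proof (induction K rule: finite_induct)
      case (insert i K)
      then show ?case by (simp only: sum.insert[OF insert(1,2)] tact_add tact_mult[OF n u(2)[rule_format]])
    qed (simp only: sum.empty t0)
    then show ?thesis using QI[of "\<lambda>i. n * \<nu> i"] u n N_sub(4) by simp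
  qed
  have "Q = MM s"
  proof (rule ccontr)
    assume ne: "Q \<noteq> MM s"
    show False
    proof (rule hom_quotient[OF sQ QM Qact ne], goal_cases)
      case (3 \<phi> h)
      note phi = 3(1) and h = 3(2) and van = 3(4)
      have hgi: "h (g i) c = 0" if "i < R'" "c < N.rdim \<phi>" for i c
      proof -
        have "g i = (\<Sum>i'<R'. if i' = i then g i else 0)" using that by simp
        also have "\<dots> = (\<Sum>i'<R'. tact (if i' = i then 1 else 0) (g i'))"
          by (rule sum.cong[OF refl]) (simp add: tact_zero tact_one[OF gM])
        also have "\<dots> \<in> Q" by (rule QI) (simp add: N_sub(1) N.zero_A)
        finally show ?thesis using van that(2) by blast
      qed
      have z: "h (put r y) c = 0" if r: "r < s" and "y \<in> MM 1" "c < N.rdim \<phi>" for r y c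
      proof (rule compl[OF phi hom_put[OF h r] _ that(2,3)], intro allI impI)
        fix a assume "a < b \<phi>"
        then have p: "(r,a) \<in> D \<phi>" using r unfolding D_def by simp
        have "\<iota> \<phi> (r,a) \<in> {..<R'} \<times> {..<N.rdim \<phi>}" using \<iota> phi p by blast
        then have "h (g (fst (\<iota> \<phi> (r,a)))) (snd (\<iota> \<phi> (r,a))) = 0" by (intro hgi) auto
        then show "h (put r (x \<phi> a)) 0 = 0" using hg[OF phi h p] by simp
      qed
      obtain y c where y: "y \<in> MM s" "c < N.rdim \<phi>" "h y c \<noteq> 0" using 3(3) by blast
      have "h (\<Sum>r<s. put r (cmp r y)) c = (\<Sum>r<s. h (put r (cmp r y)) c)"
        by (rule lin_sum[OF hom_lin[OF h y(2)]]) (use put_MM cmp_MM[OF y(1)] in auto)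
      also have "\<dots> = 0" using z cmp_MM[OF y(1)] y(2) by simp
      finally have "h y c = 0" using put_cmp_expand[OF y(1)] by simp
      then show ?case using y by simp
    qed auto
  qed
  have gen: "\<exists>\<nu>. (\<forall>i. \<nu> i \<in> N) \<and> y = (\<Sum>i<R'. tact (\<nu> i) (g i))" if "y \<in> MM s" for y
  proof -
    have "y \<in> Q" using that \<open>Q = MM s\<close> by simp
    then show ?thesis unfolding Q_def by blast
  qed
  show ?thesis by (rule that[of j R' g "f j" "x j", OF j(1)]) (use gM gen fam[OF j(1)] in \<open>simp_all add: s_def R'_def\<close>)
qed

text \<open>Applying the antipode to the coaction of an element written in terms of the generators shows that
  the matrix of coefficients has a left inverse. It is therefore invertible, and a relation between the
  generators has its coefficients annihilated by the module of \<open>j\<close> tensored with \<open>H\<close>, which is faithful.\<close>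

theorem tensor_free:
  obtains s R g where "0 < (s::nat)" and "\<And>i. i < (R::nat) \<Longrightarrow> g i \<in> MM s"
    and "\<And>y. y \<in> MM s \<Longrightarrow> \<exists>\<nu>. (\<forall>i. \<nu> i \<in> N) \<and> y = (\<Sum>i<R. tact (\<nu> i) (g i))"
    and "\<And>\<nu> i. \<lbrakk>\<forall>i. \<nu> i \<in> N; (\<Sum>i<R. tact (\<nu> i) (g i)) = 0; i < R\<rbrakk> \<Longrightarrow> \<nu> i = 0"
proof (rule generators, goal_cases)
  case (1 j R g f x)
  note j = 1(2) and gM = 1(3) and fam = 1(4) and gen = 1(5)
  define s where "s = N.rdim j"
  have s0: "0 < s" unfolding s_def by (rule N.Irr_pos[OF j])
  have "\<forall>y\<in>MM s. \<exists>\<nu>. (\<forall>i. \<nu> i \<in> N) \<and> y = (\<Sum>i<R. tact (\<nu> i) (g i))" unfolding s_def by (rule ballI, rule gen)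
  from bchoice[OF this] obtain nu where nu: "\<forall>y\<in>MM s. (\<forall>i. nu y i \<in> N) \<and> y = (\<Sum>i<R. tact (nu y i) (g i))" ..
  have gMs: "g i \<in> MM s" if "i < R" for i using gM[OF that] unfolding s_def .
  define P where "P = {..<R} \<times> {..<s}"
  have fP: "finite P" unfolding P_def by simp
  define F where "F Q y c = f (fst Q) (cmp (snd Q) y) c" for Q :: "nat \<times> nat" and y and c :: nat
  define XX where "XX Q = put (snd Q) (x (fst Q))" for Q :: "nat \<times> nat"
  have fh: "hom 1 j (f a)" and xM: "x a \<in> MM 1" if "a < R" for a using fam that unfolding family_def by blast+
  have Fh: "hom s j (F Q)" if "Q \<in> P" for Q
    using hom_cmp[OF fh[of "fst Q"], of s "snd Q"] that unfolding P_def F_def by auto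
  have Fl: "lin_on scx (MM s) (\<lambda>y. F Q y c)" if "Q \<in> P" "c < s" for Q c
    using hom_lin[OF Fh[OF that(1)]] that(2) unfolding s_def by blast
  have XM: "XX Q \<in> MM s" if "Q \<in> P" for Q using that put_MM[of "snd Q" s] xM[of "fst Q"] unfolding P_def XX_def by auto
  have FX: "F Q (XX Q') 0 = (if Q = Q' then 1 else 0)" if Q: "Q \<in> P" "Q' \<in> P" for Q Q'
  proof -
    have a: "fst Q < R" "fst Q' < R" using Q unfolding P_def by auto
    have "f (fst Q) 0 0 = 0" using lin_0[OF hom_lin[OF fh[OF a(1)] N.Irr_pos[OF j]]] .
    moreover have "f (fst Q) (x (fst Q')) 0 = (if fst Q = fst Q' then 1 else 0)" using fam a unfolding family_def by blast
    ultimately show ?thesis unfolding F_def XX_def cmp_put[OF xM[OF a(2)]] by (auto simp: prod_eq_iff)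
  qed
  define D where "D c c' n = (\<Sum>a\<in>B. sc (N.rrep j (del a n) $$ (c,c')) a)" for c c' n
  define G where "G k Q = coef (\<lambda>y. F Q y (snd k)) (g (fst k))" for k Q
  have key: "coef (\<lambda>y. F Q y c) (tact n (g i)) = (\<Sum>c'<s. D c c' n * G (i,c') Q)"
    if n: "n \<in> N" and i: "i < R" and Q: "Q \<in> P" and c: "c < s" for n i Q c
  proof -
    have "coef (\<lambda>y. F Q y c) (tact n (g i)) = (\<Sum>a\<in>B. \<Sum>e\<in>B. sc (F Q (tact (del a n) (dl e (g i))) c) (a * e))"
      by (rule coef_tact[OF Fl[OF Q c] gMs[OF i] n])
    also have "\<dots> = (\<Sum>a\<in>B. \<Sum>e\<in>B. \<Sum>c'<s. sc (N.rrep j (del a n) $$ (c,c') * F Q (dl e (g i)) c') (a * e))"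
      using hom_act[OF Fh[OF Q] del_N[OF n] dl_MM[OF gMs[OF i]]] c unfolding s_def by (simp add: scale_sum_left)
    also have "\<dots> = (\<Sum>a\<in>B. \<Sum>c'<s. \<Sum>e\<in>B. sc (N.rrep j (del a n) $$ (c,c') * F Q (dl e (g i)) c') (a * e))"
      by (rule sum.cong[OF refl], rule sum.swap)
    also have "\<dots> = (\<Sum>c'<s. \<Sum>a\<in>B. \<Sum>e\<in>B. sc (N.rrep j (del a n) $$ (c,c') * F Q (dl e (g i)) c') (a * e))"
      by (rule sum.swap)
    also have "\<dots> = (\<Sum>c'<s. D c c' n * G (i,c') Q)"
      unfolding D_def G_def coef_def fst_conv snd_conv sum_product by (simp add: sc_out mult.commute)
    finally show ?thesis .
  qed
  have coef_gen: "coef (\<lambda>y. F Q y c) (\<Sum>i<R. tact (\<nu> i) (g i)) = (\<Sum>k\<in>P. D c (snd k) (\<nu> (fst k)) * G k Q)"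
    if \<nu>: "\<forall>i. \<nu> i \<in> N" and Q: "Q \<in> P" and c: "c < s" for \<nu> Q c
  proof -
    have "coef (\<lambda>y. F Q y c) (\<Sum>i<R. tact (\<nu> i) (g i)) = (\<Sum>i<R. coef (\<lambda>y. F Q y c) (tact (\<nu> i) (g i)))"
      by (rule coef_sum[OF Fl[OF Q c]]) (use tact_MM gMs in auto)
    also have "\<dots> = (\<Sum>i<R. \<Sum>c'<s. D c c' (\<nu> i) * G (i,c') Q)"
      by (rule sum.cong[OF refl], rule key) (use \<nu> Q c in auto)
    finally show ?thesis unfolding P_def sum_Times fst_conv snd_conv .
  qed
  define Y where "Y Q k = (\<Sum>e\<in>B. S e * D 0 (snd k) (nu (dl e (XX Q)) (fst k)))" for Q and k :: "nat \<times> nat"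
  have YG: "(\<Sum>k\<in>P. Y Q' k * G k Q) = (if Q' = Q then 1 else 0)" if Q: "Q' \<in> P" "Q \<in> P" for Q' Q
  proof -
    have n: "(\<forall>i. nu (dl e (XX Q')) i \<in> N) \<and> dl e (XX Q') = (\<Sum>i<R. tact (nu (dl e (XX Q')) i) (g i))" for e
      by (rule bspec[OF nu dl_MM[OF XM[OF Q(1)]]])
    have "(\<Sum>k\<in>P. Y Q' k * G k Q) = (\<Sum>k\<in>P. \<Sum>e\<in>B. S e * (D 0 (snd k) (nu (dl e (XX Q')) (fst k)) * G k Q))"
      unfolding Y_def by (simp add: sum_distrib_right mult.assoc)
    also have "\<dots> = (\<Sum>e\<in>B. S e * (\<Sum>k\<in>P. D 0 (snd k) (nu (dl e (XX Q')) (fst k)) * G k Q))"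
      unfolding sum_distrib_left by (rule sum.swap)
    also have "\<dots> = (\<Sum>e\<in>B. S e * coef (\<lambda>y. F Q y 0) (dl e (XX Q')))"
    proof (rule sum.cong[OF refl])
      fix e
      note ne = n[of e]
      have "coef (\<lambda>y. F Q y 0) (dl e (XX Q')) = coef (\<lambda>y. F Q y 0) (\<Sum>i<R. tact (nu (dl e (XX Q')) i) (g i))"
        by (rule arg_cong[OF conjunct2[OF ne]])
      also have "\<dots> = (\<Sum>k\<in>P. D 0 (snd k) (nu (dl e (XX Q')) (fst k)) * G k Q)"
        by (rule coef_gen[OF conjunct1[OF ne] Q(2) s0])
      finally show "S e * (\<Sum>k\<in>P. D 0 (snd k) (nu (dl e (XX Q')) (fst k)) * G k Q) = S e * coef (\<lambda>y. F Q y 0) (dl e (XX Q'))" by simp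
    qed
    also have "\<dots> = sc (F Q (XX Q') 0) 1" by (rule coef_antipode[OF Fl[OF Q(2) s0] XM[OF Q(1)]])
    finally show ?thesis unfolding FX[OF Q(2,1)] by auto
  qed
  have GY: "(\<Sum>Q\<in>P. G k Q * Y Q k') = (if k = k' then 1 else 0)" if "k \<in> P" "k' \<in> P" for k k'
    by (rule algebra_matrix_left_right_inverse[OF fP YG that])
  show ?case
  proof (rule 1(1)[of s R g])
    show "0 < s" by (rule s0)
    show "g i \<in> MM s" if "i < R" for i by (rule gMs[OF that])
    show "\<exists>\<nu>. (\<forall>i. \<nu> i \<in> N) \<and> y = (\<Sum>i<R. tact (\<nu> i) (g i))" if "y \<in> MM s" for y
      by (rule exI, rule bspec[OF nu that])
    fix \<nu> i assume \<nu>: "\<forall>i. \<nu> i \<in> N" "(\<Sum>i<R. tact (\<nu> i) (g i)) = 0" and i: "i < R"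
    have D0: "D c c' (\<nu> i) = 0" if c: "c < s" "c' < s" for c c'
    proof -
      have k0: "(i,c') \<in> P" using i c unfolding P_def by simp
      let ?D = "\<lambda>k. D c (snd k) (\<nu> (fst k))"
      have DG: "(\<Sum>k\<in>P. ?D k * G k Q) = 0" if Q: "Q \<in> P" for Q
        using coef_gen[OF \<nu>(1) Q c(1)] coef_sum[OF Fl[OF Q c(1)], of "{}"] unfolding \<nu>(2) by simp
      have "?D (i,c') = (\<Sum>k\<in>P. if k = (i,c') then ?D k else 0)" using k0 fP by simp
      also have "\<dots> = (\<Sum>k\<in>P. ?D k * (\<Sum>Q\<in>P. G k Q * Y Q (i,c')))"
        by (rule sum.cong[OF refl]) (simp add: GY[OF _ k0])
      also have "\<dots> = (\<Sum>Q\<in>P. (\<Sum>k\<in>P. ?D k * G k Q) * Y Q (i,c'))"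
        unfolding sum_distrib_left sum_distrib_right mult.assoc by (rule sum.swap)
      also have "\<dots> = 0" using DG by simp
      finally show ?thesis by simp
    qed
    show "\<nu> i = 0"
    proof (rule tensor_faithful[OF j])
      show "\<nu> i \<in> N" using \<nu>(1) by blast
      fix a c c' assume "a \<in> B" "c < N.rdim j" "c' < N.rdim j"
      then show "N.rrep j (del a (\<nu> i)) $$ (c,c') = 0"
        using xi_coeffs[of a "\<lambda>a. N.rrep j (del a (\<nu> i)) $$ (c,c')"] D0[of c c'] xi_zero unfolding D_def s_def by simp
    qed
  qed
qed

text \<open>The trace of the action on the free module is computed in the frame transported from a basis of \<open>N\<close>.\<close>

lemma free_trace:
  obtains s R :: nat where "0 < s" "\<And>n. n \<in> N \<Longrightarrow> of_nat s * (\<Sum>a\<in>B. lam a * character N \<sigma> (del a n)) = of_nat R * rhoN n"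
proof (rule tensor_free, goal_cases)
  case (1 s R g)
  note s0 = 1(2) and gM = 1(3) and gen = 1(4) and free = 1(5)
  have "\<forall>y\<in>MM s. \<exists>\<nu>. (\<forall>i. \<nu> i \<in> N) \<and> y = (\<Sum>i<R. tact (\<nu> i) (g i))" by (rule ballI, rule gen)
  from bchoice[OF this] obtain nu where nu: "\<forall>y\<in>MM s. (\<forall>i. nu y i \<in> N) \<and> y = (\<Sum>i<R. tact (nu y i) (g i))" ..
  have nuN: "nu y i \<in> N" if "y \<in> MM s" for y i by (rule conjunct1[OF bspec[OF nu that], rule_format])
  have nuE: "y = (\<Sum>i<R. tact (nu y i) (g i))" if "y \<in> MM s" for y by (rule conjunct2[OF bspec[OF nu that]])
  have uniq: "\<nu> i = nu y i" if "y \<in> MM s" "\<forall>i. \<nu> i \<in> N" "y = (\<Sum>i<R. tact (\<nu> i) (g i))" "i < R" for y \<nu> i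
  proof -
    note ny = nuN[OF that(1)] nuE[OF that(1)]
    have "(\<Sum>i<R. tact (\<nu> i - nu y i) (g i)) + (\<Sum>i<R. tact (nu y i) (g i)) = (\<Sum>i<R. tact (\<nu> i) (g i))"
      unfolding sum.distrib[symmetric] tact_plus[symmetric] by simp
    then have "(\<Sum>i<R. tact (\<nu> i - nu y i) (g i)) + y = y" unfolding ny(2)[symmetric] that(3)[symmetric] .
    then have "(\<Sum>i<R. tact (\<nu> i - nu y i) (g i)) = 0" by (simp only: add_cancel_left_left)
    moreover have "\<forall>i. \<nu> i - nu y i \<in> N" using N.diff_A[OF that(2)[rule_format] ny(1)] by blast
    ultimately have "\<nu> i - nu y i = 0" by (intro free[of "\<lambda>i. \<nu> i - nu y i" i] that(4))
    then show ?thesis by simp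
  qed
  have nlin: "nu (u + v) i = nu u i + nu v i" if "u \<in> MM s" "v \<in> MM s" "i < R" for u v i
  proof (rule uniq[symmetric, of _ "\<lambda>i. nu u i + nu v i"])
    show "u + v \<in> MM s" using that X.subspace_add[OF MM_subspace] by blast
    show "\<forall>i. nu u i + nu v i \<in> N" using nuN[OF that(1)] nuN[OF that(2)] N_sub(2) by simp
    have "u = (\<Sum>i<R. tact (nu u i) (g i))" "v = (\<Sum>i<R. tact (nu v i) (g i))" by (rule nuE[OF that(1)], rule nuE[OF that(2)])
    then show "u + v = (\<Sum>i<R. tact (nu u i + nu v i) (g i))" unfolding tact_plus sum.distrib by (rule arg_cong2[of _ _ _ _ "(+)"])
  qed (use that in simp)
  have nsc: "nu (scx c u) i = sc c (nu u i)" if "u \<in> MM s" "i < R" for u i c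
  proof (rule uniq[symmetric, of _ "\<lambda>i. sc c (nu u i)"])
    show "scx c u \<in> MM s" using that X.subspace_scale[OF MM_subspace] by blast
    show "\<forall>i. sc c (nu u i) \<in> N" using nuN[OF that(1)] N_sub(3) by simp
    have "u = (\<Sum>i<R. tact (nu u i) (g i))" by (rule nuE[OF that(1)])
    then show "scx c u = (\<Sum>i<R. tact (sc c (nu u i)) (g i))" unfolding tact_sc X.scale_sum_right[symmetric] by (rule arg_cong[of _ _ "scx c"])
  qed (use that in simp)
  let ?K = "{..<R} \<times> BN"
  have fr: "X.frame (MM s) ?K (\<lambda>(i,b). tact b (g i)) (\<lambda>(i,b) y. \<xi> b (nu y i))" unfolding X.frame_def
  proof (intro conjI ballI)
    show "finite ?K" using BN'(1) by simp
    fix p assume p: "p \<in> ?K"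
    then show "(\<lambda>(i,b). tact b (g i)) p \<in> MM s" using tact_MM gM by auto
    show "lin_on scx (MM s) ((\<lambda>(i,b) y. \<xi> b (nu y i)) p)"
      using p unfolding lin_on_def case_prod_unfold by (auto simp: nlin nsc xi_add xi_scale)
  next
    fix y assume y: "y \<in> MM s"
    have ts: "tact (\<Sum>b\<in>K. h b) z = (\<Sum>b\<in>K. tact (h b) z)" if "finite K" for K h z
      using that by (induction K rule: finite_induct) (simp_all add: tact_zero tact_plus)
    have "y = (\<Sum>i<R. tact (nu y i) (g i))" by (rule nuE[OF y])
    also have "\<dots> = (\<Sum>i<R. tact (\<Sum>b\<in>BN. sc (\<xi> b (nu y i)) b) (g i))" unfolding xi_N[OF nuN[OF y]] ..
    also have "\<dots> = (\<Sum>i<R. \<Sum>b\<in>BN. scx (\<xi> b (nu y i)) (tact b (g i)))" unfolding ts[OF BN'(1)] tact_sc ..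
    finally show "y = (\<Sum>p\<in>?K. scx ((\<lambda>(i,b) y. \<xi> b (nu y i)) p y) ((\<lambda>(i,b). tact b (g i)) p))" unfolding sum_Times by simp
  qed
  show ?case
  proof (rule 1(1)[OF s0, of R])
    fix n assume n: "n \<in> N"
    have nb: "nu (tact n (tact b (g i))) i = n * b" if "i < R" "b \<in> BN" for i b
    proof -
      have "(\<lambda>i'. if i' = i then n * b else 0) i = nu (tact n (tact b (g i))) i"
      proof (rule uniq[of "tact n (tact b (g i))" "\<lambda>i'. if i' = i then n * b else 0" i])
        show "tact n (tact b (g i)) \<in> MM s" using tact_MM gM that by blast
        show "\<forall>i'. (if i' = i then n * b else 0) \<in> N" using n BN_N[OF that(2)] N_sub(4) N.zero_A by simp
        have "(\<Sum>i'<R. tact (if i' = i then n * b else 0) (g i')) = (\<Sum>i'<R. if i' = i then tact n (tact b (g i)) else 0)"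
          by (rule sum.cong[OF refl]) (simp add: tact_zero tact_mult[OF n BN_N[OF that(2)]])
        then show "tact n (tact b (g i)) = (\<Sum>i'<R. tact (if i' = i then n * b else 0) (g i'))" using that by simp
      qed (rule that)
      then show ?thesis by simp
    qed
    have "of_nat s * (\<Sum>a\<in>B. lam a * character N \<sigma> (del a n)) = (\<Sum>p\<in>?K. (\<lambda>(i,b) y. \<xi> b (nu y i)) p (tact n ((\<lambda>(i,b). tact b (g i)) p)))"
      unfolding MM_trace[OF n, symmetric] by (rule X.op_trace_frame[OF MM_subspace fr tact_endo])
    also have "\<dots> = (\<Sum>i<R. \<Sum>b\<in>BN. \<xi> b (n * b))"
      unfolding sum_Times using nb by (intro sum.cong refl) simp
    finally show "of_nat s * (\<Sum>a\<in>B. lam a * character N \<sigma> (del a n)) = of_nat R * rhoN n" unfolding rhoN_def by simp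
  qed
qed

end


section \<open>Semisimplicity of a coideal subalgebra\<close>

context tensor_module
begin

text \<open>The module \<open>V\<close> is embedded in \<open>H \<otimes> V\<close> by means of the integral of \<open>H\<close>. As \<open>(H \<otimes> V)\<^sup>s\<close> is free, an element of \<open>V\<close> killed by
  the radical is there a combination of generators whose coefficients are killed by it.\<close>

lemma radical_annihilator:
  assumes q: "0 < q" and R: "\<And>r. r \<in> Rad \<Longrightarrow> r \<in> N" "\<And>r i j. \<lbrakk>r \<in> Rad; i < q; j < q\<rbrakk> \<Longrightarrow> \<sigma> r $$ (i,j) = 0"
  obtains y i j where "y \<in> N" "i < q" "j < q" "\<sigma> y $$ (i,j) \<noteq> 0" "\<And>r. r \<in> Rad \<Longrightarrow> r * y = 0"
proof (rule left_integral_exists, goal_cases)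
  case (1 L)
  note L = 1(2,3)
  have ex: "\<exists>y\<in>N. (\<exists>i<q. \<exists>j<q. \<sigma> y $$ (i,j) \<noteq> 0) \<and> (\<forall>r\<in>Rad. r * y = 0)"
  proof (rule tensor_free, goal_cases)
    case (1 s R' g)
    note s0 = 1(1) and gM = 1(2) and gen = 1(3) and free = 1(4)
    define m where "m = inj (0,0) L"
    have mM: "m \<in> MM s" unfolding m_def by (rule inj_MM) (use s0 q in simp)
    have sgs: "(\<Sum>a\<in>B. \<epsilon> a * sg (del a n) i j) = sg n i j" if "i < q" "j < q" for n i j
    proof -
      have "sg (\<Sum>a\<in>K. sc (\<epsilon> a) (del a n)) i j = (\<Sum>a\<in>K. \<epsilon> a * sg (del a n) i j)" if "finite K" for K
        using that
      proof (induction K rule: finite_induct)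
        case empty
        have "sg (sc 0 0) i j = 0 * sg 0 i j" by (rule sg_scale[OF \<open>i < q\<close> \<open>j < q\<close>])
        then show ?case by simp
      next
        case (insert a K)
        then show ?case by (simp add: sg_add[OF \<open>i < q\<close> \<open>j < q\<close>] sg_scale[OF \<open>i < q\<close> \<open>j < q\<close>])
      qed
      from this[OF B'(1)] show ?thesis unfolding del_counit_left by simp
    qed
    have tm: "tact r m = 0" if r: "r \<in> Rad" for r
    proof (rule ext, clarify)
      fix r' i show "tact r m (r',i) = 0 (r',i)"
      proof (cases "i < q \<and> r' = 0")
        case True
        have "tact r m (r',i) = (\<Sum>a\<in>B. \<Sum>j<q. if j = 0 then sc (\<epsilon> a * sg (del a r) i 0) L else 0)"
          using True unfolding tact_in[OF conjunct1[OF True]] m_def inj_def by (intro sum.cong refl) (simp add: L(1) mult.commute)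
        also have "\<dots> = sc (\<Sum>a\<in>B. \<epsilon> a * sg (del a r) i 0) L" using q by (simp add: scale_sum_left)
        also have "\<dots> = 0" using True q R r by (simp add: sgs sg_N)
        finally show ?thesis by simp
      next
        case False
        then show ?thesis by (cases "i < q") (simp_all add: tact_in tact_out m_def inj_def)
      qed
    qed
    obtain \<nu> where \<nu>: "\<forall>i. \<nu> i \<in> N" "m = (\<Sum>i<R'. tact (\<nu> i) (g i))" using gen[OF mM] by blast
    have kill: "r * \<nu> i = 0" if r: "r \<in> Rad" and i: "i < R'" for r i
    proof (rule free[of "\<lambda>i. r * \<nu> i", OF _ _ i])
      show "\<forall>i. r * \<nu> i \<in> N" using R(1)[OF r] \<nu>(1) N_sub(4) by simp
      have t0: "tact r 0 = 0" using tact_scale[of r 0 0] by simp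
      have "tact r (\<Sum>i\<in>K. tact (\<nu> i) (g i)) = (\<Sum>i\<in>K. tact (r * \<nu> i) (g i))" if "finite K" for K
        using that
      proof (induction K rule: finite_induct)
        case (insert i K)
        then show ?case by (simp only: sum.insert[OF insert(1,2)] tact_add tact_mult[OF R(1)[OF r] \<nu>(1)[rule_format]])
      qed (simp only: sum.empty t0)
      then show "(\<Sum>i<R'. tact (r * \<nu> i) (g i)) = 0" using tm[OF r] unfolding \<nu>(2) by simp
    qed
    define E where "E x = \<epsilon> (x (0::nat, 0::nat))" for x :: "nat \<times> nat \<Rightarrow> 'h"
    have Eact: "E (tact n x) = (\<Sum>j<q. sg n 0 j * \<epsilon> (x (0,j)))" for n x
    proof -
      have "E (tact n x) = (\<Sum>a\<in>B. \<Sum>j<q. \<epsilon> a * sg (del a n) 0 j * \<epsilon> (x (0,j)))"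
        unfolding E_def tact_in[OF q] by (simp add: eps_sum[OF B'(1)] eps_sum counit_scale counit_mult mult.commute mult.left_commute mult.assoc)
      also have "\<dots> = (\<Sum>j<q. (\<Sum>a\<in>B. \<epsilon> a * sg (del a n) 0 j) * \<epsilon> (x (0,j)))"
        unfolding sum_distrib_right by (rule sum.swap)
      finally show ?thesis using sgs[OF q] by simp
    qed
    have nz: "\<exists>i<R'. \<exists>j<q. \<sigma> (\<nu> i) $$ (0,j) \<noteq> 0"
    proof (rule ccontr)
      assume c: "\<not> (\<exists>i<R'. \<exists>j<q. \<sigma> (\<nu> i) $$ (0,j) \<noteq> 0)"
      have "E m = (\<Sum>i<R'. E (tact (\<nu> i) (g i)))" unfolding \<nu>(2) E_def sum_fun_apply by (rule eps_sum) simp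
      also have "\<dots> = 0" unfolding Eact using c \<nu>(1) by (simp add: sg_N)
      finally show False unfolding E_def m_def inj_def using L(2) by simp
    qed
    then obtain i j where ij: "i < R'" "j < q" "\<sigma> (\<nu> i) $$ (0,j) \<noteq> 0" by blast
    have "\<forall>r\<in>Rad. r * \<nu> i = 0" using kill[OF _ ij(1)] by blast
    moreover have "\<exists>i'<q. \<exists>j<q. \<sigma> (\<nu> i) $$ (i',j) \<noteq> 0" using ij q by blast
    ultimately show ?case using \<nu>(1) by blast
  qed
  then obtain y i j where "y \<in> N" "i < q" "j < q" "\<sigma> y $$ (i,j) \<noteq> 0" "\<forall>r\<in>Rad. r * y = 0" by blast
  then show ?case by (intro 1(1)[of y i j]) auto
qed

end

context coideal_algebra
begin

lemma N_semisimple: "N.rad = {0}"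
proof -
  define Q where "Q = {z\<in>N. \<forall>r\<in>N.rad. r * z = 0}"
  have QN: "Q \<subseteq> N" unfolding Q_def by blast
  have sQ: "subspace Q" unfolding subspace_def Q_def using N.zero_A N_sub(2,3) by (auto simp: distrib_left sc_out)
  have lQ: "a * z \<in> Q" if "a \<in> N" "z \<in> Q" for a z
    using that N_sub(4) N.rad_mult(2)[OF that(1)] unfolding Q_def by (auto simp: mult.assoc[symmetric])
  have rQ: "z * a \<in> Q" if "a \<in> N" "z \<in> Q" for a z
    using that N_sub(4) unfolding Q_def by (auto simp: mult.assoc[symmetric])
  have hit: "\<exists>z\<in>Q. N.rrep \<phi> z \<noteq> 0\<^sub>m (N.rdim \<phi>) (N.rdim \<phi>)" if phi: "\<phi> \<in> N.Irr" for \<phi>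
  proof -
    interpret t: tensor_module sc \<Delta> \<epsilon> S N BN B "N.rdim \<phi>" "N.rrep \<phi>" by unfold_locales (rule N.Irr_is_rep[OF phi])
    show ?thesis
    proof (rule t.radical_annihilator[OF N.Irr_pos[OF phi], of N.rad], goal_cases)
      case (1 r) then show ?case by (rule N.rad_A)
    next
      case (2 r i j) then show ?case using phi unfolding N.rad_def by auto
    next
      case (3 y i j)
      then have "y \<in> Q" unfolding Q_def by blast
      moreover have "N.rrep \<phi> y \<noteq> 0\<^sub>m (N.rdim \<phi>) (N.rdim \<phi>)" using 3 by auto
      ultimately show ?case by blast
    qed
  qed
  obtain z where z: "z \<in> Q" "\<forall>\<phi>\<in>N.Irr. N.rrep \<phi> z = 1\<^sub>m (N.rdim \<phi>)"
  proof (rule N.ideal_identity[OF QN sQ lQ rQ], goal_cases)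
    case (5 z)
    show ?case by (rule 5(1)[OF 5(2)]) (use 5(3) hit in blast)
  qed auto
  have zN: "z \<in> N" using z QN by blast
  have rad: "1 - z \<in> N.rad" unfolding N.rad_def
  proof (intro CollectI conjI ballI)
    show w: "1 - z \<in> N" by (rule N.diff_A[OF N_sub(1) zN])
    fix \<phi> assume phi: "\<phi> \<in> N.Irr"
    note r = N.Irr_is_rep[OF phi]
    show "N.rrep \<phi> (1 - z) = 0\<^sub>m (N.rdim \<phi>) (N.rdim \<phi>)"
    proof (rule eq_matI)
      fix i j assume ij: "i < dim_row (0\<^sub>m (N.rdim \<phi>) (N.rdim \<phi>) :: 'k mat)" "j < dim_col (0\<^sub>m (N.rdim \<phi>) (N.rdim \<phi>) :: 'k mat)"
      then show "N.rrep \<phi> (1 - z) $$ (i,j) = 0\<^sub>m (N.rdim \<phi>) (N.rdim \<phi>) $$ (i,j)"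
        using z(2) phi by (simp add: N.rep_entry_diff[OF r N_sub(1) zN] N.rep_one[OF r])
    qed (use N.rep_carrier[OF r w] in auto)
  qed
  have wz: "(1 - z) * z = 0" using z(1) rad unfolding Q_def by blast
  have "(1 - z) * (1 - z) = (1 - z) * 1 - (1 - z) * z" by (rule right_diff_distrib)
  then have idem: "(1 - z) * (1 - z) = 1 - z" unfolding wz mult_1_right diff_0_right .
  have w0: "1 - z = 0" by (rule N.rad_idem_zero[OF rad idem fin_UNIV])
  have z1: "1 = z" by (rule iffD1[OF right_minus_eq w0])
  have "r = 0" if "r \<in> N.rad" for r
  proof -
    have "r * z = 0" using z(1) that unfolding Q_def by blast
    then show "r = 0" unfolding z1[symmetric] by (simp only: mult_1_right)
  qed
  moreover have "0 \<in> N.rad" by (rule subspace_0[OF N.rad_subspace])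
  ultimately show ?thesis by blast
qed

sublocale N: ss_algebra sc N by unfold_locales (rule N_semisimple)

lemma lam_proportional:
  obtains c where "c \<noteq> 0" "\<And>n. n \<in> N \<Longrightarrow> lam n = c * rhoN n"
proof -
  let ?e = "restrict \<epsilon> N"
  interpret t: tensor_module sc \<Delta> \<epsilon> S N BN B "N.rdim ?e" "N.rrep ?e"
    by unfold_locales (rule N.Irr_is_rep[OF eps_character(1)])
  have ch: "(\<Sum>a\<in>B. lam a * character N (N.rrep ?e) (del a n)) = lam n" if n: "n \<in> N" for n
  proof -
    have "(\<Sum>a\<in>B. lam a * character N (N.rrep ?e) (del a n)) = (\<Sum>a\<in>B. lam (sc (\<epsilon> (del a n)) a))"
      unfolding N.Irr_rep(2)[OF eps_character(1)] using del_N[OF n] by (simp add: lam_scale mult.commute)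
    then show ?thesis unfolding lam_sum[OF B'(1), symmetric] del_counit_right .
  qed
  show ?thesis
  proof (rule t.free_trace, goal_cases)
    case (1 s R)
    have lr: "lam n = of_nat R / of_nat s * rhoN n" if "n \<in> N" for n
      using 1(2)[OF that] 1(1) unfolding ch[OF that] by (simp add: field_simps)
    have c0: "card B \<noteq> 0"
    proof
      assume "card B = 0"
      then have "B = {}" using B'(1) by simp
      then have "(1::'h) \<in> span {}" using B'(3) by simp
      then show False by simp
    qed
    have "card B = 0" if z: "of_nat R / of_nat s = (0::'k)"
    proof -
      have "lam 1 = 0" using lr[OF N_sub(1)] unfolding z by simp
      then show ?thesis unfolding lam_one by simp
    qed
    from contrapos_nn[OF c0 this] have "of_nat R / of_nat s \<noteq> (0::'k)" .
    then show ?case using lr by (rule that)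
  qed
qed

end

section \<open>Trace functions and the form on the dual of a coideal subalgebra\<close>

context ss_algebra
begin

lemma munit_mult: "j < rdim \<phi> \<Longrightarrow> j' < rdim \<phi> \<Longrightarrow> munit \<phi> i j * munit \<phi> j' k = (if j = j' then munit \<phi> i k else 0)"
  by (rule ss_eqI) (auto simp: mult_A munit_A zero_A rrep_munit_left rrep_munit rep_entry_zero[OF Irr_is_rep])

text \<open>A trace function vanishes on the off-diagonal matrix units and takes the same value on all diagonal ones of a
  block.\<close>

lemma trace_function_expand:
  assumes l: "lin_on sc A f" and c: "\<And>a b. a \<in> A \<Longrightarrow> b \<in> A \<Longrightarrow> f (a * b) = f (b * a)" and a: "a \<in> A"
  shows "f a = (\<Sum>\<psi>\<in>Irr. f (munit \<psi> 0 0) * \<psi> a)"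
proof -
  let ?K = "Sigma Irr (\<lambda>\<phi>. {..<rdim \<phi>} \<times> {..<rdim \<phi>})"
  have "f (sc 0 0) = 0 * f 0" using l zero_A unfolding lin_on_def by blast
  then have f0: "f 0 = 0" by simp
  have fu: "f (munit \<phi> i j) = (if i = j then f (munit \<phi> 0 0) else 0)" if "\<phi> \<in> Irr" "i < rdim \<phi>" "j < rdim \<phi>" for \<phi> i j
  proof -
    note d = Irr_pos[OF that(1)]
    have "f (munit \<phi> i j) = f (munit \<phi> i 0 * munit \<phi> 0 j)" using munit_mult[OF d d] by simp
    also have "\<dots> = f (munit \<phi> 0 j * munit \<phi> i 0)" by (rule c[OF munit_A munit_A])
    finally show ?thesis using munit_mult[OF that(3,2)] f0 by auto
  qed
  have fK: "finite ?K" using finite_Irr by simp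
  have "a = (\<Sum>p\<in>?K. sc ((\<lambda>(\<phi>,i,j) a. rrep \<phi> a $$ (i,j)) p a) ((\<lambda>(\<phi>,i,j). munit \<phi> i j) p))"
    by (rule bspec[OF conjunct2[OF conjunct2[OF munit_frame[unfolded frame_def]]] a])
  then have "f a = f (\<Sum>p\<in>?K. sc ((\<lambda>(\<phi>,i,j) a. rrep \<phi> a $$ (i,j)) p a) ((\<lambda>(\<phi>,i,j). munit \<phi> i j) p))" by (rule arg_cong)
  also have "\<dots> = (\<Sum>p\<in>?K. (\<lambda>(\<phi>,i,j) a. rrep \<phi> a $$ (i,j)) p a * f ((\<lambda>(\<phi>,i,j). munit \<phi> i j) p))"
    by (rule lin_on_sum[OF l subspace_A fK]) (auto simp: munit_A)
  also have "\<dots> = (\<Sum>\<phi>\<in>Irr. \<Sum>p\<in>{..<rdim \<phi>} \<times> {..<rdim \<phi>}. rrep \<phi> a $$ p * f (munit \<phi> (fst p) (snd p)))"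
  proof -
    have "(\<Sum>\<phi>\<in>Irr. \<Sum>p\<in>{..<rdim \<phi>} \<times> {..<rdim \<phi>}. rrep \<phi> a $$ p * f (munit \<phi> (fst p) (snd p)))
        = (\<Sum>(\<phi>,p)\<in>?K. rrep \<phi> a $$ p * f (munit \<phi> (fst p) (snd p)))"
      by (rule sum.Sigma[OF finite_Irr]) simp
    then show ?thesis by (simp only: case_prod_unfold prod.collapse)
  qed
  also have "\<dots> = (\<Sum>\<phi>\<in>Irr. f (munit \<phi> 0 0) * \<phi> a)"
  proof (rule sum.cong[OF refl])
    fix \<phi> assume phi: "\<phi> \<in> Irr"
    have "(\<Sum>p\<in>{..<rdim \<phi>} \<times> {..<rdim \<phi>}. rrep \<phi> a $$ p * f (munit \<phi> (fst p) (snd p)))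
        = (\<Sum>i<rdim \<phi>. \<Sum>j<rdim \<phi>. if j = i then rrep \<phi> a $$ (i,i) * f (munit \<phi> 0 0) else 0)"
      unfolding sum_Times fst_conv snd_conv
    proof (intro sum.cong refl)
      fix i j assume "i \<in> {..<rdim \<phi>}" "j \<in> {..<rdim \<phi>}"
      then show "rrep \<phi> a $$ (i,j) * f (munit \<phi> i j) = (if j = i then rrep \<phi> a $$ (i,i) * f (munit \<phi> 0 0) else 0)"
        by (subst fu[OF phi]) simp_all
    qed
    also have "\<dots> = f (munit \<phi> 0 0) * \<phi> a"
      unfolding Irr_trace[OF phi a] by (simp add: sum_distrib_left mult.commute)
    finally show "(\<Sum>p\<in>{..<rdim \<phi>} \<times> {..<rdim \<phi>}. rrep \<phi> a $$ p * f (munit \<phi> (fst p) (snd p))) = f (munit \<phi> 0 0) * \<phi> a" .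
  qed
  finally show ?thesis .
qed

lemma Irr_cidem_mult: assumes "\<psi> \<in> Irr" "a \<in> A" shows "\<psi> (a * cidem \<phi>) = (if \<psi> = \<phi> then \<psi> a else 0)"
  unfolding Irr_trace[OF assms(1) mult_A[OF assms(2) cidem_A]] Irr_trace[OF assms]
  by (simp add: rrep_cidem_mult[OF assms(1) _ _ assms(2)])

end

context coideal_algebra
begin

lemma rhoN_Irr: assumes "n \<in> N" shows "rhoN n = (\<Sum>\<psi>\<in>N.Irr. of_nat (N.rdim \<psi>) * \<psi> n)"
  using N.trace_left_right[OF assms N_sub(1)] rhoN_trace[OF assms] by (simp add: N.Irr_one mult.commute)

text \<open>Multiplying by matrix units isolates the entries of \<open>n\<close>, and the weights of the regular character are nonzero in
  characteristic zero.\<close>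

lemma rhoN_nondegenerate:
  assumes n: "n \<in> N" and z: "\<And>n'. n' \<in> N \<Longrightarrow> rhoN (n' * n) = 0" shows "n = 0"
proof (rule N.ss_eqI[OF n N.zero_A])
  fix \<phi> k l assume p: "\<phi> \<in> N.Irr" "k < N.rdim \<phi>" "l < N.rdim \<phi>"
  have m: "N.munit \<phi> l k * n \<in> N" by (rule N_sub(4)[OF N.munit_A n])
  have ch: "\<psi> (N.munit \<phi> l k * n) = (if \<psi> = \<phi> then N.rrep \<phi> n $$ (k,l) else 0)" if psi: "\<psi> \<in> N.Irr" for \<psi>
  proof -
    have "\<psi> (N.munit \<phi> l k * n) = (\<Sum>i<N.rdim \<psi>. if i = l then (if \<psi> = \<phi> then N.rrep \<phi> n $$ (k,l) else 0) else 0)"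
      unfolding N.Irr_trace[OF psi m]
      by (rule sum.cong[OF refl]) (use p psi in \<open>auto simp: N.rrep_munit_left[OF n]\<close>)
    then show ?thesis using p by auto
  qed
  have "0 = rhoN (N.munit \<phi> l k * n)" using z[OF N.munit_A] by simp
  also have "\<dots> = (\<Sum>\<psi>\<in>N.Irr. if \<psi> = \<phi> then of_nat (N.rdim \<phi>) * N.rrep \<phi> n $$ (k,l) else 0)"
    unfolding rhoN_Irr[OF m] by (rule sum.cong[OF refl]) (simp add: ch)
  also have "\<dots> = of_nat (N.rdim \<phi>) * N.rrep \<phi> n $$ (k,l)" using p N.finite_Irr by simp
  finally show "N.rrep \<phi> n $$ (k,l) = N.rrep \<phi> 0 $$ (k,l)"
    using N.Irr_pos[OF p(1)] by (simp add: N.rep_entry_zero[OF N.Irr_is_rep[OF p(1)] p(2,3)])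
qed

lemma idem_integral_N: "idem_integral sc \<epsilon> N = N.cidem (restrict \<epsilon> N)"
  by (rule N.idem_integral_eq) (simp_all add: counit_add counit_scale counit_mult counit_one)

text \<open>Up to the factor relating the two regular characters, which equals the normalizing constant, the
  map \<open>N \<rightarrow> N\<^sup>*\<close> is given by the regular character of \<open>N\<close>.\<close>

lemma F_map_eq: "n \<in> N \<Longrightarrow> F_map sc \<epsilon> N n = restrict (\<lambda>n'. rhoN (n' * n)) N"
proof (rule lam_proportional, goal_cases)
  case (1 c)
  note n = 1(1) and c = 1(2,3)
  let ?e = "restrict \<epsilon> N"
  have "lambda_B sc \<epsilon> N 1 = lam (N.cidem ?e)"
    unfolding lambda_B_def harpoon_def idem_integral_N lam_regular[symmetric] by simp
  also have "\<dots> = c * rhoN (N.cidem ?e)" by (rule c(2)[OF N.cidem_A])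
  also have "rhoN (N.cidem ?e) = (\<Sum>\<psi>\<in>N.Irr. of_nat (N.rdim \<psi>) * \<psi> (1 * N.cidem ?e))" unfolding rhoN_Irr[OF N.cidem_A] by simp
  also have "\<dots> = (\<Sum>\<psi>\<in>N.Irr. if \<psi> = ?e then 1 else 0)"
  proof (rule sum.cong[OF refl])
    fix \<psi> assume psi: "\<psi> \<in> N.Irr"
    show "of_nat (N.rdim \<psi>) * \<psi> (1 * N.cidem ?e) = (if \<psi> = ?e then 1 else 0)"
      unfolding N.Irr_cidem_mult[OF psi N_sub(1)] N.Irr_one[OF psi] using eps_character(2) by simp
  qed
  also have "\<dots> = 1" using eps_character(1) N.finite_Irr by simp
  finally have lB: "lambda_B sc \<epsilon> N 1 = c" by simp
  show ?case
  proof (rule ext)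
    fix n'
    show "F_map sc \<epsilon> N n n' = restrict (\<lambda>n'. rhoN (n' * n)) N n'"
      unfolding F_map_def lB harpoon_def lam_regular[symmetric]
      using c N_sub(4)[OF _ n] by (cases "n' \<in> N") simp_all
  qed
qed

lemma F_map_inj: "inj_on (F_map sc \<epsilon> N) N"
proof (rule inj_onI)
  fix a b assume ab: "a \<in> N" "b \<in> N" "F_map sc \<epsilon> N a = F_map sc \<epsilon> N b"
  have "a - b = 0"
  proof (rule rhoN_nondegenerate[OF N.diff_A[OF ab(1,2)]])
    fix n' assume n': "n' \<in> N"
    have "restrict (\<lambda>n'. rhoN (n' * a)) N n' = restrict (\<lambda>n'. rhoN (n' * b)) N n'"
      using ab(3) unfolding F_map_eq[OF ab(1)] F_map_eq[OF ab(2)] by (rule fun_cong)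
    then have e: "rhoN (n' * a) = rhoN (n' * b)" using n' by simp
    have "rhoN (n' * (a - b) + n' * b) = rhoN (n' * (a - b)) + rhoN (n' * b)" unfolding rhoN_def by (simp add: distrib_right xi_add sum.distrib)
    then show "rhoN (n' * (a - b)) = 0" using e by (simp add: right_diff_distrib)
  qed
  then show "a = b" by simp
qed

end


context coideal_algebra
begin

text \<open>The preimage of \<open>f\<close> is the combination of the central idempotents with weights \<open>m \<psi> / \<psi> 1\<close>, where \<open>f\<close> is the sum of
  the \<open>m \<psi> * \<psi>\<close>.\<close>

lemma form_N_trace_function:
  assumes l: "lin_on sc N f" and c: "\<And>a b. a \<in> N \<Longrightarrow> b \<in> N \<Longrightarrow> f (a * b) = f (b * a)"
    and phi: "\<phi> \<in> N.Irr" and t: "t \<in> N" "\<And>\<psi>. \<psi> \<in> N.Irr \<Longrightarrow> \<psi> t = (if \<psi> = \<phi> then 1 else 0)"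
  shows "form_N sc \<epsilon> N (restrict f N) \<phi> = f t"
proof -
  define m where "m \<psi> = f (N.munit \<psi> 0 0)" for \<psi>
  have fm: "f n = (\<Sum>\<psi>\<in>N.Irr. m \<psi> * \<psi> n)" if "n \<in> N" for n
    unfolding m_def by (rule N.trace_function_expand[OF l c that])
  define y where "y = (\<Sum>\<psi>\<in>N.Irr. sc (m \<psi> / of_nat (N.rdim \<psi>)) (N.cidem \<psi>))"
  have yN: "y \<in> N" unfolding y_def by (intro N.sum_A N.scale_A N.cidem_A)
  have ch: "\<psi> (n * y) = m \<psi> / of_nat (N.rdim \<psi>) * \<psi> n" if psi: "\<psi> \<in> N.Irr" and n: "n \<in> N" for \<psi> n
  proof -
    have "\<psi> (n * y) = \<psi> (\<Sum>\<theta>\<in>N.Irr. sc (m \<theta> / of_nat (N.rdim \<theta>)) (n * N.cidem \<theta>))"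
      unfolding y_def by (simp add: sum_distrib_left sc_out)
    also have "\<dots> = (\<Sum>\<theta>\<in>N.Irr. m \<theta> / of_nat (N.rdim \<theta>) * \<psi> (n * N.cidem \<theta>))"
      by (rule lin_on_sum[OF N.Irr_lin[OF psi] N.subspace_A N.finite_Irr]) (rule N_sub(4)[OF n N.cidem_A])
    also have "\<dots> = (\<Sum>\<theta>\<in>N.Irr. if \<theta> = \<psi> then m \<psi> / of_nat (N.rdim \<psi>) * \<psi> n else 0)"
      by (rule sum.cong[OF refl]) (simp add: N.Irr_cidem_mult[OF psi n])
    finally show ?thesis using psi N.finite_Irr by simp
  qed
  have Fy: "F_map sc \<epsilon> N y = restrict f N"
  proof (rule ext)
    fix n
    show "F_map sc \<epsilon> N y n = restrict f N n"
    proof (cases "n \<in> N")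
      case True
      have "rhoN (n * y) = f n" unfolding rhoN_Irr[OF N_sub(4)[OF True yN]] fm[OF True]
      proof (rule sum.cong[OF refl])
        fix \<psi> assume psi: "\<psi> \<in> N.Irr"
        show "of_nat (N.rdim \<psi>) * \<psi> (n * y) = m \<psi> * \<psi> n" unfolding ch[OF psi True] using N.Irr_pos[OF psi] by simp
      qed
      then show ?thesis unfolding F_map_eq[OF yN] using True by simp
    qed (simp add: F_map_eq[OF yN])
  qed
  have inv: "inv_into N (F_map sc \<epsilon> N) (restrict f N) = y" by (rule inv_into_f_eq[OF F_map_inj yN Fy])
  have "form_N sc \<epsilon> N (restrict f N) \<phi> = \<phi> (1 * y)" unfolding form_N_def inv by simp
  also have "\<dots> = m \<phi>" unfolding ch[OF phi N_sub(1)] N.Irr_one[OF phi] using N.Irr_pos[OF phi] by simp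
  also have "\<dots> = (\<Sum>\<psi>\<in>N.Irr. if \<psi> = \<phi> then m \<phi> else 0)" using phi N.finite_Irr by simp
  also have "\<dots> = f t" unfolding fm[OF t(1)]
  proof (rule sum.cong[OF refl])
    fix \<psi> assume "\<psi> \<in> N.Irr"
    from t(2)[OF this] show "(if \<psi> = \<phi> then m \<phi> else 0) = m \<psi> * \<psi> t" by simp
  qed
  finally show ?thesis .
qed

end

section \<open>Orthogonality of the irreducible characters\<close>

lemma cop_fsum: "finite K \<Longrightarrow> cop \<Delta> (\<lambda>a b. \<Sum>i\<in>K. f i a b) h = (\<Sum>i\<in>K. cop \<Delta> (f i) h)"
proof (induction K rule: finite_induct)
  case empty
  show ?case unfolding cop_def by (simp add: case_prod_unfold)
qed (simp add: cop_plus)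

lemma cop_mult_left: "c * cop \<Delta> \<beta> h = cop \<Delta> (\<lambda>a b. c * \<beta> a b) h" for c :: "'a::ring"
  by (rule cop_additive[where L="\<lambda>x. c * x"]) (rule distrib_left)

context ss_hopf
begin



definition Lam :: 'h where "Lam = idem_integral sc \<epsilon> UNIV"

lemma Lam_left: "h * Lam = sc (\<epsilon> h) Lam" and Lam_eps: "\<epsilon> Lam = 1"
proof -
  have e: "idem_integral sc \<epsilon> UNIV = H.cidem (restrict \<epsilon> UNIV)"
    by (rule H.idem_integral_eq) (simp_all add: counit_add counit_scale counit_mult counit_one)
  show "h * Lam = sc (\<epsilon> h) Lam" unfolding Lam_def e
    by (rule H.cidem_integral) (simp_all add: counit_add counit_scale counit_mult counit_one)
  show "\<epsilon> Lam = 1" unfolding Lam_def e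
    by (rule H.eps_cidem) (simp_all add: counit_add counit_scale counit_mult counit_one)
qed

lemma casimir:
  assumes sv: "vspace sv" and b: "bilin sc sv \<gamma>"
  shows "cop \<Delta> (\<lambda>a b. \<gamma> (g * a) (S b)) Lam = cop \<Delta> (\<lambda>a b. \<gamma> a (S b * g)) Lam"
proof -
  note b' = b[unfolded bilin_def]
  have "bilin sc sv (\<lambda>a b. \<gamma> a (S b))" unfolding bilin_def using b' by (simp add: antipode_add antipode_scale)
  from left_integral_shift[OF sv this Lam_left, of "T g"]
  show ?thesis unfolding S_T antipode_mult .
qed

text \<open>The element \<open>\<Sum> \<Lambda>\<^sub>1 \<otimes> S \<Lambda>\<^sub>2\<close> is a Casimir element, so averaging with it produces intertwiners between
  irreducible representations. Schur's lemma evaluates these, and the antipode axiom fixes the scalars.\<close>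

lemma orthonormal:
  assumes chi: "\<chi> \<in> H.Irr" and psi: "\<psi> \<in> H.Irr"
  shows "cop \<Delta> (\<lambda>a b. \<chi> a * \<psi> (S b)) Lam = (if \<chi> = \<psi> then 1 else 0)"
proof -
  let ?d = "H.rdim \<chi>" and ?e = "H.rdim \<psi>"
  let ?\<rho> = "H.rrep \<chi>" and ?\<sigma> = "H.rrep \<psi>"
  note r = H.Irr_is_rep[OF chi] and r' = H.Irr_is_rep[OF psi]
  note vk = vspace_k
  define X where "X i j k l = cop \<Delta> (\<lambda>a b. ?\<rho> a $$ (i,j) * ?\<sigma> (S b) $$ (k,l)) Lam" for i j k l
  have lin: "?\<rho> (x + y) $$ (i,j) = ?\<rho> x $$ (i,j) + ?\<rho> y $$ (i,j)" "?\<rho> (sc c x) $$ (i,j) = c * ?\<rho> x $$ (i,j)"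
    if "i < ?d" "j < ?d" for x y c i j using H.rep_entry_add[OF r] H.rep_entry_scale[OF r] that by simp_all
  have lin': "?\<sigma> (x + y) $$ (i,j) = ?\<sigma> x $$ (i,j) + ?\<sigma> y $$ (i,j)" "?\<sigma> (sc c x) $$ (i,j) = c * ?\<sigma> x $$ (i,j)"
    if "i < ?e" "j < ?e" for x y c i j using H.rep_entry_add[OF r'] H.rep_entry_scale[OF r'] that by simp_all
  define \<theta> where "\<theta> j k = mat ?d ?e (\<lambda>(i,l). X i j k l)" for j k
  have \<theta>c: "\<theta> j k \<in> carrier_mat ?d ?e" for j k unfolding \<theta>_def by simp
  have inter: "?\<rho> g * \<theta> j k = \<theta> j k * ?\<sigma> g" if jk: "j < ?d" "k < ?e" for g j k
  proof (rule eq_matI)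
    fix i l assume "i < dim_row (\<theta> j k * ?\<sigma> g)" "l < dim_col (\<theta> j k * ?\<sigma> g)"
    then have il: "i < ?d" "l < ?e" using \<theta>c[of j k] H.rep_carrier[OF r' UNIV_I, of g] by auto
    let ?\<gamma> = "\<lambda>a b. ?\<rho> a $$ (i,j) * ?\<sigma> b $$ (k,l)"
    have b: "bilin sc (*) ?\<gamma>" unfolding bilin_def
      by (simp add: lin[OF il(1) jk(1)] lin'[OF jk(2) il(2)] distrib_left distrib_right mult.assoc mult.left_commute)
    have "(?\<rho> g * \<theta> j k) $$ (i,l) = (\<Sum>p<?d. ?\<rho> g $$ (i,p) * X p j k l)"
      unfolding mult_mat_index[OF H.rep_carrier[OF r UNIV_I] \<theta>c il] by (rule sum.cong[OF refl]) (simp add: \<theta>_def il)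
    also have "\<dots> = cop \<Delta> (\<lambda>a b. \<Sum>p<?d. ?\<rho> g $$ (i,p) * (?\<rho> a $$ (p,j) * ?\<sigma> (S b) $$ (k,l))) Lam"
      unfolding cop_fsum[OF finite_lessThan] X_def cop_mult_left ..
    also have "\<dots> = cop \<Delta> (\<lambda>a b. ?\<gamma> (g * a) (S b)) Lam"
      unfolding H.rep_entry_mult[OF r UNIV_I UNIV_I il(1) jk(1)] by (simp only: sum_distrib_right mult.assoc)
    also have "\<dots> = cop \<Delta> (\<lambda>a b. ?\<gamma> a (S b * g)) Lam" by (rule casimir[OF vk b])
    also have "\<dots> = cop \<Delta> (\<lambda>a b. \<Sum>p<?e. ?\<sigma> g $$ (p,l) * (?\<rho> a $$ (i,j) * ?\<sigma> (S b) $$ (k,p))) Lam"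
      unfolding H.rep_entry_mult[OF r' UNIV_I UNIV_I jk(2) il(2)] by (simp only: sum_distrib_left mult.assoc mult.left_commute mult.commute)
    also have "\<dots> = (\<Sum>p<?e. X i j k p * ?\<sigma> g $$ (p,l))"
      unfolding cop_fsum[OF finite_lessThan] X_def cop_mult_left[symmetric] by (simp only: mult.commute)
    also have "\<dots> = (\<theta> j k * ?\<sigma> g) $$ (i,l)"
      unfolding mult_mat_index[OF \<theta>c H.rep_carrier[OF r' UNIV_I] il] by (rule sum.cong[OF refl]) (simp add: \<theta>_def il)
    finally show "(?\<rho> g * \<theta> j k) $$ (i,l) = (\<theta> j k * ?\<sigma> g) $$ (i,l)" .
  qed (use \<theta>c[of j k] H.rep_carrier[OF r UNIV_I, of g] H.rep_carrier[OF r' UNIV_I, of g] in auto)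
  have e: "(\<lambda>a b. \<chi> a * \<psi> (S b)) = (\<lambda>a b. \<Sum>i<?d. \<Sum>k<?e. ?\<rho> a $$ (i,i) * ?\<sigma> (S b) $$ (k,k))"
  proof (intro ext)
    fix a b
    show "\<chi> a * \<psi> (S b) = (\<Sum>i<?d. \<Sum>k<?e. ?\<rho> a $$ (i,i) * ?\<sigma> (S b) $$ (k,k))"
      by (subst H.Irr_trace[OF chi UNIV_I], subst H.Irr_trace[OF psi UNIV_I], rule sum_product)
  qed
  have main: "cop \<Delta> (\<lambda>a b. \<chi> a * \<psi> (S b)) Lam = (\<Sum>i<?d. \<Sum>k<?e. X i i k k)"
  proof -
    have "cop \<Delta> (\<lambda>a b. \<chi> a * \<psi> (S b)) Lam = (\<Sum>i<?d. cop \<Delta> (\<lambda>a b. \<Sum>k<?e. ?\<rho> a $$ (i,i) * ?\<sigma> (S b) $$ (k,k)) Lam)"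
      unfolding e by (rule cop_fsum) simp
    also have "\<dots> = (\<Sum>i<?d. \<Sum>k<?e. X i i k k)"
      unfolding X_def by (rule sum.cong[OF refl], rule cop_fsum) simp
    finally show ?thesis .
  qed
  show ?thesis
  proof (cases "\<chi> = \<psi>")
    case False
    have "X i i k k = 0" if "i < ?d" "k < ?e" for i k
    proof -
      have "\<theta> i k = 0\<^sub>m ?d ?e"
        by (rule H.intertwiner_zero[OF H.Irr_rep(1)[OF psi] H.Irr_rep(1)[OF chi] \<theta>c inter[OF that]])
          (use False in \<open>simp add: H.Irr_rep(2)[OF chi] H.Irr_rep(2)[OF psi]\<close>)
      then have "\<theta> i k $$ (i,k) = 0" using that by simp
      then show ?thesis unfolding \<theta>_def using that by simp
    qed
    then show ?thesis unfolding main using False by simp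
  next
    case True
    have "\<exists>c. \<theta> j k = c \<cdot>\<^sub>m 1\<^sub>m ?d" if jk: "j < ?d" "k < ?d" for j k
    proof (rule H.schur_scalar[OF H.Irr_rep(1)[OF chi], of "\<theta> j k"], goal_cases)
      case 1 show ?case using \<theta>c True by simp
    next
      case (2 a) show ?case using inter[of j k a] jk True by simp
    next
      case (3 c) then show ?case by blast
    qed
    note ex = this
    define c where "c j k = (SOME c. \<theta> j k = c \<cdot>\<^sub>m 1\<^sub>m ?d)" for j k
    have c: "\<theta> j k = c j k \<cdot>\<^sub>m 1\<^sub>m ?d" if "j < ?d" "k < ?d" for j k
      unfolding c_def by (rule someI_ex[OF ex[OF that]])
    have Xc: "X i j k l = (if i = l then c j k else 0)" if "i < ?d" "j < ?d" "k < ?d" "l < ?d" for i j k l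
    proof -
      have "X i j k l = \<theta> j k $$ (i,l)" unfolding \<theta>_def using that True by simp
      then show ?thesis unfolding c[OF that(2,3)] using that by simp
    qed
    have d: "0 < ?d" by (rule H.Irr_pos[OF chi])
    have "(\<Sum>j<?d. c j j) = (\<Sum>j<?d. X 0 j j 0)" by (rule sum.cong[OF refl]) (simp add: Xc d)
    also have "\<dots> = cop \<Delta> (\<lambda>a b. ?\<rho> (a * S b) $$ (0,0)) Lam"
      unfolding H.rep_entry_mult[OF r UNIV_I UNIV_I d d] X_def True[symmetric] by (rule cop_fsum[symmetric]) simp
    also have "\<dots> = ?\<rho> (cop \<Delta> (\<lambda>a b. a * S b) Lam) $$ (0,0)"
      by (rule cop_additive[symmetric, where L="\<lambda>x. ?\<rho> x $$ (0,0)"]) (rule lin(1)[OF d d])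
    also have "\<dots> = 1" unfolding cop_antipode_right Lam_eps using H.rep_one[OF r] d by simp
    finally have s1: "(\<Sum>j<?d. c j j) = 1" .
    have "(\<Sum>i<?d. \<Sum>k<?e. X i i k k) = (\<Sum>i<?d. \<Sum>k<?d. if k = i then c i i else 0)"
      unfolding True[symmetric] by (intro sum.cong refl) (auto simp: Xc)
    also have "\<dots> = 1" using s1 by simp
    finally show ?thesis unfolding main using True by simp
  qed
qed

section \<open>The induced character\<close>

text \<open>For an idempotent \<open>t\<close>, the module \<open>H \<otimes>\<^sub>N N t\<close> is \<open>H t\<close>, via the multiplication.\<close>

definition ht_char :: "'h \<Rightarrow> 'h \<Rightarrow> 'k" where "ht_char t = (\<lambda>h. \<Sum>\<psi>\<in>H.Irr. \<psi> t * \<psi> h)"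

definition ev :: "('h \<times> 'h \<Rightarrow>\<^sub>0 'k) \<Rightarrow> 'h" where "ev = lin_ext (\<lambda>(x,m). x * m)"

lemma ev_balanced: "f \<in> balanced_null sc N M \<Longrightarrow> ev f = 0"
  unfolding balanced_null_def ev_def
  by (rule lin_ext_span, auto simp: lin_ext_diff lin_ext_single distrib_left distrib_right sc_out mult.assoc)

lemma free_ext_index:
  fixes f :: "'h \<times> 'h \<Rightarrow>\<^sub>0 'k"
  shows "i < d \<Longrightarrow> free_ext d \<tau> f $ i = vspace.lin_ext (*) (\<lambda>(x,m). \<tau> x m $ i) f"
proof -
  interpret k: vspace "(*) :: 'k \<Rightarrow> 'k \<Rightarrow> 'k" by (rule vspace_k)
  assume "i < d"
  then show ?thesis unfolding free_ext_def k.lin_ext_def by (simp add: case_prod_unfold)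
qed

text \<open>Every tensor is a multiple of \<open>x \<otimes> t\<close> for a single \<open>x\<close>, since \<open>x \<otimes> n t\<close> equals
  \<open>x n \<otimes> t = x n t \<otimes> t\<close> by the idempotence of \<open>t\<close>.\<close>

lemma balanced_single:
  assumes t: "t \<in> N" "t * t = t" and one: "1 \<in> N" and M: "M = {n * t | n. n \<in> N}"
    and f: "Poly_Mapping.keys f \<subseteq> UNIV \<times> M"
  shows "f - Poly_Mapping.single (ev f, t) 1 \<in> balanced_null sc N M"
proof -
  interpret fs: vector_space "free_scale :: 'k \<Rightarrow> ('h \<times> 'h \<Rightarrow>\<^sub>0 'k) \<Rightarrow> ('h \<times> 'h \<Rightarrow>\<^sub>0 'k)" by (rule vector_space_free_scale)
  let ?Z = "balanced_null sc N M"
  let ?s = "Poly_Mapping.single :: 'h \<times> 'h \<Rightarrow> 'k \<Rightarrow> ('h \<times> 'h \<Rightarrow>\<^sub>0 'k)"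
  have sZ: "fs.subspace ?Z" unfolding balanced_null_def by (rule fs.subspace_span)
  note Za = fs.subspace_add[OF sZ] and Zd = fs.subspace_diff[OF sZ] and Zs = fs.subspace_scale[OF sZ]
  have tM: "t \<in> M" unfolding M using one by (intro CollectI exI[of _ 1]) simp
  have gadd: "?s (x + y, t) 1 - ?s (x, t) 1 - ?s (y, t) 1 \<in> ?Z" for x y
    unfolding balanced_null_def by (rule fs.span_base) (use tM in blast)
  have gsc: "?s (sc c x, t) 1 - ?s (x, t) c \<in> ?Z" for c x
    unfolding balanced_null_def by (rule fs.span_base) (use tM in blast)
  have gbal: "?s (x * n, t) 1 - ?s (x, n * t) 1 \<in> ?Z" if "n \<in> N" for x n
    unfolding balanced_null_def by (rule fs.span_base) (use tM that in blast)
  have fsc: "free_scale c (?s p 1) = ?s p c" for c p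
    by (rule poly_mapping_eqI) (simp add: lookup_free_scale lookup_single when_def)
  have single: "?s (x, m) c - ?s (sc c (x * m), t) 1 \<in> ?Z" if mM: "m \<in> M" for x m c
  proof -
    obtain n where n: "n \<in> N" "m = n * t" using mM unfolding M by blast
    have 1: "?s (x * n, t) 1 - ?s (x, m) 1 \<in> ?Z" using gbal[OF n(1), of x] unfolding n(2) .
    have 2: "?s (x * n * t, t) 1 - ?s (x * n, t) 1 \<in> ?Z" using gbal[OF t(1), of "x * n"] unfolding t(2) .
    have "?s (x * m, t) 1 - ?s (x, m) 1 \<in> ?Z" using Za[OF 2 1] unfolding n(2) by (simp add: mult.assoc)
    from Zs[OF this, of c] have 3: "?s (x * m, t) c - ?s (x, m) c \<in> ?Z" by (simp only: fs.scale_right_diff_distrib fsc)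
    have "?s (sc c (x * m), t) 1 - ?s (x, m) c \<in> ?Z" using Za[OF gsc[of c "x * m"] 3] by simp
    from Zs[OF this, of "-1"] show ?thesis by (simp add: fs.scale_minus_left)
  qed
  have z0: "?s (0, t) 1 \<in> ?Z" using gsc[of 0 0] by simp
  have "(\<Sum>p\<in>K. ?s p (Poly_Mapping.lookup f p)) - ?s (\<Sum>p\<in>K. sc (Poly_Mapping.lookup f p) (fst p * snd p), t) 1 \<in> ?Z"
    if "finite K" "K \<subseteq> UNIV \<times> M" for K
    using that
  proof (induction K rule: finite_induct)
    case empty
    show ?case using fs.subspace_neg[OF sZ z0] by simp
  next
    case (insert p K)
    obtain x m where p: "p = (x,m)" by (cases p)
    let ?c = "Poly_Mapping.lookup f p" and ?w = "\<Sum>p\<in>K. sc (Poly_Mapping.lookup f p) (fst p * snd p)"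
    have mM: "m \<in> M" using insert.prems p by auto
    have a: "?s (x, m) ?c - ?s (sc ?c (x * m), t) 1 \<in> ?Z" by (rule single[OF mM])
    have b: "(\<Sum>p\<in>K. ?s p (Poly_Mapping.lookup f p)) - ?s (?w, t) 1 \<in> ?Z" using insert.IH insert.prems by blast
    from Zd[OF Za[OF a b] gadd[of "sc ?c (x * m)" "?w"]]
    have "?s p ?c + (\<Sum>p\<in>K. ?s p (Poly_Mapping.lookup f p)) - ?s (sc ?c (x * m) + ?w, t) 1 \<in> ?Z"
      unfolding p by (simp add: algebra_simps)
    then show ?case using insert.hyps p by simp
  qed
  from this[OF finite_keys f] have "(\<Sum>p\<in>Poly_Mapping.keys f. ?s p (Poly_Mapping.lookup f p)) - ?s (ev f, t) 1 \<in> ?Z"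
    unfolding ev_def lin_ext_def by (simp add: case_prod_unfold)
  moreover have "(\<Sum>p\<in>Poly_Mapping.keys f. ?s p (Poly_Mapping.lookup f p)) = f"
  proof (rule poly_mapping_eqI)
    fix q
    have "Poly_Mapping.lookup (\<Sum>p\<in>Poly_Mapping.keys f. ?s p (Poly_Mapping.lookup f p)) q = (\<Sum>p\<in>Poly_Mapping.keys f. if p = q then Poly_Mapping.lookup f q else 0)"
      unfolding lookup_sum by (rule sum.cong[OF refl]) (simp add: lookup_single when_def)
    then show "Poly_Mapping.lookup (\<Sum>p\<in>Poly_Mapping.keys f. ?s p (Poly_Mapping.lookup f p)) q = Poly_Mapping.lookup f q"
      by (simp add: in_keys_iff)
  qed
  ultimately show ?thesis by simp
qed

definition Ht :: "'h \<Rightarrow> 'h set" where "Ht t = {x. x * t = x}"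

lemma Ht_subspace: "subspace (Ht t)" unfolding subspace_def Ht_def by (simp add: distrib_right sc_out)

lemma Ht_fin: "fin_subspace (Ht t)" by (rule fin_subspace_subset[OF fin_UNIV Ht_subspace subset_UNIV])

lemma Ht_endo: "endo_on sc (Ht t) (\<lambda>x. h * x)"
  unfolding endo_on_def Ht_def by (simp add: distrib_left sc_out mult.assoc)

lemma Ht_trace: assumes t: "t * t = t" shows "op_trace (Ht t) (\<lambda>x. h * x) = ht_char t h"
proof -
  have "op_trace (Ht t) (\<lambda>x. h * x) = op_trace (Ht t) (\<lambda>x. h * x * t)"
    by (rule op_trace_cong[OF Ht_fin]) (simp add: Ht_def mult.assoc)
  also have "\<dots> = op_trace UNIV (\<lambda>x. h * x * t)"
    by (rule op_trace_sub[OF fin_UNIV Ht_fin subset_UNIV, symmetric])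
      (simp_all add: endo_on_def Ht_def distrib_left distrib_right sc_out mult.assoc t)
  also have "\<dots> = ht_char t h" unfolding ht_char_def by (subst H.trace_left_right) (simp_all add: mult.commute)
  finally show ?thesis .
qed

lemma induced_rep_exists:
  assumes t: "t \<in> N" "t * t = t" and one: "1 \<in> N" and M: "M = {n * t | n. n \<in> N}"
  obtains d \<sigma> where "induced_rep sc N M d \<sigma>"
proof -
  obtain C where C: "basis_of (Ht t) C" using fin_subspace_has_basis[OF Ht_fin] by blast
  have C': "finite C" "independent C" "span C = Ht t" using C unfolding basis_of_def by auto
  obtain bs where bs: "set bs = C" "distinct bs" using finite_distinct_list[OF C'(1)] by blast
  define d where "d = length bs"
  have bH: "bs ! i \<in> Ht t" if "i < d" for i using that nth_mem[of i bs] bs basis_of_subset[OF C] unfolding d_def by auto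
  define co where "co v i = representation C v (bs ! i)" for v i
  have co_lin: "co (u + v) i = co u i + co v i" "co (sc c u) i = c * co u i" if "u \<in> Ht t" "v \<in> Ht t" for u v c i
    unfolding co_def using C' that by (simp_all add: representation_add representation_scale)
  have co_l: "lin_on sc (Ht t) (\<lambda>v. co v i)" for i unfolding lin_on_def using co_lin by blast
  have sumC: "(\<Sum>b\<in>C. F b) = (\<Sum>i<d. F (bs ! i))" for F :: "'h \<Rightarrow> 'h"
    unfolding bs(1)[symmetric] sum.distinct_set_conv_list[OF bs(2)] d_def by (simp add: sum_list_sum_nth lessThan_atLeast0)
  have co_expand: "(\<Sum>i<d. sc (co v i) (bs ! i)) = v" if "v \<in> Ht t" for v
  proof -
    have "(\<Sum>i<d. sc (co v i) (bs ! i)) = (\<Sum>b\<in>C. sc (representation C v b) b)"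
      unfolding co_def by (rule sumC[symmetric])
    then show ?thesis using sum_representation_eq[OF C'(2) _ C'(1) subset_refl, of v] that C'(3) by simp
  qed
  have co_basis: "co (bs ! j) i = (if i = j then 1 else 0)" if "i < d" "j < d" for i j
  proof -
    have "bs ! j \<in> C" using that(2) bs(1) nth_mem[of j bs] unfolding d_def by simp
    then show ?thesis using that unfolding co_def representation_basis[OF C'(2) \<open>bs ! j \<in> C\<close>] d_def
      by (simp add: nth_eq_iff_index_eq[OF bs(2)])
  qed
  have Hm: "h * v \<in> Ht t" if "v \<in> Ht t" for h v using that unfolding Ht_def by (simp add: mult.assoc)
  have MH: "x * m \<in> Ht t" if "m \<in> M" for x m using that t(2) unfolding M Ht_def by (auto simp: mult.assoc)
  define \<sigma> where "\<sigma> h = mat d d (\<lambda>(i,j). co (h * bs ! j) i)" for h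
  define \<tau> where "\<tau> x m = vec d (\<lambda>i. co (x * m) i)" for x m
  have \<sigma>c: "\<sigma> h \<in> carrier_mat d d" for h unfolding \<sigma>_def by simp
  have \<sigma>v: "\<sigma> h *\<^sub>v vec d (co v) = vec d (co (h * v))" if v: "v \<in> Ht t" for h v
  proof (rule eq_vecI)
    fix i assume "i < dim_vec (vec d (co (h * v)))"
    then have i: "i < d" by simp
    have "(\<sigma> h *\<^sub>v vec d (co v)) $ i = (\<Sum>j<d. co v j * co (h * bs ! j) i)"
      unfolding mult_mat_vec_index[OF \<sigma>c vec_carrier i] by (rule sum.cong[OF refl]) (simp add: \<sigma>_def i mult.commute)
    also have "\<dots> = co (\<Sum>j<d. sc (co v j) (h * bs ! j)) i"
      by (rule lin_on_sum[OF co_l Ht_subspace, symmetric]) (use Hm bH in auto)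
    also have "(\<Sum>j<d. sc (co v j) (h * bs ! j)) = h * v"
      unfolding sc_out(2)[symmetric] sum_distrib_left[symmetric] by (simp add: co_expand[OF v] sc_out)
    finally show "(\<sigma> h *\<^sub>v vec d (co v)) $ i = vec d (co (h * v)) $ i" using i by simp
  qed (simp add: \<sigma>_def)
  have rep: "is_rep sc UNIV d \<sigma>" unfolding is_rep_def
  proof (intro conjI ballI allI)
    show "\<sigma> a \<in> carrier_mat d d" for a by (rule \<sigma>c)
    show "\<sigma> 1 = 1\<^sub>m d" by (rule eq_matI) (simp_all add: \<sigma>_def co_basis)
    fix a
    show "\<sigma> (a + b) = \<sigma> a + \<sigma> b" for b
      by (rule eq_matI) (simp_all add: \<sigma>_def distrib_right co_lin Hm bH)
    show "\<sigma> (sc c a) = c \<cdot>\<^sub>m \<sigma> a" for c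
      by (rule eq_matI) (simp_all add: \<sigma>_def sc_out co_lin[OF Hm[OF bH] Hm[OF bH]])
    show "\<sigma> (a * b) = \<sigma> a * \<sigma> b" for b
    proof (rule eq_matI)
      fix i j assume "i < dim_row (\<sigma> a * \<sigma> b)" "j < dim_col (\<sigma> a * \<sigma> b)"
      then have ij: "i < d" "j < d" unfolding \<sigma>_def by auto
      have "(\<sigma> a * \<sigma> b) $$ (i,j) = (\<Sum>k<d. \<sigma> a $$ (i,k) * co (b * bs ! j) k)"
        unfolding mult_mat_index[OF \<sigma>c \<sigma>c ij] by (rule sum.cong[OF refl]) (simp add: \<sigma>_def ij)
      also have "\<dots> = (\<sigma> a *\<^sub>v vec d (co (b * bs ! j))) $ i"
        unfolding mult_mat_vec_index[OF \<sigma>c vec_carrier ij(1)] by (rule sum.cong[OF refl]) simp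
      also have "\<dots> = \<sigma> (a * b) $$ (i,j)" unfolding \<sigma>v[OF Hm[OF bH[OF ij(2)]]] using ij by (simp add: \<sigma>_def mult.assoc)
      finally show "\<sigma> (a * b) $$ (i,j) = (\<sigma> a * \<sigma> b) $$ (i,j)" ..
    qed (simp_all add: \<sigma>_def)
  qed
  have fe: "free_ext d \<tau> f = vec d (co (ev f))" if f: "Poly_Mapping.keys f \<subseteq> UNIV \<times> M" for f
  proof (rule eq_vecI)
    fix i assume "i < dim_vec (vec d (co (ev f)))"
    then have i: "i < d" by simp
    have "co (ev f) i = (\<Sum>p\<in>Poly_Mapping.keys f. Poly_Mapping.lookup f p * co (fst p * snd p) i)"
      unfolding ev_def lin_ext_def case_prod_unfold
      by (rule lin_on_sum[OF co_l Ht_subspace]) (use f MH in auto)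
    then show "free_ext d \<tau> f $ i = vec d (co (ev f)) $ i"
      unfolding free_ext_def using i by (simp add: \<tau>_def case_prod_unfold)
  qed (simp add: free_ext_def)
  have evH: "ev f \<in> Ht t" if f: "Poly_Mapping.keys f \<subseteq> UNIV \<times> M" for f
    unfolding ev_def lin_ext_def case_prod_unfold
    by (rule subspace_sum[OF Ht_subspace], rule subspace_scale[OF Ht_subspace], rule MH) (use f in auto)
  have tM: "t \<in> M" unfolding M using one by (intro CollectI exI[of _ 1]) simp
  have "induced_rep sc N M d \<sigma>" unfolding induced_rep_def
  proof (intro conjI exI[of _ \<tau>] allI ballI impI)
    show "is_rep sc UNIV d \<sigma>" by (rule rep)
    show "\<tau> x m \<in> carrier_vec d" for x m unfolding \<tau>_def by simp
    show "\<sigma> h *\<^sub>v \<tau> x m = \<tau> (h * x) m" if "m \<in> M" for h x m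
      using \<sigma>v[OF MH[OF that]] unfolding \<tau>_def mult.assoc .
  next
    fix v :: "'k vec" assume v: "v \<in> carrier_vec d"
    define u where "u = (\<Sum>i<d. sc (v $ i) (bs ! i))"
    have uH: "u \<in> Ht t" unfolding u_def using bH by (intro subspace_sum[OF Ht_subspace] subspace_scale[OF Ht_subspace]) simp
    have cu: "co u i = v $ i" if i: "i < d" for i
    proof -
      have "co u i = (\<Sum>j<d. v $ j * co (bs ! j) i)" unfolding u_def by (rule lin_on_sum[OF co_l Ht_subspace]) (use bH in auto)
      also have "\<dots> = (\<Sum>j<d. if j = i then v $ i else 0)" by (rule sum.cong[OF refl]) (auto simp: co_basis i)
      finally show ?thesis using i by simp
    qed
    let ?f = "Poly_Mapping.single (u, t) 1 :: 'h \<times> 'h \<Rightarrow>\<^sub>0 'k"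
    have k: "Poly_Mapping.keys ?f \<subseteq> UNIV \<times> M" using tM by simp
    have "ev ?f = u" using uH unfolding ev_def by (simp add: lin_ext_single Ht_def)
    then have "free_ext d \<tau> ?f = vec d (co u)" unfolding fe[OF k] by simp
    also have "\<dots> = v" using v cu by (intro eq_vecI) auto
    finally show "\<exists>f. Poly_Mapping.keys f \<subseteq> UNIV \<times> M \<and> free_ext d \<tau> f = v" using k by blast
  next
    fix f :: "'h \<times> 'h \<Rightarrow>\<^sub>0 'k" assume f: "Poly_Mapping.keys f \<subseteq> UNIV \<times> M"
    show "free_ext d \<tau> f = 0\<^sub>v d \<longleftrightarrow> f \<in> balanced_null sc N M"
    proof
      assume "free_ext d \<tau> f = 0\<^sub>v d"
      then have e: "vec d (co (ev f)) = 0\<^sub>v d" unfolding fe[OF f] .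
      have "co (ev f) i = 0" if "i < d" for i
      proof -
        have "vec d (co (ev f)) $ i = 0\<^sub>v d $ i" unfolding e ..
        then show ?thesis using that by simp
      qed
      then have "ev f = 0" using co_expand[OF evH[OF f]] by simp
      interpret fs: vector_space "free_scale :: 'k \<Rightarrow> ('h \<times> 'h \<Rightarrow>\<^sub>0 'k) \<Rightarrow> ('h \<times> 'h \<Rightarrow>\<^sub>0 'k)" by (rule vector_space_free_scale)
      have "Poly_Mapping.single (sc 0 0, t) 1 - Poly_Mapping.single (0, t) 0 \<in> balanced_null sc N M"
        unfolding balanced_null_def by (rule fs.span_base) (use tM in blast)
      then have z: "Poly_Mapping.single (0, t) 1 \<in> balanced_null sc N M" by simp
      have "f - Poly_Mapping.single (0, t) 1 \<in> balanced_null sc N M"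
        using balanced_single[OF t one M f] unfolding \<open>ev f = 0\<close> .
      have sZ: "fs.subspace (balanced_null sc N M)" unfolding balanced_null_def by (rule fs.subspace_span)
      from fs.subspace_add[OF sZ \<open>f - Poly_Mapping.single (0, t) 1 \<in> balanced_null sc N M\<close> z] show "f \<in> balanced_null sc N M" by simp
    next
      assume "f \<in> balanced_null sc N M"
      then have "ev f = 0" by (rule ev_balanced)
      moreover have "co 0 i = 0" for i unfolding co_def by (simp add: representation_zero)
      ultimately show "free_ext d \<tau> f = 0\<^sub>v d" unfolding fe[OF f] by (intro eq_vecI) auto
    qed
  qed
  then show ?thesis by (rule that)
qed

text \<open>Any realization of the induced module is isomorphic to \<open>H t\<close> by \<open>u \<mapsto> u \<otimes> t\<close>, and the trace on
  \<open>H t\<close> may be computed on \<open>H\<close> after composing with right multiplication by \<open>t\<close>.\<close>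

lemma induced_rep_character:
  assumes t: "t \<in> N" "t * t = t" and one: "1 \<in> N" and M: "M = {n * t | n. n \<in> N}" and ind: "induced_rep sc N M d \<sigma>"
  shows "character UNIV \<sigma> = ht_char t"
proof (rule ext)
  fix h
  note i' = ind[unfolded induced_rep_def]
  note rep = conjunct1[OF i']
  from conjunct2[OF i'] obtain \<tau> where \<tau>: "(\<forall>x. \<forall>m\<in>M. \<tau> x m \<in> carrier_vec d) \<and>
        (\<forall>v\<in>carrier_vec d. \<exists>f. Poly_Mapping.keys f \<subseteq> UNIV \<times> M \<and> free_ext d \<tau> f = v) \<and>
        (\<forall>f. Poly_Mapping.keys f \<subseteq> UNIV \<times> M \<longrightarrow> (free_ext d \<tau> f = 0\<^sub>v d \<longleftrightarrow> f \<in> balanced_null sc N M)) \<and>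
        (\<forall>h x. \<forall>m\<in>M. \<sigma> h *\<^sub>v \<tau> x m = \<tau> (h * x) m)" ..
  note \<tau>c = conjunct1[OF \<tau>] and surj = conjunct1[OF conjunct2[OF \<tau>]]
    and ker = conjunct1[OF conjunct2[OF conjunct2[OF \<tau>]]] and act = conjunct2[OF conjunct2[OF conjunct2[OF \<tau>]]]
  have tM: "t \<in> M" unfolding M using one by (intro CollectI exI[of _ 1]) simp
  have tt: "t * t = t" by (rule t(2))
  interpret k: vspace "(*) :: 'k \<Rightarrow> 'k \<Rightarrow> 'k" by (rule vspace_k)
  interpret fs: vector_space "free_scale :: 'k \<Rightarrow> ('h \<times> 'h \<Rightarrow>\<^sub>0 'k) \<Rightarrow> ('h \<times> 'h \<Rightarrow>\<^sub>0 'k)" by (rule vector_space_free_scale)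
  let ?s = "Poly_Mapping.single :: 'h \<times> 'h \<Rightarrow> 'k \<Rightarrow> ('h \<times> 'h \<Rightarrow>\<^sub>0 'k)"
  let ?F = "\<lambda>i. \<lambda>(x,m). \<tau> x m $ i"
  have ker0: "k.lin_ext (?F i) f = 0" if "f \<in> balanced_null sc N M" "Poly_Mapping.keys f \<subseteq> UNIV \<times> M" "i < d" for f i
  proof -
    have "free_ext d \<tau> f = 0\<^sub>v d" using ker that by blast
    then have "free_ext d \<tau> f $ i = 0" using that by simp
    then show ?thesis unfolding free_ext_index[OF that(3)] .
  qed
  have kd: "Poly_Mapping.keys (f - g) \<subseteq> UNIV \<times> M" if "Poly_Mapping.keys f \<subseteq> UNIV \<times> M" "Poly_Mapping.keys g \<subseteq> UNIV \<times> M" for f g :: "'h \<times> 'h \<Rightarrow>\<^sub>0 'k"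
    using Poly_Mapping.keys_diff[of f g] that by blast
  have ks: "Poly_Mapping.keys (?s (x, t) c) \<subseteq> UNIV \<times> M" for x c using tM by (cases "c = 0") auto
  define g where "g u i = \<tau> u t $ i" for u i
  have g_add: "g (x + y) i = g x i + g y i" if "i < d" for x y i
  proof -
    have z: "?s (x + y, t) 1 - ?s (x, t) 1 - ?s (y, t) 1 \<in> balanced_null sc N M"
      unfolding balanced_null_def by (rule fs.span_base) (use tM in blast)
    have "g (x + y) i - g x i = g y i" using ker0[OF z kd[OF kd[OF ks ks] ks] that]
      by (simp add: k.lin_ext_diff k.lin_ext_single g_def)
    then show ?thesis by (simp add: diff_eq_eq add.commute)
  qed
  have g_sc: "g (sc c x) i = c * g x i" if "i < d" for x c i
  proof -
    have z: "?s (sc c x, t) 1 - ?s (x, t) c \<in> balanced_null sc N M"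
      unfolding balanced_null_def by (rule fs.span_base) (use tM in blast)
    show ?thesis using ker0[OF z kd[OF ks ks] that] by (simp add: k.lin_ext_diff k.lin_ext_single g_def)
  qed
  have g_lin: "lin_on sc (Ht t) (\<lambda>u. g u i)" if "i < d" for i unfolding lin_on_def using g_add[OF that] g_sc[OF that] by blast
  have g_inj: "u = 0" if u: "u \<in> Ht t" and z: "\<And>i. i < d \<Longrightarrow> g u i = 0" for u
  proof -
    have "free_ext d \<tau> (?s (u, t) 1) = 0\<^sub>v d"
      by (rule eq_vecI) (use z in \<open>simp_all add: free_ext_index k.lin_ext_single g_def, simp add: free_ext_def\<close>)
    then have "?s (u, t) 1 \<in> balanced_null sc N M" using ker ks[of u 1] by blast
    then have "ev (?s (u, t) 1) = 0" by (rule ev_balanced)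
    then show ?thesis using u unfolding ev_def by (simp add: lin_ext_single Ht_def)
  qed
  have g_surj: "\<exists>u\<in>Ht t. \<forall>i<d. g u i = v $ i" if v: "v \<in> carrier_vec d" for v
  proof -
    obtain f where f: "Poly_Mapping.keys f \<subseteq> UNIV \<times> M" "free_ext d \<tau> f = v" using surj v by blast
    have evH: "ev f \<in> Ht t"
      unfolding ev_def lin_ext_def case_prod_unfold
      by (rule subspace_sum[OF Ht_subspace], rule subspace_scale[OF Ht_subspace])
        (use f(1) in \<open>auto simp: M Ht_def mult.assoc tt\<close>)
    have "g (ev f) i = v $ i" if i: "i < d" for i
      using ker0[OF balanced_single[OF t one M f(1)] kd[OF f(1) ks] i] free_ext_index[OF i, of \<tau> f] f(2)
      by (simp add: k.lin_ext_diff k.lin_ext_single g_def)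
    then show ?thesis using evH by blast
  qed
  have "\<forall>j. \<exists>u. u \<in> Ht t \<and> (\<forall>i<d. g u i = unit_vec d j $ i)" using g_surj[OF unit_vec_carrier] by blast
  from choice[OF this] obtain us where us: "\<forall>j. us j \<in> Ht t \<and> (\<forall>i<d. g (us j) i = unit_vec d j $ i)" ..
  have fr: "frame (Ht t) {..<d} us (\<lambda>i u. g u i)" unfolding frame_def
  proof (intro conjI ballI)
    show "finite {..<d}" by simp
    fix j assume "j \<in> {..<d}"
    then show "us j \<in> Ht t" "lin_on sc (Ht t) (\<lambda>u. g u j)" using us g_lin by auto
  next
    fix v assume v: "v \<in> Ht t"
    let ?w = "\<Sum>j<d. sc (g v j) (us j)"
    have wH: "?w \<in> Ht t" using us by (intro subspace_sum[OF Ht_subspace] subspace_scale[OF Ht_subspace]) simp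
    have "v - ?w = 0"
    proof (rule g_inj)
      show "v - ?w \<in> Ht t" by (rule subspace_diff[OF Ht_subspace v wH])
      fix i assume i: "i < d"
      have "g ?w i = (\<Sum>j<d. g v j * g (us j) i)" by (rule lin_on_sum[OF g_lin[OF i] Ht_subspace]) (use us in auto)
      also have "\<dots> = (\<Sum>j<d. if j = i then g v i else 0)" by (rule sum.cong[OF refl]) (use us i in auto)
      also have "\<dots> = g v i" using i by simp
      finally have "g ?w i = g v i" .
      moreover have "g (v - ?w) i + g ?w i = g v i" using g_add[OF i, of "v - ?w" ?w] by simp
      ultimately show "g (v - ?w) i = 0" by simp
    qed
    then show "v = ?w" by simp
  qed
  have "ht_char t h = (\<Sum>i<d. g (h * us i) i)"
    unfolding Ht_trace[OF tt, symmetric] by (rule op_trace_frame[OF Ht_subspace fr Ht_endo])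
  also have "\<dots> = (\<Sum>i<d. \<sigma> h $$ (i,i))"
  proof (rule sum.cong[OF refl])
    fix i assume "i \<in> {..<d}"
    then have i: "i < d" by simp
    have sc: "\<sigma> h \<in> carrier_mat d d" using rep unfolding is_rep_def by blast
    have ui: "\<tau> (us i) t = unit_vec d i"
      by (rule eq_vecI) (use us \<tau>c tM in \<open>auto simp: g_def\<close>)
    have "\<tau> (h * us i) t = \<sigma> h *\<^sub>v \<tau> (us i) t" using act tM by simp
    then have "\<tau> (h * us i) t = \<sigma> h *\<^sub>v unit_vec d i" unfolding ui .
    then show "g (h * us i) i = \<sigma> h $$ (i,i)" unfolding g_def mult_mat_unit_vec[OF sc i] using sc i by simp
  qed
  also have "\<dots> = character UNIV \<sigma> h" using H.rep_trace[OF rep, of h] by simp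
  finally show "character UNIV \<sigma> h = ht_char t h" ..
qed

lemma induced_char_eq:
  assumes "t \<in> N" "t * t = t" "1 \<in> N" "M = {n * t | n. n \<in> N}"
  shows "induced_char sc N M = ht_char t"
proof (rule induced_rep_exists[OF assms], goal_cases)
  case (1 d \<sigma>)
  show ?case unfolding induced_char_def
  proof (rule the_equality)
    show "\<exists>d \<sigma>. induced_rep sc N M d \<sigma> \<and> ht_char t = character UNIV \<sigma>"
      by (rule exI[of _ d], rule exI[of _ \<sigma>], rule conjI[OF 1 induced_rep_character[OF assms 1, symmetric]])
    fix \<psi> assume "\<exists>d \<sigma>. induced_rep sc N M d \<sigma> \<and> \<psi> = character UNIV \<sigma>"
    then obtain d' \<sigma>' where i: "induced_rep sc N M d' \<sigma>'" and p: "\<psi> = character UNIV \<sigma>'" by blast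
    show "\<psi> = ht_char t" unfolding p by (rule induced_rep_character[OF assms i])
  qed
qed

lemma form_H_ht_char:
  assumes chi: "\<chi> \<in> H.Irr" shows "form_H sc \<Delta> \<epsilon> S \<chi> (ht_char t) = \<chi> t"
proof -
  have e: "(\<lambda>a b. \<chi> a * (ht_char t \<circ> S) b) = (\<lambda>a b. \<Sum>\<psi>\<in>H.Irr. \<psi> t * (\<chi> a * \<psi> (S b)))"
    by (intro ext) (simp add: ht_char_def sum_distrib_left mult.left_commute)
  have "form_H sc \<Delta> \<epsilon> S \<chi> (ht_char t) = cop \<Delta> (\<lambda>a b. \<chi> a * (ht_char t \<circ> S) b) Lam"
    by (simp only: form_H_def conv_def cop_def Lam_def)
  also have "\<dots> = (\<Sum>\<psi>\<in>H.Irr. cop \<Delta> (\<lambda>a b. \<psi> t * (\<chi> a * \<psi> (S b))) Lam)"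
    unfolding e by (rule cop_fsum[OF H.finite_Irr])
  also have "\<dots> = (\<Sum>\<psi>\<in>H.Irr. \<psi> t * cop \<Delta> (\<lambda>a b. \<chi> a * \<psi> (S b)) Lam)"
    by (rule sum.cong[OF refl], rule cop_mult_left[symmetric])
  also have "\<dots> = (\<Sum>\<psi>\<in>H.Irr. if \<psi> = \<chi> then \<chi> t else 0)"
  proof (rule sum.cong[OF refl])
    fix \<psi> assume "\<psi> \<in> H.Irr"
    from orthonormal[OF chi this] show "\<psi> t * cop \<Delta> (\<lambda>a b. \<chi> a * \<psi> (S b)) Lam = (if \<psi> = \<chi> then \<chi> t else 0)" by simp
  qed
  also have "\<dots> = \<chi> t" using chi H.finite_Irr by simp
  finally show ?thesis .
qed

lemma ht_char_multiplicity:
  assumes ind: "induced_rep sc N M d \<sigma>" "character UNIV \<sigma> = ht_char t" and chi: "\<chi> \<in> H.Irr"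
  shows "of_nat (mult_in sc UNIV \<chi> (ht_char t)) = \<chi> t"
proof -
  let ?u = "H.munit \<chi> 0 0"
  have u: "\<psi> ?u = (if \<psi> = \<chi> then 1 else 0)" if psi: "\<psi> \<in> H.Irr" for \<psi>
  proof -
    have "\<psi> ?u = (\<Sum>i<H.rdim \<psi>. H.rrep \<psi> ?u $$ (i,i))" by (rule H.Irr_trace[OF psi UNIV_I])
    also have "\<dots> = (\<Sum>i<H.rdim \<psi>. if i = 0 then (if \<psi> = \<chi> then 1 else 0) else 0)"
    proof (rule sum.cong[OF refl])
      fix i assume "i \<in> {..<H.rdim \<psi>}"
      then have i: "i < H.rdim \<psi>" by simp
      show "H.rrep \<psi> ?u $$ (i,i) = (if i = 0 then (if \<psi> = \<chi> then 1 else 0) else 0)"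
        unfolding H.rrep_munit[OF psi i i] by simp
    qed
    finally have "\<psi> ?u = (\<Sum>i<H.rdim \<psi>. if i = 0 then (if \<psi> = \<chi> then 1 else 0) else 0)" .
    then show ?thesis using H.Irr_pos[OF psi] by simp
  qed
  have "is_rep sc UNIV d \<sigma>" using ind(1) unfolding induced_rep_def by blast
  have "of_nat (mult_in sc UNIV \<chi> (ht_char t)) = ht_char t ?u"
    by (rule H.mult_in_eq[of d \<sigma> "ht_char t" ?u \<chi>, OF \<open>is_rep sc UNIV d \<sigma>\<close> ind(2) UNIV_I u])
  also have "\<dots> = (\<Sum>\<psi>\<in>H.Irr. if \<psi> = \<chi> then \<chi> t else 0)" unfolding ht_char_def
  proof (rule sum.cong[OF refl])
    fix \<psi> assume "\<psi> \<in> H.Irr"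
    from u[OF this] show "\<psi> t * \<psi> ?u = (if \<psi> = \<chi> then \<chi> t else 0)" by simp
  qed
  also have "\<dots> = \<chi> t" using chi H.finite_Irr by simp
  finally show ?thesis .
qed

end

theorem corollary2p11:
  fixes sc :: "'k::{alg_closed_field, field_char_0} \<Rightarrow> 'h::ring_1 \<Rightarrow> 'h"
    and \<Delta> :: "'h \<Rightarrow> ('h \<times> 'h) list"
    and \<epsilon> :: "'h \<Rightarrow> 'k"
    and S :: "'h \<Rightarrow> 'h"
    and N :: "'h set"
    and \<chi> \<phi> :: "'h \<Rightarrow> 'k"
    and t :: 'h
  assumes "semisimple_hopf_algebra sc \<Delta> \<epsilon> S"
    and "left_coideal_subalgebra sc \<Delta> N"
    and "\<chi> \<in> irr_chars sc UNIV"
    and "\<phi> \<in> irr_chars sc N"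
    and "primitive_idem N t"
    and "\<forall>\<psi>\<in>irr_chars sc N. central_idem sc N \<psi> * t = (if \<psi> = \<phi> then t else 0)"
  defines "\<phi>_ind \<equiv> induced_char sc N {n * t | n. n \<in> N}"
  shows "form_N sc \<epsilon> N (restrict \<chi> N) \<phi> = form_H sc \<Delta> \<epsilon> S \<chi> \<phi>_ind
       \<and> form_H sc \<Delta> \<epsilon> S \<chi> \<phi>_ind = \<chi> t
       \<and> of_nat (mult_in sc N \<phi> (restrict \<chi> N)) = form_N sc \<epsilon> N (restrict \<chi> N) \<phi>
       \<and> form_H sc \<Delta> \<epsilon> S \<chi> \<phi>_ind = of_nat (mult_in sc UNIV \<chi> \<phi>_ind)"
proof -
  interpret H0: ss_hopf sc \<Delta> \<epsilon> S using assms(1) by (simp add: ss_hopf_def)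
  note co = assms(2)[unfolded left_coideal_subalgebra_def]
  have sN: "H0.subspace N" unfolding H0.subspace_def
  proof (intro conjI ballI allI)
    have "sc 0 1 \<in> N" using co by blast
    then show "0 \<in> N" by simp
  qed (use co in blast)+
  have fN: "H0.fin_subspace N" by (rule H0.fin_subspace_subset[OF H0.fin_UNIV sN subset_UNIV])
  obtain BN where BN: "H0.basis_of N BN" using H0.fin_subspace_has_basis[OF fN] by blast
  have iBN: "H0.independent BN" using BN unfolding H0.basis_of_def by blast
  obtain B where B: "H0.basis_of UNIV B" "BN \<subseteq> B" using H0.fin_subspace_basis[OF H0.fin_UNIV iBN subset_UNIV] by blast
  interpret C: coideal_algebra sc \<Delta> \<epsilon> S N BN B by unfold_locales (rule assms(2), rule BN, rule B(1), rule B(2))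
  have chi: "\<chi> \<in> H0.H.Irr" and phi: "\<phi> \<in> C.N.Irr" using assms(3,4) unfolding H0.H.Irr_def C.N.Irr_def by blast+
  have t: "t \<in> N" "t * t = t" using assms(5) unfolding primitive_idem_def by blast+
  have tc: "\<psi> t = (if \<psi> = \<phi> then 1 else 0)" if "\<psi> \<in> C.N.Irr" for \<psi>
    by (rule C.N.primitive_char[OF assms(5) phi _ that]) (use assms(6) C.N.Irr_def in simp)
  have ind: "\<phi>_ind = H0.ht_char t" unfolding \<phi>_ind_def by (rule H0.induced_char_eq[OF t C.N_sub(1) refl])
  have lchi: "lin_on sc N \<chi>" using H0.H.Irr_lin[OF chi] unfolding lin_on_def by blast
  have formN: "form_N sc \<epsilon> N (restrict \<chi> N) \<phi> = \<chi> t"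
    by (rule C.form_N_trace_function[OF lchi H0.H.Irr_comm[OF chi UNIV_I UNIV_I] phi t(1) tc])
  have formH: "form_H sc \<Delta> \<epsilon> S \<chi> \<phi>_ind = \<chi> t" unfolding ind by (rule H0.form_H_ht_char[OF chi])
  have repN: "is_rep sc N (H0.H.rdim \<chi>) (H0.H.rrep \<chi>)" using H0.H.Irr_is_rep[OF chi] unfolding is_rep_def by blast
  have charN: "character N (H0.H.rrep \<chi>) = restrict \<chi> N"
  proof (rule ext)
    fix n
    have "\<chi> n = mat_trace (H0.H.rrep \<chi> n)" using H0.H.Irr_rep(2)[OF chi] unfolding character_def by (auto dest: fun_cong[of _ _ n])
    then show "character N (H0.H.rrep \<chi>) n = restrict \<chi> N n" unfolding character_def by (cases "n \<in> N") simp_all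
  qed
  have "of_nat (mult_in sc N \<phi> (restrict \<chi> N)) = restrict \<chi> N t"
    by (rule C.N.mult_in_eq[OF repN charN t(1)]) (rule tc)
  then have multN: "of_nat (mult_in sc N \<phi> (restrict \<chi> N)) = \<chi> t" using t(1) by simp
  have multH: "of_nat (mult_in sc UNIV \<chi> \<phi>_ind) = \<chi> t" unfolding ind
  proof (rule H0.induced_rep_exists[OF t C.N_sub(1) refl], goal_cases)
    case (1 d \<sigma>)
    show ?case by (rule H0.ht_char_multiplicity[OF 1 H0.induced_rep_character[OF t C.N_sub(1) refl 1] chi])
  qed
  show ?thesis using formN formH multN multH by simp
qed

end
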